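(* Let $\underline{\hat M}=(\hat M,\tau_{\hat M},\delta_{\hat M})$ be a rigidified local shtuka over $R$. There are canonical functorial comparison isomorphisms between the de Rham and crystalline realizations $$h_{{\rm dR},{\rm cris}}\colon\mathrm H^1_{\rm dR}(\underline{\hat M},K[[z-\zeta]])\xrightarrow{\sim}\mathrm H^1_{\rm cris}(\underline{\hat M},k((z)))\otimes_{k((z))}K[[z-\zeta]]\quad\text{and}$$ $$h_{{\rm dR},{\rm cris}}\colon\mathrm H^1_{\rm dR}(\underline{\hat M},K)\xrightarrow{\sim}\mathrm H^1_{\rm cris}(\underline{\hat M},k((z)))\otimes_{k((z)),\,z\mapsto\zeta}K,$$ which are compatible with the Hodge–Pink lattices and Hodge–Pink filtrations. They usually are not compatible with the integral structures $\mathrm H^1_{\rm dR}(\underline{\hat M},R):=\hat\sigma^*\hat M/(z-\zeta)\hat\sigma^*\hat M\subset\mathrm H^1_{\rm dR}(\underline{\hat M},K)$ and $\mathrm H^1_{\rm cris}(\underline{\hat M},k[[z]])$.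
   Context: Setting. $C$ is a smooth projective geometrically irreducible curve over a finite field $\mathbb F_q$ with function field $Q$, $\infty\in C$ is a closed point, $A=\Gamma(C\setminus\{\infty\},\mathcal O_C)$. $K$ is a field complete with respect to a non-trivial non-archimedean absolute value (value group not assumed discrete), $R$ is its valuation ring with maximal ideal $\mathfrak m_R$ and residue field $k$. $\gamma\colon A\hookrightarrow R$ is an injective ring homomorphism such that $\varepsilon:=\gamma^{-1}(\mathfrak m_R)$ is a maximal ideal. Put $\mathbb F_\varepsilon=A/\varepsilon$, $\hat q=\#\mathbb F_\varepsilon$; $z\in Q$ is a uniformizing parameter at $\varepsilon$; $A_\varepsilon\cong\mathbb F_\varepsilon[[z]]$ is the completion of $\mathcal O_{C,\varepsilon}$. By continuity $\gamma$ extends to $A_\varepsilon\hookrightarrow R$; $\zeta=\gamma(z)$, $0<|\zeta|<1$. It is assumed that there is a section $k\hookrightarrow R$ of $R\to k$, and one is fixed. $\hat\sigma$ denotes $\sum b_iz^i\mapsto\sum b_i^{\hat q}z^i$; $\hat\sigma^*$ denotes base change along $\hat\sigma$. $K[[z-\zeta]]$ is the power series ring in $z-\zeta$ with fraction field $K((z-\zeta))$. $R[[z]]$ and (via $k\hookrightarrow R$) $k((z))$ map to $K[[z-\zeta]]$ by $z\mapsto\zeta+(z-\zeta)$; $k((z))\to K$, $z\mapsto\zeta$ is the reduction of the latter map modulo $z-\zeta$. A local shtuka over $R$ is a pair $(\hat M,\tau_{\hat M})$ of a finite free $R[[z]]$-module and an isomorphism $\tau_{\hat M}\colon\hat\sigma^*\hat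 M[\frac1{z-\zeta}]\to\hat M[\frac1{z-\zeta}]$. Morphisms (quasi-morphisms) are $R[[z]]$-linear maps $\hat M\to\hat M'$ ($R[[z]][\frac1z]$-linear maps $\hat M[\frac1z]\to\hat M'[\frac1z]$) $f$ with $\tau_{\hat M'}\circ\hat\sigma^*f=f\circ\tau_{\hat M}$. $R[[z,z^{-1}\}:=\{\sum_{i\in\mathbb Z}b_iz^i: b_i\in R,\ |b_i||\zeta|^{ri}\to0\ (i\to-\infty)\text{ for all }r>0\}$, a subring of $K[[z-\zeta]]$ by Taylor expansion at $z=\zeta$, and $\ell_-:=\prod_{i\ge0}(1-\zeta^{\hat q^i}/z)\in R[[z,z^{-1}\}$. Reducing coefficients modulo $\mathfrak m_R$ gives $R[[z,z^{-1}\}[\ell_-^{-1}]\to k((z))$ with $\ell_-\mapsto1$. A rigidified local shtuka over $R$ is $(\hat M,\tau_{\hat M},\delta_{\hat M})$ with $(\hat M,\tau_{\hat M})$ a local shtuka and, writing $(\tilde D,\tau_{\tilde D})=(\hat M,\tau_{\hat M})\otimes_{R[[z]]}k((z))$, an isomorphism $\delta_{\hat M}\colon\hat M\otimes_{R[[z]]}R[[z,z^{-1}\}[\ell_-^{-1}]\to\tilde D\otimes_{k((z))}R[[z,z^{-1}\}[\ell_-^{-1}]$ with $\delta_{\hat M}\circ\tau_{\hat M}=\tau_{\tilde D}\circ\hat\sigma^*\delta_{\hat M}$ and $\delta_{\hat M}\equiv\mathrm{id}_{\tilde D}\bmod\mathfrak m_R$. Morphisms $f$ must satisfy $(f\otimes1)\circ\delta_{\hat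 M}=\delta_{\hat M'}\circ f$. de Rham realization: $\mathfrak p:=\mathrm H^1_{\rm dR}(\underline{\hat M},K[[z-\zeta]])=\hat\sigma^*\hat M\otimes_{R[[z]]}K[[z-\zeta]]$, $\mathrm H^1_{\rm dR}(\underline{\hat M},K)=\hat\sigma^*\hat M\otimes_{R[[z]],z\mapsto\zeta}K=\mathfrak p/(z-\zeta)\mathfrak p$, Hodge–Pink lattice $\mathfrak q=\tau_{\hat M}^{-1}(\hat M\otimes_{R[[z]]}K[[z-\zeta]])\subset\mathfrak p[\frac1{z-\zeta}]$, Hodge–Pink filtration $F^i\mathrm H^1_{\rm dR}(\underline{\hat M},K)=$ image of $\mathfrak p\cap(z-\zeta)^i\mathfrak q$, for $i\in\mathbb Z$. Crystalline realization: $D:=\mathrm H^1_{\rm cris}(\underline{\hat M},k((z)))=\hat\sigma^*\hat M\otimes_{R[[z]]}k((z))=\hat\sigma^*\tilde D$ with Frobenius $\tau_D=\hat\sigma^*\tau_{\tilde D}$, and $\mathrm H^1_{\rm cris}(\underline{\hat M},k[[z]])=\hat\sigma^*\hat M\otimes_{R[[z]]}k[[z]]\subset D$. Its Hodge–Pink lattice is $\mathfrak q_D=\hat\sigma^*\delta_{\hat M}\circ\tau_{\hat M}^{-1}(\hat M\otimes_{R[[z]]}K[[z-\zeta]])\subset D\otimes_{k((z))}K((z-\zeta))$; with $\mathfrak p_D=D\otimes_{k((z))}K[[z-\zeta]]$ and $D_K=\mathfrak p_D/(z-\zeta)\mathfrak p_D=D\otimes_{k((z)),z\mapsto\zeta}K$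 the Hodge–Pink filtration is $F^iD_K=$ image of $\mathfrak p_D\cap(z-\zeta)^i\mathfrak q_D$, for $i\in\mathbb Z$. *)

theory Defs
  imports "HOL-Algebra.Algebra" "HOL-Analysis.Infinite_Sum"
    "HOL-Computational_Algebra.Formal_Laurent_Series"
begin

section \<open>Complete non-archimedean fields\<close>

class complete_nonarch_field = field + complete_space +
  fixes nabs :: "'a \<Rightarrow> real"
  assumes dist_nabs: "dist x y = nabs (x - y)"
    and nabs_mult: "nabs (x * y) = nabs x * nabs y"
    and nabs_add: "nabs (x + y) \<le> max (nabs x) (nabs y)"
    and nabs_nontrivial: "\<exists>x. x \<noteq> 0 \<and> nabs x \<noteq> 1"

definition val_ring :: "'K::complete_nonarch_field set"
  where "val_ring = {x. nabs x \<le> 1}"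

definition val_ideal :: "'K::complete_nonarch_field set"
  where "val_ideal = {x. nabs x < 1}"


section \<open>Rings, localization at an element, base change\<close>

definition ring_on :: "'a::comm_ring_1 set \<Rightarrow> 'a ring"
  where "ring_on S = \<lparr>carrier = S, monoid.mult = (*), one = 1, ring.zero = 0, add = (+)\<rparr>"

text \<open>The pair \<open>(a, m)\<close> represents the fraction \<open>a / s\<^sup>m\<close>.\<close>

definition loc_rel :: "'a ring \<Rightarrow> 'a \<Rightarrow> (('a \<times> nat) \<times> ('a \<times> nat)) set"
  where "loc_rel R s = {((a, m), (b, n)) | a m b n. a \<in> carrier R \<and> b \<in> carrier R \<and>
    (\<exists>k::nat. s [^]\<^bsub>R\<^esub> k \<otimes>\<^bsub>R\<^esub> (s [^]\<^bsub>R\<^esub> n \<otimes>\<^bsub>R\<^esub> a) = s [^]\<^bsub>R\<^esub> k \<otimes>\<^bsub>R\<^esub> (s [^]\<^bsub>R\<^esub> m \<otimes>\<^bsub>R\<^esub> b))}"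

definition loc_frac :: "'a ring \<Rightarrow> 'a \<Rightarrow> 'a \<Rightarrow> nat \<Rightarrow> ('a \<times> nat) set"
  where "loc_frac R s a n = loc_rel R s `` {(a, n)}"

definition localization :: "'a ring \<Rightarrow> 'a \<Rightarrow> ('a \<times> nat) set ring"
  where "localization R s =
    \<lparr>carrier = (carrier R \<times> UNIV) // loc_rel R s,
     monoid.mult = (\<lambda>U W. \<Union>(a, m)\<in>U. \<Union>(b, n)\<in>W. loc_frac R s (a \<otimes>\<^bsub>R\<^esub> b) (m + n)),
     one = loc_frac R s \<one>\<^bsub>R\<^esub> 0,
     ring.zero = loc_frac R s \<zero>\<^bsub>R\<^esub> 0,
     add = (\<lambda>U W. \<Union>(a, m)\<in>U. \<Union>(b, n)\<in>W.
       loc_frac R s (s [^]\<^bsub>R\<^esub> n \<otimes>\<^bsub>R\<^esub> a \<oplus>\<^bsub>R\<^esub> s [^]\<^bsub>R\<^esub> m \<otimes>\<^bsub>R\<^esub> b) (m + n))\<rparr>"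

datatype ('a, 'b) rhom = RHom (src: "'a ring") (tgt: "'b ring") (app: "'a \<Rightarrow> 'b")

definition id_hom :: "'a ring \<Rightarrow> ('a, 'a) rhom"
  where "id_hom R = RHom R R (\<lambda>x. x)"

definition loc_hom :: "'a ring \<Rightarrow> 'a \<Rightarrow> ('a, ('a \<times> nat) set) rhom"
  where "loc_hom R s = RHom R (localization R s) (\<lambda>a. loc_frac R s a 0)"

text \<open>The extension to \<open>R[1/s]\<close> of a homomorphism \<open>f\<close> from \<open>R\<close> to \<open>C\<close> for which \<open>f s\<close> is a unit.\<close>

definition loc_lift :: "'a ring \<Rightarrow> 'a \<Rightarrow> 'b ring \<Rightarrow> ('a \<Rightarrow> 'b) \<Rightarrow> (('a \<times> nat) set, 'b) rhom"
  where "loc_lift R s C f = RHom (localization R s) C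
    (\<lambda>U. THE y. y \<in> carrier C \<and> (\<forall>(a, n)\<in>U. f s [^]\<^bsub>C\<^esub> n \<otimes>\<^bsub>C\<^esub> y = f a))"

definition free_basis :: "'a ring \<Rightarrow> ('a, 'm) module \<Rightarrow> nat \<Rightarrow> (nat \<Rightarrow> 'm) \<Rightarrow> bool"
  where "free_basis A M n e \<longleftrightarrow> e \<in> {..<n} \<rightarrow> carrier M \<and>
    (\<forall>x\<in>carrier M. \<exists>!c. c \<in> {..<n} \<rightarrow>\<^sub>E carrier A \<and>
       x = (\<Oplus>\<^bsub>M\<^esub>i\<in>{..<n}. c i \<odot>\<^bsub>M\<^esub> e i))"

definition free_of_rank :: "'a ring \<Rightarrow> ('a, 'm) module \<Rightarrow> nat \<Rightarrow> bool"
  where "free_of_rank A M n \<longleftrightarrow> module A M \<and> (\<exists>e. free_basis A M n e)"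

definition semilinear ::
  "('b, 'c) rhom \<Rightarrow> ('b, 'x) module \<Rightarrow> ('c, 'y) module \<Rightarrow> ('x \<Rightarrow> 'y) \<Rightarrow> bool"
  where "semilinear h U W f \<longleftrightarrow> f \<in> carrier U \<rightarrow> carrier W \<and>
    (\<forall>x\<in>carrier U. \<forall>y\<in>carrier U. f (x \<oplus>\<^bsub>U\<^esub> y) = f x \<oplus>\<^bsub>W\<^esub> f y) \<and>
    (\<forall>b\<in>carrier (src h). \<forall>x\<in>carrier U. f (b \<odot>\<^bsub>U\<^esub> x) = app h b \<odot>\<^bsub>W\<^esub> f x)"

definition module_hom :: "'a ring \<Rightarrow> ('a, 'x) module \<Rightarrow> ('a, 'y) module \<Rightarrow> ('x \<Rightarrow> 'y) \<Rightarrow> bool"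
  where "module_hom A U W f \<longleftrightarrow> semilinear (id_hom A) U W f"

definition module_iso :: "'a ring \<Rightarrow> ('a, 'x) module \<Rightarrow> ('a, 'y) module \<Rightarrow> ('x \<Rightarrow> 'y) \<Rightarrow> bool"
  where "module_iso A U W f \<longleftrightarrow> module_hom A U W f \<and> bij_betw f (carrier U) (carrier W)"

text \<open>
  The base change \<open>M \<otimes>\<^sub>A B\<close> along a ring homomorphism \<open>h\<close> from \<open>A\<close> to \<open>B\<close>: the free abelian
  group on \<open>M \<times> B\<close> modulo the bilinearity relations, with \<open>B\<close> acting on the second factor.
\<close>

type_synonym ('m, 'b) tens = "(('m \<times> 'b) \<Rightarrow>\<^sub>0 int) set"

definition bc_group :: "('a, 'b) rhom \<Rightarrow> ('a, 'm) module \<Rightarrow> (('m \<times> 'b) \<Rightarrow>\<^sub>0 int) monoid"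
  where "bc_group h M = free_Abelian_group (carrier M \<times> carrier (tgt h))"

definition bc_relators :: "('a, 'b) rhom \<Rightarrow> ('a, 'm) module \<Rightarrow> (('m \<times> 'b) \<Rightarrow>\<^sub>0 int) set"
  where "bc_relators h M =
    {frag_of (x \<oplus>\<^bsub>M\<^esub> y, b) - frag_of (x, b) - frag_of (y, b) | x y b.
       x \<in> carrier M \<and> y \<in> carrier M \<and> b \<in> carrier (tgt h)} \<union>
    {frag_of (x, b \<oplus>\<^bsub>tgt h\<^esub> c) - frag_of (x, b) - frag_of (x, c) | x b c.
       x \<in> carrier M \<and> b \<in> carrier (tgt h) \<and> c \<in> carrier (tgt h)} \<union>
    {frag_of (a \<odot>\<^bsub>M\<^esub> x, b) - frag_of (x, app h a \<otimes>\<^bsub>tgt h\<^esub> b) | a x b.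
       a \<in> carrier (src h) \<and> x \<in> carrier M \<and> b \<in> carrier (tgt h)}"

definition bc_kernel :: "('a, 'b) rhom \<Rightarrow> ('a, 'm) module \<Rightarrow> ('m, 'b) tens"
  where "bc_kernel h M = generate (bc_group h M) (bc_relators h M)"

definition base_change :: "('a, 'b) rhom \<Rightarrow> ('a, 'm) module \<Rightarrow> ('b, ('m, 'b) tens) module"
  where "base_change h M =
    \<lparr>carrier = rcosets\<^bsub>bc_group h M\<^esub> (bc_kernel h M),
     monoid.mult = undefined, one = undefined,
     ring.zero = bc_kernel h M,
     add = (\<lambda>U W. U <#>\<^bsub>bc_group h M\<^esub> W),
     module.smult = (\<lambda>b U. \<Union>u\<in>U. bc_kernel h M #>\<^bsub>bc_group h M\<^esub>
       frag_extend (\<lambda>(x, c). frag_of (x, b \<otimes>\<^bsub>tgt h\<^esub> c)) u)\<rparr>"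

definition bc_unit :: "('a, 'b) rhom \<Rightarrow> ('a, 'm) module \<Rightarrow> 'm \<Rightarrow> ('m, 'b) tens"
  where "bc_unit h M x = bc_kernel h M #>\<^bsub>bc_group h M\<^esub> frag_of (x, \<one>\<^bsub>tgt h\<^esub>)"

text \<open>
  All maps out of base changes used below are the unique semilinear maps with prescribed values on
  a generating family \<open>i m\<close>, \<open>m \<in> S\<close>, of pure tensors \<open>m \<otimes> 1\<close>.
\<close>

definition semilin_ext :: "('b, 'c) rhom \<Rightarrow> ('b, 'x) module \<Rightarrow> ('c, 'y) module \<Rightarrow>
    'm set \<Rightarrow> ('m \<Rightarrow> 'x) \<Rightarrow> ('m \<Rightarrow> 'y) \<Rightarrow> 'x \<Rightarrow> 'y"
  where "semilin_ext h U W S i j = (THE f. f \<in> extensional (carrier U) \<and>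
    semilinear h U W f \<and> (\<forall>m\<in>S. f (i m) = j m))"

text \<open>\<open>f \<otimes> id\<close> for a linear map \<open>f\<close>.\<close>

definition bc_map :: "('a, 'b) rhom \<Rightarrow> ('a, 'm) module \<Rightarrow> ('a, 'n) module \<Rightarrow> ('m \<Rightarrow> 'n) \<Rightarrow>
    ('m, 'b) tens \<Rightarrow> ('n, 'b) tens"
  where "bc_map h M N f = semilin_ext (id_hom (tgt h)) (base_change h M) (base_change h N)
    (carrier M) (bc_unit h M) (\<lambda>m. bc_unit h N (f m))"

text \<open>\<open>M \<otimes>\<^sub>A B \<rightarrow> M \<otimes>\<^sub>A C\<close>, \<open>m \<otimes> b \<mapsto> m \<otimes> g b\<close>, where \<open>h\<close>, \<open>h'\<close> are the structure maps of \<open>B\<close>, \<open>C\<close>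
  and \<open>g \<circ> h = h'\<close>.\<close>

definition bc_push :: "('a, 'b) rhom \<Rightarrow> ('a, 'c) rhom \<Rightarrow> ('b, 'c) rhom \<Rightarrow> ('a, 'm) module \<Rightarrow>
    ('m, 'b) tens \<Rightarrow> ('m, 'c) tens"
  where "bc_push h h' g M = semilin_ext g (base_change h M) (base_change h' M)
    (carrier M) (bc_unit h M) (bc_unit h' M)"

text \<open>
  For \<open>B\<close>-linear \<open>f\<close> from \<open>M \<otimes>\<^sub>A B\<close> to \<open>N \<otimes>\<^sub>A\<^sub>' B\<close> and \<open>g\<close> from \<open>B\<close> to \<open>C\<close>: the base change of \<open>f\<close> along
  \<open>g\<close>, as a map from \<open>M \<otimes>\<^sub>A C\<close> to \<open>N \<otimes>\<^sub>A\<^sub>' C\<close>.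
\<close>

definition bc_extend :: "('b, 'c) rhom \<Rightarrow>
    ('a, 'b) rhom \<Rightarrow> ('a, 'c) rhom \<Rightarrow> ('a, 'm) module \<Rightarrow>
    ('d, 'b) rhom \<Rightarrow> ('d, 'c) rhom \<Rightarrow> ('d, 'n) module \<Rightarrow>
    (('m, 'b) tens \<Rightarrow> ('n, 'b) tens) \<Rightarrow> ('m, 'c) tens \<Rightarrow> ('n, 'c) tens"
  where "bc_extend g h h' M k k' N f =
    semilin_ext (id_hom (tgt g)) (base_change h' M) (base_change k' N)
      (carrier M) (bc_unit h' M) (\<lambda>m. bc_push k k' g N (f (bc_unit h M m)))"

text \<open>
  Frobenius twists. Let \<open>s\<close> be an endomorphism of \<open>A\<close> and \<open>g\<close> a homomorphism from \<open>B\<close> to \<open>C\<close> with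
  \<open>g \<circ> h = h' \<circ> s\<close>. Then \<open>(M \<otimes>\<^sub>A B) \<otimes>\<^sub>B C\<close> is \<open>s\<^sup>*M \<otimes>\<^sub>A C\<close>: \<open>twist_unit\<close> is \<open>m \<mapsto> (m \<otimes> 1) \<otimes> 1\<close>,
  \<open>twist_push\<close> is \<open>m \<otimes> b \<mapsto> (m \<otimes> 1) \<otimes> g b\<close>, and \<open>twist_extend\<close> is the base change along \<open>g\<close> of a
  \<open>B\<close>-linear map from \<open>M \<otimes>\<^sub>A B\<close> to \<open>N \<otimes>\<^sub>A\<^sub>' B\<close>.
\<close>

definition twist_unit :: "('a, 'a) rhom \<Rightarrow> ('a, 'c) rhom \<Rightarrow> ('a, 'm) module \<Rightarrow>
    'm \<Rightarrow> (('m, 'a) tens, 'c) tens"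
  where "twist_unit s h' M m = bc_unit h' (base_change s M) (bc_unit s M m)"

definition twist_push :: "('b, 'c) rhom \<Rightarrow>
    ('a, 'a) rhom \<Rightarrow> ('a, 'b) rhom \<Rightarrow> ('a, 'c) rhom \<Rightarrow> ('a, 'm) module \<Rightarrow>
    ('m, 'b) tens \<Rightarrow> (('m, 'a) tens, 'c) tens"
  where "twist_push g s h h' M =
    semilin_ext g (base_change h M) (base_change h' (base_change s M))
      (carrier M) (bc_unit h M) (twist_unit s h' M)"

definition twist_extend :: "('b, 'c) rhom \<Rightarrow>
    ('a, 'a) rhom \<Rightarrow> ('a, 'b) rhom \<Rightarrow> ('a, 'c) rhom \<Rightarrow> ('a, 'm) module \<Rightarrow>
    ('d, 'd) rhom \<Rightarrow> ('d, 'b) rhom \<Rightarrow> ('d, 'c) rhom \<Rightarrow> ('d, 'n) module \<Rightarrow>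
    (('m, 'b) tens \<Rightarrow> ('n, 'b) tens) \<Rightarrow>
    (('m, 'a) tens, 'c) tens \<Rightarrow> (('n, 'd) tens, 'c) tens"
  where "twist_extend g s h h' M t k k' N f =
    semilin_ext (id_hom (tgt g))
      (base_change h' (base_change s M)) (base_change k' (base_change t N))
      (carrier M) (twist_unit s h' M) (\<lambda>m. twist_push g t k k' N (f (bc_unit h M m)))"


section \<open>The base data\<close>

text \<open>
  The curve \<open>C\<close> is given by its function field, the type \<open>'Q\<close>, with constant field \<open>fconst\<close>; its
  closed points are the places of \<open>'Q\<close> over \<open>fconst\<close>, given by their valuation rings (the local
  rings of \<open>C\<close>). The field \<open>K\<close> is the type \<open>'K\<close> and the residue field of \<open>R\<close> is the type \<open>'k\<close>, with
  reduction map \<open>res_map\<close> and section \<open>res_sec\<close>. Only the values of \<open>gam\<close> on \<open>A\<close> matter.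
\<close>

record ('Q, 'K, 'k) shtuka_base =
  fconst :: "'Q set"
  infty :: "'Q set"
  gam :: "'Q \<Rightarrow> 'K"
  unif :: 'Q
  res_map :: "'K \<Rightarrow> 'k"
  res_sec :: "'k \<Rightarrow> 'K"

text \<open>
  Since a finite field is perfect, geometric irreducibility of \<open>C\<close> means that \<open>F\<close> is algebraically
  closed in \<open>'Q\<close>.
\<close>

definition global_function_field :: "'Q::field set \<Rightarrow> bool"
  where "global_function_field F \<longleftrightarrow> subfield F (ring_on UNIV) \<and> finite F \<and>
    (\<exists>x. ring.transcendental (ring_on UNIV) F x \<and>
       ring.finite_dimension (ring_on UNIV) (generate_field (ring_on UNIV) (insert x F)) UNIV) \<and>
    (\<forall>x. ring.algebraic (ring_on UNIV) F x \<longrightarrow> x \<in> F)"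

definition is_place :: "'Q::field set \<Rightarrow> 'Q set \<Rightarrow> bool"
  where "is_place F V \<longleftrightarrow> subring V (ring_on UNIV) \<and> F \<subseteq> V \<and> V \<noteq> UNIV \<and>
    (\<forall>x. x \<in> V \<or> inverse x \<in> V)"

definition curve_ring :: "('Q::field, 'K, 'k) shtuka_base \<Rightarrow> 'Q set"
  where "curve_ring S = \<Inter>{V. is_place (fconst S) V \<and> V \<noteq> infty S}"

definition eps :: "('Q::field, 'K::complete_nonarch_field, 'k) shtuka_base \<Rightarrow> 'Q set"
  where "eps S = {a \<in> curve_ring S. gam S a \<in> val_ideal}"

definition eps_local_ring :: "('Q::field, 'K::complete_nonarch_field, 'k) shtuka_base \<Rightarrow> 'Q set"
  where "eps_local_ring S = {a / b | a b. a \<in> curve_ring S \<and> b \<in> curve_ring S - eps S}"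

definition eps_local_ideal :: "('Q::field, 'K::complete_nonarch_field, 'k) shtuka_base \<Rightarrow> 'Q set"
  where "eps_local_ideal S = {a / b | a b. a \<in> eps S \<and> b \<in> curve_ring S - eps S}"

definition qhat :: "('Q::field, 'K::complete_nonarch_field, 'k) shtuka_base \<Rightarrow> nat"
  where "qhat S = card (carrier (ring_on (curve_ring S) Quot eps S))"

text \<open>
  The image of \<open>z\<close> under the extension of \<open>\<gamma>\<close> to the local ring at \<open>\<epsilon>\<close>, on which the extension by
  continuity to the completion restricts to \<open>a / b \<mapsto> \<gamma> a / \<gamma> b\<close>.
\<close>

definition zeta :: "('Q::field, 'K::complete_nonarch_field, 'k) shtuka_base \<Rightarrow> 'K"
  where "zeta S = (THE x. \<exists>a\<in>curve_ring S. \<exists>b\<in>curve_ring S - eps S.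
    unif S = a / b \<and> x = gam S a / gam S b)"

definition shtuka_setting ::
    "('Q::field, 'K::complete_nonarch_field, 'k::field) shtuka_base \<Rightarrow> bool"
  where "shtuka_setting S \<longleftrightarrow>
    global_function_field (fconst S) \<and> is_place (fconst S) (infty S) \<and>
    gam S \<in> ring_hom (ring_on (curve_ring S)) (ring_on val_ring) \<and>
    inj_on (gam S) (curve_ring S) \<and>
    maximalideal (eps S) (ring_on (curve_ring S)) \<and>
    unif S \<in> eps_local_ring S \<and> eps_local_ideal S = (\<lambda>x. unif S * x) ` eps_local_ring S \<and>
    res_map S \<in> ring_hom (ring_on val_ring) (ring_on UNIV) \<and>
    res_map S ` val_ring = UNIV \<and> {x \<in> val_ring. res_map S x = 0} = val_ideal \<and>
    res_sec S \<in> ring_hom (ring_on UNIV) (ring_on val_ring) \<and>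
    (\<forall>c. res_map S (res_sec S c) = c)"


section \<open>The coefficient rings\<close>

text \<open>
  Power series in \<open>z\<close> over \<open>R\<close> are elements of \<open>'K fps\<close> with indeterminate \<open>z\<close>. In contrast,
  \<open>K[[z - \<zeta>]]\<close> and \<open>K((z - \<zeta>))\<close> are the full types \<open>'K fps\<close> and \<open>'K fls\<close> with indeterminate
  \<open>z - \<zeta>\<close>.
\<close>

definition Rz :: "'K::complete_nonarch_field fps ring"
  where "Rz = ring_on {f. \<forall>n. fps_nth f n \<in> val_ring}"

definition zmz :: "('Q::field, 'K::complete_nonarch_field, 'k) shtuka_base \<Rightarrow> 'K fps"
  where "zmz S = fps_X - fps_const (zeta S)"

type_synonym 'K loc = "('K fps \<times> nat) set"

text \<open>\<open>R[[z]][1/(z-\<zeta>)]\<close>, \<open>R[[z]][1/z]\<close> and \<open>R[[z]][1/z, 1/(z-\<zeta>)]\<close>\<close>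

definition Rz_zmz :: "('Q::field, 'K::complete_nonarch_field, 'k) shtuka_base \<Rightarrow> 'K loc ring"
  where "Rz_zmz S = localization Rz (zmz S)"

definition Rz_z :: "'K::complete_nonarch_field loc ring"
  where "Rz_z = localization Rz fps_X"

definition Rz_z_zmz :: "('Q::field, 'K::complete_nonarch_field, 'k) shtuka_base \<Rightarrow> 'K loc ring"
  where "Rz_z_zmz S = localization Rz (fps_X * zmz S)"

text \<open>\<open>R[[z,z\<^sup>-\<^sup>1}\<close>: a series is the function of its coefficients.\<close>

definition Rzi :: "('Q::field, 'K::complete_nonarch_field, 'k) shtuka_base \<Rightarrow> (int \<Rightarrow> 'K) ring"
  where "Rzi S =
    \<lparr>carrier = {b. (\<forall>i. b i \<in> val_ring) \<and>
       (\<forall>r>0. ((\<lambda>i. nabs (b i) * nabs (zeta S) powr (r * real_of_int i)) \<longlongrightarrow> 0) at_bot)},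
     monoid.mult = (\<lambda>b c n. \<Sum>\<^sub>\<infinity>i\<in>UNIV. b i * c (n - i)),
     one = (\<lambda>i. if i = 0 then 1 else 0),
     ring.zero = (\<lambda>i. 0),
     add = (\<lambda>b c i. b i + c i)\<rparr>"

definition ell :: "('Q::field, 'K::complete_nonarch_field, 'k) shtuka_base \<Rightarrow> int \<Rightarrow> 'K"
  where "ell S n = lim (\<lambda>N. fls_nth (\<Prod>i<N. 1 - fls_const (zeta S ^ (qhat S ^ i)) * fls_X_inv) n)"

type_synonym 'K liloc = "((int \<Rightarrow> 'K) \<times> nat) set"

text \<open>\<open>R[[z,z\<^sup>-\<^sup>1}[1/\<ell>\<^sub>-]\<close>\<close>

definition Rzil :: "('Q::field, 'K::complete_nonarch_field, 'k) shtuka_base \<Rightarrow> 'K liloc ring"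
  where "Rzil S = localization (Rzi S) (ell S)"


subsection \<open>Maps on series\<close>

definition frob_fps :: "nat \<Rightarrow> 'a::comm_ring_1 fps \<Rightarrow> 'a fps"
  where "frob_fps q f = Abs_fps (\<lambda>n. fps_nth f n ^ q)"

definition frob_fls :: "nat \<Rightarrow> 'a::comm_ring_1 fls \<Rightarrow> 'a fls"
  where "frob_fls q f = Abs_fls (\<lambda>n. fls_nth f n ^ q)"

definition frob_bi :: "nat \<Rightarrow> (int \<Rightarrow> 'a::comm_ring_1) \<Rightarrow> int \<Rightarrow> 'a"
  where "frob_bi q b = (\<lambda>i. b i ^ q)"

definition fps_to_bi :: "'a::zero fps \<Rightarrow> int \<Rightarrow> 'a"
  where "fps_to_bi f i = (if 0 \<le> i then fps_nth f (nat i) else 0)"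

definition fls_to_bi :: "('k \<Rightarrow> 'a) \<Rightarrow> 'k::zero fls \<Rightarrow> int \<Rightarrow> 'a"
  where "fls_to_bi s f i = s (fls_nth f i)"

definition red_bi :: "('a \<Rightarrow> 'k::zero) \<Rightarrow> (int \<Rightarrow> 'a) \<Rightarrow> 'k fls"
  where "red_bi p b = Abs_fls (\<lambda>i. p (b i))"

text \<open>
  Taylor expansion at \<open>z = \<zeta>\<close>, that is, \<open>z\<^sup>i = (\<zeta> + (z - \<zeta>))\<^sup>i\<close> for all integers \<open>i\<close>. The field \<open>K\<close> has
  positive characteristic, so the binomial coefficients are formed in the integers, where the
  division is exact.
\<close>

definition int_binom :: "int \<Rightarrow> nat \<Rightarrow> int"
  where "int_binom i n = (\<Prod>j<n. i - int j) div fact n"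

definition taylor :: "'K::complete_nonarch_field \<Rightarrow> (int \<Rightarrow> 'K) \<Rightarrow> 'K fps"
  where "taylor \<zeta> b =
    Abs_fps (\<lambda>n. \<Sum>\<^sub>\<infinity>i\<in>UNIV. of_int (int_binom i n) * b i * \<zeta> powi (i - int n))"


subsection \<open>Ring homomorphisms\<close>

text \<open>
  In the names, \<open>Rz\<close> is \<open>R[[z]]\<close>, \<open>L\<close> is \<open>R[[z]][1/(z-\<zeta>)]\<close>, \<open>Z\<close> is \<open>R[[z]][1/z]\<close>, \<open>ZL\<close> is
  \<open>R[[z]][1/z, 1/(z-\<zeta>)]\<close>, \<open>B\<close> is \<open>R[[z,z\<^sup>-\<^sup>1}[1/\<ell>\<^sub>-]\<close>, \<open>kz\<close> is \<open>k((z))\<close>, \<open>ki\<close> is \<open>k[[z]]\<close>, \<open>P\<close> is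
  \<open>K[[z-\<zeta>]]\<close>, \<open>F\<close> is \<open>K((z-\<zeta>))\<close>, \<open>K\<close> is \<open>K\<close> and \<open>s\<close> marks a precomposition with the Frobenius
  \<open>\<sigma>\<close> of the source.
\<close>

type_synonym ('Q, 'K, 'k, 'a, 'b) base_hom = "('Q, 'K, 'k) shtuka_base \<Rightarrow> ('a, 'b) rhom"

abbreviation ring_kz :: "'k::field fls ring" where "ring_kz \<equiv> ring_on UNIV"
abbreviation ring_ki :: "'k::field fps ring" where "ring_ki \<equiv> ring_on UNIV"
abbreviation ring_P :: "'K::complete_nonarch_field fps ring" where "ring_P \<equiv> ring_on UNIV"
abbreviation ring_F :: "'K::complete_nonarch_field fls ring" where "ring_F \<equiv> ring_on UNIV"
abbreviation ring_K :: "'K::complete_nonarch_field ring" where "ring_K \<equiv> ring_on UNIV"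

definition emb_B :: "('Q::field, 'K::complete_nonarch_field, 'k) shtuka_base \<Rightarrow> (int \<Rightarrow> 'K) \<Rightarrow> 'K liloc"
  where "emb_B S b = loc_frac (Rzi S) (ell S) b 0"

definition Rz_s :: "('Q::field, 'K::complete_nonarch_field, 'k::field, 'K fps, 'K fps) base_hom"
  where "Rz_s S = RHom Rz Rz (frob_fps (qhat S))"

definition Rz_L :: "('Q::field, 'K::complete_nonarch_field, 'k::field, 'K fps, 'K loc) base_hom"
  where "Rz_L S = loc_hom Rz (zmz S)"

definition Rz_Z :: "('K::complete_nonarch_field fps, 'K loc) rhom"
  where "Rz_Z = loc_hom Rz fps_X"

definition Rz_ZL :: "('Q::field, 'K::complete_nonarch_field, 'k::field, 'K fps, 'K loc) base_hom"
  where "Rz_ZL S = loc_hom Rz (fps_X * zmz S)"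

definition Rz_B :: "('Q::field, 'K::complete_nonarch_field, 'k::field, 'K fps, 'K liloc) base_hom"
  where "Rz_B S = RHom Rz (Rzil S) (\<lambda>f. emb_B S (fps_to_bi f))"

definition Rz_ki :: "('Q::field, 'K::complete_nonarch_field, 'k::field, 'K fps, 'k fps) base_hom"
  where "Rz_ki S = RHom Rz ring_ki (\<lambda>f. Abs_fps (\<lambda>n. res_map S (fps_nth f n)))"

definition Rz_kz :: "('Q::field, 'K::complete_nonarch_field, 'k::field, 'K fps, 'k fls) base_hom"
  where "Rz_kz S = RHom Rz ring_kz (\<lambda>f. fps_to_fls (app (Rz_ki S) f))"

definition Rz_P :: "('Q::field, 'K::complete_nonarch_field, 'k::field, 'K fps, 'K fps) base_hom"
  where "Rz_P S = RHom Rz ring_P (\<lambda>f. taylor (zeta S) (fps_to_bi f))"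

definition Rz_F :: "('Q::field, 'K::complete_nonarch_field, 'k::field, 'K fps, 'K fls) base_hom"
  where "Rz_F S = RHom Rz ring_F (\<lambda>f. fps_to_fls (app (Rz_P S) f))"

definition Rz_K :: "('Q::field, 'K::complete_nonarch_field, 'k::field, 'K fps, 'K) base_hom"
  where "Rz_K S = RHom Rz ring_K (\<lambda>f. fps_nth (app (Rz_P S) f) 0)"

definition L_ZL :: "('Q::field, 'K::complete_nonarch_field, 'k::field, 'K loc, 'K loc) base_hom"
  where "L_ZL S = loc_lift Rz (zmz S) (Rz_z_zmz S) (app (Rz_ZL S))"

definition L_B :: "('Q::field, 'K::complete_nonarch_field, 'k::field, 'K loc, 'K liloc) base_hom"
  where "L_B S = loc_lift Rz (zmz S) (Rzil S) (app (Rz_B S))"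

definition L_kz :: "('Q::field, 'K::complete_nonarch_field, 'k::field, 'K loc, 'k fls) base_hom"
  where "L_kz S = loc_lift Rz (zmz S) ring_kz (app (Rz_kz S))"

definition L_F :: "('Q::field, 'K::complete_nonarch_field, 'k::field, 'K loc, 'K fls) base_hom"
  where "L_F S = loc_lift Rz (zmz S) ring_F (app (Rz_F S))"

definition Z_ZL :: "('Q::field, 'K::complete_nonarch_field, 'k::field, 'K loc, 'K loc) base_hom"
  where "Z_ZL S = loc_lift Rz fps_X (Rz_z_zmz S) (app (Rz_ZL S))"

definition Z_B :: "('Q::field, 'K::complete_nonarch_field, 'k::field, 'K loc, 'K liloc) base_hom"
  where "Z_B S = loc_lift Rz fps_X (Rzil S) (app (Rz_B S))"

definition Z_kz :: "('Q::field, 'K::complete_nonarch_field, 'k::field, 'K loc, 'k fls) base_hom"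
  where "Z_kz S = loc_lift Rz fps_X ring_kz (app (Rz_kz S))"

definition Z_s_ZL :: "('Q::field, 'K::complete_nonarch_field, 'k::field, 'K loc, 'K loc) base_hom"
  where "Z_s_ZL S = loc_lift Rz fps_X (Rz_z_zmz S) (\<lambda>f. app (Rz_ZL S) (app (Rz_s S) f))"

definition Z_s_P :: "('Q::field, 'K::complete_nonarch_field, 'k::field, 'K loc, 'K fps) base_hom"
  where "Z_s_P S = loc_lift Rz fps_X ring_P (\<lambda>f. app (Rz_P S) (app (Rz_s S) f))"

definition Z_s_K :: "('Q::field, 'K::complete_nonarch_field, 'k::field, 'K loc, 'K) base_hom"
  where "Z_s_K S = loc_lift Rz fps_X ring_K (\<lambda>f. app (Rz_K S) (app (Rz_s S) f))"

definition kz_s :: "('Q::field, 'K::complete_nonarch_field, 'k::field, 'k fls, 'k fls) base_hom"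
  where "kz_s S = RHom ring_kz ring_kz (frob_fls (qhat S))"

definition kz_B :: "('Q::field, 'K::complete_nonarch_field, 'k::field, 'k fls, 'K liloc) base_hom"
  where "kz_B S = RHom ring_kz (Rzil S) (\<lambda>f. emb_B S (fls_to_bi (res_sec S) f))"

definition kz_P :: "('Q::field, 'K::complete_nonarch_field, 'k::field, 'k fls, 'K fps) base_hom"
  where "kz_P S = RHom ring_kz ring_P (\<lambda>f. taylor (zeta S) (fls_to_bi (res_sec S) f))"

definition kz_F :: "('Q::field, 'K::complete_nonarch_field, 'k::field, 'k fls, 'K fls) base_hom"
  where "kz_F S = RHom ring_kz ring_F (\<lambda>f. fps_to_fls (app (kz_P S) f))"

definition kz_K :: "('Q::field, 'K::complete_nonarch_field, 'k::field, 'k fls, 'K) base_hom"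
  where "kz_K S = RHom ring_kz ring_K (\<lambda>f. fps_nth (app (kz_P S) f) 0)"

definition ki_kz :: "('k::field fps, 'k fls) rhom"
  where "ki_kz = RHom ring_ki ring_kz fps_to_fls"

text \<open>
  \<open>\<sigma>(\<ell>\<^sub>-) = \<ell>\<^sub>- / (1 - \<zeta>/z)\<close> divides \<open>\<ell>\<^sub>-\<close>, hence is a unit in \<open>B\<close>, and it does not vanish at \<open>z = \<zeta>\<close>, hence
  is a unit in \<open>K[[z-\<zeta>]]\<close>. Thus \<open>\<sigma>\<close> extends to \<open>B\<close>, and followed by Taylor expansion maps \<open>B\<close> into
  \<open>K[[z-\<zeta>]]\<close>.
\<close>

definition B_s :: "('Q::field, 'K::complete_nonarch_field, 'k::field, 'K liloc, 'K liloc) base_hom"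
  where "B_s S = loc_lift (Rzi S) (ell S) (Rzil S) (\<lambda>b. emb_B S (frob_bi (qhat S) b))"

definition B_kz :: "('Q::field, 'K::complete_nonarch_field, 'k::field, 'K liloc, 'k fls) base_hom"
  where "B_kz S = loc_lift (Rzi S) (ell S) ring_kz (red_bi (res_map S))"

definition B_s_P :: "('Q::field, 'K::complete_nonarch_field, 'k::field, 'K liloc, 'K fps) base_hom"
  where "B_s_P S = loc_lift (Rzi S) (ell S) ring_P (\<lambda>b. taylor (zeta S) (frob_bi (qhat S) b))"

definition B_s_F :: "('Q::field, 'K::complete_nonarch_field, 'k::field, 'K liloc, 'K fls) base_hom"
  where "B_s_F S = RHom (Rzil S) ring_F (\<lambda>b. fps_to_fls (app (B_s_P S) b))"

definition B_s_K :: "('Q::field, 'K::complete_nonarch_field, 'k::field, 'K liloc, 'K) base_hom"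
  where "B_s_K S = RHom (Rzil S) ring_K (\<lambda>b. fps_nth (app (B_s_P S) b) 0)"

definition P_F :: "('K::complete_nonarch_field fps, 'K fls) rhom"
  where "P_F = RHom ring_P ring_F fps_to_fls"

definition P_K :: "('K::complete_nonarch_field fps, 'K) rhom"
  where "P_K = RHom ring_P ring_K (\<lambda>f. fps_nth f 0)"


section \<open>Rigidified local shtukas\<close>

record (overloaded) ('K, 'k, 'm) rig_shtuka =
  smod :: "('K fps, 'm) module"
  stau :: "(('m, 'K fps) tens, 'K loc) tens \<Rightarrow> ('m, 'K loc) tens"
  sdelta :: "('m, 'K liloc) tens \<Rightarrow> (('m, 'k fls) tens, 'K liloc) tens"

definition sig_mod :: "('Q::field, 'K::complete_nonarch_field, 'k::field) shtuka_base \<Rightarrow>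
    ('K, 'k, 'm) rig_shtuka \<Rightarrow> ('K fps, ('m, 'K fps) tens) module"
  where "sig_mod S U = base_change (Rz_s S) (smod U)"

definition local_shtuka :: "('Q::field, 'K::complete_nonarch_field, 'k::field) shtuka_base \<Rightarrow>
    ('K, 'k, 'm) rig_shtuka \<Rightarrow> bool"
  where "local_shtuka S U \<longleftrightarrow> (\<exists>n. free_of_rank Rz (smod U) n) \<and>
    module_iso (Rz_zmz S) (base_change (Rz_L S) (sig_mod S U)) (base_change (Rz_L S) (smod U)) (stau U)"

text \<open>The base change of \<open>\<tau>\<close> along a homomorphism \<open>g\<close> out of \<open>R[[z]][1/(z-\<zeta>)]\<close>.\<close>

definition tau_ext :: "('Q::field, 'K::complete_nonarch_field, 'k::field) shtuka_base \<Rightarrow>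
    ('K, 'k, 'm) rig_shtuka \<Rightarrow> ('K loc, 'c) rhom \<Rightarrow> ('K fps, 'c) rhom \<Rightarrow>
    (('m, 'K fps) tens, 'c) tens \<Rightarrow> ('m, 'c) tens"
  where "tau_ext S U g h =
    bc_extend g (Rz_L S) h (sig_mod S U) (Rz_L S) h (smod U) (stau U)"

text \<open>\<open>D~ = M \<otimes> k((z))\<close> and \<open>D = \<sigma>\<^sup>*D~\<close>, which is identified with \<open>\<sigma>\<^sup>*M \<otimes> k((z))\<close>.\<close>

definition Dt :: "('Q::field, 'K::complete_nonarch_field, 'k::field) shtuka_base \<Rightarrow>
    ('K, 'k, 'm) rig_shtuka \<Rightarrow> ('k fls, ('m, 'k fls) tens) module"
  where "Dt S U = base_change (Rz_kz S) (smod U)"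

definition cris :: "('Q::field, 'K::complete_nonarch_field, 'k::field) shtuka_base \<Rightarrow>
    ('K, 'k, 'm) rig_shtuka \<Rightarrow> ('k fls, (('m, 'k fls) tens, 'k fls) tens) module"
  where "cris S U = base_change (kz_s S) (Dt S U)"

definition tau_Dt :: "('Q::field, 'K::complete_nonarch_field, 'k::field) shtuka_base \<Rightarrow>
    ('K, 'k, 'm) rig_shtuka \<Rightarrow> (('m, 'k fls) tens, 'k fls) tens \<Rightarrow> ('m, 'k fls) tens"
  where "tau_Dt S U = semilin_ext (id_hom ring_kz) (cris S U) (Dt S U) (carrier (smod U))
    (\<lambda>m. bc_unit (kz_s S) (Dt S U) (bc_unit (Rz_kz S) (smod U) m))
    (\<lambda>m. tau_ext S U (L_kz S) (Rz_kz S) (twist_unit (Rz_s S) (Rz_kz S) (smod U) m))"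

text \<open>
  The base change of \<open>\<delta>\<close> along a homomorphism \<open>g\<close> from \<open>B\<close> to \<open>C\<close> with \<open>g \<circ> Rz_B = h \<circ> \<sigma>\<close> and
  \<open>g \<circ> kz_B = k \<circ> \<sigma>\<close>. If \<open>g\<close> is \<open>\<sigma>\<close> followed by a map from \<open>\<sigma>(B)\<close> to \<open>C\<close>, this is the base change of
  \<open>\<sigma>\<^sup>*\<delta>\<close> to \<open>C\<close>.
\<close>

definition sig_delta :: "('Q::field, 'K::complete_nonarch_field, 'k::field) shtuka_base \<Rightarrow>
    ('K, 'k, 'm) rig_shtuka \<Rightarrow> ('K liloc, 'c) rhom \<Rightarrow> ('K fps, 'c) rhom \<Rightarrow> ('k fls, 'c) rhom \<Rightarrow>
    (('m, 'K fps) tens, 'c) tens \<Rightarrow> ((('m, 'k fls) tens, 'k fls) tens, 'c) tens"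
  where "sig_delta S U g h k =
    twist_extend g (Rz_s S) (Rz_B S) h (smod U) (kz_s S) (kz_B S) k (Dt S U) (sdelta U)"

text \<open>The last condition says that reducing \<open>\<delta>\<close> modulo the maximal ideal gives the identity of \<open>D~\<close>.\<close>

definition rigidified_shtuka :: "('Q::field, 'K::complete_nonarch_field, 'k::field) shtuka_base \<Rightarrow>
    ('K, 'k, 'm) rig_shtuka \<Rightarrow> bool"
  where "rigidified_shtuka S U \<longleftrightarrow> local_shtuka S U \<and>
    module_iso (Rzil S) (base_change (Rz_B S) (smod U)) (base_change (kz_B S) (Dt S U)) (sdelta U) \<and>
    (\<forall>x\<in>carrier (base_change (Rz_B S) (sig_mod S U)).
       sdelta U (tau_ext S U (L_B S) (Rz_B S) x) =
       bc_map (kz_B S) (cris S U) (Dt S U) (tau_Dt S U)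
         (sig_delta S U (B_s S) (Rz_B S) (kz_B S) x)) \<and>
    (\<forall>x\<in>carrier (base_change (Rz_B S) (smod U)).
       semilin_ext (B_kz S) (base_change (kz_B S) (Dt S U)) (Dt S U)
         (carrier (Dt S U)) (bc_unit (kz_B S) (Dt S U)) (\<lambda>d. d) (sdelta U x) =
       bc_push (Rz_B S) (Rz_kz S) (B_kz S) (smod U) x)"


subsection \<open>Morphisms and quasi-morphisms\<close>

definition rig_morphism :: "('Q::field, 'K::complete_nonarch_field, 'k::field) shtuka_base \<Rightarrow>
    ('K, 'k, 'm) rig_shtuka \<Rightarrow> ('K, 'k, 'n) rig_shtuka \<Rightarrow> ('m \<Rightarrow> 'n) \<Rightarrow> bool"
  where "rig_morphism S U W f \<longleftrightarrow> module_hom Rz (smod U) (smod W) f \<and>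
    (\<forall>x\<in>carrier (base_change (Rz_L S) (sig_mod S U)).
       stau W (bc_map (Rz_L S) (sig_mod S U) (sig_mod S W) (bc_map (Rz_s S) (smod U) (smod W) f) x) =
       bc_map (Rz_L S) (smod U) (smod W) f (stau U x)) \<and>
    (\<forall>x\<in>carrier (base_change (Rz_B S) (smod U)).
       bc_map (kz_B S) (Dt S U) (Dt S W) (bc_map (Rz_kz S) (smod U) (smod W) f) (sdelta U x) =
       sdelta W (bc_map (Rz_B S) (smod U) (smod W) f x))"

definition rig_morphism_dR :: "('Q::field, 'K::complete_nonarch_field, 'k::field) shtuka_base \<Rightarrow>
    ('K, 'k, 'm) rig_shtuka \<Rightarrow> ('K, 'k, 'n) rig_shtuka \<Rightarrow> ('m \<Rightarrow> 'n) \<Rightarrow> ('K fps, 'c) rhom \<Rightarrow>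
    (('m, 'K fps) tens, 'c) tens \<Rightarrow> (('n, 'K fps) tens, 'c) tens"
  where "rig_morphism_dR S U W f h =
    bc_map h (sig_mod S U) (sig_mod S W) (bc_map (Rz_s S) (smod U) (smod W) f)"

definition rig_morphism_cris :: "('Q::field, 'K::complete_nonarch_field, 'k::field) shtuka_base \<Rightarrow>
    ('K, 'k, 'm) rig_shtuka \<Rightarrow> ('K, 'k, 'n) rig_shtuka \<Rightarrow> ('m \<Rightarrow> 'n) \<Rightarrow>
    (('m, 'k fls) tens, 'k fls) tens \<Rightarrow> (('n, 'k fls) tens, 'k fls) tens"
  where "rig_morphism_cris S U W f =
    bc_map (kz_s S) (Dt S U) (Dt S W) (bc_map (Rz_kz S) (smod U) (smod W) f)"

text \<open>The base change of an \<open>R[[z]][1/z]\<close>-linear map \<open>f\<close> from \<open>M[1/z]\<close> to \<open>M'[1/z]\<close> along \<open>g\<close>.\<close>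

definition quasi_ext :: "('K, 'k, 'm) rig_shtuka \<Rightarrow> ('K, 'k, 'n) rig_shtuka \<Rightarrow>
    (('m, 'K loc) tens \<Rightarrow> ('n, 'K loc) tens) \<Rightarrow>
    ('K::complete_nonarch_field loc, 'c) rhom \<Rightarrow> ('K fps, 'c) rhom \<Rightarrow>
    ('m, 'c) tens \<Rightarrow> ('n, 'c) tens"
  where "quasi_ext U W f g h = bc_extend g Rz_Z h (smod U) Rz_Z h (smod W) f"

text \<open>The base change of \<open>\<sigma>\<^sup>*f\<close>; here \<open>g\<close> is \<open>\<sigma>\<close> followed by a homomorphism extending \<open>h\<close>.\<close>

definition quasi_sig_ext :: "('Q::field, 'K::complete_nonarch_field, 'k::field) shtuka_base \<Rightarrow>
    ('K, 'k, 'm) rig_shtuka \<Rightarrow> ('K, 'k, 'n) rig_shtuka \<Rightarrow>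
    (('m, 'K loc) tens \<Rightarrow> ('n, 'K loc) tens) \<Rightarrow> ('K loc, 'c) rhom \<Rightarrow> ('K fps, 'c) rhom \<Rightarrow>
    (('m, 'K fps) tens, 'c) tens \<Rightarrow> (('n, 'K fps) tens, 'c) tens"
  where "quasi_sig_ext S U W f g h =
    twist_extend g (Rz_s S) Rz_Z h (smod U) (Rz_s S) Rz_Z h (smod W) f"

definition rig_quasi_morphism :: "('Q::field, 'K::complete_nonarch_field, 'k::field) shtuka_base \<Rightarrow>
    ('K, 'k, 'm) rig_shtuka \<Rightarrow> ('K, 'k, 'n) rig_shtuka \<Rightarrow>
    (('m, 'K loc) tens \<Rightarrow> ('n, 'K loc) tens) \<Rightarrow> bool"
  where "rig_quasi_morphism S U W f \<longleftrightarrow>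
    module_hom Rz_z (base_change Rz_Z (smod U)) (base_change Rz_Z (smod W)) f \<and>
    (\<forall>x\<in>carrier (base_change (Rz_ZL S) (sig_mod S U)).
       tau_ext S W (L_ZL S) (Rz_ZL S) (quasi_sig_ext S U W f (Z_s_ZL S) (Rz_ZL S) x) =
       quasi_ext U W f (Z_ZL S) (Rz_ZL S) (tau_ext S U (L_ZL S) (Rz_ZL S) x)) \<and>
    (\<forall>x\<in>carrier (base_change (Rz_B S) (smod U)).
       bc_map (kz_B S) (Dt S U) (Dt S W) (quasi_ext U W f (Z_kz S) (Rz_kz S)) (sdelta U x) =
       sdelta W (quasi_ext U W f (Z_B S) (Rz_B S) x))"

definition quasi_morphism_cris :: "('Q::field, 'K::complete_nonarch_field, 'k::field) shtuka_base \<Rightarrow>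
    ('K, 'k, 'm) rig_shtuka \<Rightarrow> ('K, 'k, 'n) rig_shtuka \<Rightarrow>
    (('m, 'K loc) tens \<Rightarrow> ('n, 'K loc) tens) \<Rightarrow>
    (('m, 'k fls) tens, 'k fls) tens \<Rightarrow> (('n, 'k fls) tens, 'k fls) tens"
  where "quasi_morphism_cris S U W f =
    bc_map (kz_s S) (Dt S U) (Dt S W) (quasi_ext U W f (Z_kz S) (Rz_kz S))"


section \<open>Realizations\<close>

definition dR_P :: "('Q::field, 'K::complete_nonarch_field, 'k::field) shtuka_base \<Rightarrow>
    ('K, 'k, 'm) rig_shtuka \<Rightarrow> ('K fps, (('m, 'K fps) tens, 'K fps) tens) module"
  where "dR_P S U = base_change (Rz_P S) (sig_mod S U)"

definition dR_K :: "('Q::field, 'K::complete_nonarch_field, 'k::field) shtuka_base \<Rightarrow>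
    ('K, 'k, 'm) rig_shtuka \<Rightarrow> ('K, (('m, 'K fps) tens, 'K) tens) module"
  where "dR_K S U = base_change (Rz_K S) (sig_mod S U)"

definition cris_P :: "('Q::field, 'K::complete_nonarch_field, 'k::field) shtuka_base \<Rightarrow>
    ('K, 'k, 'm) rig_shtuka \<Rightarrow> ('K fps, ((('m, 'k fls) tens, 'k fls) tens, 'K fps) tens) module"
  where "cris_P S U = base_change (kz_P S) (cris S U)"

definition cris_K :: "('Q::field, 'K::complete_nonarch_field, 'k::field) shtuka_base \<Rightarrow>
    ('K, 'k, 'm) rig_shtuka \<Rightarrow> ('K, ((('m, 'k fls) tens, 'k fls) tens, 'K) tens) module"
  where "cris_K S U = base_change (kz_K S) (cris S U)"

text \<open>The reductions modulo \<open>z - \<zeta>\<close>.\<close>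

definition dR_red :: "('Q::field, 'K::complete_nonarch_field, 'k::field) shtuka_base \<Rightarrow>
    ('K, 'k, 'm) rig_shtuka \<Rightarrow> (('m, 'K fps) tens, 'K fps) tens \<Rightarrow> (('m, 'K fps) tens, 'K) tens"
  where "dR_red S U = bc_push (Rz_P S) (Rz_K S) P_K (sig_mod S U)"

definition cris_red :: "('Q::field, 'K::complete_nonarch_field, 'k::field) shtuka_base \<Rightarrow>
    ('K, 'k, 'm) rig_shtuka \<Rightarrow> ((('m, 'k fls) tens, 'k fls) tens, 'K fps) tens \<Rightarrow>
    ((('m, 'k fls) tens, 'k fls) tens, 'K) tens"
  where "cris_red S U = bc_push (kz_P S) (kz_K S) P_K (cris S U)"

text \<open>Here \<open>\<sigma>\<^sup>*M \<otimes> K((z-\<zeta>))\<close> is the localization of \<open>dR_P\<close> at \<open>z - \<zeta>\<close>, likewise for \<open>cris_P\<close>.\<close>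

definition dR_lattice :: "('Q::field, 'K::complete_nonarch_field, 'k::field) shtuka_base \<Rightarrow>
    ('K, 'k, 'm) rig_shtuka \<Rightarrow> (('m, 'K fps) tens, 'K fls) tens set"
  where "dR_lattice S U = {x \<in> carrier (base_change (Rz_F S) (sig_mod S U)).
    tau_ext S U (L_F S) (Rz_F S) x \<in>
      bc_push (Rz_P S) (Rz_F S) P_F (smod U) ` carrier (base_change (Rz_P S) (smod U))}"

definition cris_lattice :: "('Q::field, 'K::complete_nonarch_field, 'k::field) shtuka_base \<Rightarrow>
    ('K, 'k, 'm) rig_shtuka \<Rightarrow> ((('m, 'k fls) tens, 'k fls) tens, 'K fls) tens set"
  where "cris_lattice S U = sig_delta S U (B_s_F S) (Rz_F S) (kz_F S) ` dR_lattice S U"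

definition dR_fil :: "('Q::field, 'K::complete_nonarch_field, 'k::field) shtuka_base \<Rightarrow>
    ('K, 'k, 'm) rig_shtuka \<Rightarrow> int \<Rightarrow> (('m, 'K fps) tens, 'K) tens set"
  where "dR_fil S U i = dR_red S U ` {x \<in> carrier (dR_P S U).
    bc_push (Rz_P S) (Rz_F S) P_F (sig_mod S U) x \<in>
      (\<lambda>y. fls_X_intpow i \<odot>\<^bsub>base_change (Rz_F S) (sig_mod S U)\<^esub> y) ` dR_lattice S U}"

definition cris_fil :: "('Q::field, 'K::complete_nonarch_field, 'k::field) shtuka_base \<Rightarrow>
    ('K, 'k, 'm) rig_shtuka \<Rightarrow> int \<Rightarrow> ((('m, 'k fls) tens, 'k fls) tens, 'K) tens set"
  where "cris_fil S U i = cris_red S U ` {x \<in> carrier (cris_P S U).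
    bc_push (kz_P S) (kz_F S) P_F (cris S U) x \<in>
      (\<lambda>y. fls_X_intpow i \<odot>\<^bsub>base_change (kz_F S) (cris S U)\<^esub> y) ` cris_lattice S U}"

text \<open>
  The integral structures: the image in \<open>H\<^sub>d\<^sub>R(K)\<close> of \<open>\<sigma>\<^sup>*M\<close>, and the image in \<open>D\<close> of \<open>\<sigma>\<^sup>*M \<otimes> k[[z]]\<close>.
\<close>

definition dR_integral :: "('Q::field, 'K::complete_nonarch_field, 'k::field) shtuka_base \<Rightarrow>
    ('K, 'k, 'm) rig_shtuka \<Rightarrow> (('m, 'K fps) tens, 'K) tens set"
  where "dR_integral S U = bc_unit (Rz_K S) (sig_mod S U) ` carrier (sig_mod S U)"

definition cris_integral :: "('Q::field, 'K::complete_nonarch_field, 'k::field) shtuka_base \<Rightarrow>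
    ('K, 'k, 'm) rig_shtuka \<Rightarrow> (('m, 'k fls) tens, 'k fls) tens set"
  where "cris_integral S U =
    semilin_ext ki_kz (base_change (Rz_ki S) (sig_mod S U)) (cris S U) (carrier (smod U))
      (twist_unit (Rz_s S) (Rz_ki S) (smod U))
      (\<lambda>m. bc_unit (kz_s S) (Dt S U) (bc_unit (Rz_kz S) (smod U) m))
    ` carrier (base_change (Rz_ki S) (sig_mod S U))"

text \<open>The \<open>R\<close>-lattice in \<open>D \<otimes> K\<close> generated by the integral structure of \<open>D\<close>.\<close>

definition cris_integral_R :: "('Q::field, 'K::complete_nonarch_field, 'k::field) shtuka_base \<Rightarrow>
    ('K, 'k, 'm) rig_shtuka \<Rightarrow> ((('m, 'k fls) tens, 'k fls) tens, 'K) tens set"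
  where "cris_integral_R S U = \<Inter>{H. submodule H (ring_on val_ring) (cris_K S U) \<and>
    bc_unit (kz_K S) (cris S U) ` cris_integral S U \<subseteq> H}"


section \<open>The comparison maps\<close>

text \<open>
  The canonical maps \<open>h\<^sub>d\<^sub>R\<^sub>,\<^sub>c\<^sub>r\<^sub>i\<^sub>s = \<sigma>\<^sup>*\<delta> \<otimes> id\<close> over \<open>K[[z-\<zeta>]]\<close> and, reduced modulo \<open>z - \<zeta>\<close>, over \<open>K\<close>.
\<close>

definition h_dR_cris_P :: "('Q::field, 'K::complete_nonarch_field, 'k::field) shtuka_base \<Rightarrow>
    ('K, 'k, 'm) rig_shtuka \<Rightarrow>
    (('m, 'K fps) tens, 'K fps) tens \<Rightarrow> ((('m, 'k fls) tens, 'k fls) tens, 'K fps) tens"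
  where "h_dR_cris_P S U = sig_delta S U (B_s_P S) (Rz_P S) (kz_P S)"

definition h_dR_cris_K :: "('Q::field, 'K::complete_nonarch_field, 'k::field) shtuka_base \<Rightarrow>
    ('K, 'k, 'm) rig_shtuka \<Rightarrow>
    (('m, 'K fps) tens, 'K) tens \<Rightarrow> ((('m, 'k fls) tens, 'k fls) tens, 'K) tens"
  where "h_dR_cris_K S U = sig_delta S U (B_s_K S) (Rz_K S) (kz_K S)"

text \<open>The base change of \<open>h\<^sub>d\<^sub>R\<^sub>,\<^sub>c\<^sub>r\<^sub>i\<^sub>s\<close> to \<open>K((z-\<zeta>))\<close>.\<close>

definition h_dR_cris_F :: "('Q::field, 'K::complete_nonarch_field, 'k::field) shtuka_base \<Rightarrow>
    ('K, 'k, 'm) rig_shtuka \<Rightarrow>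
    (('m, 'K fps) tens, 'K fls) tens \<Rightarrow> ((('m, 'k fls) tens, 'k fls) tens, 'K fls) tens"
  where "h_dR_cris_F S U = bc_extend P_F (Rz_P S) (Rz_F S) (sig_mod S U)
    (kz_P S) (kz_F S) (cris S U) (h_dR_cris_P S U)"

end

theory Submission
  imports Defs "HOL-Computational_Algebra.Primes"
begin

text \<open>
  The comparison isomorphism is \<open>\<delta>\<close> twisted by \<open>\<sigma>\<close> and base changed along Taylor expansion at
  \<open>z = \<zeta>\<close>. This makes sense because \<open>\<sigma>(\<ell>\<^sub>-) = \<Prod>\<^bsub>i > 0\<^esub> (1 - \<zeta>\<^bsup>q^i\<^esup> / z)\<close> does not vanish at \<open>z = \<zeta>\<close>,
  so that \<open>\<sigma>\<close> extends to a map from \<open>R[[z, z\<^sup>-\<^sup>1}[1 / \<ell>\<^sub>-]\<close> to \<open>K[[z - \<zeta>]]\<close>; compatibility with lattices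
  and filtrations and functoriality then follow from the uniqueness of semilinear extensions.
  That \<open>\<sigma>\<close> is a Frobenius power, i.e. that \<open>A / \<epsilon>\<close> is finite of prime power order, comes from the
  theory of function fields over \<open>F\<^sub>q\<close>.

  The integral structures are not respected by the shtuka with
  \<open>\<tau> = ((z - \<zeta>)\<^sup>q, -\<zeta>; 0, (z - \<zeta>)\<^bsup>q + 1\<^esup>)\<close>, because the off-diagonal entry of its comparison
  isomorphism has a value of absolute value \<open>|\<zeta>|\<^sup>-\<^sup>1\<close> at \<open>z = \<zeta>\<close>.
\<close>

text \<open>The exponents of the example balance a pole against the Frobenius. With diagonal entries
  (z - \<zeta>)^a and (z - \<zeta>)^d the off-diagonal entry of \<delta> starts with \<zeta> z^(-d),
  so its twist has at z = \<zeta> a leading value of size |\<zeta>|^(q - d): d = q + 1 is the first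
  exponent that leaves R, and a = d - 1 makes the recursion for the coefficients a shift by one. The
  factor \<zeta> off the diagonal makes \<tau> diagonal after reduction, which lets \<delta> reduce
  to the identity. That A / \<epsilon> is finite needs a nonzero element of \<epsilon>, so A must
  not be a field: there has to be a nonconstant function without poles away from \<infinity>. As the
  constants are finite, the linear algebra behind this is done by counting elements. The value group
  may be dense, so convergence is expressed by families tending to zero, whose sums may be
  rearranged. Two-sided series must decay faster than every |\<zeta>|^(r m); a functional equation
  that bounds a coefficient by the square of an earlier one turns mere convergence to zero into such
  decay.\<close>

abbreviation "bc \<equiv> base_change"

section \<open>Homomorphism data, semilinear maps and generating sets\<close>

definition rhom_ok :: "('a, 'b) rhom => bool"
 where "rhom_ok h \<longleftrightarrow> cring (src h) \<and> cring (tgt h) \<and> app h \<in> ring_hom (src h) (tgt h)"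

lemma rhom_okD:
 assumes "rhom_ok h"
 shows "cring (src h)" "cring (tgt h)" "app h \<in> ring_hom (src h) (tgt h)"
  "ring (src h)" "ring (tgt h)"
  "!!a. a \<in> carrier (src h) ==> app h a \<in> carrier (tgt h)"
  "!!a b. a \<in> carrier (src h) ==> b \<in> carrier (src h) ==>
   app h (a \<otimes>\<^bsub>src h\<^esub> b) = app h a \<otimes>\<^bsub>tgt h\<^esub> app h b"
  "!!a b. a \<in> carrier (src h) ==> b \<in> carrier (src h) ==>
   app h (a \<oplus>\<^bsub>src h\<^esub> b) = app h a \<oplus>\<^bsub>tgt h\<^esub> app h b"
  "app h \<one>\<^bsub>src h\<^esub> = \<one>\<^bsub>tgt h\<^esub>"
 using assms unfolding rhom_ok_def
 by (auto simp: cring.axioms(1) ring_hom_memE)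

lemma rhom_ok_id: "cring R ==> rhom_ok (id_hom R)"
 by (auto simp: rhom_ok_def id_hom_def ring_hom_def)

lemma rhom_ok_comp:
 assumes g: "rhom_ok g" and r: "rhom_ok r" "src r = tgt g"
 shows "rhom_ok (RHom (src g) (tgt r) (\<lambda>a. app r (app g a)))"
 unfolding rhom_ok_def rhom.sel
proof (intro conjI ring_hom_memI)
 note 1 = rhom_okD[OF g] and 2 = rhom_okD[OF r(1), unfolded r(2)]
 show "cring (src g)" "cring (tgt r)" by (rule 1 2)+
 show "app r (app g \<one>\<^bsub>src g\<^esub>) = \<one>\<^bsub>tgt r\<^esub>" by (simp only: 1(9) 2(9))
 fix x y assume xy: "x \<in> carrier (src g)" "y \<in> carrier (src g)"
 show "app r (app g x) \<in> carrier (tgt r)" using xy by (intro 1 2)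
 show "app r (app g (x \<otimes>\<^bsub>src g\<^esub> y)) = app r (app g x) \<otimes>\<^bsub>tgt r\<^esub> app r (app g y)"
  using xy by (simp only: 1(6,7) 2(7))
 show "app r (app g (x \<oplus>\<^bsub>src g\<^esub> y)) = app r (app g x) \<oplus>\<^bsub>tgt r\<^esub> app r (app g y)"
  using xy by (simp only: 1(6,8) 2(8))
qed

lemma id_hom_simps [simp]: "src (id_hom R) = R" "tgt (id_hom R) = R" "app (id_hom R) x = x"
 by (auto simp: id_hom_def)

lemma semilinearI:
 assumes "!!x. x \<in> carrier U ==> f x \<in> carrier W"
  "!!x y. x \<in> carrier U ==> y \<in> carrier U ==> f (x \<oplus>\<^bsub>U\<^esub> y) = f x \<oplus>\<^bsub>W\<^esub> f y"
  "!!b x. b \<in> carrier (src h) ==> x \<in> carrier U ==> f (b \<odot>\<^bsub>U\<^esub> x) = app h b \<odot>\<^bsub>W\<^esub> f x"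
 shows "semilinear h U W f"
 using assms by (auto simp: semilinear_def)

lemma semilinearD:
 assumes "semilinear h U W f"
 shows "!!x. x \<in> carrier U ==> f x \<in> carrier W"
  "!!x y. x \<in> carrier U ==> y \<in> carrier U ==> f (x \<oplus>\<^bsub>U\<^esub> y) = f x \<oplus>\<^bsub>W\<^esub> f y"
  "!!b x. b \<in> carrier (src h) ==> x \<in> carrier U ==> f (b \<odot>\<^bsub>U\<^esub> x) = app h b \<odot>\<^bsub>W\<^esub> f x"
 using assms by (auto simp: semilinear_def)

lemma semilinear_cong:
 assumes "semilinear h U W f" "src h' = src h"
  "!!b. b \<in> carrier (src h) ==> app h b = app h' b"
  "!!x. x \<in> carrier U ==> f x = f' x"
  "module (src h) U"
 shows "semilinear h' U W f'"
proof (rule semilinearI)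
 interpret U: module "src h" U by fact
 fix x y b assume x: "x \<in> carrier U"
 show "f' x \<in> carrier W" using assms(4)[OF x] semilinearD(1)[OF assms(1) x] by simp
 show "f' (x \<oplus>\<^bsub>U\<^esub> y) = f' x \<oplus>\<^bsub>W\<^esub> f' y" if "y \<in> carrier U"
  using assms(4)[symmetric] semilinearD(2)[OF assms(1) x that] x that by simp
 show "f' (b \<odot>\<^bsub>U\<^esub> x) = app h' b \<odot>\<^bsub>W\<^esub> f' x" if "b \<in> carrier (src h')"
  using assms(3,4)[symmetric] semilinearD(3)[OF assms(1) _ x, of b] x that assms(2) by simp
qed

lemma semilinear_comp:
 assumes "semilinear g U V f" "semilinear g' V W f'" "rhom_ok g" "src g' = tgt g" "src k = src g"
  "!!b. b \<in> carrier (src g) ==> app k b = app g' (app g b)"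
 shows "semilinear k U W (\<lambda>x. f' (f x))"
 using assms rhom_okD(6)[OF assms(3)] by (auto simp: semilinear_def Pi_iff)

lemma additive_zero:
 assumes "abelian_group U" "abelian_group W" "!!x. x \<in> carrier U ==> f x \<in> carrier W"
  "!!x y. x \<in> carrier U ==> y \<in> carrier U ==> f (x \<oplus>\<^bsub>U\<^esub> y) = f x \<oplus>\<^bsub>W\<^esub> f y"
 shows "f \<zero>\<^bsub>U\<^esub> = \<zero>\<^bsub>W\<^esub>"
proof -
 interpret U: abelian_group U by fact
 interpret W: abelian_group W by fact
 have "f \<zero>\<^bsub>U\<^esub> \<oplus>\<^bsub>W\<^esub> f \<zero>\<^bsub>U\<^esub> = f \<zero>\<^bsub>U\<^esub> \<oplus>\<^bsub>W\<^esub> \<zero>\<^bsub>W\<^esub>"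
  using assms(4)[of "\<zero>\<^bsub>U\<^esub>" "\<zero>\<^bsub>U\<^esub>"] assms(3) by simp
 thus ?thesis using W.add.l_cancel[of "f \<zero>\<^bsub>U\<^esub>" "f \<zero>\<^bsub>U\<^esub>" "\<zero>\<^bsub>W\<^esub>"] assms(3) by simp
qed

lemma (in abelian_group) add_minus_minus:
 assumes "x \<in> carrier G" "y \<in> carrier G"
 shows "(x \<oplus> y) \<ominus> x \<ominus> y = \<zero>"
proof -
 have "x \<oplus> y \<oplus> \<ominus> x = y" using assms by (simp add: a_comm[of x y] a_assoc r_neg)
 thus ?thesis using assms by (simp add: minus_eq r_neg)
qed

lemma semilinear_zero:
 "semilinear h U W f ==> abelian_group U ==> abelian_group W ==> f \<zero>\<^bsub>U\<^esub> = \<zero>\<^bsub>W\<^esub>"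
 by (rule additive_zero) (auto dest: semilinearD)

text \<open>Generation is encoded as an induction principle rather than by finite sums: zero, sums
  and multiples of generators reach everything. Negatives are reached as multiples by -1.\<close>

definition gens :: "'b ring => ('b, 'x) module => 'x set => bool"
 where "gens B U I \<longleftrightarrow> I \<subseteq> carrier U \<and>
  (\<forall>H. \<zero>\<^bsub>U\<^esub> \<in> H \<and> (\<forall>x\<in>H \<inter> carrier U. \<forall>y\<in>H \<inter> carrier U. x \<oplus>\<^bsub>U\<^esub> y \<in> H) \<and>
    (\<forall>b\<in>carrier B. \<forall>x\<in>I. b \<odot>\<^bsub>U\<^esub> x \<in> H) --> carrier U \<subseteq> H)"

lemma gens_induct [consumes 2, case_names zero add smult]:
 assumes "gens B U I" "x \<in> carrier U" "P \<zero>\<^bsub>U\<^esub>"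
  "!!x y. x \<in> carrier U ==> y \<in> carrier U ==> P x ==> P y ==> P (x \<oplus>\<^bsub>U\<^esub> y)"
  "!!b x. b \<in> carrier B ==> x \<in> I ==> P (b \<odot>\<^bsub>U\<^esub> x)"
 shows "P x"
 using assms(1)[unfolded gens_def, THEN conjunct2, rule_format, of "{x. P x}"] assms(2-5) by auto

lemma gensD: "gens B U I ==> x \<in> I ==> x \<in> carrier U"
 by (auto simp: gens_def)

lemma gens_mono: "gens B U I ==> I \<subseteq> J ==> J \<subseteq> carrier U ==> gens B U J"
 unfolding gens_def by (meson subset_iff)

lemma gens_carrier:
 assumes "module B U"
 shows "gens B U (carrier U)"
proof -
 interpret module B U by fact
 show ?thesis unfolding gens_def
  by (metis smult_one one_closed subsetI)
qed

text \<open>Every \<open>THE\<close> hidden in \<open>semilin_ext\<close> rests on this, and so does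
  every identity between maps below: it is enough to compare two semilinear maps on
  generators.\<close>

lemma semilinear_unique:
 assumes "gens (src g) U I" "semilinear g U W f" "semilinear g U W f'" "abelian_group U" "abelian_group W"
  "!!x. x \<in> I ==> f x = f' x" "x \<in> carrier U"
 shows "f x = f' x"
 using assms(1,7)
proof (induction rule: gens_induct)
 case zero
 thus ?case using semilinear_zero assms by metis
next
 case (add x y)
 thus ?case using assms(2,3) by (simp add: semilinearD)
next
 case (smult b x)
 thus ?case using assms(2,3,6) gensD[OF assms(1)] by (simp add: semilinearD)
qed

section \<open>Base change of modules\<close>

locale bc_ctx =
 fixes h :: "('a, 'b) rhom" and M :: "('a, 'm) module"
 assumes hok: "rhom_ok h" and Mmod: "module (src h) M"
begin

abbreviation "B \<equiv> tgt h"
abbreviation "G \<equiv> bc_group h M"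
abbreviation "N \<equiv> bc_kernel h M"
abbreviation "S \<equiv> carrier M \<times> carrier B"

sublocale A: cring "src h" by (rule rhom_okD(1)[OF hok])
sublocale B: cring "tgt h" by (rule rhom_okD(2)[OF hok])
sublocale M: module "src h" M by (rule Mmod)
sublocale G: comm_group G unfolding bc_group_def by (rule abelian_free_Abelian_group)

lemma hcl [simp]: "a \<in> carrier (src h) ==> app h a \<in> carrier B"
 by (rule rhom_okD(6)[OF hok])

lemma G_simps [simp]: "u \<in> carrier G \<longleftrightarrow> Poly_Mapping.keys u \<subseteq> S" "x \<otimes>\<^bsub>G\<^esub> y = x + y"
 "\<one>\<^bsub>G\<^esub> = 0"
 by (simp_all add: bc_group_def)

lemma rel_sub: "bc_relators h M \<subseteq> carrier G"
 unfolding bc_relators_def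
 by (fastforce dest!: subsetD[OF keys_diff] intro: M.a_closed M.smult_closed)

lemma N_sub: "subgroup N G"
 unfolding bc_kernel_def by (rule G.generate_is_subgroup[OF rel_sub])

lemma N_normal: "N \<lhd> G"
 by (rule G.subgroup_imp_normal[OF N_sub])

sublocale N: normal N G by (rule N_normal)

lemma N_rel: "r \<in> bc_relators h M ==> r \<in> N"
 unfolding bc_kernel_def by (rule generate.incl)

lemma N_add: "x \<in> N ==> y \<in> N ==> x + y \<in> N"
 using subgroup.m_closed[OF N_sub] by simp

lemma N_keys: "x \<in> N ==> Poly_Mapping.keys x \<subseteq> S"
 using subgroup.mem_carrier[OF N_sub, of x] by simp

lemma N_minus: "x \<in> N ==> - x \<in> N"
 using subgroup.m_inv_closed[OF N_sub, of x] N_keys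
 by (metis bc_group_def inv_free_Abelian_group)

lemma N_diff: "x \<in> N ==> y \<in> N ==> x - y \<in> N"
 using N_add[OF _ N_minus] by fastforce

lemma N_zero: "0 \<in> N"
 using subgroup.one_closed[OF N_sub] by simp

lemma N_induct [consumes 1, case_names zero rel add minus]:
 assumes "x \<in> N" "P 0" "!!r. r \<in> bc_relators h M ==> P r"
  "!!x y. x \<in> N ==> y \<in> N ==> P x ==> P y ==> P (x + y)"
  "!!x. x \<in> N ==> P x ==> P (- x)"
 shows "P x"
 using assms(1)[unfolded bc_kernel_def]
proof (induction rule: generate.induct)
 case (inv r)
 hence "inv\<^bsub>G\<^esub> r = - r" using rel_sub by (simp add: bc_group_def subset_iff)
 thus ?case using assms(3,5) inv N_rel by metis
next
 case (eng h1 h2)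
 thus ?case using assms(4) unfolding bc_kernel_def by simp
qed (use assms(2,3) in auto)

definition cls :: "('m \<times> 'b \<Rightarrow>\<^sub>0 int) => ('m, 'b) tens" where "cls u = N #>\<^bsub>G\<^esub> u"

lemma carrier_bc: "U \<in> carrier (bc h M) \<longleftrightarrow> (\<exists>u\<in>carrier G. U = cls u)"
 by (auto simp: base_change_def RCOSETS_def cls_def)

lemma bcE:
 assumes "U \<in> carrier (bc h M)"
 obtains u where "u \<in> carrier G" "U = cls u"
 using assms carrier_bc by metis

lemma cls_closed [intro]: "u \<in> carrier G ==> cls u \<in> carrier (bc h M)"
 unfolding carrier_bc by auto

lemma cls_eq_iff: "u \<in> carrier G ==> v \<in> carrier G ==> cls u = cls v \<longleftrightarrow> u - v \<in> N"
proof -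
 assume u: "u \<in> carrier G" and v: "v \<in> carrier G"
 have 1: "cls u = cls v \<longleftrightarrow> u \<in> cls v"
  unfolding cls_def using u v
  by (metis G.repr_independence G.rcos_self N_sub)
 have "u \<in> cls v \<longleftrightarrow> u - v \<in> N"
  unfolding cls_def r_coset_def by (auto simp: algebra_simps) (metis diff_add_cancel)
 thus ?thesis using 1 by simp
qed

lemma cls_self: "u \<in> carrier G ==> u \<in> cls u"
 unfolding cls_def by (rule G.rcos_self[OF _ N_sub])

lemma cls_memD:
 assumes "u \<in> carrier G" "v \<in> cls u"
 shows "v \<in> carrier G \<and> cls v = cls u"
 using subsetD[OF G.r_coset_subset_G[OF N.subset assms(1)]] assms(2)
  G.repr_independence[OF _ assms(1) N_sub, of v] unfolding cls_def by (auto simp del: G_simps)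

lemma cls_mem_diff: "u \<in> carrier G ==> v \<in> cls u ==> v - u \<in> N"
 using cls_memD[of u v] cls_eq_iff[of v u] by argo

lemma cls_add: "u \<in> carrier G ==> v \<in> carrier G ==> cls u \<oplus>\<^bsub>bc h M\<^esub> cls v = cls (u + v)"
 unfolding cls_def base_change_def using N.rcos_sum[of u v] by simp

lemma cls_zero: "\<zero>\<^bsub>bc h M\<^esub> = cls 0"
 unfolding cls_def base_change_def using G.coset_mult_one[OF N.subset] by simp

lemma add_carrier: "u \<in> carrier G ==> v \<in> carrier G ==> u + v \<in> carrier G"
 using G.m_closed[of u v] by simp
lemma minus_carrier: "u \<in> carrier G ==> - u \<in> carrier G"
 by simp
lemma diff_carrier: "u \<in> carrier G ==> v \<in> carrier G ==> u - v \<in> carrier G"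
 using add_carrier[of u "-v"] minus_carrier[of v] by simp

text \<open>Scalar multiplication by \<open>b\<close>, lifted to the free abelian group.
  \<open>base_change\<close> applies it to all representatives of a coset and takes the union, so
  stability of the kernel under \<open>E b\<close> is what makes this union a single coset.\<close>

definition E :: "'b => ('m \<times> 'b \<Rightarrow>\<^sub>0 int) => ('m \<times> 'b \<Rightarrow>\<^sub>0 int)"
 where "E b = frag_extend (\<lambda>(x, c). frag_of (x, b \<otimes>\<^bsub>B\<^esub> c))"

lemma E_simps: "E b (frag_of (x, c)) = frag_of (x, b \<otimes>\<^bsub>B\<^esub> c)" "E b (u + v) = E b u + E b v"
  "E b (u - v) = E b u - E b v" "E b 0 = 0" "E b (- u) = - E b u"
 by (simp_all add: E_def frag_extend_add frag_extend_diff frag_extend_minus)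

lemma G_induct [consumes 1, case_names zero frag diff]:
 assumes "u \<in> carrier G" "P 0" "!!x c. x \<in> carrier M ==> c \<in> carrier B ==> P (frag_of (x, c))"
  "!!u v. u \<in> carrier G ==> v \<in> carrier G ==> P u ==> P v ==> P (u - v)"
 shows "P u"
 by (rule free_Abelian_group_induct[of u S P]) (use assms in auto)

lemma E_closed: "b \<in> carrier B ==> u \<in> carrier G ==> E b u \<in> carrier G"
proof (rule G_induct[of u "\<lambda>u. E b u \<in> carrier G"], goal_cases)
 case (4 u v)
 thus ?case unfolding E_simps by (intro diff_carrier)
qed (auto simp: E_simps)

lemma relI1: "x \<in> carrier M ==> y \<in> carrier M ==> b \<in> carrier B ==>
  frag_of (x \<oplus>\<^bsub>M\<^esub> y, b) - frag_of (x, b) - frag_of (y, b) \<in> N"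
 by (rule N_rel) (unfold bc_relators_def, blast)
lemma relI2: "x \<in> carrier M ==> c \<in> carrier B ==> b \<in> carrier B ==>
  frag_of (x, b \<oplus>\<^bsub>B\<^esub> c) - frag_of (x, b) - frag_of (x, c) \<in> N"
 by (rule N_rel) (unfold bc_relators_def, blast)
lemma relI3: "x \<in> carrier M ==> a \<in> carrier (src h) ==> b \<in> carrier B ==>
  frag_of (a \<odot>\<^bsub>M\<^esub> x, b) - frag_of (x, app h a \<otimes>\<^bsub>B\<^esub> b) \<in> N"
 by (rule N_rel) (unfold bc_relators_def, blast)

text \<open>Multiplication in the second factor sends each relator to a relator of the same kind;
  for the third kind this uses that the target ring is commutative.\<close>

lemma E_rel: "b \<in> carrier B ==> r \<in> bc_relators h M ==> E b r \<in> N"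
proof -
 assume b: "b \<in> carrier B" and r: "r \<in> bc_relators h M"
 from r consider
  (1) x y c where "r = frag_of (x \<oplus>\<^bsub>M\<^esub> y, c) - frag_of (x, c) - frag_of (y, c)"
    "x \<in> carrier M" "y \<in> carrier M" "c \<in> carrier B"
 | (2) x c d where "r = frag_of (x, c \<oplus>\<^bsub>B\<^esub> d) - frag_of (x, c) - frag_of (x, d)"
    "x \<in> carrier M" "d \<in> carrier B" "c \<in> carrier B"
 | (3) a x c where "r = frag_of (a \<odot>\<^bsub>M\<^esub> x, c) - frag_of (x, app h a \<otimes>\<^bsub>B\<^esub> c)"
    "x \<in> carrier M" "a \<in> carrier (src h)" "c \<in> carrier B"
  unfolding bc_relators_def by blast
 thus ?thesis
 proof cases
  case 1 thus ?thesis using relI1 b by (simp add: E_simps)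
 next
  case 2 thus ?thesis using relI2 b by (simp add: E_simps B.r_distr)
 next
  case 3 thus ?thesis using relI3[of x a "b \<otimes>\<^bsub>B\<^esub> c"] b by (simp add: E_simps B.m_lcomm)
 qed
qed

lemma E_N: "b \<in> carrier B ==> u \<in> N ==> E b u \<in> N"
 by (erule N_induct) (auto simp: E_simps N_zero N_add N_minus E_rel)

lemma smult_cls: "b \<in> carrier B ==> u \<in> carrier G ==> b \<odot>\<^bsub>bc h M\<^esub> cls u = cls (E b u)"
proof -
 assume b: "b \<in> carrier B" and u: "u \<in> carrier G"
 have *: "cls (E b v) = cls (E b u)" if "v \<in> cls u" for v
 proof -
  from cls_memD[OF u that] have v: "v \<in> carrier G" "v - u \<in> N"
   using cls_eq_iff[OF _ u] by auto
  thus ?thesis using cls_eq_iff[OF E_closed[OF b v(1)] E_closed[OF b u]] E_N[OF b v(2)]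
   by (simp add: E_simps)
 qed
 have "b \<odot>\<^bsub>bc h M\<^esub> cls u = (\<Union>v\<in>cls u. cls (E b v))"
  unfolding base_change_def cls_def E_def by simp
 also have "\<dots> = cls (E b u)" using * cls_self[OF u] by blast
 finally show ?thesis .
qed

lemma bc_abelian: "abelian_group (bc h M)"
proof (rule abelian_groupI)
 fix x y z assume "x \<in> carrier (bc h M)" "y \<in> carrier (bc h M)" "z \<in> carrier (bc h M)"
 then obtain u v w where "u \<in> carrier G" "x = cls u" "v \<in> carrier G" "y = cls v" "w \<in> carrier G" "z = cls w"
  by (metis bcE)
 thus "x \<oplus>\<^bsub>bc h M\<^esub> y \<oplus>\<^bsub>bc h M\<^esub> z = x \<oplus>\<^bsub>bc h M\<^esub> (y \<oplus>\<^bsub>bc h M\<^esub> z)"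
  by (simp add: cls_add add_carrier add.assoc del: G_simps(1))
next
 fix x y assume "x \<in> carrier (bc h M)" "y \<in> carrier (bc h M)"
 then obtain u v where "u \<in> carrier G" "x = cls u" "v \<in> carrier G" "y = cls v"
  by (metis bcE)
 thus "x \<oplus>\<^bsub>bc h M\<^esub> y \<in> carrier (bc h M)"
  "x \<oplus>\<^bsub>bc h M\<^esub> y = y \<oplus>\<^bsub>bc h M\<^esub> x"
  by (simp_all add: cls_add add_carrier cls_closed add.commute del: G_simps(1))
next
 show "\<zero>\<^bsub>bc h M\<^esub> \<in> carrier (bc h M)"
  unfolding cls_zero by (rule cls_closed) simp
next
 fix x assume "x \<in> carrier (bc h M)"
 then obtain u where u: "u \<in> carrier G" "x = cls u" by (metis bcE)
 thus "\<zero>\<^bsub>bc h M\<^esub> \<oplus>\<^bsub>bc h M\<^esub> x = x"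
  unfolding cls_zero using cls_add[of 0 u] by simp
 show "\<exists>y\<in>carrier (bc h M). y \<oplus>\<^bsub>bc h M\<^esub> x = \<zero>\<^bsub>bc h M\<^esub>"
  using u cls_add[of "-u" u] by (intro bexI[of _ "cls (- u)"]) (auto simp: cls_zero)
qed

lemma E_mult: "u \<in> carrier G ==> b \<in> carrier B ==> c \<in> carrier B ==> E (b \<otimes>\<^bsub>B\<^esub> c) u = E b (E c u)"
 by (erule G_induct) (auto simp: E_simps B.m_assoc)

lemma E_one: "u \<in> carrier G ==> E \<one>\<^bsub>B\<^esub> u = u"
 by (erule G_induct) (auto simp: E_simps)

text \<open>On the free group the action is not additive in the scalar. The defect on a generator is
  a relator of the second kind, hence it lies in the kernel.\<close>

lemma E_plus: "u \<in> carrier G ==> b \<in> carrier B ==> c \<in> carrier B ==>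
  E (b \<oplus>\<^bsub>B\<^esub> c) u - E b u - E c u \<in> N"
proof (induction rule: G_induct)
 case zero
 thus ?case using N_zero by (simp add: E_simps)
next
 case (frag x d)
 thus ?case using relI2[of x "c \<otimes>\<^bsub>B\<^esub> d" "b \<otimes>\<^bsub>B\<^esub> d"] by (simp add: E_simps B.l_distr)
next
 case (diff u v)
 have "E (b \<oplus>\<^bsub>B\<^esub> c) (u - v) - E b (u - v) - E c (u - v) =
  (E (b \<oplus>\<^bsub>B\<^esub> c) u - E b u - E c u) - (E (b \<oplus>\<^bsub>B\<^esub> c) v - E b v - E c v)"
  by (simp add: E_simps)
 thus ?case using N_diff[OF diff.IH] diff.prems by simp
qed

lemma bc_module: "module (tgt h) (bc h M)"
proof (rule moduleI)
 show "cring B" by (rule B.is_cring)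
 show "abelian_group (bc h M)" by (rule bc_abelian)
next
 fix a x assume "a \<in> carrier B" "x \<in> carrier (bc h M)"
 thus "a \<odot>\<^bsub>bc h M\<^esub> x \<in> carrier (bc h M)"
  using smult_cls E_closed by (auto simp only: carrier_bc)
next
 fix a b x assume ab: "a \<in> carrier B" "b \<in> carrier B" and "x \<in> carrier (bc h M)"
 then obtain u where u: "u \<in> carrier G" "x = cls u" by (metis bcE)
 have "cls (E (a \<oplus>\<^bsub>B\<^esub> b) u) = cls (E a u + E b u)"
  by (subst cls_eq_iff) (use E_plus[OF u(1) ab] ab u(1) in \<open>auto intro!: E_closed add_carrier simp del: G_simps(1) simp: diff_diff_eq\<close>)
 thus "(a \<oplus>\<^bsub>B\<^esub> b) \<odot>\<^bsub>bc h M\<^esub> x = a \<odot>\<^bsub>bc h M\<^esub> x \<oplus>\<^bsub>bc h M\<^esub> b \<odot>\<^bsub>bc h M\<^esub> x"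
  using u ab by (simp add: smult_cls cls_add E_closed del: G_simps(1))
 show "(a \<otimes>\<^bsub>B\<^esub> b) \<odot>\<^bsub>bc h M\<^esub> x = a \<odot>\<^bsub>bc h M\<^esub> (b \<odot>\<^bsub>bc h M\<^esub> x)"
  using u ab by (simp add: smult_cls E_mult E_closed del: G_simps(1))
next
 fix a x y assume a: "a \<in> carrier B" and "x \<in> carrier (bc h M)" "y \<in> carrier (bc h M)"
 then obtain u v where u: "u \<in> carrier G" "x = cls u" and v: "v \<in> carrier G" "y = cls v"
  by (metis bcE)
 show "a \<odot>\<^bsub>bc h M\<^esub> (x \<oplus>\<^bsub>bc h M\<^esub> y) = a \<odot>\<^bsub>bc h M\<^esub> x \<oplus>\<^bsub>bc h M\<^esub> a \<odot>\<^bsub>bc h M\<^esub> y"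
  using u v a by (simp add: smult_cls cls_add E_closed add_carrier E_simps del: G_simps(1))
next
 fix x assume "x \<in> carrier (bc h M)"
 then obtain u where u: "u \<in> carrier G" "x = cls u" by (metis bcE)
 thus "\<one>\<^bsub>B\<^esub> \<odot>\<^bsub>bc h M\<^esub> x = x"
  by (simp add: smult_cls E_one del: G_simps(1))
qed

lemma bc_unit_cls: "bc_unit h M x = cls (frag_of (x, \<one>\<^bsub>B\<^esub>))"
 by (simp add: bc_unit_def cls_def)

lemma smult_unit: "b \<in> carrier B ==> x \<in> carrier M ==>
  b \<odot>\<^bsub>bc h M\<^esub> bc_unit h M x = cls (frag_of (x, b))"
 unfolding bc_unit_cls by (subst smult_cls) (auto simp: E_simps)

lemma bc_unit_semilinear: "semilinear h M (bc h M) (bc_unit h M)"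
proof (rule semilinearI)
 fix x assume x: "x \<in> carrier M"
 thus "bc_unit h M x \<in> carrier (bc h M)"
  unfolding bc_unit_cls by auto
 fix y assume y: "y \<in> carrier M"
 thus "bc_unit h M (x \<oplus>\<^bsub>M\<^esub> y) = bc_unit h M x \<oplus>\<^bsub>bc h M\<^esub> bc_unit h M y"
  unfolding bc_unit_cls using x relI1[of x y "\<one>\<^bsub>B\<^esub>"]
  by (subst cls_add, simp, simp, subst cls_eq_iff) (auto simp: diff_diff_eq dest!: subsetD[OF keys_add])
next
 fix a x assume a: "a \<in> carrier (src h)" and x: "x \<in> carrier M"
 hence "cls (frag_of (a \<odot>\<^bsub>M\<^esub> x, \<one>\<^bsub>B\<^esub>)) = cls (frag_of (x, app h a))"
  using relI3[of x a "\<one>\<^bsub>B\<^esub>"] by (subst cls_eq_iff) auto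
 thus "bc_unit h M (a \<odot>\<^bsub>M\<^esub> x) = app h a \<odot>\<^bsub>bc h M\<^esub> bc_unit h M x"
  using a x by (simp add: smult_unit bc_unit_cls[of "a \<odot>\<^bsub>M\<^esub> x"])
qed

lemma bc_gens_carrier: "gens (tgt h) (bc h M) (bc_unit h M ` carrier M)"
 unfolding gens_def
proof (intro conjI allI impI)
 show "bc_unit h M ` carrier M \<subseteq> carrier (bc h M)"
  using bc_unit_semilinear by (auto dest: semilinearD)
 fix H assume H: "\<zero>\<^bsub>bc h M\<^esub> \<in> H \<and> (\<forall>x\<in>H \<inter> carrier (bc h M). \<forall>y\<in>H \<inter> carrier (bc h M). x \<oplus>\<^bsub>bc h M\<^esub> y \<in> H) \<and>
   (\<forall>b\<in>carrier (tgt h). \<forall>x\<in>bc_unit h M ` carrier M. b \<odot>\<^bsub>bc h M\<^esub> x \<in> H)"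
 have add: "cls (u + v) \<in> H" if "cls u \<in> H" "cls v \<in> H" "u \<in> carrier G" "v \<in> carrier G" for u v
  using H that by (metis Int_iff cls_add cls_closed)
 have fr: "cls (frag_of (x, b)) \<in> H" if "x \<in> carrier M" "b \<in> carrier B" for x b
  using H that smult_unit by (metis imageI)
 \<comment> \<open>The free group is exhausted by differences while \<open>H\<close> is only closed
   under sums, so \<open>u\<close> and \<open>- u\<close> are treated together. For a generator the
   negative is absorbed by the second factor, because (x, 0) lies in the kernel.\<close>
 have "cls u \<in> H \<and> cls (- u) \<in> H" if "u \<in> carrier G" for u
  using that
 proof (induction rule: G_induct)
  case zero
  thus ?case using H cls_zero by simp
 next
  case (frag x c)
  have "cls (- frag_of (x, c)) = cls (frag_of (x, \<ominus>\<^bsub>B\<^esub> c))"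
  proof (subst cls_eq_iff)
   have z: "frag_of (x, \<zero>\<^bsub>B\<^esub>) \<in> N"
    using N_minus[OF relI2[of x "\<zero>\<^bsub>B\<^esub>" "\<zero>\<^bsub>B\<^esub>"]] frag by simp
   show "- frag_of (x, c) - frag_of (x, \<ominus>\<^bsub>B\<^esub> c) \<in> N"
    using N_diff[OF relI2[of x "\<ominus>\<^bsub>B\<^esub> c" c] z] frag by (simp add: B.r_neg)
  qed (use frag in auto)
  thus ?case using fr frag by simp
 next
  case (diff u v)
  thus ?case using add[of u "-v"] add[of "-u" v] minus_carrier by (simp del: G_simps(1))
 qed
 thus "carrier (bc h M) \<subseteq> H" by (auto elim!: bcE simp del: G_simps)
qed

lemma bc_gens:
 assumes "gens (src h) M I"
 shows "gens (tgt h) (bc h M) (bc_unit h M ` I)"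
 unfolding gens_def
proof (intro conjI allI impI)
 show "bc_unit h M ` I \<subseteq> carrier (bc h M)"
  using bc_unit_semilinear gensD[OF assms] by (auto dest: semilinearD)
 fix H assume H: "\<zero>\<^bsub>bc h M\<^esub> \<in> H \<and> (\<forall>x\<in>H \<inter> carrier (bc h M). \<forall>y\<in>H \<inter> carrier (bc h M). x \<oplus>\<^bsub>bc h M\<^esub> y \<in> H) \<and>
   (\<forall>b\<in>carrier (tgt h). \<forall>x\<in>bc_unit h M ` I. b \<odot>\<^bsub>bc h M\<^esub> x \<in> H)"
 interpret T: module "tgt h" "bc h M" by (rule bc_module)
 note u = semilinearD[OF bc_unit_semilinear]
 have "b \<odot>\<^bsub>bc h M\<^esub> bc_unit h M x \<in> H" if b: "b \<in> carrier B" and x: "x \<in> carrier M" for b x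
  using assms x b
 proof (induction arbitrary: b rule: gens_induct)
  case zero
  thus ?case using H semilinear_zero[OF bc_unit_semilinear M.abelian_group_axioms bc_abelian] by simp
 next
  case (add x y)
  thus ?case using H u by (simp add: T.smult_r_distr)
 next
  case (smult a x)
  thus ?case using H u gensD[OF assms] by (simp add: T.smult_assoc1[symmetric])
 qed
 thus "carrier (bc h M) \<subseteq> H"
  using bc_gens_carrier[unfolded gens_def, THEN conjunct2, rule_format, of H] H by blast
qed

text \<open>The universal property of the tensor product, combined with a further change of rings
  \<open>g\<close>. The homomorphism of free groups with (x, c) \<mapsto> g(c) j(x) kills the three
  kinds of relators and therefore descends to cosets.\<close>

lemma bc_universal:
 assumes g: "rhom_ok g" "src g = tgt h" and W: "module (tgt g) W"
  and j: "semilinear k M W j" "src k = src h" "!!a. a \<in> carrier (src h) ==> app k a = app g (app h a)"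
 shows "\<exists>f. semilinear g (bc h M) W f \<and> (\<forall>m\<in>carrier M. f (bc_unit h M m) = j m)"
proof -
 interpret W: module "tgt g" W by (rule W)
 note gD = rhom_okD[OF g(1), unfolded g(2)]
 note jD = semilinearD[OF j(1), unfolded j(2)]
 have kc: "app k a \<in> carrier (tgt g)" if "a \<in> carrier (src h)" for a
  using that j(3) gD(6) by simp
 define F where "F = (\<lambda>(x, c). app g c \<odot>\<^bsub>W\<^esub> j x)"
 have "F ` S \<subseteq> carrier (add_monoid W)" by (auto simp: F_def gD jD)
 from comm_group.free_Abelian_group_universal[OF W.a_comm_group this] obtain \<phi> where
  \<phi>: "\<phi> \<in> hom (free_Abelian_group S) (add_monoid W)" "!!x. x \<in> S ==> \<phi> (frag_of x) = F x" by blast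
 have \<phi>c: "\<phi> u \<in> carrier W" if "u \<in> carrier G" for u
  using \<phi>(1) that by (auto simp: hom_def Pi_def)
 have \<phi>a: "\<phi> (u + v) = \<phi> u \<oplus>\<^bsub>W\<^esub> \<phi> v" if "u \<in> carrier G" "v \<in> carrier G" for u v
  using \<phi>(1) that by (auto simp: hom_def Pi_def)
 have \<phi>0: "\<phi> 0 = \<zero>\<^bsub>W\<^esub>" using \<phi>a[of 0 0] \<phi>c[of 0] W.add.l_cancel_one' by simp
 have \<phi>m: "\<phi> (- u) = \<ominus>\<^bsub>W\<^esub> \<phi> u" if "u \<in> carrier G" for u
  using \<phi>a[of "-u" u] \<phi>c[of u] \<phi>c[of "-u"] \<phi>0 that W.minus_equality by simp
 have \<phi>d: "\<phi> (u - v) = \<phi> u \<ominus>\<^bsub>W\<^esub> \<phi> v" if "u \<in> carrier G" "v \<in> carrier G" for u v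
  using \<phi>a[of u "-v"] \<phi>m[of v] that by (simp add: W.minus_eq)
 have fr: "\<phi> (frag_of (x, c)) = app g c \<odot>\<^bsub>W\<^esub> j x" if "x \<in> carrier M" "c \<in> carrier B" for x c
  using \<phi>(2)[of "(x, c)"] that by (simp add: F_def)
 have frc: "frag_of (x, c) \<in> carrier G" if "x \<in> carrier M" "c \<in> carrier B" for x c using that by simp
 have rel: "\<phi> r = \<zero>\<^bsub>W\<^esub>" if "r \<in> bc_relators h M" for r
 proof -
  from that consider
   (1) x y c where "r = frag_of (x \<oplus>\<^bsub>M\<^esub> y, c) - frag_of (x, c) - frag_of (y, c)"
     "x \<in> carrier M" "y \<in> carrier M" "c \<in> carrier B"
  | (2) x c d where "r = frag_of (x, c \<oplus>\<^bsub>B\<^esub> d) - frag_of (x, c) - frag_of (x, d)"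
     "x \<in> carrier M" "d \<in> carrier B" "c \<in> carrier B"
  | (3) a x c where "r = frag_of (a \<odot>\<^bsub>M\<^esub> x, c) - frag_of (x, app h a \<otimes>\<^bsub>B\<^esub> c)"
     "x \<in> carrier M" "a \<in> carrier (src h)" "c \<in> carrier B"
   unfolding bc_relators_def by blast
  thus ?thesis
  proof cases
   case 1
   thus ?thesis
    by (simp add: \<phi>d frc diff_carrier fr jD gD W.smult_r_distr W.add_minus_minus del: G_simps(1))
  next
   case 2
   thus ?thesis
    by (simp add: \<phi>d frc diff_carrier fr jD gD W.smult_l_distr W.add_minus_minus del: G_simps(1))
  next
   case 3
   hence "app g (app h a \<otimes>\<^bsub>B\<^esub> c) \<odot>\<^bsub>W\<^esub> j x = app g c \<odot>\<^bsub>W\<^esub> j (a \<odot>\<^bsub>M\<^esub> x)"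
    by (simp add: jD gD j(3) W.smult_assoc1[symmetric] W.R.m_comm)
   thus ?thesis using 3
    by (simp add: \<phi>d frc fr jD gD kc W.minus_eq W.r_neg del: G_simps(1))
  qed
 qed
 have \<phi>N: "\<phi> n = \<zero>\<^bsub>W\<^esub>" if "n \<in> N" for n
  using that
 proof (induction rule: N_induct)
  case (add x y)
  thus ?case using \<phi>a N_keys by simp
 next
  case (minus x)
  thus ?case using \<phi>m N_keys by simp
 qed (use \<phi>0 rel in auto)
 \<comment> \<open>Any representative may be chosen: two of them differ by an element of the kernel,
   on which \<phi> vanishes.\<close>
 define f where "f U = \<phi> (SOME u. u \<in> U)" for U
 have fcls: "f (cls u) = \<phi> u" if u: "u \<in> carrier G" for u
 proof -
  have "(SOME v. v \<in> cls u) \<in> cls u" using cls_self[OF u] someI by metis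
  hence v: "(SOME v. v \<in> cls u) \<in> carrier G" "(SOME v. v \<in> cls u) - u \<in> N"
   using cls_memD[OF u] cls_mem_diff[OF u] by (blast, blast)
  hence "\<phi> (SOME v. v \<in> cls u) \<ominus>\<^bsub>W\<^esub> \<phi> u = \<zero>\<^bsub>W\<^esub>" using \<phi>N \<phi>d[OF v(1) u] by metis
  hence "(\<phi> (SOME v. v \<in> cls u) \<oplus>\<^bsub>W\<^esub> \<ominus>\<^bsub>W\<^esub> \<phi> u) \<oplus>\<^bsub>W\<^esub> \<phi> u = \<phi> u"
   using \<phi>c[OF u] by (simp add: W.minus_eq)
  thus ?thesis unfolding f_def using \<phi>c[OF u] \<phi>c[OF v(1)] by (simp add: W.a_assoc W.l_neg)
 qed
 have E\<phi>: "\<phi> (E b u) = app g b \<odot>\<^bsub>W\<^esub> \<phi> u" if "u \<in> carrier G" "b \<in> carrier B" for u b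
  using that
 proof (induction rule: G_induct)
  case zero
  thus ?case by (simp add: E_simps \<phi>0 gD)
 next
  case (frag x c)
  thus ?case by (simp add: E_simps fr gD jD W.smult_assoc1)
 next
  case (diff u v)
  thus ?case by (simp add: E_simps \<phi>d E_closed \<phi>c gD W.smult_r_distr W.smult_r_minus W.minus_eq del: G_simps(1))
 qed
 have "semilinear g (bc h M) W f"
 proof (rule semilinearI)
  fix x y b assume x: "x \<in> carrier (bc h M)"
  then obtain u where u: "u \<in> carrier G" "x = cls u" by (metis bcE)
  show "f x \<in> carrier W" using u fcls \<phi>c by simp
  { assume y: "y \<in> carrier (bc h M)"
   then obtain v where v: "v \<in> carrier G" "y = cls v" by (metis bcE)
   show "f (x \<oplus>\<^bsub>bc h M\<^esub> y) = f x \<oplus>\<^bsub>W\<^esub> f y"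
    using u v by (simp add: cls_add fcls add_carrier \<phi>a del: G_simps(1)) }
  { assume b: "b \<in> carrier (src g)"
   thus "f (b \<odot>\<^bsub>bc h M\<^esub> x) = app g b \<odot>\<^bsub>W\<^esub> f x"
    using u g(2) by (simp add: smult_cls fcls E_closed E\<phi> del: G_simps(1)) }
 qed
 moreover have "f (bc_unit h M m) = j m" if "m \<in> carrier M" for m
  using that by (simp add: bc_unit_cls fcls fr gD jD)
 ultimately show ?thesis by blast
qed

end

lemmas bc_module = bc_ctx.bc_module[OF bc_ctx.intro]
lemmas bc_gens = bc_ctx.bc_gens[OF bc_ctx.intro]
lemmas bc_unit_semilinear = bc_ctx.bc_unit_semilinear[OF bc_ctx.intro]
lemmas bc_universal = bc_ctx.bc_universal[OF bc_ctx.intro]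

lemma module_abelian: "module R M ==> abelian_group M"
 by (simp add: module_def)

lemma semilinear_restrict:
 assumes "semilinear h U W f" "module (src h) U"
 shows "semilinear h U W (restrict f (carrier U))"
 by (rule semilinear_cong[OF assms(1)]) (use assms(2) in auto)

text \<open>Existence of some map with the prescribed values is enough. Its restriction to the
  carrier is extensional, and uniqueness on generators makes it the only candidate for the
  description operator.\<close>

lemma semilin_ext_spec:
 assumes "\<exists>f. semilinear h U W f \<and> (\<forall>m\<in>S. f (i m) = j m)" "gens (src h) U (i ` S)"
  "module (src h) U" "abelian_group W"
 shows "semilinear h U W (semilin_ext h U W S i j)" "!!m. m \<in> S ==> semilin_ext h U W S i j (i m) = j m"
proof -
 obtain f where f: "semilinear h U W f" "\<forall>m\<in>S. f (i m) = j m" using assms(1) by blast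
 have im: "i m \<in> carrier U" if "m \<in> S" for m using assms(2) that by (auto simp: gens_def)
 let ?P = "\<lambda>f. f \<in> extensional (carrier U) \<and> semilinear h U W f \<and> (\<forall>m\<in>S. f (i m) = j m)"
 have 1: "?P (restrict f (carrier U))"
  using f im semilinear_restrict[OF f(1) assms(3)] by simp
 have 2: "g = g'" if "?P g" "?P g'" for g g'
 proof (rule extensionalityI[of _ "carrier U"])
  fix x assume "x \<in> carrier U"
  thus "g x = g' x"
   using that by (intro semilinear_unique[OF assms(2), of W g g' x]) (auto intro: module_abelian assms)
 qed (use that in auto)
 have "?P (semilin_ext h U W S i j)"
  unfolding semilin_ext_def by (rule theI[of ?P, OF 1]) (rule 2[OF _ 1])
 thus "semilinear h U W (semilin_ext h U W S i j)" "!!m. m \<in> S ==> semilin_ext h U W S i j (i m) = j m"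
  by auto
qed

lemma bc_unit_closed: "rhom_ok h ==> module (src h) M ==> m \<in> carrier M ==>
  bc_unit h M m \<in> carrier (bc h M)"
 by (rule semilinearD(1)[OF bc_unit_semilinear])

lemma bc_ext_spec:
 assumes "rhom_ok h" "module (src h) M" "rhom_ok g" "src g = tgt h" "module (tgt g) W"
  "semilinear k M W j" "src k = src h" "!!a. a \<in> carrier (src h) ==> app k a = app g (app h a)"
 shows "semilinear g (bc h M) W (semilin_ext g (bc h M) W (carrier M) (bc_unit h M) j)"
  "!!m. m \<in> carrier M ==>
   semilin_ext g (bc h M) W (carrier M) (bc_unit h M) j (bc_unit h M m) = j m"
proof -
 have g: "gens (src g) (bc h M) (bc_unit h M ` carrier M)"
  using bc_gens[OF assms(1,2) gens_carrier[OF assms(2)]] assms(4) by simp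
 have m: "module (src g) (bc h M)" using bc_module[OF assms(1,2)] assms(4) by simp
 note * = semilin_ext_spec[OF bc_universal[OF assms] g m module_abelian[OF assms(5)]]
 show "semilinear g (bc h M) W (semilin_ext g (bc h M) W (carrier M) (bc_unit h M) j)"
  by (rule *(1))
 show "!!m. m \<in> carrier M ==>
   semilin_ext g (bc h M) W (carrier M) (bc_unit h M) j (bc_unit h M m) = j m"
  by (rule *(2))
qed

lemma bc_eqI:
 assumes "rhom_ok h" "module (src h) M" "src g = tgt h" "abelian_group W"
  "semilinear g (bc h M) W f" "semilinear g (bc h M) W f'"
  "!!m. m \<in> carrier M ==> f (bc_unit h M m) = f' (bc_unit h M m)" "x \<in> carrier (bc h M)"
 shows "f x = f' x"
proof (rule semilinear_unique[of g "bc h M" "bc_unit h M ` carrier M" W])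
 show "gens (src g) (bc h M) (bc_unit h M ` carrier M)"
  using bc_gens[OF assms(1,2) gens_carrier[OF assms(2)]] assms(3) by simp
 show "abelian_group (bc h M)" by (rule module_abelian[OF bc_module[OF assms(1,2)]])
qed (use assms in auto)

text \<open>Triangles \<open>g \<circ> h = h'\<close> and squares \<open>g \<circ> h = h' \<circ> s\<close>.\<close>

definition tri :: "('b, 'c) rhom => ('a, 'b) rhom => ('a, 'c) rhom => bool"
 where "tri g h h' \<longleftrightarrow> rhom_ok g \<and> rhom_ok h \<and> rhom_ok h' \<and> src g = tgt h \<and> src h' = src h \<and>
  tgt h' = tgt g \<and> (\<forall>a\<in>carrier (src h). app h' a = app g (app h a))"

definition sqr :: "('b, 'c) rhom => ('a, 'a) rhom => ('a, 'b) rhom => ('a, 'c) rhom => bool"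
 where "sqr g s h h' \<longleftrightarrow> rhom_ok g \<and> rhom_ok s \<and> rhom_ok h \<and> rhom_ok h' \<and> src g = tgt h \<and>
  src s = src h \<and> tgt s = src h' \<and> src h' = src h \<and> tgt h' = tgt g \<and>
  (\<forall>a\<in>carrier (src h). app h' (app s a) = app g (app h a))"

lemma triD:
 assumes "tri g h h'"
 shows "rhom_ok g" "rhom_ok h" "rhom_ok h'" "src g = tgt h" "src h' = src h" "tgt h' = tgt g"
  "!!a. a \<in> carrier (src h) ==> app h' a = app g (app h a)"
 using assms unfolding tri_def by auto

lemma sqrD:
 assumes "sqr g s h h'"
 shows "rhom_ok g" "rhom_ok s" "rhom_ok h" "rhom_ok h'" "src g = tgt h" "src s = src h" "tgt s = src h'"
  "src h' = src h" "tgt h' = tgt g"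
  "!!a. a \<in> carrier (src h) ==> app h' (app s a) = app g (app h a)"
 using assms unfolding sqr_def by auto

lemma module_homD: "module_hom A U W f ==> semilinear (id_hom A) U W f"
 by (simp add: module_hom_def)

lemma bc_push_spec:
 assumes "tri g h h'" "module (src h) M"
 shows "semilinear g (bc h M) (bc h' M) (bc_push h h' g M)"
  "!!m. m \<in> carrier M ==> bc_push h h' g M (bc_unit h M m) = bc_unit h' M m"
proof -
 note t = assms(1)[unfolded tri_def]
 have W: "module (tgt g) (bc h' M)" using bc_module[of h' M] t assms(2) by simp
 have u: "semilinear h' M (bc h' M) (bc_unit h' M)"
  by (rule bc_unit_semilinear) (use t assms(2) in auto)
 show "semilinear g (bc h M) (bc h' M) (bc_push h h' g M)"
  "!!m. m \<in> carrier M ==> bc_push h h' g M (bc_unit h M m) = bc_unit h' M m"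
  unfolding bc_push_def
  by (rule bc_ext_spec[OF _ assms(2) _ _ W u]; use t in auto)+
qed

lemma bc_map_spec:
 assumes "rhom_ok h" "module (src h) M" "module (src h) N" "module_hom (src h) M N f"
 shows "semilinear (id_hom (tgt h)) (bc h M) (bc h N) (bc_map h M N f)"
  "!!m. m \<in> carrier M ==> bc_map h M N f (bc_unit h M m) = bc_unit h N (f m)"
proof -
 have W: "module (tgt (id_hom (tgt h))) (bc h N)" using bc_module[of h N] assms by simp
 have u: "semilinear h M (bc h N) (\<lambda>m. bc_unit h N (f m))"
  by (rule semilinear_comp[OF module_homD[OF assms(4)] bc_unit_semilinear[OF assms(1,3)]])
   (use assms in \<open>auto intro: rhom_ok_id rhom_okD\<close>)
 have i: "rhom_ok (id_hom (tgt h))" by (rule rhom_ok_id[OF rhom_okD(2)[OF assms(1)]])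
 show "semilinear (id_hom (tgt h)) (bc h M) (bc h N) (bc_map h M N f)"
  "!!m. m \<in> carrier M ==> bc_map h M N f (bc_unit h M m) = bc_unit h N (f m)"
  unfolding bc_map_def
  by (rule bc_ext_spec[OF assms(1,2) i _ W u]; simp)+
qed

lemma bc_extend_spec:
 assumes "tri g h h'" "tri g k k'" "module (src h) M" "module (src k) N"
  "module_hom (tgt h) (bc h M) (bc k N) f"
 shows "semilinear (id_hom (tgt g)) (bc h' M) (bc k' N) (bc_extend g h h' M k k' N f)"
  "!!m. m \<in> carrier M ==> bc_extend g h h' M k k' N f (bc_unit h' M m) = bc_push k k' g N (f (bc_unit h M m))"
  "!!x. x \<in> carrier (bc h M) ==>
   bc_extend g h h' M k k' N f (bc_push h h' g M x) = bc_push k k' g N (f x)"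
proof -
 note t = assms(1,2)[unfolded tri_def]
 have M': "module (src h') M" using t assms(3) by simp
 have W: "module (tgt (id_hom (tgt g))) (bc k' N)" using bc_module[of k' N] t assms by simp
 have f: "semilinear h M (bc k N) (\<lambda>m. f (bc_unit h M m))"
  by (rule semilinear_comp[OF bc_unit_semilinear module_homD[OF assms(5)]]) (use t assms in auto)
 have u: "semilinear h' M (bc k' N) (\<lambda>m. bc_push k k' g N (f (bc_unit h M m)))"
  by (rule semilinear_comp[OF f bc_push_spec(1)[OF assms(2,4)]]) (use t in auto)
 have i: "rhom_ok (id_hom (tgt g))" by (rule rhom_ok_id) (use t rhom_okD(2) in auto)
 have h': "rhom_ok h'" using t by simp
 show 1: "semilinear (id_hom (tgt g)) (bc h' M) (bc k' N) (bc_extend g h h' M k k' N f)"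
  unfolding bc_extend_def
  by (rule bc_ext_spec[OF h' M' i _ W u]) (use t in auto)
 show 2: "bc_extend g h h' M k k' N f (bc_unit h' M m) = bc_push k k' g N (f (bc_unit h M m))"
  if "m \<in> carrier M" for m
  unfolding bc_extend_def
  by (rule bc_ext_spec[OF h' M' i _ W u]) (use t that in auto)
 show "bc_extend g h h' M k k' N f (bc_push h h' g M x) = bc_push k k' g N (f x)"
  if x: "x \<in> carrier (bc h M)" for x
 proof (rule bc_eqI[of h M g "bc k' N"])
  show "semilinear g (bc h M) (bc k' N) (\<lambda>x. bc_extend g h h' M k k' N f (bc_push h h' g M x))"
   by (rule semilinear_comp[OF bc_push_spec(1)[OF assms(1,3)] 1]) (use t in auto)
  show "semilinear g (bc h M) (bc k' N) (\<lambda>x. bc_push k k' g N (f x))"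
   by (rule semilinear_comp[OF module_homD[OF assms(5)] bc_push_spec(1)[OF assms(2,4)]])
    (use t in \<open>auto intro: rhom_ok_id rhom_okD(2)\<close>)
 qed (use t assms x W module_abelian 2 bc_push_spec(2)[OF assms(1,3)] in auto)
qed

section \<open>Frobenius twists\<close>

lemma twist_unit_semilinear:
 assumes "sqr g s h h'" "module (src h) M"
 shows "semilinear (RHom (src h) (tgt g) (\<lambda>a. app g (app h a))) M (bc h' (bc s M)) (twist_unit s h' M)"
proof -
 note t = assms(1)[unfolded sqr_def]
 have s: "semilinear s M (bc s M) (bc_unit s M)"
  by (rule bc_unit_semilinear) (use t assms in auto)
 have m: "module (tgt s) (bc s M)"
  by (rule bc_module) (use t assms in auto)
 have u: "semilinear h' (bc s M) (bc h' (bc s M)) (bc_unit h' (bc s M))"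
  by (rule bc_unit_semilinear) (use t m in auto)
 show ?thesis unfolding twist_unit_def[abs_def]
  by (rule semilinear_comp[OF s u]) (use t in auto)
qed

lemma twist_module:
 assumes "sqr g s h h'" "module (src h) M"
 shows "module (src h') (bc s M)" "module (tgt g) (bc h' (bc s M))"
proof -
 note t = assms(1)[unfolded sqr_def]
 have "module (tgt s) (bc s M)" by (rule bc_module) (use t assms in auto)
 thus 1: "module (src h') (bc s M)" using t by simp
 have "module (tgt h') (bc h' (bc s M))" by (rule bc_module) (use t 1 in auto)
 thus "module (tgt g) (bc h' (bc s M))" using t by simp
qed

lemma twist_gens:
 assumes "sqr g s h h'" "gens (src h) M I" "module (src h) M"
 shows "gens (tgt g) (bc h' (bc s M)) (twist_unit s h' M ` I)"
proof -
 note t = assms(1)[unfolded sqr_def]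
 have "gens (tgt s) (bc s M) (bc_unit s M ` I)"
  by (rule bc_gens) (use t assms in auto)
 hence "gens (tgt h') (bc h' (bc s M)) (bc_unit h' (bc s M) ` bc_unit s M ` I)"
  using t twist_module(1)[OF assms(1,3)] by (intro bc_gens) auto
 thus ?thesis using t by (simp add: image_image twist_unit_def[abs_def])
qed

text \<open>The universal property is applied twice: first along \<open>s\<close>, with
  \<open>W\<close> regarded as a module over the source of \<open>h'\<close>, then along
  \<open>h'\<close>. The scalars match because g h = h' s.\<close>

lemma twist_ext_spec:
 assumes "sqr g s h h'" "module (src h) M" "module (tgt r) W" "src r = tgt g" "rhom_ok r"
  "semilinear k M W j" "src k = src h" "!!a. a \<in> carrier (src h) ==> app k a = app r (app g (app h a))"
 shows "semilinear r (bc h' (bc s M)) W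
   (semilin_ext r (bc h' (bc s M)) W (carrier M) (twist_unit s h' M) j)"
  "!!m. m \<in> carrier M ==>
   semilin_ext r (bc h' (bc s M)) W (carrier M) (twist_unit s h' M) j (twist_unit s h' M m) = j m"
proof -
 note t = assms(1)[unfolded sqr_def]
 let ?r = "RHom (src h') (tgt r) (\<lambda>a. app r (app h' a))"
 have r: "rhom_ok ?r"
  by (rule rhom_ok_comp) (use t assms(4,5) in simp_all)
 have "\<exists>f. semilinear ?r (bc s M) W f \<and> (\<forall>m\<in>carrier M. f (bc_unit s M m) = j m)"
  by (rule bc_universal[OF _ _ r _ _ assms(6)]) (use t assms in auto)
 then obtain f where f: "semilinear ?r (bc s M) W f" "!!m. m \<in> carrier M ==> f (bc_unit s M m) = j m"
  by auto
 have "\<exists>f'. semilinear r (bc h' (bc s M)) W f' \<and>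
   (\<forall>m\<in>carrier (bc s M). f' (bc_unit h' (bc s M) m) = f m)"
  by (rule bc_universal[OF _ twist_module(1)[OF assms(1,2)] _ _ _ f(1)]) (use t assms in auto)
 then obtain f' where f': "semilinear r (bc h' (bc s M)) W f'"
   "!!m. m \<in> carrier (bc s M) ==> f' (bc_unit h' (bc s M) m) = f m" by auto
 have "f' (twist_unit s h' M m) = j m" if "m \<in> carrier M" for m
  unfolding twist_unit_def using t that assms(2) by (simp add: f'(2) f(2) bc_unit_closed)
 hence ex: "\<exists>f'. semilinear r (bc h' (bc s M)) W f' \<and>
   (\<forall>m\<in>carrier M. f' (twist_unit s h' M m) = j m)" using f'(1) by auto
 have g: "gens (src r) (bc h' (bc s M)) (twist_unit s h' M ` carrier M)"
  using twist_gens[OF assms(1) gens_carrier[OF assms(2)] assms(2)] assms(4) by simp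
 have m: "module (src r) (bc h' (bc s M))"
  using twist_module(2)[OF assms(1,2)] assms(4) by simp
 note * = semilin_ext_spec[OF ex g m module_abelian[OF assms(3)]]
 show "semilinear r (bc h' (bc s M)) W
   (semilin_ext r (bc h' (bc s M)) W (carrier M) (twist_unit s h' M) j)" by (rule *(1))
 show "!!m. m \<in> carrier M ==>
   semilin_ext r (bc h' (bc s M)) W (carrier M) (twist_unit s h' M) j (twist_unit s h' M m) = j m"
  by (rule *(2))
qed

lemma twist_eqI:
 assumes "sqr g s h h'" "module (src h) M" "src r = tgt g" "abelian_group W"
  "semilinear r (bc h' (bc s M)) W f" "semilinear r (bc h' (bc s M)) W f'"
  "!!m. m \<in> carrier M ==> f (twist_unit s h' M m) = f' (twist_unit s h' M m)"
  "x \<in> carrier (bc h' (bc s M))"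
 shows "f x = f' x"
proof (rule semilinear_unique[of r "bc h' (bc s M)" "twist_unit s h' M ` carrier M" W])
 show "gens (src r) (bc h' (bc s M)) (twist_unit s h' M ` carrier M)"
  using twist_gens[OF assms(1) gens_carrier[OF assms(2)] assms(2)] assms(3) by simp
 show "abelian_group (bc h' (bc s M))"
  by (rule module_abelian[OF twist_module(2)[OF assms(1,2)]])
qed (use assms in auto)

lemma twist_push_spec:
 assumes "sqr g s h h'" "module (src h) M"
 shows "semilinear g (bc h M) (bc h' (bc s M)) (twist_push g s h h' M)"
  "!!m. m \<in> carrier M ==> twist_push g s h h' M (bc_unit h M m) = twist_unit s h' M m"
proof -
 note t = assms(1)[unfolded sqr_def]
 show "semilinear g (bc h M) (bc h' (bc s M)) (twist_push g s h h' M)"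
  "!!m. m \<in> carrier M ==> twist_push g s h h' M (bc_unit h M m) = twist_unit s h' M m"
  unfolding twist_push_def
  by (rule bc_ext_spec[OF _ assms(2) _ _ twist_module(2)[OF assms] twist_unit_semilinear[OF assms]];
   use t in auto)+
qed

lemma twist_extend_spec:
 assumes "sqr g s h h'" "sqr g t k k'" "module (src h) M" "module (src k) N"
  "module_hom (tgt h) (bc h M) (bc k N) f"
 shows "semilinear (id_hom (tgt g)) (bc h' (bc s M)) (bc k' (bc t N))
   (twist_extend g s h h' M t k k' N f)"
  "!!x. x \<in> carrier (bc h M) ==>
   twist_extend g s h h' M t k k' N f (twist_push g s h h' M x) = twist_push g t k k' N (f x)"
  "!!m. m \<in> carrier M ==>
   twist_extend g s h h' M t k k' N f (twist_unit s h' M m) = twist_push g t k k' N (f (bc_unit h M m))"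
proof -
 note t = assms(1,2)[unfolded sqr_def]
 have W: "module (tgt (id_hom (tgt g))) (bc k' (bc t N))"
  using twist_module(2)[OF assms(2,4)] by simp
 have f: "semilinear h M (bc k N) (\<lambda>m. f (bc_unit h M m))"
  by (rule semilinear_comp[OF bc_unit_semilinear module_homD[OF assms(5)]]) (use t assms in auto)
 let ?k = "RHom (src h) (tgt g) (\<lambda>a. app g (app h a))"
 have u: "semilinear ?k M (bc k' (bc t N)) (\<lambda>m. twist_push g t k k' N (f (bc_unit h M m)))"
  by (rule semilinear_comp[OF f twist_push_spec(1)[OF assms(2,4)]]) (use t in auto)
 have i: "rhom_ok (id_hom (tgt g))" by (rule rhom_ok_id) (use t rhom_okD(2) in auto)
 show 1: "semilinear (id_hom (tgt g)) (bc h' (bc s M)) (bc k' (bc t N))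
   (twist_extend g s h h' M t k k' N f)"
  unfolding twist_extend_def
  by (rule twist_ext_spec[OF assms(1,3) W _ i u]) auto
 show 2: "twist_extend g s h h' M t k k' N f (twist_unit s h' M m) = twist_push g t k k' N (f (bc_unit h M m))"
  if "m \<in> carrier M" for m
  unfolding twist_extend_def
  by (rule twist_ext_spec[OF assms(1,3) W _ i u]) (use that in auto)
 show "twist_extend g s h h' M t k k' N f (twist_push g s h h' M x) = twist_push g t k k' N (f x)"
  if x: "x \<in> carrier (bc h M)" for x
 proof (rule bc_eqI[of h M g "bc k' (bc t N)"])
  show "semilinear g (bc h M) (bc k' (bc t N))
    (\<lambda>x. twist_extend g s h h' M t k k' N f (twist_push g s h h' M x))"
   by (rule semilinear_comp[OF twist_push_spec(1)[OF assms(1,3)] 1]) (use t in auto)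
  show "semilinear g (bc h M) (bc k' (bc t N)) (\<lambda>x. twist_push g t k k' N (f x))"
   by (rule semilinear_comp[OF module_homD[OF assms(5)] twist_push_spec(1)[OF assms(2,4)]])
    (use t in \<open>auto intro: rhom_ok_id rhom_okD(2)\<close>)
 qed (use t assms x W module_abelian 2 twist_push_spec(2)[OF assms(1,3)] in auto)
qed

lemma twist_push_eqI:
 assumes "sqr g s h h'" "module (src h) M" "src r = tgt g" "abelian_group W"
  "semilinear r (bc h' (bc s M)) W f" "semilinear r (bc h' (bc s M)) W f'"
  "!!x. x \<in> carrier (bc h M) ==> f (twist_push g s h h' M x) = f' (twist_push g s h h' M x)"
  "x \<in> carrier (bc h' (bc s M))"
 shows "f x = f' x"
proof (rule twist_eqI[OF assms(1-6) _ assms(8)])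
 fix m assume m: "m \<in> carrier M"
 have "bc_unit h M m \<in> carrier (bc h M)"
  by (rule bc_unit_closed) (use assms(1,2) m in \<open>auto simp: sqr_def\<close>)
 from assms(7)[OF this] show "f (twist_unit s h' M m) = f' (twist_unit s h' M m)"
  using twist_push_spec(2)[OF assms(1,2) m] by simp
qed

text \<open>Both sides are linear and agree on the image of \<open>twist_push\<close>, which
  contains the generators m \<otimes> 1 \<otimes> 1. Together with \<open>twist_extend_id\<close>
  this makes twisting a functor.\<close>

lemma twist_extend_comp:
 assumes "sqr g s h h'" "sqr g t k k'" "sqr g u l l'" "module (src h) M" "module (src k) N" "module (src l) L"
  "module_hom (tgt h) (bc h M) (bc k N) f"
  "module_hom (tgt k) (bc k N) (bc l L) f'"
  "x \<in> carrier (bc h' (bc s M))"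
 shows "twist_extend g t k k' N u l l' L f' (twist_extend g s h h' M t k k' N f x) =
  twist_extend g s h h' M u l l' L (\<lambda>x. f' (f x)) x"
proof -
 note t = assms(1,2,3)[unfolded sqr_def]
 have cr: "rhom_ok (id_hom (tgt g))" "rhom_ok (id_hom (tgt h))"
  by (rule rhom_ok_id, use t rhom_okD(2) in auto)+
 have c: "module_hom (tgt h) (bc h M) (bc l L) (\<lambda>x. f' (f x))"
  unfolding module_hom_def
  by (rule semilinear_comp[OF module_homD[OF assms(7)] module_homD[OF assms(8)]]) (use t cr in auto)
 note 1 = twist_extend_spec[OF assms(1,2,4,5,7)]
 note 2 = twist_extend_spec[OF assms(2,3,5,6,8)]
 note 3 = twist_extend_spec[OF assms(1,3,4,6) c]
 show ?thesis
 proof (rule twist_push_eqI[OF assms(1,4), of "id_hom (tgt g)" "bc l' (bc u L)"])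
  show "semilinear (id_hom (tgt g)) (bc h' (bc s M)) (bc l' (bc u L))
    (\<lambda>x. twist_extend g t k k' N u l l' L f' (twist_extend g s h h' M t k k' N f x))"
   by (rule semilinear_comp[OF 1(1) 2(1)]) (use cr in auto)
  show "abelian_group (bc l' (bc u L))"
   by (rule module_abelian[OF twist_module(2)[OF assms(3,6)]])
 next
  fix x assume "x \<in> carrier (bc h M)"
  thus "twist_extend g t k k' N u l l' L f' (twist_extend g s h h' M t k k' N f (twist_push g s h h' M x)) =
    twist_extend g s h h' M u l l' L (\<lambda>x. f' (f x)) (twist_push g s h h' M x)"
   using 1(2) 2(2) 3(2) semilinearD(1)[OF module_homD[OF assms(7)]] by simp
 qed (use 3(1) assms(9) in auto)
qed

lemma twist_extend_id:
 assumes "sqr g s h h'" "module (src h) M" "!!x. x \<in> carrier (bc h M) ==> f x = x"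
  "x \<in> carrier (bc h' (bc s M))"
 shows "twist_extend g s h h' M s h h' M f x = x"
proof -
 note t = assms(1)[unfolded sqr_def]
 have mh: "module (tgt h) (bc h M)" by (rule bc_module) (use t assms in auto)
 have f: "module_hom (tgt h) (bc h M) (bc h M) f"
  unfolding module_hom_def
 proof (rule semilinear_cong[of "id_hom (tgt h)" _ _ "\<lambda>x. x"])
  show "semilinear (id_hom (tgt h)) (bc h M) (bc h M) (\<lambda>x. x)"
   by (rule semilinearI) auto
 qed (use mh assms(3) in auto)
 note 1 = twist_extend_spec[OF assms(1,1,2,2) f]
 show ?thesis
 proof (rule twist_push_eqI[OF assms(1,2), of "id_hom (tgt g)" "bc h' (bc s M)" _ "\<lambda>x. x"])
  show "semilinear (id_hom (tgt g)) (bc h' (bc s M)) (bc h' (bc s M)) (\<lambda>x. x)"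
   by (rule semilinearI) auto
  show "abelian_group (bc h' (bc s M))"
   by (rule module_abelian[OF twist_module(2)[OF assms(1,2)]])
 qed (use 1 assms in auto)
qed

lemma module_iso_inv:
 assumes "module_iso A U W f" "module A U" "module A W"
 shows "module_iso A W U (inv_into (carrier U) f)"
proof -
 interpret U: module A U by fact
 interpret W: module A W by fact
 note f = semilinearD[OF module_homD[OF conjunct1[OF assms(1)[unfolded module_iso_def]]]]
 have b: "bij_betw f (carrier U) (carrier W)" using assms(1) by (simp add: module_iso_def)
 hence b': "bij_betw (inv_into (carrier U) f) (carrier W) (carrier U)" by (rule bij_betw_inv_into)
 have i: "inv_into (carrier U) f y \<in> carrier U" "f (inv_into (carrier U) f y) = y" if "y \<in> carrier W" for y
  using b that by (auto simp: bij_betw_def inv_into_into f_inv_into_f)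
 have j: "inv_into (carrier U) f (f x) = x" if "x \<in> carrier U" for x
  using b that by (auto simp: bij_betw_def)
 have "semilinear (id_hom A) W U (inv_into (carrier U) f)"
 proof (rule semilinearI)
  fix x y assume xy: "x \<in> carrier W" "y \<in> carrier W"
  have "f (inv_into (carrier U) f x \<oplus>\<^bsub>U\<^esub> inv_into (carrier U) f y) = x \<oplus>\<^bsub>W\<^esub> y"
   using i xy f(2) by simp
  thus "inv_into (carrier U) f (x \<oplus>\<^bsub>W\<^esub> y) = inv_into (carrier U) f x \<oplus>\<^bsub>U\<^esub> inv_into (carrier U) f y"
   using j[of "inv_into (carrier U) f x \<oplus>\<^bsub>U\<^esub> inv_into (carrier U) f y"] i xy by simp
 next
  fix a x assume xy: "a \<in> carrier (src (id_hom A))" "x \<in> carrier W"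
  hence "f (a \<odot>\<^bsub>U\<^esub> inv_into (carrier U) f x) = a \<odot>\<^bsub>W\<^esub> x"
   using i xy f(3) by simp
  thus "inv_into (carrier U) f (a \<odot>\<^bsub>W\<^esub> x) = app (id_hom A) a \<odot>\<^bsub>U\<^esub> inv_into (carrier U) f x"
   using j[of "a \<odot>\<^bsub>U\<^esub> inv_into (carrier U) f x"] i xy by simp
 qed (use i in auto)
 thus ?thesis using b' by (simp add: module_iso_def module_hom_def)
qed

text \<open>By functoriality the twist of the inverse map is inverse to the twist. This is how the
  comparison maps become isomorphisms.\<close>

lemma twist_extend_iso:
 assumes "sqr g s h h'" "sqr g t k k'" "module (src h) M" "module (src k) N"
  "module_iso (tgt h) (bc h M) (bc k N) f"
 shows "module_iso (tgt g) (bc h' (bc s M)) (bc k' (bc t N))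
   (twist_extend g s h h' M t k k' N f)"
proof -
 note t = assms(1,2)[unfolded sqr_def]
 have tt: "tgt h = tgt k" using t by simp
 have mh: "module (tgt h) (bc h M)" "module (tgt h) (bc k N)"
  by (rule bc_module, use t assms in auto) (subst tt, rule bc_module, use t assms in auto)
 note f' = module_iso_inv[OF assms(5) mh]
 let ?f' = "inv_into (carrier (bc h M)) f"
 have fh: "module_hom (tgt h) (bc h M) (bc k N) f"
  "module_hom (tgt k) (bc k N) (bc h M) ?f'"
  using assms(5) f' tt by (auto simp: module_iso_def)
 have b: "bij_betw f (carrier (bc h M)) (carrier (bc k N))" using assms(5) by (simp add: module_iso_def)
 have i: "f (?f' y) = y" if "y \<in> carrier (bc k N)" for y
  using b that by (auto simp: bij_betw_def inv_into_into f_inv_into_f)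
 have j: "?f' (f x) = x" if "x \<in> carrier (bc h M)" for x
  using b that by (auto simp: bij_betw_def)
 note 1 = twist_extend_spec[OF assms(1,2,3,4) fh(1)]
 note 2 = twist_extend_spec[OF assms(2,1,4,3) fh(2)]
 have "bij_betw (twist_extend g s h h' M t k k' N f) (carrier (bc h' (bc s M)))
   (carrier (bc k' (bc t N)))"
 proof (rule bij_betw_byWitness[where f' = "twist_extend g t k k' N s h h' M ?f'"])
  show "\<forall>x\<in>carrier (bc h' (bc s M)).
    twist_extend g t k k' N s h h' M ?f' (twist_extend g s h h' M t k k' N f x) = x"
   using twist_extend_comp[OF assms(1,2,1,3,4,3) fh] twist_extend_id[OF assms(1,3)] j by simp
  show "\<forall>x\<in>carrier (bc k' (bc t N)).
    twist_extend g s h h' M t k k' N f (twist_extend g t k k' N s h h' M ?f' x) = x"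
   using twist_extend_comp[OF assms(2,1,2,4,3,4) fh(2,1)] twist_extend_id[OF assms(2,4)] i by simp
 qed (use semilinearD(1)[OF 1(1)] semilinearD(1)[OF 2(1)] in auto)
 thus ?thesis using 1(1) by (simp add: module_iso_def module_hom_def)
qed

text \<open>Twisting along \<open>g\<close> and then changing rings along \<open>r\<close> is
  twisting along r g. With r the reduction modulo z - \<zeta>, or the passage to K((z - \<zeta>)),
  it relates the comparison maps over the different rings.\<close>

lemma twist_extend_push:
 assumes "sqr g s h h'" "sqr g t k k'" "module (src h) M" "module (src k) N"
  "module_hom (tgt h) (bc h M) (bc k N) f"
  "tri r h' h''" "tri r k' k''" "sqr g' s h h''" "sqr g' t k k''"
  "!!b. b \<in> carrier (tgt h) ==> app g' b = app r (app g b)"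
  "x \<in> carrier (bc h' (bc s M))"
 shows "bc_push k' k'' r (bc t N) (twist_extend g s h h' M t k k' N f x) =
  twist_extend g' s h h'' M t k k'' N f (bc_push h' h'' r (bc s M) x)"
proof -
 note 1 = twist_extend_spec[OF assms(1,2,3,4,5)]
 note 2 = twist_extend_spec[OF assms(8,9,3,4,5)]
 note m1 = twist_module[OF assms(1,3)] and m2 = twist_module[OF assms(2,4)] and m3 = twist_module[OF assms(9,4)]
 note p1 = bc_push_spec[OF assms(6) m1(1)] and p2 = bc_push_spec[OF assms(7) m2(1)]
 have e: "rhom_ok g" "src r = tgt g" "src g' = src g" "src g = tgt h" "src g = tgt k" "src g' = tgt k"
  "tgt g' = tgt r" "rhom_ok k" "src k' = src k" "rhom_ok h'" "rhom_ok k'" "rhom_ok r" "rhom_ok h" "src t = src k"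
   "rhom_ok t" "rhom_ok s" "src s = src h" "src r = tgt h'"
  using sqrD(1-9)[OF assms(1)] sqrD(1-9)[OF assms(2)] sqrD(1,5,9)[OF assms(8)] triD(1,4,6)[OF assms(6)] triD(5)[OF assms(7)] by metis+
 have e2: "rhom_ok (id_hom (tgt g))" "rhom_ok (id_hom (tgt r))" by (rule rhom_ok_id rhom_okD(2) e)+
 \<comment> \<open>The same compatibility for the push maps alone; the values of \<open>f\<close>
   are arbitrary elements of the base change, so it is needed beyond generators.\<close>
 have pp: "bc_push k' k'' r (bc t N) (twist_push g t k k' N y) = twist_push g' t k k'' N y"
  if y: "y \<in> carrier (bc k N)" for y
 proof (rule bc_eqI[of k N g' "bc k'' (bc t N)"])
  show "semilinear g' (bc k N) (bc k'' (bc t N))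
    (\<lambda>y. bc_push k' k'' r (bc t N) (twist_push g t k k' N y))"
   by (rule semilinear_comp[OF twist_push_spec(1)[OF assms(2,4)] p2(1)]) (use e assms(10) in simp_all)
  fix m assume "m \<in> carrier N"
  thus "bc_push k' k'' r (bc t N) (twist_push g t k k' N (bc_unit k N m)) =
     twist_push g' t k k'' N (bc_unit k N m)"
   using twist_push_spec(2)[OF assms(2,4)] twist_push_spec(2)[OF assms(9,4)] p2(2) e assms(4)
   by (simp add: twist_unit_def bc_unit_closed)
 qed (use e assms(4) y twist_push_spec(1)[OF assms(9,4)] module_abelian[OF m3(2)] in simp_all)
 show ?thesis
 proof (rule twist_eqI[OF assms(1,3), of r "bc k'' (bc t N)"])
  show "semilinear r (bc h' (bc s M)) (bc k'' (bc t N))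
    (\<lambda>x. bc_push k' k'' r (bc t N) (twist_extend g s h h' M t k k' N f x))"
   by (rule semilinear_comp[OF 1(1) p2(1)]) (use e e2 in simp_all)
  show "semilinear r (bc h' (bc s M)) (bc k'' (bc t N))
    (\<lambda>x. twist_extend g' s h h'' M t k k'' N f (bc_push h' h'' r (bc s M) x))"
   by (rule semilinear_comp[OF p1(1) 2(1)]) (use e e2 in simp_all)
  fix m assume m: "m \<in> carrier M"
  have "f (bc_unit h M m) \<in> carrier (bc k N)"
   using semilinearD(1)[OF module_homD[OF assms(5)] bc_unit_closed[OF _ assms(3) m]] e by simp
  thus "bc_push k' k'' r (bc t N) (twist_extend g s h h' M t k k' N f (twist_unit s h' M m)) =
     twist_extend g' s h h'' M t k k'' N f (bc_push h' h'' r (bc s M) (twist_unit s h' M m))"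
   using m 1(3) 2(3)[OF m] pp p1(2) e assms(3) by (simp add: twist_unit_def bc_unit_closed)
 qed (use e assms(11) module_abelian[OF m3(2)] in simp_all)
qed

section \<open>Localization at one element and its universal property\<close>

locale loc_ctx = cring R for R :: "'a ring" (structure) +
 fixes s :: 'a
 assumes s_closed [simp]: "s \<in> carrier R"
begin

abbreviation "frc a n \<equiv> loc_frac R s a n"

lemma pow_closed [simp]: "s [^] (n::nat) \<in> carrier R"
 by (rule nat_pow_closed[OF s_closed])

lemma pow_add: "s [^] (m + n) = s [^] m \<otimes> s [^] (n::nat)"
 by (rule nat_pow_mult[OF s_closed, symmetric])

lemma loc_rel_iff: "((a, m), (b, n)) \<in> loc_rel R s \<longleftrightarrow> a \<in> carrier R \<and> b \<in> carrier R \<and>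
  (\<exists>k::nat. s [^] k \<otimes> (s [^] n \<otimes> a) = s [^] k \<otimes> (s [^] m \<otimes> b))"
 by (simp add: loc_rel_def)

lemma loc_rel_refl: "a \<in> carrier R ==> ((a, m), (a, m)) \<in> loc_rel R s"
 by (simp add: loc_rel_iff)

lemma loc_rel_sym: "(x, y) \<in> loc_rel R s ==> (y, x) \<in> loc_rel R s"
 by (cases x, cases y) (auto simp: loc_rel_iff dest: sym)

lemma loc_rel_trans:
 assumes "(x, y) \<in> loc_rel R s" "(y, z) \<in> loc_rel R s"
 shows "(x, z) \<in> loc_rel R s"
proof -
 obtain a m b n c p where e: "x = (a, m)" "y = (b, n)" "z = (c, p)" by (metis surj_pair)
 from assms obtain k l :: nat where c: "a \<in> carrier R" "b \<in> carrier R" "c \<in> carrier R"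
  and k: "s [^] k \<otimes> (s [^] n \<otimes> a) = s [^] k \<otimes> (s [^] m \<otimes> b)"
  and l: "s [^] l \<otimes> (s [^] p \<otimes> b) = s [^] l \<otimes> (s [^] n \<otimes> c)"
  unfolding e loc_rel_iff by blast
 \<comment> \<open>As s may be a zero divisor, the denominator s^n of the middle fraction cannot be
   cancelled; it is kept as a part of the witnessing power.\<close>
 have "s [^] (k + l + n) \<otimes> (s [^] p \<otimes> a) = (s [^] l \<otimes> s [^] p) \<otimes> (s [^] k \<otimes> (s [^] n \<otimes> a))"
  using c by (simp add: pow_add m_ac)
 also have "\<dots> = (s [^] k \<otimes> s [^] m) \<otimes> (s [^] l \<otimes> (s [^] p \<otimes> b))"
  unfolding k using c by (simp add: m_ac)
 also have "\<dots> = s [^] (k + l + n) \<otimes> (s [^] m \<otimes> c)"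
  unfolding l using c by (simp add: pow_add m_ac)
 finally show ?thesis unfolding e loc_rel_iff using c by blast
qed

lemma frac_eq_iff:
 assumes "a \<in> carrier R" "b \<in> carrier R"
 shows "frc a m = frc b n \<longleftrightarrow> (\<exists>k::nat. s [^] k \<otimes> (s [^] n \<otimes> a) = s [^] k \<otimes> (s [^] m \<otimes> b))"
proof -
 have "frc a m = frc b n \<longleftrightarrow> ((a, m), (b, n)) \<in> loc_rel R s"
  unfolding loc_frac_def using loc_rel_refl[OF assms(2)] loc_rel_sym loc_rel_trans by blast
 thus ?thesis using assms by (simp add: loc_rel_iff)
qed

lemma frac_eqI:
 assumes "a \<in> carrier R" "b \<in> carrier R" "s [^] n \<otimes> a = s [^] m \<otimes> b"
 shows "frc a m = frc b n"
 unfolding frac_eq_iff[OF assms(1,2)] using assms(3) by auto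

lemma frac_mem: "(a, m) \<in> frc b n \<longleftrightarrow> b \<in> carrier R \<and> a \<in> carrier R \<and> frc a m = frc b n"
 using frac_eq_iff[of b a n m] by (auto simp: loc_frac_def loc_rel_iff)

lemma loc_carrier: "U \<in> carrier (localization R s) \<longleftrightarrow> (\<exists>a\<in>carrier R. \<exists>n. U = frc a n)"
 by (auto simp: localization_def quotient_def loc_frac_def)

lemma frac_closed [simp]: "a \<in> carrier R ==> frc a n \<in> carrier (localization R s)"
 using loc_carrier by auto

lemma locE:
 assumes "U \<in> carrier (localization R s)"
 obtains a n where "a \<in> carrier R" "U = frc a n"
 using assms loc_carrier by auto

text \<open>The operations of \<open>localization\<close> are unions over all representatives. They
  collapse to one class as soon as the members of the union are seen not to depend on the
  representatives.\<close>

lemma Union_const: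
 assumes "x \<in> A" "!!y. y \<in> A ==> f y = c"
 shows "(\<Union>y\<in>A. f y) = c"
 using assms by auto

lemma loc_mult:
 assumes "a \<in> carrier R" "b \<in> carrier R"
 shows "frc a m \<otimes>\<^bsub>localization R s\<^esub> frc b n = frc (a \<otimes> b) (m + n)"
proof -
 have *: "frc (a' \<otimes> b') (m' + n') = frc (a \<otimes> b) (m + n)"
  if "(a', m') \<in> frc a m" "(b', n') \<in> frc b n" for a' m' b' n'
 proof -
  from that obtain k l :: nat where c: "a' \<in> carrier R" "b' \<in> carrier R"
   and k: "s [^] k \<otimes> (s [^] m \<otimes> a') = s [^] k \<otimes> (s [^] m' \<otimes> a)"
   and l: "s [^] l \<otimes> (s [^] n \<otimes> b') = s [^] l \<otimes> (s [^] n' \<otimes> b)"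
   unfolding frac_mem using frac_eq_iff[of a' a m' m] frac_eq_iff[of b' b n' n] assms by blast
  have "s [^] (k + l) \<otimes> (s [^] (m + n) \<otimes> (a' \<otimes> b')) =
    (s [^] k \<otimes> (s [^] m \<otimes> a')) \<otimes> (s [^] l \<otimes> (s [^] n \<otimes> b'))"
   using c by (simp add: pow_add m_ac)
  also have "\<dots> = s [^] (k + l) \<otimes> (s [^] (m' + n') \<otimes> (a \<otimes> b))"
   unfolding k l using assms by (simp add: pow_add m_ac)
  finally show ?thesis using c assms by (subst frac_eq_iff) auto
 qed
 have self: "(a, m) \<in> frc a m" "(b, n) \<in> frc b n" using assms by (simp_all add: frac_mem)
 have "frc a m \<otimes>\<^bsub>localization R s\<^esub> frc b n =
   (\<Union>(a', m')\<in>frc a m. \<Union>(b', n')\<in>frc b n. frc (a' \<otimes> b') (m' + n'))"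
  by (simp add: localization_def)
 also have "\<dots> = frc (a \<otimes> b) (m + n)"
  by (rule Union_const[OF self(1)], clarify, rule Union_const[OF self(2)], clarify, rule *)
 finally show ?thesis .
qed

lemma loc_add:
 assumes "a \<in> carrier R" "b \<in> carrier R"
 shows "frc a m \<oplus>\<^bsub>localization R s\<^esub> frc b n = frc (s [^] n \<otimes> a \<oplus> s [^] m \<otimes> b) (m + n)"
proof -
 have *: "frc (s [^] n' \<otimes> a' \<oplus> s [^] m' \<otimes> b') (m' + n') = frc (s [^] n \<otimes> a \<oplus> s [^] m \<otimes> b) (m + n)"
  if "(a', m') \<in> frc a m" "(b', n') \<in> frc b n" for a' m' b' n'
 proof -
  from that obtain k l :: nat where c: "a' \<in> carrier R" "b' \<in> carrier R"
   and k: "s [^] k \<otimes> (s [^] m \<otimes> a') = s [^] k \<otimes> (s [^] m' \<otimes> a)"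
   and l: "s [^] l \<otimes> (s [^] n \<otimes> b') = s [^] l \<otimes> (s [^] n' \<otimes> b)"
   unfolding frac_mem using frac_eq_iff[of a' a m' m] frac_eq_iff[of b' b n' n] assms by blast
  have "s [^] (k + l) \<otimes> (s [^] (m + n) \<otimes> (s [^] n' \<otimes> a' \<oplus> s [^] m' \<otimes> b')) =
    (s [^] l \<otimes> s [^] n \<otimes> s [^] n') \<otimes> (s [^] k \<otimes> (s [^] m \<otimes> a')) \<oplus>
    (s [^] k \<otimes> s [^] m \<otimes> s [^] m') \<otimes> (s [^] l \<otimes> (s [^] n \<otimes> b'))"
   using c by (simp add: pow_add m_ac r_distr)
  also have "\<dots> = s [^] (k + l) \<otimes> (s [^] (m' + n') \<otimes> (s [^] n \<otimes> a \<oplus> s [^] m \<otimes> b))"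
   unfolding k l using assms by (simp add: pow_add m_ac r_distr)
  finally show ?thesis using c assms by (subst frac_eq_iff) auto
 qed
 have self: "(a, m) \<in> frc a m" "(b, n) \<in> frc b n" using assms by (simp_all add: frac_mem)
 have "frc a m \<oplus>\<^bsub>localization R s\<^esub> frc b n =
   (\<Union>(a', m')\<in>frc a m. \<Union>(b', n')\<in>frc b n. frc (s [^] n' \<otimes> a' \<oplus> s [^] m' \<otimes> b') (m' + n'))"
  by (simp add: localization_def)
 also have "\<dots> = frc (s [^] n \<otimes> a \<oplus> s [^] m \<otimes> b) (m + n)"
  by (rule Union_const[OF self(1)], clarify, rule Union_const[OF self(2)], clarify, rule *)
 finally show ?thesis .
qed

lemma loc_one: "\<one>\<^bsub>localization R s\<^esub> = frc \<one> 0" and loc_zero: "\<zero>\<^bsub>localization R s\<^esub> = frc \<zero> 0"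
 by (simp_all add: localization_def)

lemma loc_cring: "cring (localization R s)"
proof (rule cringI)
 show "abelian_group (localization R s)"
 proof (rule abelian_groupI)
  fix x y z assume "x \<in> carrier (localization R s)" "y \<in> carrier (localization R s)" "z \<in> carrier (localization R s)"
  then obtain a m b n c p where *: "a \<in> carrier R" "x = frc a m" "b \<in> carrier R" "y = frc b n"
   "c \<in> carrier R" "z = frc c p" by (metis locE)
  thus "x \<oplus>\<^bsub>localization R s\<^esub> y \<oplus>\<^bsub>localization R s\<^esub> z = x \<oplus>\<^bsub>localization R s\<^esub> (y \<oplus>\<^bsub>localization R s\<^esub> z)"
   by (simp add: loc_add) (rule frac_eqI, simp_all add: pow_add r_distr m_ac a_ac)
 next
  fix x y assume "x \<in> carrier (localization R s)" "y \<in> carrier (localization R s)"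
  then obtain a m b n where *: "a \<in> carrier R" "x = frc a m" "b \<in> carrier R" "y = frc b n" by (metis locE)
  thus "x \<oplus>\<^bsub>localization R s\<^esub> y = y \<oplus>\<^bsub>localization R s\<^esub> x" "x \<oplus>\<^bsub>localization R s\<^esub> y \<in> carrier (localization R s)"
   by (simp_all add: loc_add a_comm add.commute)
 next
  fix x assume "x \<in> carrier (localization R s)"
  then obtain a m where *: "a \<in> carrier R" "x = frc a m" by (metis locE)
  thus "\<zero>\<^bsub>localization R s\<^esub> \<oplus>\<^bsub>localization R s\<^esub> x = x"
   by (simp add: loc_add loc_zero)
  have "frc (\<ominus> a) m \<oplus>\<^bsub>localization R s\<^esub> x = \<zero>\<^bsub>localization R s\<^esub>"
   using * by (simp add: loc_add loc_zero r_minus l_neg) (rule frac_eqI, simp_all)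
  thus "\<exists>y\<in>carrier (localization R s). y \<oplus>\<^bsub>localization R s\<^esub> x = \<zero>\<^bsub>localization R s\<^esub>"
   using * by (metis a_inv_closed frac_closed)
 qed (simp add: loc_zero)
 show "comm_monoid (localization R s)"
 proof (rule comm_monoidI)
  fix x y z assume "x \<in> carrier (localization R s)" "y \<in> carrier (localization R s)" "z \<in> carrier (localization R s)"
  then obtain a m b n c p where *: "a \<in> carrier R" "x = frc a m" "b \<in> carrier R" "y = frc b n"
   "c \<in> carrier R" "z = frc c p" by (metis locE)
  thus "x \<otimes>\<^bsub>localization R s\<^esub> y \<otimes>\<^bsub>localization R s\<^esub> z = x \<otimes>\<^bsub>localization R s\<^esub> (y \<otimes>\<^bsub>localization R s\<^esub> z)"
   by (simp add: loc_mult m_assoc add.assoc)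
 next
  fix x y assume "x \<in> carrier (localization R s)" "y \<in> carrier (localization R s)"
  then obtain a m b n where *: "a \<in> carrier R" "x = frc a m" "b \<in> carrier R" "y = frc b n" by (metis locE)
  thus "x \<otimes>\<^bsub>localization R s\<^esub> y = y \<otimes>\<^bsub>localization R s\<^esub> x" "x \<otimes>\<^bsub>localization R s\<^esub> y \<in> carrier (localization R s)"
   by (simp_all add: loc_mult m_comm add.commute)
 next
  fix x assume "x \<in> carrier (localization R s)"
  then obtain a m where *: "a \<in> carrier R" "x = frc a m" by (metis locE)
  thus "\<one>\<^bsub>localization R s\<^esub> \<otimes>\<^bsub>localization R s\<^esub> x = x"
   by (simp add: loc_mult loc_one)
 qed (simp add: loc_one)
 fix x y z assume "x \<in> carrier (localization R s)" "y \<in> carrier (localization R s)" "z \<in> carrier (localization R s)"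
 then obtain a m b n c p where *: "a \<in> carrier R" "x = frc a m" "b \<in> carrier R" "y = frc b n"
  "c \<in> carrier R" "z = frc c p" by (metis locE)
 thus "(x \<oplus>\<^bsub>localization R s\<^esub> y) \<otimes>\<^bsub>localization R s\<^esub> z =
   x \<otimes>\<^bsub>localization R s\<^esub> z \<oplus>\<^bsub>localization R s\<^esub> y \<otimes>\<^bsub>localization R s\<^esub> z"
  by (simp add: loc_add loc_mult) (rule frac_eqI, simp_all add: pow_add r_distr l_distr m_ac a_ac)
qed

lemma frac_hom: "(\<lambda>a. frc a 0) \<in> ring_hom R (localization R s)"
 by (rule ring_hom_memI) (simp_all add: loc_mult loc_add loc_one)

lemma frac_pow_s: "a \<in> carrier R ==> frc (s [^] n) 0 \<otimes>\<^bsub>localization R s\<^esub> frc a n = frc a 0"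
 by (simp add: loc_mult) (rule frac_eqI, simp_all)

lemma s_unit: "frc s 0 \<in> Units (localization R s)"
proof -
 have "frc s 0 \<otimes>\<^bsub>localization R s\<^esub> frc \<one> 1 = \<one>\<^bsub>localization R s\<^esub>"
  by (simp add: loc_mult loc_one) (rule frac_eqI, simp_all)
 thus ?thesis using comm_monoid.m_comm[OF cring.axioms(2)[OF loc_cring], of "frc s 0" "frc \<one> 1"]
  by (auto simp: Units_def intro!: bexI[of _ "frc \<one> 1"])
qed

context
 fixes C :: "'b ring" and f :: "'a => 'b"
 assumes C: "cring C" and f: "f \<in> ring_hom R C" and fs: "f s \<in> Units C"
begin

interpretation C: cring C by (rule C)

lemma f_simps [simp]: "a \<in> carrier R ==> f a \<in> carrier C" "f \<one> = \<one>\<^bsub>C\<^esub>"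
  "a \<in> carrier R ==> b \<in> carrier R ==> f (a \<otimes> b) = f a \<otimes>\<^bsub>C\<^esub> f b"
  "a \<in> carrier R ==> b \<in> carrier R ==> f (a \<oplus> b) = f a \<oplus>\<^bsub>C\<^esub> f b"
 using ring_hom_memE[OF f] by auto

lemma f_pow: "f (s [^] (n::nat)) = f s [^]\<^bsub>C\<^esub> n"
 by (induction n) simp_all

lemma fs_pow_unit: "f s [^]\<^bsub>C\<^esub> (n::nat) \<in> Units C"
 by (rule C.Units_pow_closed[OF fs])

lemma fs_pow_closed [simp]: "f s [^]\<^bsub>C\<^esub> (n::nat) \<in> carrier C"
 using fs_pow_unit C.Units_closed by auto

lemma fs_cancel:
 assumes "x \<in> carrier C" "y \<in> carrier C" "f s [^]\<^bsub>C\<^esub> (n::nat) \<otimes>\<^bsub>C\<^esub> x = f s [^]\<^bsub>C\<^esub> n \<otimes>\<^bsub>C\<^esub> y"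
 shows "x = y"
 using C.Units_l_cancel[OF fs_pow_unit assms(1,2)] assms(3) by simp

text \<open>The description in \<open>loc_lift\<close> ranges over all fractions of a class, but one
  is enough: f(s) is a unit and can be cancelled, so the equation passes from one representative to
  the others.\<close>

lemma loc_lift_eqI:
 assumes a: "a \<in> carrier R" and y: "y \<in> carrier C" "f s [^]\<^bsub>C\<^esub> (n::nat) \<otimes>\<^bsub>C\<^esub> y = f a"
 shows "app (loc_lift R s C f) (frc a n) = y"
proof -
 have *: "f s [^]\<^bsub>C\<^esub> n' \<otimes>\<^bsub>C\<^esub> y = f a'" if "(a', n') \<in> frc a n" for a' n'
 proof -
  from that obtain k :: nat where a': "a' \<in> carrier R"
   and k: "s [^] k \<otimes> (s [^] n \<otimes> a') = s [^] k \<otimes> (s [^] n' \<otimes> a)"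
   unfolding frac_mem using frac_eq_iff[of a' a n' n] a by blast
  have "f s [^]\<^bsub>C\<^esub> (k + n) \<otimes>\<^bsub>C\<^esub> f a' = f (s [^] k \<otimes> (s [^] n \<otimes> a'))"
   using a' fs by (simp add: f_pow C.nat_pow_mult[symmetric] C.m_assoc)
  also have "\<dots> = f s [^]\<^bsub>C\<^esub> k \<otimes>\<^bsub>C\<^esub> (f s [^]\<^bsub>C\<^esub> n' \<otimes>\<^bsub>C\<^esub> (f s [^]\<^bsub>C\<^esub> n \<otimes>\<^bsub>C\<^esub> y))"
   unfolding k y(2) using a by (simp add: f_pow)
  also have "\<dots> = f s [^]\<^bsub>C\<^esub> (k + n) \<otimes>\<^bsub>C\<^esub> (f s [^]\<^bsub>C\<^esub> n' \<otimes>\<^bsub>C\<^esub> y)"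
   using y(1) fs by (simp add: C.nat_pow_mult[symmetric] C.m_ac)
  finally show ?thesis using fs_cancel[of "f a'" "f s [^]\<^bsub>C\<^esub> n' \<otimes>\<^bsub>C\<^esub> y" "k + n"] a' y(1) by simp
 qed
 have self: "(a, n) \<in> frc a n" using a by (simp add: frac_mem)
 show ?thesis unfolding loc_lift_def rhom.sel
 proof (rule the_equality)
  show "y \<in> carrier C \<and> (\<forall>(a', n')\<in>frc a n. f s [^]\<^bsub>C\<^esub> n' \<otimes>\<^bsub>C\<^esub> y = f a')"
   using * y(1) by auto
  fix z assume "z \<in> carrier C \<and> (\<forall>(a', n')\<in>frc a n. f s [^]\<^bsub>C\<^esub> n' \<otimes>\<^bsub>C\<^esub> z = f a')"
  thus "z = y" using self y fs_cancel[of z y n] by fastforce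
 qed
qed

lemma loc_lift_frac:
 assumes "a \<in> carrier R"
 shows "app (loc_lift R s C f) (frc a n) \<in> carrier C"
  "f s [^]\<^bsub>C\<^esub> n \<otimes>\<^bsub>C\<^esub> app (loc_lift R s C f) (frc a n) = f a"
proof -
 let ?y = "inv\<^bsub>C\<^esub> (f s [^]\<^bsub>C\<^esub> n) \<otimes>\<^bsub>C\<^esub> f a"
 have y: "?y \<in> carrier C" "f s [^]\<^bsub>C\<^esub> n \<otimes>\<^bsub>C\<^esub> ?y = f a"
  using assms fs_pow_unit by (simp_all add: C.m_assoc[symmetric] C.Units_r_inv)
 thus "app (loc_lift R s C f) (frc a n) \<in> carrier C"
  "f s [^]\<^bsub>C\<^esub> n \<otimes>\<^bsub>C\<^esub> app (loc_lift R s C f) (frc a n) = f a"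
  using loc_lift_eqI[OF assms y] by simp_all
qed

lemma loc_lift_of: "a \<in> carrier R ==> app (loc_lift R s C f) (frc a 0) = f a"
 by (rule loc_lift_eqI) simp_all

lemma loc_lift_hom: "app (loc_lift R s C f) \<in> ring_hom (localization R s) C"
proof (rule ring_hom_memI)
 fix x assume "x \<in> carrier (localization R s)"
 thus "app (loc_lift R s C f) x \<in> carrier C" using loc_lift_frac(1) by (metis locE)
next
 fix x y assume "x \<in> carrier (localization R s)" "y \<in> carrier (localization R s)"
 then obtain a m b n where *: "a \<in> carrier R" "x = frc a m" "b \<in> carrier R" "y = frc b n" by (metis locE)
 define u v where uv: "u = app (loc_lift R s C f) (frc a m)" "v = app (loc_lift R s C f) (frc b n)"
 have u: "u \<in> carrier C" "f s [^]\<^bsub>C\<^esub> m \<otimes>\<^bsub>C\<^esub> u = f a" and v: "v \<in> carrier C" "f s [^]\<^bsub>C\<^esub> n \<otimes>\<^bsub>C\<^esub> v = f b"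
  unfolding uv using loc_lift_frac * by auto
 have "app (loc_lift R s C f) (frc (a \<otimes> b) (m + n)) = u \<otimes>\<^bsub>C\<^esub> v"
  by (rule loc_lift_eqI) (use u(1) v(1) * fs in \<open>simp_all add: u(2)[symmetric] v(2)[symmetric] C.nat_pow_mult[symmetric] C.m_ac\<close>)
 thus "app (loc_lift R s C f) (x \<otimes>\<^bsub>localization R s\<^esub> y) = app (loc_lift R s C f) x \<otimes>\<^bsub>C\<^esub> app (loc_lift R s C f) y"
  using * by (simp add: loc_mult uv)
 have "app (loc_lift R s C f) (frc (s [^] n \<otimes> a \<oplus> s [^] m \<otimes> b) (m + n)) = u \<oplus>\<^bsub>C\<^esub> v"
  by (rule loc_lift_eqI) (use u(1) v(1) * fs in \<open>simp_all add: f_pow u(2)[symmetric] v(2)[symmetric] C.nat_pow_mult[symmetric] C.r_distr C.l_distr C.m_ac\<close>)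
 thus "app (loc_lift R s C f) (x \<oplus>\<^bsub>localization R s\<^esub> y) = app (loc_lift R s C f) x \<oplus>\<^bsub>C\<^esub> app (loc_lift R s C f) y"
  using * by (simp add: loc_add uv)
next
 show "app (loc_lift R s C f) \<one>\<^bsub>localization R s\<^esub> = \<one>\<^bsub>C\<^esub>"
  unfolding loc_one by (subst loc_lift_of) simp_all
qed

lemma loc_lift_unique:
 assumes g: "g \<in> ring_hom (localization R s) C" "!!a. a \<in> carrier R ==> g (frc a 0) = f a"
  and x: "x \<in> carrier (localization R s)"
 shows "g x = app (loc_lift R s C f) x"
proof -
 obtain a n where a: "a \<in> carrier R" "x = frc a n" using x by (metis locE)
 have "g (frc (s [^] n) 0) \<otimes>\<^bsub>C\<^esub> g (frc a n) = g (frc a 0)"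
  using ring_hom_memE(2)[OF g(1), of "frc (s [^] n) 0" "frc a n"] a by (simp add: frac_pow_s)
 hence "f s [^]\<^bsub>C\<^esub> n \<otimes>\<^bsub>C\<^esub> g (frc a n) = f a" using a g(2) by (simp add: f_pow)
 hence "app (loc_lift R s C f) (frc a n) = g (frc a n)"
  using ring_hom_memE(1)[OF g(1), of "frc a n"] a by (intro loc_lift_eqI) auto
 thus ?thesis using a by simp
qed

end

end

section \<open>Sums in complete non-archimedean fields\<close>

context complete_nonarch_field
begin

lemma nabs_zero [simp]: "nabs 0 = 0"
 using dist_nabs[of 0 0] by simp

lemma nabs_eq_0 [simp]: "nabs x = 0 \<longleftrightarrow> x = 0"
 using dist_nabs[of x 0] by auto

lemma nabs_nonneg [simp]: "0 \<le> nabs x"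
 using dist_nabs[of x 0] zero_le_dist[of x 0] by simp

lemma nabs_one [simp]: "nabs 1 = 1"
proof -
 have "nabs 1 * nabs 1 = nabs 1 * 1" using nabs_mult[of 1 1] by simp
 moreover have "nabs 1 \<noteq> 0" by simp
 ultimately show ?thesis by auto
qed

lemma nabs_minus [simp]: "nabs (- x) = nabs x"
 using dist_nabs[of 0 x] dist_nabs[of x 0] by (simp add: dist_commute)

lemma nabs_diff: "nabs (x - y) \<le> max (nabs x) (nabs y)"
 using nabs_add[of x "- y"] by simp

lemma nabs_inverse: "nabs (inverse x) = inverse (nabs x)"
proof (cases "x = 0")
 case False
 hence "nabs x * nabs (inverse x) = 1" using nabs_mult[of x "inverse x"] by simp
 thus ?thesis using False by (simp add: field_simps)
qed simp

lemma nabs_sum_le: "0 \<le> c ==> (!!i. i \<in> A ==> nabs (f i) \<le> c) ==> nabs (sum f A) \<le> c"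
proof (induction A rule: infinite_finite_induct)
 case (insert x F)
 hence "nabs (f x) \<le> c" "nabs (sum f F) \<le> c" by auto
 thus ?case using order_trans[OF nabs_add max.boundedI] insert(1,2) by simp
qed auto

lemma nabs_of_nat: "nabs (of_nat n) \<le> 1"
proof (induction n)
 case (Suc n)
 thus ?case using nabs_add[of 1 "of_nat n"] by simp
qed simp

lemma nabs_of_int: "nabs (of_int n) \<le> 1"
 by (cases n rule: int_cases2) (simp_all add: nabs_of_nat)

text \<open>The ultrametric inequality applied to x = (x + y) - y. It turns a dominant term of a
  series into an exact absolute value.\<close>

lemma nabs_add_dominant: "nabs y < nabs x ==> nabs (x + y) = nabs x"
 using nabs_add[of x y] nabs_diff[of "x + y" y] by (simp add: max_def split: if_splits)

end

lemma nabs_power: "nabs (x ^ n) = nabs (x :: 'a::complete_nonarch_field) ^ n"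
 by (induction n) (simp_all add: nabs_mult)

lemma nabs_power_int: "nabs (x powi n) = nabs (x :: 'a::complete_nonarch_field) powi n"
 by (simp add: power_int_def nabs_power nabs_inverse)

lemma dist_add_le:
 fixes a b c d :: "'a::complete_nonarch_field"
 shows "dist (a + c) (b + d) \<le> max (dist a b) (dist c d)"
 unfolding dist_nabs using nabs_add[of "a - b" "c - d"] by (simp add: algebra_simps)

text \<open>The exchange of two infinite sums asks for uniformly continuous addition; the
  ultrametric inequality provides it with the same bound for the summands and for the sum.\<close>

instance complete_nonarch_field \<subseteq> uniform_topological_group_add
proof
 fix a b :: 'a
 show "filterlim (\<lambda>((a :: 'a, b), (c, d)). (a + c, b + d)) uniformity (uniformity \<times>\<^sub>F uniformity)"
  unfolding filterlim_def le_filter_def eventually_filtermap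
 proof safe
  fix P :: "'a \<times> 'a => bool" assume "eventually P uniformity"
  then obtain e where e: "e > 0" "!!x y. dist x y < e ==> P (x, y)"
   unfolding eventually_uniformity_metric by blast
  have ev: "eventually (\<lambda>(x, y :: 'a). dist x y < e) uniformity"
   unfolding eventually_uniformity_metric using e(1) by auto
  have "P (x + z, y + w)" if "dist x y < e" "dist z w < e" for x y z w
   by (rule e(2), rule le_less_trans[OF dist_add_le]) (use that in auto)
  with ev    show "\<forall>\<^sub>F x in uniformity \<times>\<^sub>F uniformity. P (case x of (x, xa) => (case x of (a :: 'a, b) => \<lambda>(c, d). (a + c, b + d)) xa)"
   unfolding eventually_prod_filter
   by (intro exI[of _ "\<lambda>(x, y :: 'a). dist x y < e"]) auto
 qed
 have m: "dist (- x) (- y) = dist x y" for x y :: 'a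
  unfolding dist_nabs using nabs_minus[of "x - y"] by (simp del: nabs_minus add: algebra_simps)
 show "filterlim (\<lambda>(a :: 'a, b). (- a, - b)) uniformity uniformity"
  unfolding filterlim_def le_filter_def eventually_filtermap eventually_uniformity_metric
  by (auto simp: m)
 have *: "\<forall>\<^sub>F x in nhds a. nabs (x - a) < e" if "e > 0" for e and a :: 'a
  unfolding eventually_nhds_metric dist_nabs using that by auto
 show "((\<lambda>x. fst x + snd x) \<longlongrightarrow> a + b) (nhds a \<times>\<^sub>F nhds b)"
  unfolding tendsto_iff eventually_prod_filter
 proof safe
  fix e :: real assume e: "e > 0"
  show "\<exists>P Q. eventually P (nhds a) \<and> eventually Q (nhds b) \<and>
    (\<forall>x y. P x --> Q y --> dist (fst (x, y) + snd (x, y)) (a + b) < e)"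
   using *[OF e, of a] *[OF e, of b]
   by - (rule exI[of _ "\<lambda>x. nabs (x - a) < e"], rule exI[of _ "\<lambda>x. nabs (x - b) < e"],
    auto intro!: le_less_trans[OF dist_add_le], simp_all add: dist_nabs)
 qed
 show "(uminus \<longlongrightarrow> - a) (nhds a)"
  unfolding tendsto_iff
 proof safe
  fix e :: real assume e: "e > 0"
  show "\<forall>\<^sub>F x in nhds a. dist (- x) (- a) < e"
   using *[OF e, of a] by (simp only: m) (simp only: dist_nabs)
 qed
qed

instance complete_nonarch_field \<subseteq> topological_ab_group_add ..

lemma complete_nonarch_mult_aux:
 fixes a b x y :: "'a::complete_nonarch_field"
 shows "nabs (x * y - a * b) \<le> max (nabs (x - a) * nabs y) (nabs a * nabs (y - b))"
proof -
 have "x * y - a * b = (x - a) * y + a * (y - b)" by (simp add: algebra_simps)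
 thus ?thesis using nabs_add[of "(x - a) * y" "a * (y - b)"] by (simp add: nabs_mult)
qed

instance complete_nonarch_field \<subseteq> topological_semigroup_mult
proof
 fix a b :: 'a
 have *: "\<forall>\<^sub>F x in nhds a. nabs (x - a) < e" if "e > 0" for e and a :: 'a
  unfolding eventually_nhds_metric dist_nabs using that by auto
 show "((\<lambda>x. fst x * snd x) \<longlongrightarrow> a * b) (nhds a \<times>\<^sub>F nhds b)"
  unfolding tendsto_iff eventually_prod_filter
 proof safe
  fix e :: real assume e: "e > 0"
  define c where "c = nabs a + nabs b + 1"
  have c: "c > 0" "nabs a \<le> c" using nabs_nonneg[of a] nabs_nonneg[of b] by (auto simp: c_def simp del: nabs_nonneg)
  have 1: "e / c > 0" "min 1 (e / c) > 0" using e c by auto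
  have "dist (x * y) (a * b) < e" if x: "nabs (x - a) < e / c" and y: "nabs (y - b) < min 1 (e / c)" for x y
  proof -
   have "nabs y \<le> c" using nabs_add[of "y - b" b] y nabs_nonneg[of a] nabs_nonneg[of b]
    by (auto simp: c_def max_def split: if_splits simp del: nabs_nonneg)
   hence "nabs (x - a) * nabs y \<le> nabs (x - a) * c" by (intro mult_left_mono) auto
   also have "\<dots> < e" using x c by (simp add: field_simps)
   finally have A: "nabs (x - a) * nabs y < e" .
   have "nabs a * nabs (y - b) \<le> c * nabs (y - b)" using c by (intro mult_right_mono) auto
   also have "\<dots> < e" using y c by (simp add: field_simps)
   finally show ?thesis using A complete_nonarch_mult_aux[of x y a b] by (simp add: dist_nabs)
  qed
  thus "\<exists>P Q. eventually P (nhds a) \<and> eventually Q (nhds b) \<and>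
    (\<forall>x y. P x --> Q y --> dist (fst (x, y) * snd (x, y)) (a * b) < e)"
   using *[OF 1(1), of a] *[OF 1(2), of b]
   by - (rule exI[of _ "\<lambda>x. nabs (x - a) < e / c"], rule exI[of _ "\<lambda>x. nabs (x - b) < min 1 (e / c)"], auto)
 qed
qed

text \<open>The family tends to zero along the cofinite filter. No order on the index set is
  involved, so the notion applies equally to integers and to pairs of integers, and it survives
  reindexing along injections.\<close>

definition vanish :: "('i => 'a::complete_nonarch_field) => 'i set => bool"
 where "vanish f A \<longleftrightarrow> (\<forall>e>0. finite {i \<in> A. e \<le> nabs (f i)})"

lemma vanish_subset: "vanish f A ==> B \<subseteq> A ==> vanish f B"
 unfolding vanish_def by (auto intro: finite_subset[rotated])

lemma vanish_le:
 assumes "vanish f A" "!!i. i \<in> A ==> nabs (g i) \<le> C * nabs (f i)" "0 \<le> C"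
 shows "vanish g A"
 unfolding vanish_def
proof (intro allI impI)
 fix e :: real assume e: "e > 0"
 have "{i \<in> A. e \<le> nabs (g i)} \<subseteq> {i \<in> A. e / (C + 1) \<le> nabs (f i)}"
 proof safe
  fix i assume i: "i \<in> A" "e \<le> nabs (g i)"
  hence "e \<le> C * nabs (f i)" using assms(2) by force
  also have "\<dots> \<le> (C + 1) * nabs (f i)" by (simp add: distrib_right)
  finally show "e / (C + 1) \<le> nabs (f i)" using assms(3) by (simp add: field_simps)
 qed
 thus "finite {i \<in> A. e \<le> nabs (g i)}"
  using assms(1,3) e unfolding vanish_def by (meson add_nonneg_pos divide_pos_pos finite_subset zero_less_one)
qed

lemma vanish_cmult: "vanish f A ==> vanish (\<lambda>i. c * f i) A"
 by (erule vanish_le[where C = "nabs c"]) (simp_all add: nabs_mult)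

lemma vanish_add: "vanish f A ==> vanish g A ==> vanish (\<lambda>i. f i + g i) A"
 unfolding vanish_def
proof (intro allI impI)
 fix e :: real assume f: "\<forall>e>0. finite {i \<in> A. e \<le> nabs (f i)}" and g: "\<forall>e>0. finite {i \<in> A. e \<le> nabs (g i)}" and e: "e > 0"
 have "{i \<in> A. e \<le> nabs (f i + g i)} \<subseteq> {i \<in> A. e \<le> nabs (f i)} \<union> {i \<in> A. e \<le> nabs (g i)}"
  by (auto simp: not_le dest: order_trans[OF _ nabs_add])
 thus "finite {i \<in> A. e \<le> nabs (f i + g i)}" using f g e by (meson finite_UnI finite_subset)
qed

lemma vanish_bounded:
 assumes "vanish f A"
 shows "\<exists>C>0. \<forall>i\<in>A. nabs (f i) \<le> C"
proof -
 have fin: "finite {i \<in> A. 1 \<le> nabs (f i)}" using assms by (simp add: vanish_def)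
 define C where "C = 1 + (\<Sum>i\<in>{i \<in> A. 1 \<le> nabs (f i)}. nabs (f i))"
 have "nabs (f i) \<le> C" if "i \<in> A" for i
 proof (cases "1 \<le> nabs (f i)")
  case True
  hence "nabs (f i) \<le> (\<Sum>i\<in>{i \<in> A. 1 \<le> nabs (f i)}. nabs (f i))"
   using that fin by (intro member_le_sum) auto
  thus ?thesis by (simp add: C_def)
 next
  case False
  have "0 \<le> (\<Sum>i\<in>{i \<in> A. 1 \<le> nabs (f i)}. nabs (f i))" by (intro sum_nonneg) auto
  thus ?thesis using False by (simp add: C_def)
 qed
 moreover have "C > 0" unfolding C_def by (intro add_pos_nonneg sum_nonneg) auto
 ultimately show ?thesis by blast
qed

lemma vanish_reindex:
 assumes "vanish f B" "inj_on h A" "h ` A \<subseteq> B"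
 shows "vanish (\<lambda>i. f (h i)) A"
 unfolding vanish_def
proof (intro allI impI)
 fix e :: real assume e: "e > 0"
 have "finite (h -` {i \<in> B. e \<le> nabs (f i)} \<inter> A)"
  by (rule finite_vimage_IntI) (use assms e in \<open>auto simp: vanish_def\<close>)
 moreover have "h -` {i \<in> B. e \<le> nabs (f i)} \<inter> A = {i \<in> A. e \<le> nabs (f (h i))}" using assms(3) by auto
 ultimately show "finite {i \<in> A. e \<le> nabs (f (h i))}" by simp
qed

text \<open>Null families are bounded, so a product that is not small forces both of its factors to
  be not small, which leaves finitely many pairs.\<close>

lemma vanish_prod:
 assumes "vanish f A" "vanish g B"
 shows "vanish (\<lambda>(i, j). f i * g j) (A \<times> B)"
 unfolding vanish_def
proof (intro allI impI)
 fix e :: real assume e: "e > 0"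
 obtain C D where C: "C > 0" "!!i. i \<in> A ==> nabs (f i) \<le> C" and D: "D > 0" "!!i. i \<in> B ==> nabs (g i) \<le> D"
  using vanish_bounded assms by metis
 have "{p \<in> A \<times> B. e \<le> nabs (case p of (i, j) => f i * g j)} \<subseteq>
   {i \<in> A. e / D \<le> nabs (f i)} \<times> {j \<in> B. e / C \<le> nabs (g j)}"
 proof safe
  fix i j assume ij: "i \<in> A" "j \<in> B" "e \<le> nabs (f i * g j)"
  have "nabs (f i) * nabs (g j) \<le> nabs (f i) * D" using D ij by (intro mult_left_mono) auto
  thus "e / D \<le> nabs (f i)" using ij D by (simp add: nabs_mult field_simps)
  have "nabs (f i) * nabs (g j) \<le> C * nabs (g j)" using C ij by (intro mult_right_mono) auto
  thus "e / C \<le> nabs (g j)" using ij C by (simp add: nabs_mult field_simps)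
 qed
 moreover have "finite ({i \<in> A. e / D \<le> nabs (f i)} \<times> {j \<in> B. e / C \<le> nabs (g j)})"
  using assms e C(1) D(1) by (intro finite_cartesian_product) (auto simp: vanish_def)
 ultimately show "finite {p \<in> A \<times> B. e \<le> nabs (case p of (i, j) => f i * g j)}" by (rule finite_subset)
qed

text \<open>Adding terms of absolute value below 1/(n+1), however many, changes a sum by at most
  1/(n+1). Hence the sums over the finite sets of terms of size at least 1/(n+1) form a Cauchy
  sequence, and its limit is the unconditional sum.\<close>

lemma vanish_summable:
 assumes "vanish f A"
 shows "f summable_on A"
proof -
 define F where "F n = {i \<in> A. 1 / real (Suc n) \<le> nabs (f i)}" for n
 have fin: "finite (F n)" for n using assms by (simp add: F_def vanish_def)
 have sub: "F n \<subseteq> A" for n by (auto simp: F_def)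
 have mono: "F m \<subseteq> F n" if "m \<le> n" for m n
 proof -
  have "1 / real (Suc n) \<le> 1 / real (Suc m)" using that by (simp add: frac_le)
  thus ?thesis unfolding F_def by (auto intro: order_trans)
 qed
 have small: "nabs (sum f Y - sum f (F n)) < e" if Y: "finite Y" "F n \<subseteq> Y" "Y \<subseteq> A" "1 / real (Suc n) < e" for Y n e
 proof -
  have "sum f Y - sum f (F n) = sum f (Y - F n)" using Y by (simp add: sum_diff)
  moreover have "nabs (sum f (Y - F n)) \<le> 1 / real (Suc n)"
   by (rule nabs_sum_le) (use Y(3) in \<open>auto simp: F_def\<close>)
  ultimately show ?thesis using Y(4) by simp
 qed
 have "Cauchy (\<lambda>n. sum f (F n))"
 proof (rule metric_CauchyI)
  fix e :: real assume "e > 0"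
  then obtain N where N: "1 / real (Suc N) < e" using nat_approx_posE by metis
  have "dist (sum f (F m)) (sum f (F n)) < e" if "m \<ge> N" "n \<ge> N" for m n
  proof -
   have "nabs (sum f (F m) - sum f (F N)) < e" "nabs (sum f (F n) - sum f (F N)) < e"
    by (rule small[OF fin mono[OF that(1)] sub N], rule small[OF fin mono[OF that(2)] sub N])
   hence "nabs ((sum f (F m) - sum f (F N)) - (sum f (F n) - sum f (F N))) < e"
    using nabs_diff[of "sum f (F m) - sum f (F N)" "sum f (F n) - sum f (F N)"] by simp
   thus ?thesis by (simp add: dist_nabs)
  qed
  thus "\<exists>M. \<forall>m\<ge>M. \<forall>n\<ge>M. dist (sum f (F m)) (sum f (F n)) < e" by blast
 qed
 then obtain s where s: "(\<lambda>n. sum f (F n)) \<longlonglongrightarrow> s" using Cauchy_convergent convergent_def by blast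
 have "(f has_sum s) A"
  unfolding has_sum_def tendsto_iff
 proof safe
  fix e :: real assume e: "e > 0"
  then obtain N where N: "1 / real (Suc N) < e" using nat_approx_posE by metis
  obtain M where M: "!!n. n \<ge> M ==> dist (sum f (F n)) s < e" using metric_LIMSEQ_D[OF s e] by blast
  define n where "n = max M N"
  have n: "1 / real (Suc n) < e"
  proof -
   have "1 / real (Suc n) \<le> 1 / real (Suc N)" by (rule frac_le) (simp_all add: n_def)
   thus ?thesis using N by linarith
  qed
  have "dist (sum f Y) s < e" if Y: "finite Y" "F n \<subseteq> Y" "Y \<subseteq> A" for Y
  proof -
   have "nabs (sum f Y - sum f (F n)) < e" by (rule small[OF Y n])
   moreover have "nabs (sum f (F n) - s) < e" using M[of n] by (simp add: n_def dist_nabs)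
   ultimately show ?thesis using nabs_add[of "sum f Y - sum f (F n)" "sum f (F n) - s"] by (simp add: dist_nabs)
  qed
  thus "\<forall>\<^sub>F Y in finite_subsets_at_top A. dist (sum f Y) s < e"
   unfolding eventually_finite_subsets_at_top using fin sub by (intro exI[of _ "F n"]) auto
 qed
 thus ?thesis by (auto simp: summable_on_def)
qed

text \<open>The bound passes to limits of finite sums; a family without a sum has the default value
  0, which \<open>0 \<le> c\<close> covers.\<close>

lemma nabs_infsum_le:
 fixes f :: "'i => 'a::complete_nonarch_field"
 assumes "0 \<le> c" "!!i. i \<in> A ==> nabs (f i) \<le> c"
 shows "nabs (infsum f A) \<le> c"
proof (cases "f summable_on A")
 case True
 show ?thesis
 proof (rule field_le_epsilon)
  fix e :: real assume e: "e > 0"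
  have "\<forall>\<^sub>F Y in finite_subsets_at_top A. dist (sum f Y) (infsum f A) < e"
   using has_sum_infsum[OF True] e unfolding has_sum_def tendsto_iff by blast
  then obtain Y where Y: "finite Y" "Y \<subseteq> A" "dist (sum f Y) (infsum f A) < e"
   unfolding eventually_finite_subsets_at_top by blast
  have "nabs (sum f Y) \<le> c" by (rule nabs_sum_le) (use Y assms in auto)
  thus "nabs (infsum f A) \<le> c + e"
   using Y(3) nabs_diff[of "sum f Y" "sum f Y - infsum f A"] assms(1) e by (simp add: dist_nabs)
 qed
qed (simp add: infsum_not_exists assms)

lemma infsum_insert_sub:
 fixes f :: "'i => 'a::complete_nonarch_field"
 assumes "vanish f A" "i \<in> A"
 shows "infsum f A = f i + infsum f (A - {i})"
proof -
 have "infsum f (insert i (A - {i})) = f i + infsum f (A - {i})"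
  by (rule infsum_insert) (use vanish_summable[OF vanish_subset[OF assms(1)]] in auto)
 thus ?thesis using assms(2) by (simp add: insert_absorb)
qed

lemma vanish_swap:
 fixes f :: "'i => 'j => 'a::complete_nonarch_field"
 assumes "vanish (\<lambda>(i, j). f i j) (A \<times> B)"
 shows "infsum (\<lambda>i. infsum (\<lambda>j. f i j) B) A = infsum (\<lambda>j. infsum (\<lambda>i. f i j) A) B"
proof (rule infsum_swap)
 show "uniformly_continuous_on UNIV (\<lambda>(x :: 'a, y). x + y)" by (rule uniformly_continuous_add)
 show "(\<lambda>(x, y). f x y) summable_on A \<times> B" by (rule vanish_summable[OF assms])
 show "f a summable_on B" if "a \<in> A" for a
  by (rule vanish_summable) (use vanish_reindex[OF assms, of "\<lambda>j. (a, j)" B] that in \<open>auto simp: inj_on_def\<close>)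
 show "(\<lambda>a. f a b) summable_on A" if "b \<in> B" for b
  by (rule vanish_summable) (use vanish_reindex[OF assms, of "\<lambda>a. (a, b)" A] that in \<open>auto simp: inj_on_def\<close>)
qed

subsection \<open>Convolution of null families\<close>

definition conv :: "(int => 'a::complete_nonarch_field) => (int => 'a) => int => 'a"
 where "conv g h n = (\<Sum>\<^sub>\<infinity>i\<in>UNIV. g i * h (n - i))"

lemma vanish_conv_terms:
 assumes "vanish g UNIV" "vanish h UNIV"
 shows "vanish (\<lambda>i. g i * h (n - i)) (UNIV :: int set)"
 using vanish_reindex[OF vanish_prod[OF assms], of "\<lambda>i. (i, n - i)" UNIV] by (simp add: inj_on_def)

lemma vanish_conv:
 assumes "vanish g UNIV" "vanish h UNIV"
 shows "vanish (conv g h) UNIV"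
 unfolding vanish_def
proof (intro allI impI)
 fix e :: real assume e: "e > 0"
 let ?P = "{p \<in> UNIV \<times> UNIV. e / 2 \<le> nabs (case p of (i, j) => g i * h j)}"
 have "{n \<in> UNIV. e \<le> nabs (conv g h n)} \<subseteq> (\<lambda>(i, j). i + j) ` ?P"
 proof safe
  fix n assume n: "e \<le> nabs (conv g h n)"
  \<comment> \<open>The margin e/2 is there because infinitely many terms below e only bound the sum
    by e, without strictness.\<close>
  have "\<exists>i. e / 2 \<le> nabs (g i * h (n - i))"
  proof (rule ccontr)
   assume "\<not> ?thesis"
   hence "nabs (conv g h n) \<le> e / 2"
    unfolding conv_def using e by (intro nabs_infsum_le) (auto simp: not_le less_imp_le)
   thus False using n e by simp
  qed
  then obtain i where "e / 2 \<le> nabs (g i * h (n - i))" by blast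
  thus "n \<in> (\<lambda>(i, j). i + j) ` ?P" by (intro image_eqI[of _ _ "(i, n - i)"]) auto
 qed
 moreover have "finite ?P" by (rule vanish_prod[OF assms, unfolded vanish_def, rule_format]) (use e in simp)
 ultimately show "finite {n \<in> UNIV. e \<le> nabs (conv g h n)}" by (meson finite_imageI finite_subset)
qed

lemma infsum_shift: "(\<Sum>\<^sub>\<infinity>i\<in>UNIV. f (i + n :: int)) = (\<Sum>\<^sub>\<infinity>i\<in>UNIV. f i)"
 by (rule infsum_reindex_bij_betw) (rule bij_betwI[where g = "\<lambda>i. i - n"], auto)

lemma infsum_reflect: "(\<Sum>\<^sub>\<infinity>i\<in>UNIV. f (n - i :: int)) = (\<Sum>\<^sub>\<infinity>i\<in>UNIV. f i)"
 by (rule infsum_reindex_bij_betw) (rule bij_betwI[where g = "\<lambda>i. n - i"], auto)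

lemma conv_commute: "conv g h = conv h g"
proof
 fix n
 show "conv g h n = conv h g n"
  unfolding conv_def using infsum_reflect[of "\<lambda>i. g i * h (n - i)" n] by (simp add: mult.commute)
qed

lemma conv_assoc:
 assumes "vanish g UNIV" "vanish h UNIV" "vanish k UNIV"
 shows "conv (conv g h) k = conv g (conv h k)"
proof
 fix n
 let ?F = "\<lambda>i j. g j * h (i - j) * k (n - i)"
 have "vanish (\<lambda>(i, j). ?F i j) (UNIV \<times> UNIV)"
 proof -
  have "vanish (\<lambda>(x, y, z). g x * (h y * k z)) (UNIV \<times> UNIV \<times> UNIV)"
   using vanish_prod[OF assms(1) vanish_prod[OF assms(2,3)]] by (simp add: case_prod_unfold)
  \<comment> \<open>The triples whose indices add up to n are embedded into the full three-fold
    product family, which is null.\<close>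
  from vanish_reindex[OF this, of "\<lambda>(i, j). (j, i - j, n - i)" "UNIV \<times> UNIV"]
  show ?thesis by (simp add: inj_on_def case_prod_unfold mult.assoc prod_eq_iff)
 qed
 note sw = vanish_swap[OF this]
 have "conv (conv g h) k n = (\<Sum>\<^sub>\<infinity>i\<in>UNIV. \<Sum>\<^sub>\<infinity>j\<in>UNIV. ?F i j)"
  unfolding conv_def
  by (rule infsum_cong) (rule infsum_cmult_left[symmetric], rule vanish_summable, rule vanish_conv_terms[OF assms(1,2)])
 also have "\<dots> = (\<Sum>\<^sub>\<infinity>j\<in>UNIV. \<Sum>\<^sub>\<infinity>i\<in>UNIV. ?F i j)" by (rule sw)
 also have "\<dots> = (\<Sum>\<^sub>\<infinity>j\<in>UNIV. g j * conv h k (n - j))"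
 proof (rule infsum_cong)
  fix j
  have "(\<Sum>\<^sub>\<infinity>i\<in>UNIV. ?F i j) = (\<Sum>\<^sub>\<infinity>l\<in>UNIV. g j * (h l * k (n - j - l)))"
   using infsum_shift[of "\<lambda>i. ?F i j" j] by (simp add: mult.assoc algebra_simps)
  also have "\<dots> = g j * conv h k (n - j)"
   unfolding conv_def by (rule infsum_cmult_right) (rule vanish_summable, rule vanish_conv_terms[OF assms(2,3)])
  finally show "(\<Sum>\<^sub>\<infinity>i\<in>UNIV. ?F i j) = g j * conv h k (n - j)" .
 qed
 finally show "conv (conv g h) k n = conv g (conv h k) n" by (simp add: conv_def)
qed

lemma infsum_single:
 fixes f :: "'i => 'a::complete_nonarch_field"
 assumes "!!i. i \<noteq> a ==> f i = 0"
 shows "(\<Sum>\<^sub>\<infinity>i\<in>UNIV. f i) = f a"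
proof -
 have "(\<Sum>\<^sub>\<infinity>i\<in>UNIV. f i) = (\<Sum>\<^sub>\<infinity>i\<in>{a}. f i)"
  by (rule infsum_cong_neutral) (use assms in auto)
 thus ?thesis by simp
qed

lemma conv_delta: "conv (\<lambda>i. if i = a then c else 0) h n = c * h (n - a)"
 unfolding conv_def by (subst infsum_single[of a]) auto

text \<open>The n-th divided derivative at the point 1 of the series with coefficients
  \<open>g\<close>. The rescaling \<open>tw\<close> below moves the point \<zeta> to 1, so this
  computes Taylor coefficients at \<zeta>.\<close>

definition binom_sum :: "nat => (int => 'a::complete_nonarch_field) => 'a"
 where "binom_sum n g = (\<Sum>\<^sub>\<infinity>i\<in>UNIV. of_int (int_binom i n) * g i)"

lemma vanish_binom: "vanish g A ==> vanish (\<lambda>i. of_int (h i) * g i) A"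
 by (erule vanish_le[where C = 1]) (auto simp: nabs_mult nabs_of_int intro: mult_left_le_one_le)

text \<open>Modulo n! the product depends only on the residue of i, so i may be replaced by a
  natural number m, for which the product is n! times a binomial coefficient.\<close>

lemma fact_dvd_prod_int: "fact n dvd (\<Prod>j<n. i - int j)"
proof -
 have *: "(\<Prod>j<n. int m - int j) = fact n * int (m choose n)" for m
 proof -
  have "of_int (\<Prod>j<n. int m - int j) = (of_int (fact n * int (m choose n)) :: real)"
   using binomial_gbinomial[of m n, where ?'a = real] by (simp add: gbinomial_prod_rev field_simps atLeast0LessThan)
  thus ?thesis by (simp only: of_int_eq_iff)
 qed
 define m where "m = nat (i mod fact n)"
 have m: "int m = i mod fact n" by (simp add: m_def)
 have "(\<Prod>j<n. i - int j) mod fact n = (\<Prod>j<n. (i - int j) mod fact n) mod fact n"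
  by (rule mod_prod_eq[symmetric])
 also have "\<dots> = (\<Prod>j<n. (int m - int j) mod fact n) mod fact n"
  by (simp add: m mod_diff_left_eq)
 also have "\<dots> = (\<Prod>j<n. int m - int j) mod fact n" by (rule mod_prod_eq)
 also have "\<dots> = 0" by (simp add: *)
 finally show ?thesis by (simp add: dvd_eq_mod_eq_0)
qed

lemma of_int_int_binom: "of_int (int_binom i n) = ((of_int i :: real) gchoose n)"
 unfolding int_binom_def gbinomial_prod_rev using fact_dvd_prod_int[of n i]
 by (subst of_int_div) (auto simp: atLeast0LessThan of_int_fact)

text \<open>Vandermonde's identity for generalized binomial coefficients over the reals, pulled back
  along the injection of the integers. It has to hold integrally before it can be read in positive
  characteristic.\<close>

lemma int_binom_add: "int_binom (i + j) n = (\<Sum>k\<le>n. int_binom i k * int_binom j (n - k))"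
proof -
 have "(of_int (int_binom (i + j) n) :: real) = of_int (\<Sum>k\<le>n. int_binom i k * int_binom j (n - k))"
  unfolding of_int_sum of_int_mult of_int_int_binom of_int_add
  using gbinomial_Vandermonde[of "of_int i :: real" "of_int j" n] by (simp add: atMost_atLeast0)
 thus ?thesis by (simp only: of_int_eq_iff)
qed

lemma int_binom_0 [simp]: "int_binom i 0 = 1"
 by (simp add: int_binom_def)

lemma infsum_sum:
 fixes f :: "'k => 'i => 'a::complete_nonarch_field"
 assumes "!!k. k \<in> K ==> f k summable_on A"
 shows "(\<Sum>\<^sub>\<infinity>j\<in>A. \<Sum>k\<in>K. f k j) = (\<Sum>k\<in>K. \<Sum>\<^sub>\<infinity>j\<in>A. f k j)"
proof -
 have "((\<lambda>j. \<Sum>k\<in>K. f k j) has_sum (\<Sum>k\<in>K. \<Sum>\<^sub>\<infinity>j\<in>A. f k j)) A"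
  using assms by (induction K rule: infinite_finite_induct) (auto intro: has_sum_add)
 thus ?thesis by (rule infsumI)
qed

text \<open>The Leibniz rule for divided derivatives. It is Vandermonde's identity, summed over both
  indices after an exchange of the sums.\<close>

lemma binom_sum_conv:
 assumes "vanish g UNIV" "vanish h UNIV"
 shows "binom_sum n (conv g h) = (\<Sum>k\<le>n. binom_sum k g * binom_sum (n - k) h)"
proof -
 let ?F = "\<lambda>m i. of_int (int_binom m n) * (g i * h (m - i))"
 have v: "vanish (\<lambda>(m, i). ?F m i) (UNIV \<times> UNIV)"
 proof -
  have "vanish (\<lambda>(i, j). of_int (int_binom (i + j) n) * (g i * h j)) (UNIV \<times> UNIV)"
   using vanish_binom[OF vanish_prod[OF assms], of "\<lambda>(i, j). int_binom (i + j) n"] by (simp add: case_prod_unfold)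
  from vanish_reindex[OF this, of "\<lambda>(m, i). (i, m - i)" "UNIV \<times> UNIV"]
  show ?thesis by (simp add: inj_on_def case_prod_unfold prod_eq_iff)
 qed
 have "binom_sum n (conv g h) = (\<Sum>\<^sub>\<infinity>m\<in>UNIV. \<Sum>\<^sub>\<infinity>i\<in>UNIV. ?F m i)"
  unfolding binom_sum_def conv_def
  by (rule infsum_cong) (rule infsum_cmult_right[symmetric], rule vanish_summable, rule vanish_conv_terms[OF assms])
 also have "\<dots> = (\<Sum>\<^sub>\<infinity>i\<in>UNIV. \<Sum>\<^sub>\<infinity>m\<in>UNIV. ?F m i)" by (rule vanish_swap[OF v])
 also have "\<dots> = (\<Sum>\<^sub>\<infinity>i\<in>UNIV. \<Sum>k\<le>n. of_int (int_binom i k) * g i * binom_sum (n - k) h)"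
 proof (rule infsum_cong)
  fix i
  have "?F (j + i) i = (\<Sum>k\<le>n. of_int (int_binom i k) * g i * (of_int (int_binom j (n - k)) * h j))" for j
   unfolding add.commute[of j i] int_binom_add by (simp add: sum_distrib_right sum_distrib_left mult_ac)
  hence "(\<Sum>\<^sub>\<infinity>m\<in>UNIV. ?F m i) = (\<Sum>\<^sub>\<infinity>j\<in>UNIV. \<Sum>k\<le>n. of_int (int_binom i k) * g i * (of_int (int_binom j (n - k)) * h j))"
   using infsum_shift[of "\<lambda>m. ?F m i" i] by simp
  also have "\<dots> = (\<Sum>k\<le>n. \<Sum>\<^sub>\<infinity>j\<in>UNIV. of_int (int_binom i k) * g i * (of_int (int_binom j (n - k)) * h j))"
   by (rule infsum_sum) (intro vanish_summable vanish_cmult vanish_binom assms)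
  also have "\<dots> = (\<Sum>k\<le>n. of_int (int_binom i k) * g i * binom_sum (n - k) h)"
   unfolding binom_sum_def
   by (intro sum.cong refl infsum_cmult_right vanish_summable vanish_binom assms)
  finally show "(\<Sum>\<^sub>\<infinity>m\<in>UNIV. ?F m i) = (\<Sum>k\<le>n. of_int (int_binom i k) * g i * binom_sum (n - k) h)" .
 qed
 also have "\<dots> = (\<Sum>k\<le>n. \<Sum>\<^sub>\<infinity>i\<in>UNIV. of_int (int_binom i k) * g i * binom_sum (n - k) h)"
  by (rule infsum_sum) (subst mult.commute, intro vanish_summable vanish_cmult vanish_binom assms)
 also have "\<dots> = (\<Sum>k\<le>n. binom_sum k g * binom_sum (n - k) h)"
  unfolding binom_sum_def
  by (intro sum.cong refl infsum_cmult_left vanish_summable vanish_binom assms)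
 finally show ?thesis .
qed

unbundle fps_syntax

section \<open>The coefficient rings\<close>

lemma continuous_on_pow: "continuous_on UNIV (\<lambda>x :: 'a::complete_nonarch_field. x ^ n)"
 by (induction n) (auto intro!: continuous_on_mult')

lemma cring_ring_on:
 assumes "0 \<in> A" "1 \<in> A" "!!x y. x \<in> A ==> y \<in> A ==> x + y \<in> A" "!!x. x \<in> A ==> - x \<in> A"
  "!!x y. x \<in> A ==> y \<in> A ==> x * y \<in> A"
 shows "cring (ring_on A)"
proof (rule cringI)
 show "abelian_group (ring_on A)"
  by (rule abelian_groupI) (use assms in \<open>auto simp: ring_on_def algebra_simps intro: bexI[of _ "- _"]\<close>)
 show "Group.comm_monoid (ring_on A)"
  by (rule comm_monoidI) (use assms in \<open>auto simp: ring_on_def algebra_simps\<close>)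
qed (auto simp: ring_on_def algebra_simps)

lemma cring_ring_on_UNIV: "cring (ring_on UNIV)"
 by (rule cring_ring_on) auto

lemma ring_on_simps [simp]: "carrier (ring_on A) = A" "x \<otimes>\<^bsub>ring_on A\<^esub> y = x * y"
  "x \<oplus>\<^bsub>ring_on A\<^esub> y = x + y" "\<one>\<^bsub>ring_on A\<^esub> = 1" "\<zero>\<^bsub>ring_on A\<^esub> = 0"
 by (simp_all add: ring_on_def)

lemma ring_on_pow [simp]: "x [^]\<^bsub>ring_on A\<^esub> (n :: nat) = x ^ n"
 by (induction n) (simp_all add: nat_pow_def ring_on_def mult.commute)

lemma ring_on_hom:
 "f \<in> ring_hom (ring_on A) (ring_on B) \<longleftrightarrow> (\<forall>x\<in>A. f x \<in> B) \<and> f 1 = 1 \<and>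
  (\<forall>x\<in>A. \<forall>y\<in>A. f (x * y) = f x * f y) \<and> (\<forall>x\<in>A. \<forall>y\<in>A. f (x + y) = f x + f y)"
 by (auto simp: ring_hom_def)

lemma units_ring_on: "x * y = 1 ==> x \<in> A ==> y \<in> A ==> x \<in> Units (ring_on A)"
 by (auto simp: Units_def mult.commute)

text \<open>Arbitrary lower bounds of the supports can take the place of the subdegrees, since the
  terms that are added or dropped are zero.\<close>

lemma fls_times_nth_bounds:
 fixes f g :: "'a::comm_ring_1 fls"
 assumes "!!i. i < a ==> f $$ i = 0" "!!i. i < b ==> g $$ i = 0"
 shows "(f * g) $$ n = (\<Sum>i=a..n-b. f $$ i * g $$ (n - i))"
proof -
 let ?m = "min a (fls_subdegree f)" and ?l = "min b (fls_subdegree g)"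
 have "(\<Sum>i=a..n-b. f $$ i * g $$ (n - i)) = (\<Sum>i=?m..n-?l. f $$ i * g $$ (n - i))"
 proof (rule sum.mono_neutral_left)
  show "\<forall>i\<in>{?m..n-?l} - {a..n-b}. f $$ i * g $$ (n - i) = 0"
  proof
   fix i assume "i \<in> {?m..n-?l} - {a..n-b}"
   hence "i < a \<or> n - i < b" by auto
   thus "f $$ i * g $$ (n - i) = 0" using assms by auto
  qed
 qed auto
 also have "\<dots> = (\<Sum>i=fls_subdegree f..n-fls_subdegree g. f $$ i * g $$ (n - i))"
 proof (rule sum.mono_neutral_right)
  show "\<forall>i\<in>{?m..n-?l} - {fls_subdegree f..n-fls_subdegree g}. f $$ i * g $$ (n - i) = 0"
  proof
   fix i assume "i \<in> {?m..n-?l} - {fls_subdegree f..n-fls_subdegree g}"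
   hence "i < fls_subdegree f \<or> n - i < fls_subdegree g" by auto
   thus "f $$ i * g $$ (n - i) = 0" by auto
  qed
 qed auto
 finally show ?thesis by (simp add: fls_times_nth(2))
qed

text \<open>Rescales the variable by z^r, so that convergence at radius |z|^r becomes
  \<open>vanish\<close> for the rescaled family. Rescaling is injective for z \<noteq> 0 and
  multiplicative, hence identities for null families carry over to two-sided series.\<close>

definition tw :: "'a::field => nat => (int => 'a) => int => 'a"
 where "tw z r b = (\<lambda>i. b i * z powi (int r * i))"

definition bmono :: "int => 'a::zero => int => 'a"
 where "bmono a c = (\<lambda>i. if i = a then c else 0)"

lemma conv_bmono: "conv (bmono a c) h n = c * h (n - a)"
 unfolding bmono_def by (rule conv_delta)

lemma conv_bmono_bmono: "conv (bmono a c) (bmono b d) = bmono (a + b) (c * d)"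
 by (rule ext, unfold conv_bmono) (auto simp: bmono_def)

text \<open>The curve enters the analysis only through these facts;
  \<open>shtuka_setting_ana\<close> derives them. The law \<open>frobK\<close> records that
  \<open>qhat S\<close> is a power of the characteristic.\<close>

locale ana_setting =
 fixes S :: "('Q::field, 'K::complete_nonarch_field, 'k::field) shtuka_base"
 assumes zeta_nz: "zeta S \<noteq> 0" and zeta_lt: "nabs (zeta S) < 1" and q2: "2 \<le> qhat S"
  and frobK: "!!x y :: 'K. (x + y) ^ qhat S = x ^ qhat S + y ^ qhat S"
  and res_hom: "res_map S \<in> ring_hom (ring_on val_ring) (ring_on UNIV)"
  and res_ker: "{x \<in> val_ring. res_map S x = 0} = val_ideal"
  and sec_hom: "res_sec S \<in> ring_hom (ring_on UNIV) (ring_on val_ring)"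
  and res_sec: "!!c. res_map S (res_sec S c) = c"
begin

abbreviation "z \<equiv> zeta S"
abbreviation "q \<equiv> qhat S"

lemma d_pos: "0 < nabs z"
 using zeta_nz nabs_nonneg[of z] nabs_eq_0[of z] by linarith

lemma val_simps: "(0::'K) \<in> val_ring" "(1::'K) \<in> val_ring"
  "!!x y :: 'K. x \<in> val_ring ==> y \<in> val_ring ==> x + y \<in> val_ring"
  "!!x y :: 'K. x \<in> val_ring ==> y \<in> val_ring ==> x * y \<in> val_ring"
  "!!x :: 'K. x \<in> val_ring ==> - x \<in> val_ring"
  "!!(x :: 'K) n. x \<in> val_ring ==> x ^ n \<in> val_ring"
  "!!(f :: 'i => 'K) A. (!!i. i \<in> A ==> f i \<in> val_ring) ==> sum f A \<in> val_ring"
  "z \<in> val_ring"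
 using zeta_lt
 by (auto simp: val_ring_def nabs_mult nabs_power
  intro: order_trans[OF nabs_add] mult_le_one power_le_one nabs_sum_le)

lemma frob_sum: "(\<Sum>i\<in>A. f i :: 'K) ^ q = (\<Sum>i\<in>A. f i ^ q)"
 by (induction A rule: infinite_finite_induct) (use q2 in \<open>auto simp: frobK\<close>)

lemma sec_simps: "res_sec S c \<in> val_ring" "res_sec S 0 = 0" "res_sec S 1 = 1"
  "res_sec S (c + d) = res_sec S c + res_sec S d" "res_sec S (c * d) = res_sec S c * res_sec S d"
proof -
 note h = sec_hom[unfolded ring_on_hom]
 show "res_sec S c \<in> val_ring" "res_sec S 1 = 1" "res_sec S (c + d) = res_sec S c + res_sec S d"
  "res_sec S (c * d) = res_sec S c * res_sec S d" using h by auto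
 have "res_sec S 0 + res_sec S 0 = res_sec S 0 + 0" using h by (metis UNIV_I add_0_right)
 thus "res_sec S 0 = 0" by (simp only: add_left_cancel)
qed

lemma sec_pow: "res_sec S (c ^ n) = res_sec S c ^ n"
 by (induction n) (simp_all add: sec_simps)

lemma sec_inj: "res_sec S c = res_sec S d ==> c = d"
 using res_sec by metis

text \<open>The section is an injective ring homomorphism from the residue field to K, so the
  Frobenius law descends.\<close>

lemma frobk: "(x + y :: 'k) ^ q = x ^ q + y ^ q"
 by (rule sec_inj) (simp add: sec_simps sec_pow frobK)

lemma frobk_sum: "(\<Sum>i\<in>A. f i :: 'k) ^ q = (\<Sum>i\<in>A. f i ^ q)"
 by (induction A rule: infinite_finite_induct) (use q2 in \<open>auto simp: frobk\<close>)

lemma res_simps: "res_map S 1 = 1" "res_map S 0 = 0"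
  "!!x y. x \<in> val_ring ==> y \<in> val_ring ==> res_map S (x + y) = res_map S x + res_map S y"
  "!!x y. x \<in> val_ring ==> y \<in> val_ring ==> res_map S (x * y) = res_map S x * res_map S y"
 using res_hom[unfolded ring_on_hom] res_ker by (auto simp: val_ideal_def)

lemma res_zero_iff: "x \<in> val_ring ==> res_map S x = 0 \<longleftrightarrow> nabs x < 1"
 using res_ker by (auto simp: val_ideal_def val_ring_def)

lemma res_sum: "(!!i. i \<in> A ==> f i \<in> val_ring) ==> res_map S (sum f A) = (\<Sum>i\<in>A. res_map S (f i))"
 by (induction A rule: infinite_finite_induct) (simp_all add: res_simps val_simps)

lemma nabs_zpow: "nabs (z powi i) = nabs z powi i"
 by (rule nabs_power_int)

lemma small_pow: "0 < e ==> \<exists>N. \<forall>i\<ge>N. nabs z powi i < e"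
proof -
 assume "0 < e"
 then obtain n :: nat where n: "nabs z ^ n < e" using real_arch_pow_inv zeta_lt by blast
 have "nabs z powi i < e" if "i \<ge> int n" for i
 proof -
  have "nabs z powi i \<le> nabs z powi (int n)"
   using that d_pos zeta_lt by (intro power_int_decreasing) auto
  thus ?thesis using n by simp
 qed
 thus ?thesis by blast
qed

lemma vanish_powi_above:
 assumes "!!i. nabs (b i) \<le> 1" "!!i. i < N ==> b i = 0" "r \<ge> 1"
 shows "vanish (tw z r b) UNIV"
 unfolding vanish_def
proof (intro allI impI)
 fix e :: real assume e: "e > 0"
 obtain M where M: "!!i. i \<ge> M ==> nabs z powi i < e" using small_pow[OF e] by blast
 have "nabs (tw z r b i) < e" if i: "i \<ge> max M 0" for i
 proof -
  have "int 1 * i \<le> int r * i" using i assms(3) by (intro mult_right_mono) auto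
  hence "nabs z powi (int r * i) \<le> nabs z powi i"
   using i d_pos zeta_lt by (intro power_int_decreasing) auto
  moreover have "nabs (tw z r b i) \<le> 1 * nabs z powi (int r * i)"
   unfolding tw_def nabs_mult nabs_zpow using assms(1) by (intro mult_right_mono) auto
  ultimately show ?thesis using M[of i] i by simp
 qed
 moreover have "nabs (tw z r b i) < e" if "i < N" for i
  using assms(2)[OF that] e by (simp add: tw_def)
 ultimately have "{i \<in> UNIV. e \<le> nabs (tw z r b i)} \<subseteq> {N..max M 0}"
  by (metis (mono_tags, lifting) atLeastAtMost_iff linorder_le_cases mem_Collect_eq not_le subsetI)
 thus "finite {i \<in> UNIV. e \<le> nabs (tw z r b i)}" by (rule finite_subset) simp
qed

text \<open>Since |z| < 1 and the coefficients are bounded, the terms with i tending to infinity are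
  small anyway. Only the behaviour at minus infinity carries information.\<close>

lemma vanish_tw_split:
 assumes "!!i. nabs (b i) \<le> 1" "r \<ge> 1"
 shows "vanish (tw z r b) UNIV \<longleftrightarrow> (\<forall>e>0. \<exists>N. \<forall>i<N. nabs (tw z r b i) < e)"
proof
 assume v: "vanish (tw z r b) UNIV"
 show "\<forall>e>0. \<exists>N. \<forall>i<N. nabs (tw z r b i) < e"
 proof (intro allI impI)
  fix e :: real assume "e > 0"
  hence "finite {i. e \<le> nabs (tw z r b i)}" using v by (simp add: vanish_def)
  hence "bdd_below {i. e \<le> nabs (tw z r b i)}" by (rule bdd_below_finite)
  then obtain N where "!!i. e \<le> nabs (tw z r b i) ==> N \<le> i" by (auto simp: bdd_below_def)
  thus "\<exists>N. \<forall>i<N. nabs (tw z r b i) < e" by (metis not_le)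
 qed
next
 assume *: "\<forall>e>0. \<exists>N. \<forall>i<N. nabs (tw z r b i) < e"
 show "vanish (tw z r b) UNIV"
  unfolding vanish_def
 proof (intro allI impI)
  fix e :: real assume e: "e > 0"
  then obtain N where N: "!!i. i < N ==> nabs (tw z r b i) < e" using * by blast
  let ?b = "\<lambda>i. if i < N then 0 else b i"
  have "vanish (tw z r ?b) UNIV" by (rule vanish_powi_above[where N = N]) (use assms in auto)
  hence "finite {i. e \<le> nabs (tw z r ?b i)}" using e by (simp add: vanish_def)
  moreover have "{i \<in> UNIV. e \<le> nabs (tw z r b i)} \<subseteq> {i. e \<le> nabs (tw z r ?b i)}"
  proof safe
   fix i assume i: "e \<le> nabs (tw z r b i)"
   hence "\<not> i < N" using N[of i] by linarith
   thus "e \<le> nabs (tw z r ?b i)" using i by (simp add: tw_def)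
  qed
  ultimately show "finite {i \<in> UNIV. e \<le> nabs (tw z r b i)}" by (rule finite_subset[rotated])
 qed
qed

lemma Rzi_mem: "b \<in> carrier (Rzi S) \<longleftrightarrow> (\<forall>i. b i \<in> val_ring) \<and>
  (\<forall>r>0. ((\<lambda>i. nabs (b i) * nabs z powr (r * real_of_int i)) \<longlongrightarrow> 0) at_bot)"
 unfolding Rzi_def partial_object.select_convs mem_Collect_eq by (rule refl)

text \<open>Natural exponents r are as good as real ones: for i \<le> 0 the condition becomes
  stronger as r grows, so r is replaced by its ceiling.\<close>

lemma Rzi_iff: "b \<in> carrier (Rzi S) \<longleftrightarrow> (\<forall>i. nabs (b i) \<le> 1) \<and> (\<forall>r\<ge>1. vanish (tw z r b) UNIV)"
proof (cases "\<forall>i. nabs (b i) \<le> 1")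
 case True
 let ?t = "\<lambda>r. ((\<lambda>i. nabs (b i) * nabs z powr (r * real_of_int i)) \<longlongrightarrow> 0) at_bot"
 have pw: "nabs z powr (real r * real_of_int i) = nabs z powi (int r * i)" for r i
  using powr_real_of_int'[of "nabs z" "int r * i"] d_pos zeta_nz by simp
 have tr: "vanish (tw z r b) UNIV \<longleftrightarrow> ?t (real r)" if "r \<ge> 1" for r
 proof -
  have "?t (real r) \<longleftrightarrow> (\<forall>e>0. \<exists>N. \<forall>i<N. nabs (tw z r b i) < e)"
   unfolding tendsto_iff pw eventually_at_bot_dense
   by (simp add: tw_def nabs_mult nabs_zpow dist_real_def)
  thus ?thesis using vanish_tw_split[of b r] True that by simp
 qed
 have 1: "?t r" if r: "r > 0" and v: "\<forall>r\<ge>1. vanish (tw z r b) UNIV" for r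
 proof -
  define n where "n = nat \<lceil>r\<rceil>"
  have n: "n \<ge> 1" "r \<le> real n" using r by (auto simp: n_def) linarith
  have "?t (real n)" using tr n v by blast
  moreover have "nabs (b i) * nabs z powr (r * real_of_int i) \<le> nabs (b i) * nabs z powr (real n * real_of_int i)"
   if "i \<le> 0" for i
  proof (rule mult_left_mono)
   have "real n * real_of_int i \<le> r * real_of_int i" using n that by (intro mult_right_mono_neg) auto
   thus "nabs z powr (r * real_of_int i) \<le> nabs z powr (real n * real_of_int i)"
    using d_pos zeta_lt by (intro powr_mono') auto
  qed simp
  hence "\<forall>\<^sub>F i in at_bot. nabs (b i) * nabs z powr (r * real_of_int i) \<le> nabs (b i) * nabs z powr (real n * real_of_int i)"
   by (rule eventually_mono[OF eventually_le_at_bot[of 0]])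
  moreover have "\<forall>\<^sub>F i in at_bot. 0 \<le> nabs (b i) * nabs z powr (r * real_of_int i)" by simp
  ultimately show "?t r" by (rule_tac tendsto_sandwich[OF _ _ tendsto_const]) auto
 qed
 have "(\<forall>r>0. ?t r) \<longleftrightarrow> (\<forall>r\<ge>1. vanish (tw z r b) UNIV)"
 proof safe
  fix r :: nat assume "\<forall>r>0. ?t r" "1 \<le> r"
  thus "vanish (tw z r b) UNIV" using tr[of r] by simp
 qed (rule 1)
 moreover have "b \<in> carrier (Rzi S) \<longleftrightarrow> (\<forall>r>0. ?t r)"
 proof -
  have v: "\<forall>i. b i \<in> val_ring" using True by (auto simp: val_ring_def)
  show ?thesis
   by (rule iffI, erule Rzi_mem[THEN iffD1, THEN conjunct2], rule Rzi_mem[THEN iffD2], rule conjI[OF v])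
 qed
 ultimately show ?thesis using True by iprover
next
 case False
 hence "b \<notin> carrier (Rzi S)" using Rzi_mem[of b] by (auto simp: val_ring_def)
 thus ?thesis using False by iprover
qed

lemma RziD: "b \<in> carrier (Rzi S) ==> nabs (b i) \<le> 1" "b \<in> carrier (Rzi S) ==> r \<ge> 1 ==> vanish (tw z r b) UNIV"
 by (auto simp: Rzi_iff)

lemma Rzi_simps: "b \<otimes>\<^bsub>Rzi S\<^esub> c = conv b c" "b \<oplus>\<^bsub>Rzi S\<^esub> c = (\<lambda>i. b i + c i)"
  "\<one>\<^bsub>Rzi S\<^esub> = bmono 0 1" "\<zero>\<^bsub>Rzi S\<^esub> = (\<lambda>i. 0)"
 by (auto simp: Rzi_def conv_def bmono_def fun_eq_iff)

lemma Rzi_lowI: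
 assumes "!!i. nabs (b i) \<le> 1" "!!i. i < N ==> b i = 0"
 shows "b \<in> carrier (Rzi S)"
 using assms vanish_powi_above[of b N] by (simp add: Rzi_iff)

lemma bmono_Rzi: "c \<in> val_ring ==> bmono a c \<in> carrier (Rzi S)"
 by (rule Rzi_lowI[of _ a]) (auto simp: bmono_def val_ring_def)

lemma tw_add: "tw z r (\<lambda>i. b i + c i) = (\<lambda>i. tw z r b i + tw z r c i)"
 by (auto simp: tw_def distrib_right)

lemma tw_inj: "tw z r b = tw z r c ==> b = c"
 using zeta_nz by (auto simp: tw_def fun_eq_iff)

text \<open>Up to the constant z^(-r n) these are the terms of a convolution of two null
  families.\<close>

lemma conv_summable:
 assumes "vanish (tw z r b) UNIV" "vanish (tw z r c) UNIV"
 shows "vanish (\<lambda>i. b i * c (n - i)) UNIV"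
proof -
 have "vanish (\<lambda>i. z powi (- (int r * n)) * (tw z r b i * tw z r c (n - i))) UNIV"
  by (intro vanish_cmult vanish_conv_terms assms)
 moreover have "z powi (- (int r * n)) * (tw z r b i * tw z r c (n - i)) = b i * c (n - i)" for i
 proof -
  have "z powi (- (int r * n)) * (z powi (int r * i) * z powi (int r * (n - i))) = 1"
   using zeta_nz by (simp flip: power_int_add add: algebra_simps)
  thus ?thesis by (simp add: tw_def mult_ac)
 qed
 ultimately show ?thesis by simp
qed

lemma tw_conv:
 assumes "vanish (tw z r b) UNIV" "vanish (tw z r c) UNIV"
 shows "tw z r (conv b c) = conv (tw z r b) (tw z r c)"
proof
 fix n
 have "tw z r b i * tw z r c (n - i) = b i * c (n - i) * z powi (int r * n)" for i
 proof -
  have "z powi (int r * i) * z powi (int r * (n - i)) = z powi (int r * n)"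
   using zeta_nz by (simp flip: power_int_add add: algebra_simps)
  thus ?thesis by (simp add: tw_def mult_ac)
 qed
 hence "conv (tw z r b) (tw z r c) n = (\<Sum>\<^sub>\<infinity>i\<in>UNIV. b i * c (n - i) * z powi (int r * n))"
  by (simp add: conv_def)
 also have "\<dots> = conv b c n * z powi (int r * n)"
  unfolding conv_def by (rule infsum_cmult_left) (rule vanish_summable[OF conv_summable[OF assms]])
 finally show "tw z r (conv b c) n = conv (tw z r b) (tw z r c) n" by (simp add: tw_def)
qed

lemma conv_Rzi:
 assumes b: "b \<in> carrier (Rzi S)" and c: "c \<in> carrier (Rzi S)"
 shows "conv b c \<in> carrier (Rzi S)"
 unfolding Rzi_iff[of "conv b c"]
proof (intro conjI allI impI)
 show "nabs (conv b c i) \<le> 1" for i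
  unfolding conv_def
  by (rule nabs_infsum_le) (auto simp: nabs_mult RziD b c intro!: mult_le_one)
 show "vanish (tw z r (conv b c)) UNIV" if "1 \<le> r" for r
  using that by (simp add: tw_conv RziD b c vanish_conv)
qed

lemma add_Rzi: "b \<in> carrier (Rzi S) ==> c \<in> carrier (Rzi S) ==> (\<lambda>i. b i + c i) \<in> carrier (Rzi S)"
 by (auto simp: Rzi_iff tw_add intro: vanish_add order_trans[OF nabs_add])

lemma neg_Rzi:
 assumes b: "b \<in> carrier (Rzi S)"
 shows "(\<lambda>i. - b i) \<in> carrier (Rzi S)"
 unfolding Rzi_iff
proof (intro conjI allI impI)
 show "nabs (- b i) \<le> 1" for i using RziD(1)[OF b] by simp
 show "vanish (tw z r (\<lambda>i. - b i)) UNIV" if "1 \<le> r" for r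
  using vanish_cmult[OF RziD(2)[OF b that], of "-1"] by (simp add: tw_def)
qed

text \<open>Associativity is known for null families, and elements of the ring become null families
  after rescaling with r = 1. Rescaling commutes with products and is injective.\<close>

lemma Rzi_conv_assoc:
 assumes "b \<in> carrier (Rzi S)" "c \<in> carrier (Rzi S)" "d \<in> carrier (Rzi S)"
 shows "conv (conv b c) d = conv b (conv c d)"
 by (rule tw_inj[of 1]) (simp add: assms tw_conv RziD conv_Rzi vanish_conv conv_assoc)

lemma Rzi_conv_add:
 assumes "b \<in> carrier (Rzi S)" "c \<in> carrier (Rzi S)" "d \<in> carrier (Rzi S)"
 shows "conv (\<lambda>i. b i + c i) d = (\<lambda>i. conv b d i + conv c d i)"
proof
 fix n
 have "vanish (\<lambda>i. b i * d (n - i)) UNIV"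
  by (rule conv_summable[of 1 b d n]) (simp_all add: RziD assms)
 moreover have "vanish (\<lambda>i. c i * d (n - i)) UNIV"
  by (rule conv_summable[of 1 c d n]) (simp_all add: RziD assms)
 ultimately
 show "conv (\<lambda>i. b i + c i) d n = conv b d n + conv c d n"
  unfolding conv_def distrib_right by (intro infsum_add vanish_summable)
qed

lemma Rzi_cring: "cring (Rzi S)"
proof (rule cringI)
 show "abelian_group (Rzi S)"
 proof (rule abelian_groupI)
  fix x assume "x \<in> carrier (Rzi S)"
  thus "\<exists>y\<in>carrier (Rzi S). y \<oplus>\<^bsub>Rzi S\<^esub> x = \<zero>\<^bsub>Rzi S\<^esub>"
   using neg_Rzi by (intro bexI[of _ "\<lambda>i. - x i"]) (auto simp: Rzi_simps)
 qed (use Rzi_lowI[of "\<lambda>i. 0"] in \<open>auto simp: Rzi_simps add_Rzi algebra_simps\<close>)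
 show "Group.comm_monoid (Rzi S)"
 proof (rule comm_monoidI)
  fix x y assume "x \<in> carrier (Rzi S)" "y \<in> carrier (Rzi S)"
  thus "x \<otimes>\<^bsub>Rzi S\<^esub> y = y \<otimes>\<^bsub>Rzi S\<^esub> x" by (simp add: Rzi_simps conv_commute)
 next
  fix x assume "x \<in> carrier (Rzi S)"
  show "\<one>\<^bsub>Rzi S\<^esub> \<otimes>\<^bsub>Rzi S\<^esub> x = x" by (auto simp: Rzi_simps conv_bmono fun_eq_iff)
 qed (auto simp: Rzi_simps conv_Rzi Rzi_conv_assoc bmono_Rzi val_simps)
qed (auto simp: Rzi_simps Rzi_conv_add)

lemma Rzi_loc: "loc_ctx (Rzi S) b" if "b \<in> carrier (Rzi S)"
 using that Rzi_cring by (simp add: loc_ctx_def loc_ctx_axioms_def)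

subsection \<open>Homomorphisms between the coefficient rings\<close>

lemma conv_fls:
 assumes h: "h 0 = 0" "!!x y. h (x + y) = h x + h y" "!!x y. h (x * y) = h x * h y"
 shows "conv (\<lambda>i. h (f $$ i)) (\<lambda>i. h (g $$ i)) n = (h ((f * g) $$ n) :: 'b::complete_nonarch_field)"
proof -
 have hs: "h (sum u A) = (\<Sum>i\<in>A. h (u i))" for u :: "int => _" and A
  by (induction A rule: infinite_finite_induct) (simp_all add: h)
 let ?A = "{fls_subdegree f..n - fls_subdegree g}"
 have "conv (\<lambda>i. h (f $$ i)) (\<lambda>i. h (g $$ i)) n = (\<Sum>\<^sub>\<infinity>i\<in>?A. h (f $$ i) * h (g $$ (n - i)))"
  unfolding conv_def
 proof (rule infsum_cong_neutral)
  fix i assume "i \<in> UNIV - ?A"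
  hence "i < fls_subdegree f \<or> n - i < fls_subdegree g" by auto
  thus "h (f $$ i) * h (g $$ (n - i)) = 0" using h(1) by auto
 qed auto
 also have "\<dots> = h ((f * g) $$ n)" unfolding fls_times_nth(2)[of f g n] hs by (simp add: h(3))
 finally show ?thesis .
qed

lemma fps_to_bi_alt: "fps_to_bi f = (\<lambda>i. fps_to_fls f $$ i)"
 by (auto simp: fps_to_bi_def fun_eq_iff)

lemma fps_to_bi_mult: "fps_to_bi (f * g :: 'K fps) = conv (fps_to_bi f) (fps_to_bi g)"
 using conv_fls[of "\<lambda>x. x :: 'K" "fps_to_fls f" "fps_to_fls g"]
 by (auto simp: fps_to_bi_alt fls_times_fps_to_fls fun_eq_iff)

lemma fps_to_bi_const: "fps_to_bi (fps_const c) = bmono 0 c"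
 by (auto simp: fps_to_bi_def bmono_def fun_eq_iff)

lemma fps_to_bi_X: "fps_to_bi fps_X = bmono 1 1"
 by (auto simp: fps_to_bi_def bmono_def fun_eq_iff fps_X_def)

lemma Rz_carrier: "f \<in> carrier Rz \<longleftrightarrow> (\<forall>n. fps_nth f n \<in> (val_ring :: 'K set))"
 by (simp add: Rz_def)

lemma Rz_cring: "cring (Rz :: 'K fps ring)"
 unfolding Rz_def
 by (rule cring_ring_on) (auto simp: fps_mult_nth intro!: val_simps)

lemma Rz_simps: "f \<otimes>\<^bsub>Rz\<^esub> g = f * g" "f \<oplus>\<^bsub>Rz\<^esub> g = f + g" "\<one>\<^bsub>Rz\<^esub> = 1" "\<zero>\<^bsub>Rz\<^esub> = 0"
  "f [^]\<^bsub>Rz\<^esub> (n::nat) = f ^ n"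
 by (simp_all add: Rz_def)

lemma fps_to_bi_hom: "fps_to_bi \<in> ring_hom Rz (Rzi S)"
proof (rule ring_hom_memI)
 fix f :: "'K fps" assume "f \<in> carrier Rz"
 thus "fps_to_bi f \<in> carrier (Rzi S)"
  by (intro Rzi_lowI[of _ 0]) (auto simp: Rz_carrier val_ring_def fps_to_bi_def)
next
 show "fps_to_bi \<one>\<^bsub>Rz\<^esub> = (\<one>\<^bsub>Rzi S\<^esub> :: int => 'K)"
  using fps_to_bi_const[of 1] by (simp add: Rz_simps Rzi_simps)
qed (auto simp: Rz_simps Rzi_simps fps_to_bi_mult fps_to_bi_def fun_eq_iff)

lemma fls_to_bi_hom: "fls_to_bi (res_sec S) \<in> ring_hom (ring_on UNIV) (Rzi S)"
proof (rule ring_hom_memI)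
 fix f :: "'k fls"
 show "fls_to_bi (res_sec S) f \<in> carrier (Rzi S)"
  using sec_simps(1) by (intro Rzi_lowI[of _ "fls_subdegree f"]) (auto simp: fls_to_bi_def val_ring_def sec_simps)
next
 fix f g :: "'k fls"
 show "fls_to_bi (res_sec S) (f \<otimes>\<^bsub>ring_on UNIV\<^esub> g) = fls_to_bi (res_sec S) f \<otimes>\<^bsub>Rzi S\<^esub> fls_to_bi (res_sec S) g"
  using conv_fls[of "res_sec S" f g] by (auto simp: Rzi_simps fls_to_bi_def[abs_def] fun_eq_iff sec_simps)
qed (auto simp: Rzi_simps fls_to_bi_def fun_eq_iff sec_simps bmono_def)

lemma frob_bi_hom: "frob_bi q \<in> ring_hom (Rzi S) (Rzi S)"
proof (rule ring_hom_memI)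
 fix b assume b: "b \<in> carrier (Rzi S)"
 have le: "nabs (b i) ^ q \<le> nabs (b i)" for i
  using power_decreasing[of 1 q "nabs (b i)"] q2 RziD(1)[OF b] by simp
 show "frob_bi q b \<in> carrier (Rzi S)"
  unfolding Rzi_iff
 proof (intro conjI allI impI)
  show "nabs (frob_bi q b i) \<le> 1" for i
   using le[of i] RziD(1)[OF b, of i] by (simp add: frob_bi_def nabs_power)
  show "vanish (tw z r (frob_bi q b)) UNIV" if "1 \<le> r" for r
   by (rule vanish_le[OF RziD(2)[OF b that], where C = 1])
    (use le in \<open>auto simp: tw_def frob_bi_def nabs_mult nabs_power nabs_zpow intro!: mult_right_mono\<close>)
 qed
next
 fix b c assume bc: "b \<in> carrier (Rzi S)" "c \<in> carrier (Rzi S)"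
 have "conv (frob_bi q b) (frob_bi q c) n = conv b c n ^ q" for n
 proof -
  have "((\<lambda>i. b i * c (n - i)) has_sum conv b c n) UNIV"
   unfolding conv_def
   by (rule has_sum_infsum, rule vanish_summable, rule conv_summable[of 1]) (use bc in \<open>auto simp: RziD\<close>)
  \<comment> \<open>The q-th power is additive and continuous, so it may be applied to an infinite
    sum term by term.\<close>
  hence "((\<lambda>i. (b i * c (n - i)) ^ q) has_sum (conv b c n) ^ q) UNIV"
   by (rule has_sum_homomorphism) (use q2 in \<open>auto simp: frobK continuous_on_pow\<close>)
  thus ?thesis unfolding conv_def by (simp add: infsumI frob_bi_def power_mult_distrib)
 qed
 thus "frob_bi q (b \<otimes>\<^bsub>Rzi S\<^esub> c) = frob_bi q b \<otimes>\<^bsub>Rzi S\<^esub> frob_bi q c"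
  by (auto simp: Rzi_simps frob_bi_def fun_eq_iff)
qed (use q2 in \<open>auto simp: Rzi_simps frob_bi_def bmono_def frobK fun_eq_iff\<close>)

lemma frob_fps_hom: "frob_fps q \<in> ring_hom Rz (Rz :: 'K fps ring)"
 by (rule ring_hom_memI)
  (use q2 in \<open>auto simp: Rz_simps frob_fps_def fps_eq_iff fps_mult_nth frob_sum power_mult_distrib frobK Rz_carrier val_simps\<close>)

lemma frob_fls_nth: "frob_fls q f $$ n = (f $$ n) ^ q" for f :: "'b::field fls"
 unfolding frob_fls_def
 by (rule nth_Abs_fls_ex_lower_bound) (use q2 in \<open>auto intro!: exI[of _ "fls_subdegree f"]\<close>)

lemma frob_fls_hom: "frob_fls q \<in> ring_hom (ring_on UNIV) (ring_on (UNIV :: 'k fls set))"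
proof (rule ring_hom_memI)
 fix f g :: "'k fls"
 have "(frob_fls q f * frob_fls q g) $$ n = ((f * g) $$ n) ^ q" for n
  unfolding fls_times_nth(2)[of f g] frobk_sum
  by (subst fls_times_nth_bounds[of "fls_subdegree f" _ "fls_subdegree g"])
   (use q2 in \<open>auto simp: frob_fls_nth power_mult_distrib\<close>)
 thus "frob_fls q (f \<otimes>\<^bsub>ring_on UNIV\<^esub> g) = frob_fls q f \<otimes>\<^bsub>ring_on UNIV\<^esub> frob_fls q g"
  by (simp add: fls_eq_iff frob_fls_nth)
qed (use q2 in \<open>auto simp: fls_eq_iff frob_fls_nth frobk\<close>)

lemma taylor_nth: "fps_nth (taylor z b) n = z powi (- int n) * binom_sum n (tw z 1 b)"
 if "vanish (tw z 1 b) UNIV"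
proof -
 have "of_int (int_binom i n) * b i * z powi (i - int n) = z powi (- int n) * (of_int (int_binom i n) * tw z 1 b i)" for i
  using zeta_nz by (simp add: tw_def power_int_diff power_int_minus field_simps)
 thus ?thesis
  unfolding taylor_def binom_sum_def
  using infsum_cmult_right[OF vanish_summable[OF vanish_binom[OF that]], of "z powi (- int n)" "\<lambda>i. int_binom i n"]
  by (simp only: fps_nth_Abs_fps)
qed

lemma taylor_bmono: "fps_nth (taylor z (bmono a c)) n = of_int (int_binom a n) * c * z powi (a - int n)"
 unfolding taylor_def by (simp, subst infsum_single[of a]) (auto simp: bmono_def)

text \<open>In rescaled coordinates this is the Leibniz rule \<open>binom_sum_conv\<close>; the
  powers of z split along n = k + (n - k).\<close>

lemma taylor_mult:
 assumes "vanish (tw z 1 b) UNIV" "vanish (tw z 1 c) UNIV"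
 shows "taylor z (conv b c) = taylor z b * taylor z c"
proof (rule fps_ext)
 fix n
 have *: "z powi (- int n) * (binom_sum k (tw z 1 b) * binom_sum (n - k) (tw z 1 c)) =
  (z powi (- int k) * binom_sum k (tw z 1 b)) * (z powi (- int (n - k)) * binom_sum (n - k) (tw z 1 c))"
  if "k \<le> n" for k
 proof -
  have "z powi (- int n) = z powi (- int k) * z powi (- int (n - k))"
   using zeta_nz that by (simp flip: power_int_add)
  thus ?thesis by (simp add: mult_ac)
 qed
 have "fps_nth (taylor z (conv b c)) n = (\<Sum>k\<le>n. z powi (- int n) * (binom_sum k (tw z 1 b) * binom_sum (n - k) (tw z 1 c)))"
  using assms by (simp add: taylor_nth tw_conv vanish_conv binom_sum_conv sum_distrib_left del: One_nat_def)
 also have "\<dots> = fps_nth (taylor z b * taylor z c) n"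
  unfolding fps_mult_nth atLeast0AtMost taylor_nth[OF assms(1)] taylor_nth[OF assms(2)]
  by (rule sum.cong[OF refl]) (rule *, simp)
 finally show "fps_nth (taylor z (conv b c)) n = fps_nth (taylor z b * taylor z c) n" .
qed

lemma taylor_hom: "taylor z \<in> ring_hom (Rzi S) (ring_on UNIV)"
proof (rule ring_hom_memI)
 fix b c assume bc: "b \<in> carrier (Rzi S)" "c \<in> carrier (Rzi S)"
 hence v: "vanish (tw z 1 b) UNIV" "vanish (tw z 1 c) UNIV" by (auto simp: RziD)
 show "taylor z (b \<otimes>\<^bsub>Rzi S\<^esub> c) = taylor z b \<otimes>\<^bsub>ring_on UNIV\<^esub> taylor z c"
  unfolding Rzi_simps ring_on_simps by (rule taylor_mult[OF v])
 have "binom_sum n (\<lambda>i. tw z 1 b i + tw z 1 c i) = binom_sum n (tw z 1 b) + binom_sum n (tw z 1 c)" for n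
  unfolding binom_sum_def distrib_left by (intro infsum_add vanish_summable vanish_binom v)
 thus "taylor z (b \<oplus>\<^bsub>Rzi S\<^esub> c) = taylor z b \<oplus>\<^bsub>ring_on UNIV\<^esub> taylor z c"
  using v vanish_add[OF v] by (simp add: Rzi_simps fps_eq_iff taylor_nth tw_add distrib_left del: One_nat_def)
next
 have "int_binom 0 n = (if n = 0 then 1 else 0)" for n
 proof (cases "n = 0")
  case False
  hence "(\<Prod>j<n. 0 - int j) = 0" by (intro prod_zero) auto
  thus ?thesis using False by (simp only: int_binom_def) simp
 qed simp
 thus "taylor z \<one>\<^bsub>Rzi S\<^esub> = \<one>\<^bsub>ring_on UNIV\<^esub>"
  by (auto simp: Rzi_simps fps_eq_iff taylor_bmono)
qed simp

subsection \<open>The element \<open>\<ell>\<^sub>-\<close>\<close>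

text \<open>Once g lies below r^(K+1), squaring an earlier value gains a factor r^(K+1). This pays
  for going back from m + 1 to m - j with j \<le> K, so the bound C r^m propagates. Applied to
  arbitrarily small r, it gives decay faster than every geometric rate.\<close>

lemma super_decay:
 fixes g h :: "nat => real"
 assumes r: "0 < r" "r < 1" and g: "!!m. 0 \<le> g m" "g \<longlonglongrightarrow> 0" and h: "!!m. h m \<le> H * r ^ m"
  and step: "!!m. g (Suc m) \<le> h (Suc m) \<or> (\<exists>j\<le>K. j \<le> m \<and> g (Suc m) \<le> g (m - j) ^ 2)"
 shows "\<exists>C. \<forall>m. g m \<le> C * r ^ m"
proof -
 obtain m0 where m0: "!!m. m \<ge> m0 ==> g m < r ^ (K + 1)"
  using order_tendstoD(2)[OF g(2), of "r ^ (K + 1)"] r by (auto simp: eventually_sequentially)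
 \<comment> \<open>The sum secures the bound for all m \<le> m0 + K, beyond which every m - 1 - j
   with j \<le> K is at least m0; the absolute value of H takes care of the inhomogeneous
   alternative.\<close>
 define C where "C = \<bar>H\<bar> + (\<Sum>m\<le>m0 + K. g m / r ^ m)"
 have C0: "0 \<le> (\<Sum>m\<le>m0 + K. g m / r ^ m)" using g r by (intro sum_nonneg) auto
 have "g m \<le> C * r ^ m" for m
 proof (induction m rule: less_induct)
  case (less m)
  show ?case
  proof (cases "m \<le> m0 + K")
   case True
   have "g m / r ^ m \<le> (\<Sum>m\<le>m0 + K. g m / r ^ m)"
    using True g r by (intro member_le_sum) auto
   hence "g m / r ^ m \<le> C" by (simp add: C_def)
   thus ?thesis using r by (simp add: field_simps)
  next
   case False
   then obtain n where n: "m = Suc n" by (cases m) auto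
   from step[of n] show ?thesis
   proof
    assume "g (Suc n) \<le> h (Suc n)"
    also have "\<dots> \<le> H * r ^ m" using h[of "Suc n"] n by simp
    also have "\<dots> \<le> C * r ^ m" using C0 r by (intro mult_right_mono) (auto simp: C_def)
    finally show ?thesis using n by simp
   next
    assume "\<exists>j\<le>K. j \<le> n \<and> g (Suc n) \<le> g (n - j) ^ 2"
    then obtain j where j: "j \<le> K" "j \<le> n" "g (Suc n) \<le> g (n - j) ^ 2" by blast
    have "g (n - j) ^ 2 = g (n - j) * g (n - j)" by (simp add: power2_eq_square)
    also have "\<dots> \<le> r ^ (K + 1) * (C * r ^ (n - j))"
    proof (rule mult_mono)
     have "n - j \<ge> m0" "n - j < m" using False n j by auto
     thus "g (n - j) \<le> r ^ (K + 1)" "g (n - j) \<le> C * r ^ (n - j)"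
      using m0[of "n - j"] less[of "n - j"] by linarith+
    qed (use g(1) r in auto)
    also have "\<dots> = C * r ^ (K + 1 + (n - j))" by (simp add: power_add mult_ac)
    also have "\<dots> \<le> C * r ^ m"
     using r j n C0 by (intro mult_left_mono power_decreasing) (auto simp: C_def)
    finally show ?thesis using j(3) n by simp
   qed
  qed
 qed
 thus ?thesis by blast
qed

lemma Rzi_decayI:
 assumes "!!i. nabs (b i) \<le> 1" "!!i. i > N ==> b i = 0"
  "!!r. \<exists>C. \<forall>m. nabs (b (N - int m)) \<le> C * (nabs z ^ r) ^ m"
 shows "b \<in> carrier (Rzi S)"
 unfolding Rzi_iff
proof (intro conjI allI impI assms(1))
 fix r :: nat assume r: "1 \<le> r"
 \<comment> \<open>Decay at the rate r + 1 leaves one spare factor |z|^m, so that the family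
   rescaled with r tends to zero and is not merely bounded.\<close>
 obtain C where C: "!!m. nabs (b (N - int m)) \<le> C * (nabs z ^ (r + 1)) ^ m" using assms(3) by blast
 have C0: "0 \<le> C" using order_trans[OF nabs_nonneg C[of 0]] by simp
 have "vanish (\<lambda>i. tw z r b (N - i)) {0..}"
 proof (rule vanish_le)
  show "vanish (tw z 1 (\<lambda>i. if i < 0 then 0 else 1)) {0..}"
   by (rule vanish_subset[of _ UNIV], rule vanish_powi_above[where N = 0]) auto
  fix i :: int assume i: "i \<in> {0..}"
  have "nabs (tw z r b (N - i)) \<le> (C * (nabs z ^ (r + 1)) ^ nat i) * nabs z powi (int r * (N - i))"
   using C[of "nat i"] i unfolding tw_def nabs_mult nabs_zpow by (intro mult_right_mono) auto
  also have "(nabs z ^ (r + 1)) ^ nat i = nabs z powi (int (r + 1) * i)"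
  proof -
   obtain m where m: "i = int m" using i by (auto elim: nonneg_int_cases)
   show ?thesis
    unfolding m nat_int power_mult[symmetric] of_nat_mult[symmetric] power_int_of_nat by (rule refl)
  qed
  also have "C * nabs z powi (int (r + 1) * i) * nabs z powi (int r * (N - i)) = C * nabs z powi (int r * N) * nabs z powi i"
  proof -
   have nz: "nabs z \<noteq> 0" using zeta_nz by simp
   have "int (r + 1) * i + int r * (N - i) = int r * N + i" by (simp add: algebra_simps)
   hence "nabs z powi (int (r + 1) * i) * nabs z powi (int r * (N - i)) = nabs z powi (int r * N) * nabs z powi i"
    using power_int_add[of "nabs z"] nz by metis
   thus ?thesis by (simp only: mult.assoc)
  qed
  also have "nabs z powi i = nabs (tw z 1 (\<lambda>i. if i < 0 then 0 else 1) i)"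
   using i by (simp add: tw_def nabs_zpow)
  finally show "nabs (tw z r b (N - i)) \<le> C * nabs z powi (int r * N) * nabs (tw z 1 (\<lambda>i. if i < 0 then 0 else 1) i)" .
 qed (use C0 d_pos in auto)
 from vanish_reindex[OF this, of "\<lambda>i. N - i" "{..N}"]
 have v: "vanish (tw z r b) {..N}" by (simp add: inj_on_def image_subset_iff)
 show "vanish (tw z r b) UNIV"
  unfolding vanish_def
 proof (intro allI impI)
  fix e :: real assume e: "e > 0"
  have "{i \<in> UNIV. e \<le> nabs (tw z r b i)} \<subseteq> {i \<in> {..N}. e \<le> nabs (tw z r b i)}"
   using assms(2) e by (auto simp: tw_def) (metis mult_zero_left nabs_zero not_le)
  thus "finite {i \<in> UNIV. e \<le> nabs (tw z r b i)}"
   using v e unfolding vanish_def by (meson finite_subset)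
 qed
qed

lemma Rzi_decayD:
 assumes b: "b \<in> carrier (Rzi S)"
 shows "\<exists>C. \<forall>m. nabs (b (- int m)) \<le> C * (nabs z ^ r) ^ m"
proof (cases "r = 0")
 case True
 thus ?thesis using RziD(1)[OF b] by (intro exI[of _ 1]) simp
next
 case False
 hence "1 \<le> r" by simp
 from vanish_bounded[OF RziD(2)[OF b this]] obtain C where C: "!!i. nabs (tw z r b i) \<le> C" by auto
 have "nabs (b (- int m)) \<le> C * (nabs z ^ r) ^ m" for m
 proof -
  have "nabs (b (- int m)) * inverse ((nabs z ^ r) ^ m) \<le> C"
   using C[of "- int m"] by (simp add: tw_def nabs_mult nabs_inverse nabs_power power_int_minus power_mult[symmetric] flip: of_nat_mult)
  thus ?thesis using d_pos by (simp add: field_simps)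
 qed
 thus ?thesis by blast
qed

lemma frob_diff: "(x - y :: 'K) ^ q = x ^ q - y ^ q"
 using frobK[of "x - y" y] by (simp add: algebra_simps)

definition ellN :: "nat => 'K fls"
 where "ellN N = (\<Prod>i<N. 1 - fls_const (z ^ (q ^ i)) * fls_X_inv)"

lemma mult_lin_nth: "(f * (1 - fls_const a * fls_X_inv)) $$ n = f $$ n - a * (f $$ (n + 1) :: 'K)"
proof -
 have "f * (1 - fls_const a * fls_X_inv) = f - fls_const a * fls_shift 1 f"
  using fls_X_inv_times_conv_shift[of f] by (simp add: algebra_simps)
 thus ?thesis by simp
qed

lemma ellN_0: "ellN 0 $$ n = (if n = 0 then 1 else 0)"
 by (simp add: ellN_def)

lemma ellN_Suc: "ellN (Suc N) $$ n = ellN N $$ n - z ^ (q ^ N) * ellN N $$ (n + 1)"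
 by (simp add: ellN_def mult_lin_nth)

text \<open>Here the first factor is split off instead of the last. The remaining factors are the
  Frobenius image of the shorter product, as raising to the power q turns \<zeta>^(q^i) into
  \<zeta>^(q^(i+1)). In the limit this becomes the functional equation
  \<open>ell_fe\<close>.\<close>

lemma ellN_Suc': "ellN (Suc N) $$ n = (ellN N $$ n) ^ q - z * (ellN N $$ (n + 1)) ^ q"
proof -
 let ?E = "\<lambda>N. (\<Prod>i<N. 1 - fls_const (z ^ (q ^ Suc i)) * fls_X_inv)"
 have E: "?E N $$ n = (ellN N $$ n) ^ q" for N n
 proof (induction N arbitrary: n)
  case 0
  thus ?case using q2 by (simp add: ellN_0)
 next
  case (Suc N)
  have "?E (Suc N) $$ n = ?E N $$ n - z ^ (q ^ Suc N) * ?E N $$ (n + 1)"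
   unfolding prod.lessThan_Suc by (rule mult_lin_nth)
  thus ?case unfolding Suc ellN_Suc frob_diff
   by (simp add: power_mult_distrib power_mult[symmetric] mult.commute)
 qed
 have "ellN (Suc N) = ?E N * (1 - fls_const z * fls_X_inv)"
  unfolding ellN_def prod.lessThan_Suc_shift by (simp add: mult.commute)
 hence "ellN (Suc N) $$ n = ?E N $$ n - z * ?E N $$ (n + 1)" by (simp only: mult_lin_nth)
 thus ?thesis by (simp only: E)
qed

lemma ellN_pos: "n > 0 ==> ellN N $$ n = 0"
 by (induction N arbitrary: n) (auto simp: ellN_0 ellN_Suc)

lemma ellN_at_0: "ellN N $$ 0 = 1"
 by (induction N) (auto simp: ellN_0 ellN_Suc ellN_pos)

lemma nabs_z_pow_q: "nabs (z ^ (q ^ i)) \<le> nabs z"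
 using power_decreasing[of 1 "q ^ i" "nabs z"] zeta_lt q2 by (simp add: nabs_power)

lemma ellN_le_1: "nabs (ellN N $$ n) \<le> 1"
proof (induction N arbitrary: n)
 case (Suc N)
 have "nabs (z ^ (q ^ N) * ellN N $$ (n + 1)) \<le> 1"
  unfolding nabs_mult using nabs_z_pow_q[of N] zeta_lt Suc by (intro mult_le_one) auto
 thus ?case unfolding ellN_Suc using Suc[of n] by (intro order_trans[OF nabs_diff] max.boundedI)
qed (auto simp: ellN_0)

lemma ellN_neg: "n < 0 ==> nabs (ellN N $$ n) \<le> nabs z"
proof (induction N arbitrary: n)
 case (Suc N)
 have "nabs (z ^ (q ^ N) * ellN N $$ (n + 1)) \<le> nabs z * 1"
  unfolding nabs_mult using nabs_z_pow_q[of N] ellN_le_1 by (intro mult_mono) auto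
 thus ?case unfolding ellN_Suc using Suc.IH[OF Suc.prems] by (intro order_trans[OF nabs_diff] max.boundedI) auto
qed (auto simp: ellN_0)

lemmas ellN_bounds = ellN_le_1 ellN_pos ellN_at_0 ellN_neg

lemma LIMSEQ_nabs_le:
 assumes "f \<longlonglongrightarrow> (L :: 'K)" "!!n. nabs (f n) \<le> c"
 shows "nabs L \<le> c"
proof (rule field_le_epsilon)
 fix e :: real assume e: "e > 0"
 obtain n where "dist (f n) L < e" using metric_LIMSEQ_D[OF assms(1) e] by blast
 hence 1: "nabs (f n - L) \<le> e" by (simp add: dist_nabs)
 have 0: "0 \<le> c" by (rule order_trans[OF nabs_nonneg assms(2)])
 have "nabs L \<le> max (nabs (f n)) (nabs (f n - L))" using nabs_diff[of "f n" "f n - L"] by simp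
 also have "\<dots> \<le> c + e" by (rule max.boundedI) (use 0 1 assms(2)[of n] e in linarith)+
 finally show "nabs L \<le> c + e" .
qed

text \<open>Passing from M to M + 1 factors changes a coefficient by at most |z|^(q^M), which is at
  most |z|^M. So the coefficients form Cauchy sequences, and the \<open>lim\<close> in the
  definition of \<open>ell\<close> is a genuine limit.\<close>

lemma ellN_lim: "(\<lambda>N. ellN N $$ n) \<longlonglongrightarrow> ell S n"
proof -
 have st: "nabs (ellN (M + k) $$ n - ellN M $$ n) \<le> nabs z ^ M" for M k
 proof (induction k)
  case (Suc k)
  have "nabs (ellN (Suc (M + k)) $$ n - ellN (M + k) $$ n) = nabs z ^ (q ^ (M + k)) * nabs (ellN (M + k) $$ (n + 1))"
   unfolding ellN_Suc by (simp add: nabs_mult nabs_power)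
  also have "\<dots> \<le> nabs z ^ (q ^ (M + k)) * 1"
   using ellN_bounds(1) by (intro mult_left_mono) auto
  also have "\<dots> \<le> nabs z ^ M"
  proof -
   have "M + k < q ^ (M + k)" using q2 less_exp[of "M + k"] power_mono[of 2 q "M + k"] by linarith
   thus ?thesis using zeta_lt power_decreasing[of M "q ^ (M + k)" "nabs z"] by simp
  qed
  finally show ?case
   using Suc nabs_add[of "ellN (Suc (M + k)) $$ n - ellN (M + k) $$ n" "ellN (M + k) $$ n - ellN M $$ n"] by simp
 qed (use d_pos in simp)
 have "Cauchy (\<lambda>N. ellN N $$ n)"
 proof (rule metric_CauchyI)
  fix e :: real assume "e > 0"
  then obtain M where M: "nabs z ^ M < e" using real_arch_pow_inv zeta_lt by blast
  have "dist (ellN m $$ n) (ellN k $$ n) < e" if "m \<ge> M" "k \<ge> M" for m k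
  proof -
   have "nabs (ellN m $$ n - ellN M $$ n) \<le> nabs z ^ M" "nabs (ellN k $$ n - ellN M $$ n) \<le> nabs z ^ M"
    using st[of M "m - M"] st[of M "k - M"] that by auto
   thus ?thesis
    using nabs_diff[of "ellN m $$ n - ellN M $$ n" "ellN k $$ n - ellN M $$ n"] M by (simp add: dist_nabs)
  qed
  thus "\<exists>M. \<forall>m\<ge>M. \<forall>k\<ge>M. dist (ellN m $$ n) (ellN k $$ n) < e" by blast
 qed
 hence "convergent (\<lambda>N. ellN N $$ n)" by (rule Cauchy_convergent)
 thus ?thesis unfolding convergent_LIMSEQ_iff by (simp add: ell_def ellN_def)
qed

lemma ell_bounds: "nabs (ell S n) \<le> 1" "n > 0 ==> ell S n = 0" "ell S 0 = 1" "n < 0 ==> nabs (ell S n) \<le> nabs z"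
proof -
 show "nabs (ell S n) \<le> 1" by (rule LIMSEQ_nabs_le[OF ellN_lim]) (rule ellN_bounds)
 show "n > 0 ==> ell S n = 0" using ellN_lim[of n] by (simp add: ellN_bounds LIMSEQ_const_iff)
 show "ell S 0 = 1" using ellN_lim[of 0] by (simp add: ellN_bounds LIMSEQ_const_iff)
 show "n < 0 ==> nabs (ell S n) \<le> nabs z" by (rule LIMSEQ_nabs_le[OF ellN_lim]) (rule ellN_bounds)
qed

lemma ell_fe: "ell S n = ell S n ^ q - z * ell S (n + 1) ^ q"
proof -
 have pw: "(\<lambda>N. (ellN N $$ m) ^ q) \<longlonglongrightarrow> ell S m ^ q" for m
  using continuous_on_tendsto_compose[OF continuous_on_pow[of q] ellN_lim[of m]] by simp
 have "(\<lambda>N. ellN (Suc N) $$ n) \<longlonglongrightarrow> ell S n ^ q - z * ell S (n + 1) ^ q"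
  unfolding ellN_Suc' by (intro tendsto_diff tendsto_mult tendsto_const pw)
 moreover have "(\<lambda>N. ellN (Suc N) $$ n) \<longlonglongrightarrow> ell S n" using ellN_lim by (rule LIMSEQ_Suc)
 ultimately show ?thesis by (rule LIMSEQ_unique[rotated])
qed

text \<open>For n < 0 the coefficient has absolute value below 1, so in the functional equation its
  own q-th power is strictly smaller than itself. The other term must therefore account for its
  size.\<close>

lemma ell_step:
 assumes "n < 0"
 shows "nabs (ell S n) \<le> nabs z * nabs (ell S (n + 1)) ^ q"
proof (cases "ell S n = 0")
 case True
 thus ?thesis using d_pos by simp
next
 case False
 hence pos: "0 < nabs (ell S n)" using nabs_nonneg[of "ell S n"] nabs_eq_0[of "ell S n"] by linarith
 have lt: "nabs (ell S n) < 1" using ell_bounds(4)[OF assms] zeta_lt by linarith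
 have "nabs (ell S n) ^ q \<le> nabs (ell S n) ^ 2" using lt q2 by (intro power_decreasing) auto
 also have "\<dots> < nabs (ell S n)" using pos lt by (simp add: power2_eq_square)
 finally have "nabs (ell S n) ^ q < nabs (ell S n)" .
 moreover have "nabs (ell S n) \<le> max (nabs (ell S n) ^ q) (nabs z * nabs (ell S (n + 1)) ^ q)"
  by (subst ell_fe) (use nabs_diff[of "ell S n ^ q" "z * ell S (n + 1) ^ q"] in \<open>simp add: nabs_mult nabs_power\<close>)
 ultimately show ?thesis by linarith
qed

lemma ell_decay: "nabs (ell S (- int m)) \<le> nabs z ^ m"
proof (induction m)
 case (Suc m)
 have "nabs (ell S (- int m)) ^ q \<le> nabs (ell S (- int m)) ^ 1"
  using ell_bounds(1) q2 by (intro power_decreasing) auto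
 hence "nabs (ell S (- int m)) ^ q \<le> nabs z ^ m" using Suc by simp
 hence "nabs z * nabs (ell S (- int m)) ^ q \<le> nabs z * nabs z ^ m" by (intro mult_left_mono) auto
 thus ?case using ell_step[of "- int (Suc m)"] by simp
qed (simp add: ell_bounds)

lemma zpow_null: "(\<lambda>m. nabs z ^ m) \<longlonglongrightarrow> 0"
 using d_pos zeta_lt by (intro LIMSEQ_realpow_zero) auto

text \<open>As q \<ge> 2, \<open>ell_step\<close> bounds each coefficient by the square of its
  neighbour, and \<open>ell_decay\<close> shows that they tend to zero. So
  \<open>super_decay\<close> applies without delay and without an inhomogeneous term.\<close>

lemma ell_Rzi: "ell S \<in> carrier (Rzi S)"
proof (rule Rzi_decayI[where N = 0])
 fix r :: nat
 show "\<exists>C. \<forall>m. nabs (ell S (0 - int m)) \<le> C * (nabs z ^ r) ^ m"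
 proof (cases "r = 0")
  case True
  thus ?thesis using ell_bounds(1) by (intro exI[of _ 1]) auto
 next
  case False
  show ?thesis
  proof (rule super_decay[where h = "\<lambda>_. 0" and H = 0 and K = 0])
   show "0 < nabs z ^ r" using d_pos by simp
   show "nabs z ^ r < 1" using zeta_lt False by (simp add: power_less_one_iff)
   show "(\<lambda>m. nabs (ell S (0 - int m))) \<longlonglongrightarrow> 0"
    by (rule tendsto_sandwich[OF _ _ tendsto_const zpow_null]) (auto simp: ell_decay)
   fix m
   have "nabs (ell S (- int (Suc m))) \<le> nabs z * nabs (ell S (- int m)) ^ q"
    using ell_step[of "- int (Suc m)"] by simp
   also have "\<dots> \<le> 1 * nabs (ell S (- int m)) ^ q"
    using zeta_lt by (intro mult_right_mono) auto
   also have "\<dots> \<le> nabs (ell S (- int m)) ^ 2"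
    using power_decreasing[OF q2, of "nabs (ell S (- int m))"] ell_bounds(1) by simp
   finally show "nabs (ell S (0 - int (Suc m))) \<le> 0 \<or>
     (\<exists>j\<le>0. j \<le> m \<and> nabs (ell S (0 - int (Suc m))) \<le> nabs (ell S (0 - int (m - j))) ^ 2)" by simp
  qed auto
 qed
qed (auto simp: ell_bounds)

text \<open>This is \<sigma>(\<open>ell\<close>), and the next series \<open>wlin\<close> is 1 -
  \<zeta>/z; their product is \<open>ell\<close>.\<close>

definition sell :: "int => 'K" where "sell = frob_bi q (ell S)"
definition wlin :: "int => 'K" where "wlin = (\<lambda>i. bmono 0 1 i + bmono (- 1) (- z) i)"

lemma sell_Rzi: "sell \<in> carrier (Rzi S)"
 unfolding sell_def by (rule ring_hom_closed[OF frob_bi_hom ell_Rzi])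

lemma wlin_Rzi: "wlin \<in> carrier (Rzi S)"
 unfolding wlin_def by (intro add_Rzi bmono_Rzi val_simps)

lemma wlin_conv: "b \<in> carrier (Rzi S) ==> conv wlin b = (\<lambda>n. b n - z * b (n + 1))"
 unfolding wlin_def
 by (subst Rzi_conv_add) (auto simp: conv_bmono intro!: bmono_Rzi val_simps)

lemma ell_fact: "conv wlin sell = ell S"
 by (rule ext) (simp add: wlin_conv sell_Rzi, simp add: sell_def frob_bi_def ell_fe[symmetric])

end

section \<open>Units, homomorphisms out of localizations, and the commuting squares of coefficient
  rings\<close>

lemma rhom_ok_loc_lift:
 assumes "loc_ctx R s" "cring C" "f \<in> ring_hom R C" "f s \<in> Units C"
 shows "rhom_ok (loc_lift R s C f)"
 using loc_ctx.loc_cring[OF assms(1)] loc_ctx.loc_lift_hom[OF assms] assms(2)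
 by (simp add: rhom_ok_def loc_lift_def)

lemma loc_lift_simps [simp]: "src (loc_lift R s C f) = localization R s" "tgt (loc_lift R s C f) = C"
 by (simp_all add: loc_lift_def)

lemma rhom_ok_loc_hom:
 assumes "loc_ctx R s"
 shows "rhom_ok (loc_hom R s)"
 using loc_ctx.loc_cring[OF assms] loc_ctx.frac_hom[OF assms] assms
 by (simp add: rhom_ok_def loc_hom_def loc_ctx_def)

lemma loc_hom_simps [simp]: "src (loc_hom R s) = R" "tgt (loc_hom R s) = localization R s"
  "app (loc_hom R s) a = loc_frac R s a 0"
 by (simp_all add: loc_hom_def)

lemma (in cring) unit_of_mult:
 assumes "a \<otimes> b \<in> Units R" "a \<in> carrier R" "b \<in> carrier R"
 shows "a \<in> Units R" "b \<in> Units R"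
proof -
 obtain c where c: "c \<in> carrier R" "a \<otimes> b \<otimes> c = \<one>" using assms(1) by (auto simp: Units_def)
 have "a \<otimes> (b \<otimes> c) = \<one>" "b \<otimes> (a \<otimes> c) = \<one>" "(b \<otimes> c) \<otimes> a = \<one>" "(a \<otimes> c) \<otimes> b = \<one>"
  using c assms(2,3) by (simp_all add: m_ac)
 moreover have "b \<otimes> c \<in> carrier R" "a \<otimes> c \<in> carrier R" using assms(2,3) c(1) by simp_all
 ultimately show "a \<in> Units R" "b \<in> Units R" unfolding Units_def using assms(2,3) by auto
qed

lemma ring_hom_comp: "f \<in> ring_hom R T ==> g \<in> ring_hom T U ==> (\<lambda>x. g (f x)) \<in> ring_hom R U"
 using ring_hom_trans[of f R T g U] by (simp add: comp_def)

lemma fps_unit: "fps_nth f 0 \<noteq> 0 ==> (f :: 'a::field fps) \<in> Units (ring_on UNIV)"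
 by (rule units_ring_on[of f "inverse f"]) (auto simp: inverse_mult_eq_1')

lemma field_unit: "x \<noteq> 0 ==> (x :: 'a::field) \<in> Units (ring_on UNIV)"
 by (rule units_ring_on[of x "inverse x"]) auto

context ana_setting
begin

abbreviation "emb \<equiv> emb_B S"

lemma ell_loc: "loc_ctx (Rzi S) (ell S)"
 by (rule Rzi_loc[OF ell_Rzi])

lemma Rzil_cring: "cring (Rzil S)"
 unfolding Rzil_def by (rule loc_ctx.loc_cring[OF ell_loc])

lemma emb_hom: "emb \<in> ring_hom (Rzi S) (Rzil S)"
 unfolding Rzil_def emb_B_def[abs_def] by (rule loc_ctx.frac_hom[OF ell_loc])

lemma emb_closed: "b \<in> carrier (Rzi S) ==> emb b \<in> carrier (Rzil S)"
 by (rule ring_hom_closed[OF emb_hom])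

lemma emb_conv: "b \<in> carrier (Rzi S) ==> c \<in> carrier (Rzi S) ==> emb (conv b c) = emb b \<otimes>\<^bsub>Rzil S\<^esub> emb c"
 using ring_hom_mult[OF emb_hom, of b c] by (simp add: Rzi_simps)

lemma emb_unit:
 assumes "emb (conv b c) \<in> Units (Rzil S)" "b \<in> carrier (Rzi S)" "c \<in> carrier (Rzi S)"
 shows "emb b \<in> Units (Rzil S)" "emb c \<in> Units (Rzil S)"
 using cring.unit_of_mult[OF Rzil_cring _ emb_closed[OF assms(2)] emb_closed[OF assms(3)]] assms
 by (simp_all add: emb_conv)

lemma emb_unit_mult: "emb b \<in> Units (Rzil S) ==> emb c \<in> Units (Rzil S) ==> b \<in> carrier (Rzi S) ==> c \<in> carrier (Rzi S) ==>
  emb (conv b c) \<in> Units (Rzil S)"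
 using monoid.Units_m_closed[OF ring.is_monoid[OF cring.axioms(1)[OF Rzil_cring]]] by (simp add: emb_conv)

lemma ell_unit: "emb (ell S) \<in> Units (Rzil S)"
 unfolding Rzil_def emb_B_def by (rule loc_ctx.s_unit[OF ell_loc])

lemma sell_unit: "emb sell \<in> Units (Rzil S)" and wlin_unit: "emb wlin \<in> Units (Rzil S)"
 using emb_unit[of wlin sell] ell_unit wlin_Rzi sell_Rzi by (simp_all add: ell_fact)

lemma bmono_unit: "emb (bmono a 1) \<in> Units (Rzil S)"
proof (rule emb_unit(1)[of "bmono a 1" "bmono (- a) 1"])
 have "emb (bmono 0 1) = \<one>\<^bsub>Rzil S\<^esub>" using ring_hom_one[OF emb_hom] by (simp add: Rzi_simps)
 thus "emb (conv (bmono a 1) (bmono (- a) 1)) \<in> Units (Rzil S)"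
  using monoid.Units_one_closed[OF ring.is_monoid[OF cring.axioms(1)[OF Rzil_cring]]]
  by (simp add: conv_bmono_bmono)
qed (simp_all add: bmono_Rzi val_simps)

text \<open>The factorization z - \<zeta> = z (1 - \<zeta>/z) exhibits z - \<zeta> as a product of
  units of B. This is what lets R[[z]][1/(z - \<zeta>)] map to B.\<close>

lemma fps_to_bi_zmz: "fps_to_bi (zmz S) = conv (bmono 1 1) wlin"
proof
 fix i :: int
 consider "i < 0" | "i = 0" | "i = 1" | "i > 1" by linarith
 thus "fps_to_bi (zmz S) i = conv (bmono 1 1) wlin i"
  unfolding conv_bmono by cases (simp_all add: fps_to_bi_def zmz_def wlin_def bmono_def)
qed

lemma zmz_unit: "emb (fps_to_bi (zmz S)) \<in> Units (Rzil S)"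
 unfolding fps_to_bi_zmz by (intro emb_unit_mult bmono_unit wlin_unit bmono_Rzi wlin_Rzi val_simps)

lemma zmz_Rz: "zmz S \<in> carrier Rz"
 unfolding Rz_carrier
proof
 fix n
 show "fps_nth (zmz S) n \<in> val_ring"
  using val_simps(1,2,8) val_simps(5)[OF val_simps(8)] by (cases n) (simp_all add: zmz_def fps_nth_fps_const)
qed

lemma X_Rz: "fps_X \<in> carrier (Rz :: 'K fps ring)"
 by (auto simp: Rz_carrier fps_X_def val_simps)

lemma Rz_loc: "f \<in> carrier Rz ==> loc_ctx Rz (f :: 'K fps)"
 using Rz_cring by (simp add: loc_ctx_def loc_ctx_axioms_def)

lemma taylor_const: "vanish (tw z 1 b) UNIV ==> fps_nth (taylor z b) 0 = (\<Sum>\<^sub>\<infinity>i\<in>UNIV. b i * z powi i)"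
 by (simp add: taylor_nth binom_sum_def) (simp add: tw_def)

text \<open>A uniform bound c strictly below the dominant term is required, because the supremum of
  infinitely many smaller terms could reach the dominant one.\<close>

lemma nabs_val_dominant:
 assumes b: "vanish (tw z 1 b) UNIV" and c: "0 \<le> c" "c < nabs (b i0 * z powi i0)"
  and o: "!!i. i \<noteq> i0 ==> nabs (b i * z powi i) \<le> c"
 shows "nabs (fps_nth (taylor z b) 0) = nabs (b i0 * z powi i0)"
proof -
 have v: "vanish (\<lambda>i. b i * z powi i) UNIV" using b by (simp add: tw_def)
 have 1: "fps_nth (taylor z b) 0 = b i0 * z powi i0 + (\<Sum>\<^sub>\<infinity>i\<in>UNIV - {i0}. b i * z powi i)"
  unfolding taylor_const[OF b] by (rule infsum_insert_sub[OF v]) simp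
 have "nabs (\<Sum>\<^sub>\<infinity>i\<in>UNIV - {i0}. b i * z powi i) \<le> c"
  by (rule nabs_infsum_le) (use c o in auto)
 hence "nabs (\<Sum>\<^sub>\<infinity>i\<in>UNIV - {i0}. b i * z powi i) < nabs (b i0 * z powi i0)" using c by linarith
 from nabs_add_dominant[OF this] show ?thesis using 1 by simp
qed

lemma sell_bound: "nabs (sell (- int m)) \<le> nabs z ^ (q * m)"
proof -
 have "nabs (sell (- int m)) \<le> (nabs z ^ m) ^ q"
  unfolding sell_def frob_bi_def nabs_power by (intro power_mono ell_decay) auto
 thus ?thesis by (simp add: power_mult[symmetric] mult.commute)
qed

lemma sell_pos: "n > 0 ==> sell n = 0" and sell_0: "sell 0 = 1"
 using q2 by (simp_all add: sell_def frob_bi_def ell_bounds)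

text \<open>The coefficient at z^(-m) has absolute value at most |\<zeta>|^(q m), so its term has at
  z = \<zeta> size at most |\<zeta>|^((q-1) m), which is at most |\<zeta>| for m \<ge> 1. The
  constant term 1 dominates. Without the twist the factor 1 - \<zeta>/z would vanish there.\<close>

lemma taylor_sell: "nabs (fps_nth (taylor z sell) 0) = 1"
proof -
 have "nabs (fps_nth (taylor z sell) 0) = nabs (sell 0 * z powi 0)"
 proof (rule nabs_val_dominant[where c = "nabs z"])
  fix i :: int assume "i \<noteq> 0"
  then consider "i > 0" | "i < 0" by linarith
  thus "nabs (sell i * z powi i) \<le> nabs z"
  proof cases
   case 2
   define m where "m = nat (- i - 1)"
   have i: "i = - int (Suc m)" using 2 by (simp add: m_def)
   have nz: "nabs z \<noteq> 0" using zeta_nz by simp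
   have "nabs (sell i) * nabs z powi i \<le> nabs z ^ (q * Suc m) * nabs z powi i"
    unfolding i by (rule mult_right_mono[OF sell_bound]) (use d_pos in simp)
   also have "\<dots> = nabs z powi (int (q * Suc m) + - int (Suc m))"
    unfolding i by (simp only: power_int_add[OF disjI1[OF nz]] power_int_of_nat)
   also have "\<dots> \<le> nabs z powi 1"
   proof (rule power_int_decreasing)
    have m: "2 * Suc m \<le> q * Suc m" using q2 by (rule mult_right_mono) simp
    have g: "1 \<le> int A + - int n" if "2 * n \<le> A" "1 \<le> n" for A n using that by linarith
    show "1 \<le> int (q * Suc m) + - int (Suc m)" by (rule g[OF m]) simp
   qed (use d_pos zeta_lt in auto)
   finally show ?thesis by (simp add: nabs_mult nabs_zpow)
  qed (simp add: sell_pos)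
 qed (use sell_Rzi zeta_lt in \<open>auto simp: RziD sell_0\<close>)
 thus ?thesis by (simp add: sell_0)
qed

definition "tf b = taylor z (frob_bi q b)"

lemma tf_hom: "tf \<in> ring_hom (Rzi S) (ring_on UNIV)"
 unfolding tf_def[abs_def] by (rule ring_hom_comp[OF frob_bi_hom taylor_hom])

lemma tf_ell_unit: "tf (ell S) \<in> Units (ring_on UNIV)"
 unfolding tf_def sell_def[symmetric] by (rule fps_unit) (use taylor_sell in auto)

lemma B_s_P_alt: "B_s_P S = loc_lift (Rzi S) (ell S) (ring_on UNIV) tf"
 by (simp add: B_s_P_def tf_def[abs_def])

lemma B_s_P_ok: "rhom_ok (B_s_P S)"
 unfolding B_s_P_alt by (rule rhom_ok_loc_lift[OF ell_loc cring_ring_on_UNIV tf_hom]) (rule tf_ell_unit)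

lemma B_s_P_emb: "b \<in> carrier (Rzi S) ==> app (B_s_P S) (emb b) = tf b"
 unfolding B_s_P_alt emb_B_def by (rule loc_ctx.loc_lift_of[OF ell_loc cring_ring_on_UNIV tf_hom]) (rule tf_ell_unit)

lemma B_simps [simp]: "src (B_s_P S) = Rzil S" "tgt (B_s_P S) = ring_on UNIV"
  "src (B_s_F S) = Rzil S" "tgt (B_s_F S) = ring_on UNIV" "src (B_s_K S) = Rzil S" "tgt (B_s_K S) = ring_on UNIV"
  "src (B_s S) = Rzil S" "tgt (B_s S) = Rzil S" "src (B_kz S) = Rzil S" "tgt (B_kz S) = ring_on UNIV"
  "src (Rz_s S) = Rz" "tgt (Rz_s S) = Rz" "src (Rz_B S) = Rz" "tgt (Rz_B S) = Rzil S"
  "src (Rz_ki S) = Rz" "tgt (Rz_ki S) = ring_on UNIV" "src (Rz_kz S) = Rz" "tgt (Rz_kz S) = ring_on UNIV"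
  "src (Rz_P S) = Rz" "tgt (Rz_P S) = ring_on UNIV" "src (Rz_F S) = Rz" "tgt (Rz_F S) = ring_on UNIV"
  "src (Rz_K S) = Rz" "tgt (Rz_K S) = ring_on UNIV"
  "src (kz_s S) = ring_on UNIV" "tgt (kz_s S) = ring_on UNIV" "src (kz_B S) = ring_on UNIV" "tgt (kz_B S) = Rzil S"
  "src (kz_P S) = ring_on UNIV" "tgt (kz_P S) = ring_on UNIV" "src (kz_F S) = ring_on UNIV" "tgt (kz_F S) = ring_on UNIV"
  "src (kz_K S) = ring_on UNIV" "tgt (kz_K S) = ring_on UNIV"
  "src P_F = ring_on UNIV" "tgt P_F = ring_on UNIV" "src P_K = ring_on UNIV" "tgt P_K = ring_on UNIV"
  "src ki_kz = ring_on UNIV" "tgt ki_kz = ring_on UNIV"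
  "src (Rz_L S) = Rz" "tgt (Rz_L S) = Rz_zmz S" "src Rz_Z = Rz" "tgt Rz_Z = Rz_z"
  "src (L_B S) = Rz_zmz S" "tgt (L_B S) = Rzil S" "src (L_kz S) = Rz_zmz S" "tgt (L_kz S) = ring_on UNIV"
  "src (Z_B S) = Rz_z" "tgt (Z_B S) = Rzil S" "src (Z_kz S) = Rz_z" "tgt (Z_kz S) = ring_on UNIV"
  "src (Z_s_P S) = Rz_z" "tgt (Z_s_P S) = ring_on UNIV" "src (Z_s_K S) = Rz_z" "tgt (Z_s_K S) = ring_on UNIV"
 by (simp_all add: B_s_P_def B_s_F_def B_s_K_def B_s_def B_kz_def Rz_s_def Rz_B_def Rz_ki_def Rz_kz_def Rz_P_def
   Rz_F_def Rz_K_def kz_s_def kz_B_def kz_P_def kz_F_def kz_K_def P_F_def P_K_def ki_kz_def Rzil_def Rz_L_def Rz_Z_def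
   L_B_def L_kz_def Z_B_def Z_kz_def Z_s_P_def Z_s_K_def Rz_zmz_def Rz_z_def)

lemma P_F_ok: "rhom_ok (P_F :: ('K fps, 'K fls) rhom)"
 by (auto simp: rhom_ok_def cring_ring_on_UNIV P_F_def ring_on_hom fls_times_fps_to_fls)

lemma ki_kz_ok: "rhom_ok (ki_kz :: ('k fps, 'k fls) rhom)"
 by (auto simp: rhom_ok_def cring_ring_on_UNIV ki_kz_def ring_on_hom fls_times_fps_to_fls)

lemma P_K_ok: "rhom_ok (P_K :: ('K fps, 'K) rhom)"
 by (auto simp: rhom_ok_def cring_ring_on_UNIV P_K_def ring_on_hom)

lemma app_P_F [simp]: "app P_F f = fps_to_fls f" and app_P_K [simp]: "app P_K g = fps_nth g 0"
 and app_ki_kz [simp]: "app ki_kz u = fps_to_fls u"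
 by (simp_all add: P_F_def P_K_def ki_kz_def)

lemma B_s_F_alt: "B_s_F S = RHom (src (B_s_P S)) (tgt P_F) (\<lambda>b. app P_F (app (B_s_P S) b))"
 by (simp add: B_s_F_def)

lemma B_s_K_alt: "B_s_K S = RHom (src (B_s_P S)) (tgt P_K) (\<lambda>b. app P_K (app (B_s_P S) b))"
 by (simp add: B_s_K_def)

lemma B_s_F_ok: "rhom_ok (B_s_F S)"
 unfolding B_s_F_alt by (rule rhom_ok_comp[OF B_s_P_ok P_F_ok]) simp

lemma B_s_K_ok: "rhom_ok (B_s_K S)"
 unfolding B_s_K_alt by (rule rhom_ok_comp[OF B_s_P_ok P_K_ok]) simp

lemma Rz_s_ok: "rhom_ok (Rz_s S)"
 using Rz_cring frob_fps_hom by (simp add: rhom_ok_def Rz_s_def)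

lemma kz_s_ok: "rhom_ok (kz_s S)"
 using cring_ring_on_UNIV frob_fls_hom by (simp add: rhom_ok_def kz_s_def)

lemma Rz_B_ok: "rhom_ok (Rz_B S)"
 using Rz_cring Rzil_cring ring_hom_comp[OF fps_to_bi_hom emb_hom] by (simp add: rhom_ok_def Rz_B_def)

lemma kz_B_ok: "rhom_ok (kz_B S)"
 using cring_ring_on_UNIV Rzil_cring ring_hom_comp[OF fls_to_bi_hom emb_hom] by (simp add: rhom_ok_def kz_B_def)

lemma Rz_P_ok: "rhom_ok (Rz_P S)"
 using Rz_cring cring_ring_on_UNIV ring_hom_comp[OF fps_to_bi_hom taylor_hom] by (simp add: rhom_ok_def Rz_P_def)

lemma kz_P_ok: "rhom_ok (kz_P S)"
 using ring_hom_comp[OF fls_to_bi_hom taylor_hom] by (simp add: rhom_ok_def kz_P_def cring_ring_on_UNIV)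

lemma Rz_F_alt: "Rz_F S = RHom (src (Rz_P S)) (tgt P_F) (\<lambda>b. app P_F (app (Rz_P S) b))"
 and Rz_K_alt: "Rz_K S = RHom (src (Rz_P S)) (tgt P_K) (\<lambda>b. app P_K (app (Rz_P S) b))"
 and kz_F_alt: "kz_F S = RHom (src (kz_P S)) (tgt P_F) (\<lambda>b. app P_F (app (kz_P S) b))"
 and kz_K_alt: "kz_K S = RHom (src (kz_P S)) (tgt P_K) (\<lambda>b. app P_K (app (kz_P S) b))"
 by (simp_all add: Rz_F_def Rz_K_def kz_F_def kz_K_def)

lemma Rz_F_ok: "rhom_ok (Rz_F S)" unfolding Rz_F_alt by (rule rhom_ok_comp[OF Rz_P_ok P_F_ok]) simp
lemma Rz_K_ok: "rhom_ok (Rz_K S)" unfolding Rz_K_alt by (rule rhom_ok_comp[OF Rz_P_ok P_K_ok]) simp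
lemma kz_F_ok: "rhom_ok (kz_F S)" unfolding kz_F_alt by (rule rhom_ok_comp[OF kz_P_ok P_F_ok]) simp
lemma kz_K_ok: "rhom_ok (kz_K S)" unfolding kz_K_alt by (rule rhom_ok_comp[OF kz_P_ok P_K_ok]) simp

lemma Rz_ki_ok: "rhom_ok (Rz_ki S)"
 unfolding rhom_ok_def
proof (intro conjI)
 show "app (Rz_ki S) \<in> ring_hom (src (Rz_ki S)) (tgt (Rz_ki S))"
  by (rule ring_hom_memI)
   (auto simp: Rz_ki_def Rz_simps fps_eq_iff fps_mult_nth res_sum res_simps Rz_carrier val_simps)
qed (simp_all add: Rz_cring cring_ring_on_UNIV)

lemma Rz_kz_alt: "Rz_kz S = RHom (src (Rz_ki S)) (tgt ki_kz) (\<lambda>b. app ki_kz (app (Rz_ki S) b))"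
 by (simp add: Rz_kz_def)

lemma Rz_kz_ok: "rhom_ok (Rz_kz S)"
 unfolding Rz_kz_alt by (rule rhom_ok_comp[OF Rz_ki_ok ki_kz_ok]) simp

text \<open>Membership in the ring gives |b_i| |z|^i \<rightarrow> 0 at minus infinity, and |z|^i
  \<ge> 1 for i \<le> 0, so |b_i| < 1 far to the left. There the reduced coefficients are zero, and
  \<open>Abs_fls\<close> returns them unchanged.\<close>

lemma red_nth: "b \<in> carrier (Rzi S) ==> red_bi (res_map S) b $$ i = res_map S (b i)"
proof -
 assume b: "b \<in> carrier (Rzi S)"
 have "finite {i. 1 \<le> nabs (tw z 1 b i)}" using RziD(2)[OF b, of 1] by (simp add: vanish_def)
 hence "bdd_below {i. 1 \<le> nabs (tw z 1 b i)}" by (rule bdd_below_finite)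
 then obtain N where N: "!!i. 1 \<le> nabs (tw z 1 b i) ==> N \<le> i" by (auto simp: bdd_below_def)
 have "res_map S (b i) = 0" if i: "i < min N 0" for i
 proof -
  have "nabs (b i) * 1 \<le> nabs (b i) * nabs z powi i"
   using power_int_decreasing[of i 0 "nabs z"] i d_pos zeta_nz zeta_lt by (intro mult_left_mono) auto
  moreover have "nabs (tw z 1 b i) < 1" using N[of i] i by linarith
  ultimately have "nabs (b i) < 1" by (simp add: tw_def nabs_mult nabs_zpow)
  thus ?thesis using res_zero_iff[of "b i"] by (simp add: val_ring_def)
 qed
 thus ?thesis unfolding red_bi_def by (intro nth_Abs_fls_ex_lower_bound) blast
qed

lemma red_hom: "red_bi (res_map S) \<in> ring_hom (Rzi S) (ring_on UNIV)"
proof (rule ring_hom_memI)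
 fix b c assume bc: "b \<in> carrier (Rzi S)" "c \<in> carrier (Rzi S)"
 let ?f = "red_bi (res_map S) b" and ?g = "red_bi (res_map S) c"
 have vr: "b i \<in> val_ring" "c i \<in> val_ring" for i using bc RziD(1) by (auto simp: val_ring_def)
 have "res_map S (conv b c n) = (?f * ?g) $$ n" for n
 proof -
  let ?t = "\<lambda>i. b i * c (n - i)"
  have v: "vanish ?t UNIV" by (rule conv_summable[of 1 b c n]) (use bc in \<open>auto simp: RziD\<close>)
  \<comment> \<open>Outside this finite set the terms sum to something of absolute value at most
    1/2, which reduces to zero. The bound 1/2 in place of 1 keeps the infinite sum strictly below
    1.\<close>
  define F where "F = {i. 1 / 2 \<le> nabs (?t i)}"
  have "finite {i \<in> UNIV. 1 / 2 \<le> nabs (?t i)}" by (rule v[unfolded vanish_def, rule_format]) simp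
  hence F: "finite F" by (simp add: F_def)
  let ?A = "{fls_subdegree ?f..n - fls_subdegree ?g}"
  have "conv b c n = sum ?t F + (\<Sum>\<^sub>\<infinity>i\<in>UNIV - F. ?t i)"
  proof -
   have "infsum ?t (F \<union> (UNIV - F)) = infsum ?t F + infsum ?t (UNIV - F)"
    by (rule infsum_Un_disjoint) (use F vanish_summable[OF vanish_subset[OF v]] in auto)
   thus ?thesis using F by (simp add: conv_def)
  qed
  moreover have "nabs (\<Sum>\<^sub>\<infinity>i\<in>UNIV - F. ?t i) \<le> 1 / 2"
   by (rule nabs_infsum_le) (auto simp: F_def)
  hence "res_map S (\<Sum>\<^sub>\<infinity>i\<in>UNIV - F. ?t i) = 0" "(\<Sum>\<^sub>\<infinity>i\<in>UNIV - F. ?t i) \<in> val_ring"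
   using res_zero_iff[of "\<Sum>\<^sub>\<infinity>i\<in>UNIV - F. ?t i"] by (auto simp: val_ring_def)
  ultimately have "res_map S (conv b c n) = (\<Sum>i\<in>F. res_map S (?t i))"
   using vr by (simp add: res_simps res_sum val_simps)
  also have "\<dots> = (\<Sum>i\<in>F \<union> ?A. res_map S (?t i))"
  proof (rule sum.mono_neutral_left)
   show "\<forall>i\<in>F \<union> ?A - F. res_map S (?t i) = 0"
    using vr by (auto simp: F_def res_zero_iff val_simps)
  qed (use F in auto)
  also have "\<dots> = (\<Sum>i\<in>F \<union> ?A. ?f $$ i * ?g $$ (n - i))"
   using vr bc by (simp add: res_simps red_nth)
  also have "\<dots> = (\<Sum>i\<in>?A. ?f $$ i * ?g $$ (n - i))"
  proof (rule sum.mono_neutral_right)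
   show "\<forall>i\<in>F \<union> ?A - ?A. ?f $$ i * ?g $$ (n - i) = 0"
   proof
    fix i assume "i \<in> F \<union> ?A - ?A"
    hence "i < fls_subdegree ?f \<or> n - i < fls_subdegree ?g" by auto
    thus "?f $$ i * ?g $$ (n - i) = 0" by auto
   qed
  qed (use F in auto)
  finally show ?thesis by (simp add: fls_times_nth(2))
 qed
 thus "red_bi (res_map S) (b \<otimes>\<^bsub>Rzi S\<^esub> c) = red_bi (res_map S) b \<otimes>\<^bsub>ring_on UNIV\<^esub> red_bi (res_map S) c"
  using bc by (auto simp: Rzi_simps fls_eq_iff red_nth conv_Rzi)
 show "red_bi (res_map S) (b \<oplus>\<^bsub>Rzi S\<^esub> c) = red_bi (res_map S) b \<oplus>\<^bsub>ring_on UNIV\<^esub> red_bi (res_map S) c"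
  using bc vr by (auto simp: Rzi_simps fls_eq_iff red_nth add_Rzi res_simps)
next
 show "red_bi (res_map S) \<one>\<^bsub>Rzi S\<^esub> = \<one>\<^bsub>ring_on UNIV\<^esub>"
  unfolding Rzi_simps ring_on_simps fls_eq_iff
  by (subst red_nth) (auto simp: bmono_Rzi val_simps, simp_all add: bmono_def res_simps)
qed simp

lemma red_ell: "red_bi (res_map S) (ell S) = 1"
 unfolding fls_eq_iff
proof
 fix n
 have "res_map S (ell S n) = 0" if "n \<noteq> 0"
 proof (cases "n > 0")
  case False
  hence "nabs (ell S n) < 1" using ell_bounds(4)[of n] zeta_lt that by linarith
  thus ?thesis using res_zero_iff[of "ell S n"] ell_bounds(1) by (simp add: val_ring_def)
 qed (simp add: ell_bounds res_simps)
 thus "red_bi (res_map S) (ell S) $$ n = 1 $$ n"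
  by (simp add: red_nth ell_Rzi ell_bounds res_simps)
qed

lemma red_ell_unit: "red_bi (res_map S) (ell S) \<in> Units (ring_on UNIV)"
 unfolding red_ell by (rule field_unit) simp

lemma B_kz_ok: "rhom_ok (B_kz S)"
 unfolding B_kz_def by (rule rhom_ok_loc_lift[OF ell_loc cring_ring_on_UNIV red_hom]) (rule red_ell_unit)

lemma B_kz_emb: "b \<in> carrier (Rzi S) ==> app (B_kz S) (emb b) = red_bi (res_map S) b"
 unfolding B_kz_def emb_B_def by (rule loc_ctx.loc_lift_of[OF ell_loc cring_ring_on_UNIV red_hom]) (rule red_ell_unit)

lemma ef_hom: "(\<lambda>b. emb (frob_bi q b)) \<in> ring_hom (Rzi S) (Rzil S)"
 by (rule ring_hom_comp[OF frob_bi_hom emb_hom])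

lemma ef_unit: "emb (frob_bi q (ell S)) \<in> Units (Rzil S)"
 using sell_unit by (simp add: sell_def)

lemma B_s_ok: "rhom_ok (B_s S)"
 unfolding B_s_def by (rule rhom_ok_loc_lift[OF ell_loc Rzil_cring ef_hom]) (rule ef_unit)

lemma B_s_emb: "b \<in> carrier (Rzi S) ==> app (B_s S) (emb b) = emb (frob_bi q b)"
 unfolding B_s_def
 by (subst emb_B_def, rule loc_ctx.loc_lift_of[OF ell_loc Rzil_cring ef_hom]) (rule ef_unit)

lemma Rz_L_ok: "rhom_ok (Rz_L S)"
 unfolding Rz_L_def by (rule rhom_ok_loc_hom[OF Rz_loc[OF zmz_Rz]])

lemma Rz_Z_ok: "rhom_ok (Rz_Z :: ('K fps, 'K loc) rhom)"
 unfolding Rz_Z_def by (rule rhom_ok_loc_hom[OF Rz_loc[OF X_Rz]])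

lemma L_B_unit: "app (Rz_B S) (zmz S) \<in> Units (Rzil S)"
 using zmz_unit by (simp add: Rz_B_def)

lemma L_kz_unit: "app (Rz_kz S) (zmz S) \<in> Units (ring_on UNIV)"
proof (rule field_unit)
 have "fps_nth (app (Rz_ki S) (zmz S)) 1 = 1" by (simp add: Rz_ki_def zmz_def res_simps)
 hence "app (Rz_ki S) (zmz S) \<noteq> 0" by auto
 thus "app (Rz_kz S) (zmz S) \<noteq> 0" by (simp add: Rz_kz_def)
qed

lemma Z_kz_unit: "app (Rz_kz S) fps_X \<in> Units (ring_on UNIV)"
proof (rule field_unit)
 have "fps_nth (app (Rz_ki S) fps_X) 1 = 1" by (simp add: Rz_ki_def res_simps)
 hence "app (Rz_ki S) fps_X \<noteq> 0" by auto
 thus "app (Rz_kz S) fps_X \<noteq> 0" by (simp add: Rz_kz_def)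
qed

lemma Z_B_unit: "app (Rz_B S) fps_X \<in> Units (Rzil S)"
 by (simp add: Rz_B_def fps_to_bi_X bmono_unit)

lemma Rz_s_X: "app (Rz_s S) fps_X = fps_X"
 using q2 by (simp add: Rz_s_def frob_fps_def fps_eq_iff fps_X_def)

lemma Rz_P_X0: "fps_nth (app (Rz_P S) fps_X) 0 = z"
 by (simp add: Rz_P_def fps_to_bi_X taylor_bmono)

lemma hom_of: "rhom_ok h ==> app h \<in> ring_hom (src h) (tgt h)"
 by (simp add: rhom_ok_def)

lemma Rz_B_hom: "app (Rz_B S) \<in> ring_hom Rz (Rzil S)" and Rz_kz_hom: "app (Rz_kz S) \<in> ring_hom Rz (ring_on UNIV)"
 using hom_of[OF Rz_B_ok] hom_of[OF Rz_kz_ok] by simp_all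

lemma L_B_ok: "rhom_ok (L_B S)" and L_B_of: "f \<in> carrier Rz ==> app (L_B S) (app (Rz_L S) f) = app (Rz_B S) f"
 unfolding L_B_def using rhom_ok_loc_lift[OF Rz_loc[OF zmz_Rz] Rzil_cring Rz_B_hom L_B_unit]
  loc_ctx.loc_lift_of[OF Rz_loc[OF zmz_Rz] Rzil_cring Rz_B_hom L_B_unit]
 by (simp_all add: Rz_L_def)

lemma L_kz_ok: "rhom_ok (L_kz S)" and L_kz_of: "f \<in> carrier Rz ==> app (L_kz S) (app (Rz_L S) f) = app (Rz_kz S) f"
 unfolding L_kz_def using rhom_ok_loc_lift[OF Rz_loc[OF zmz_Rz] cring_ring_on_UNIV Rz_kz_hom L_kz_unit]
  loc_ctx.loc_lift_of[OF Rz_loc[OF zmz_Rz] cring_ring_on_UNIV Rz_kz_hom L_kz_unit]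
 by (simp_all add: Rz_L_def)

lemma Z_B_ok: "rhom_ok (Z_B S)" and Z_B_of: "f \<in> carrier Rz ==> app (Z_B S) (app Rz_Z f) = app (Rz_B S) f"
 unfolding Z_B_def using rhom_ok_loc_lift[OF Rz_loc[OF X_Rz] Rzil_cring Rz_B_hom Z_B_unit]
  loc_ctx.loc_lift_of[OF Rz_loc[OF X_Rz] Rzil_cring Rz_B_hom Z_B_unit]
 by (simp_all add: Rz_Z_def)

lemma Z_kz_ok: "rhom_ok (Z_kz S)" and Z_kz_of: "f \<in> carrier Rz ==> app (Z_kz S) (app Rz_Z f) = app (Rz_kz S) f"
 unfolding Z_kz_def using rhom_ok_loc_lift[OF Rz_loc[OF X_Rz] cring_ring_on_UNIV Rz_kz_hom Z_kz_unit]
  loc_ctx.loc_lift_of[OF Rz_loc[OF X_Rz] cring_ring_on_UNIV Rz_kz_hom Z_kz_unit]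
 by (simp_all add: Rz_Z_def)

lemma Z_s_P_hom: "(\<lambda>f. app (Rz_P S) (app (Rz_s S) f)) \<in> ring_hom Rz (ring_on UNIV)"
 by (rule ring_hom_comp[OF hom_of[OF Rz_s_ok, unfolded B_simps] hom_of[OF Rz_P_ok, unfolded B_simps]])

lemma Z_s_K_hom: "(\<lambda>f. app (Rz_K S) (app (Rz_s S) f)) \<in> ring_hom Rz (ring_on UNIV)"
 by (rule ring_hom_comp[OF hom_of[OF Rz_s_ok, unfolded B_simps] hom_of[OF Rz_K_ok, unfolded B_simps]])

lemma Z_s_P_unit: "app (Rz_P S) (app (Rz_s S) fps_X) \<in> Units (ring_on UNIV)"
 unfolding Rz_s_X by (rule fps_unit) (simp add: Rz_P_X0 zeta_nz)

lemma Z_s_K_unit: "app (Rz_K S) (app (Rz_s S) fps_X) \<in> Units (ring_on UNIV)"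
 unfolding Rz_s_X by (rule field_unit) (simp add: Rz_K_def Rz_P_X0 zeta_nz)

lemma Z_s_P_ok: "rhom_ok (Z_s_P S)"
 and Z_s_P_of: "f \<in> carrier Rz ==> app (Z_s_P S) (app Rz_Z f) = app (Rz_P S) (app (Rz_s S) f)"
 unfolding Z_s_P_def using rhom_ok_loc_lift[OF Rz_loc[OF X_Rz] cring_ring_on_UNIV Z_s_P_hom] Z_s_P_unit
  loc_ctx.loc_lift_of[OF Rz_loc[OF X_Rz] cring_ring_on_UNIV Z_s_P_hom]
 by (simp_all add: Rz_Z_def)

lemma Z_s_K_ok: "rhom_ok (Z_s_K S)"
 and Z_s_K_of: "f \<in> carrier Rz ==> app (Z_s_K S) (app Rz_Z f) = app (Rz_K S) (app (Rz_s S) f)"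
 unfolding Z_s_K_def using rhom_ok_loc_lift[OF Rz_loc[OF X_Rz] cring_ring_on_UNIV Z_s_K_hom] Z_s_K_unit
  loc_ctx.loc_lift_of[OF Rz_loc[OF X_Rz] cring_ring_on_UNIV Z_s_K_hom]
 by (simp_all add: Rz_Z_def)

text \<open>A homomorphism out of a localization is determined on the original ring, so the two
  routes from R[[z]][1/z] to K[[z - \<zeta>]] need only be compared on R[[z]]. Quasi-morphisms are
  transported along this identity.\<close>

lemma B_s_P_Z_B:
 assumes "x \<in> carrier Rz_z"
 shows "app (B_s_P S) (app (Z_B S) x) = app (Z_s_P S) x"
proof -
 have "(\<lambda>x. app (B_s_P S) (app (Z_B S) x)) \<in> ring_hom Rz_z (ring_on UNIV)"
  by (rule ring_hom_comp[OF hom_of[OF Z_B_ok, unfolded B_simps] hom_of[OF B_s_P_ok, unfolded B_simps]])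
 moreover have "app (B_s_P S) (app (Z_B S) (loc_frac Rz fps_X f 0)) = app (Rz_P S) (app (Rz_s S) f)"
  if f: "f \<in> carrier Rz" for f
 proof -
  have "app (Z_B S) (loc_frac Rz fps_X f 0) = emb (fps_to_bi f)"
   using Z_B_of[OF f] by (simp add: Rz_Z_def) (simp add: Rz_B_def)
  moreover have "frob_bi q (fps_to_bi f) = fps_to_bi (frob_fps q f)"
   using q2 by (auto simp: frob_bi_def fps_to_bi_def frob_fps_def fun_eq_iff)
  ultimately show ?thesis
   using ring_hom_closed[OF fps_to_bi_hom f] by (simp add: B_s_P_emb tf_def Rz_P_def Rz_s_def)
 qed
 ultimately show ?thesis
  unfolding Z_s_P_def
  using loc_ctx.loc_lift_unique[OF Rz_loc[OF X_Rz] cring_ring_on_UNIV Z_s_P_hom] Z_s_P_unit assms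
  by (simp add: Rz_z_def)
qed

lemma frob_fps_to_bi: "frob_bi q (fps_to_bi f) = fps_to_bi (frob_fps q (f :: 'K fps))"
 using q2 by (auto simp: frob_bi_def fps_to_bi_def frob_fps_def fun_eq_iff)

lemma frob_fls_to_bi: "frob_bi q (fls_to_bi (res_sec S) f) = fls_to_bi (res_sec S) (frob_fls q f)"
 by (auto simp: frob_bi_def fls_to_bi_def frob_fls_nth sec_pow fun_eq_iff)

text \<open>The Frobenius acts coefficientwise and therefore commutes with the inclusions of R[[z]]
  and k((z)) into two-sided series; for k((z)) this uses that the section is multiplicative. These
  squares make the twist of \<delta> meaningful over K[[z - \<zeta>]].\<close>

lemma sqr_P: "sqr (B_s_P S) (Rz_s S) (Rz_B S) (Rz_P S)" "sqr (B_s_P S) (kz_s S) (kz_B S) (kz_P S)"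
proof -
 have "app (Rz_P S) (app (Rz_s S) f) = app (B_s_P S) (app (Rz_B S) f)" if "f \<in> carrier Rz" for f
  using ring_hom_closed[OF fps_to_bi_hom that]
  by (simp add: Rz_P_def Rz_s_def Rz_B_def B_s_P_emb tf_def frob_fps_to_bi)
 thus "sqr (B_s_P S) (Rz_s S) (Rz_B S) (Rz_P S)"
  by (simp add: sqr_def B_s_P_ok Rz_s_ok Rz_B_ok Rz_P_ok)
 have "app (kz_P S) (app (kz_s S) u) = app (B_s_P S) (app (kz_B S) u)" for u
  using ring_hom_closed[OF fls_to_bi_hom, of u]
  by (simp add: kz_P_def kz_s_def kz_B_def B_s_P_emb tf_def frob_fls_to_bi)
 thus "sqr (B_s_P S) (kz_s S) (kz_B S) (kz_P S)"
  by (simp add: sqr_def B_s_P_ok kz_s_ok kz_B_ok kz_P_ok)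
qed

lemma sqr_F: "sqr (B_s_F S) (Rz_s S) (Rz_B S) (Rz_F S)" "sqr (B_s_F S) (kz_s S) (kz_B S) (kz_F S)"
 using sqrD(10)[OF sqr_P(1)] sqrD(10)[OF sqr_P(2)]
 by (simp_all add: sqr_def B_s_F_ok Rz_s_ok Rz_B_ok Rz_F_ok kz_s_ok kz_B_ok kz_F_ok, simp_all add: B_s_F_def Rz_F_def kz_F_def)

lemma sqr_K: "sqr (B_s_K S) (Rz_s S) (Rz_B S) (Rz_K S)" "sqr (B_s_K S) (kz_s S) (kz_B S) (kz_K S)"
 using sqrD(10)[OF sqr_P(1)] sqrD(10)[OF sqr_P(2)]
 by (simp_all add: sqr_def B_s_K_ok Rz_s_ok Rz_B_ok Rz_K_ok kz_s_ok kz_B_ok kz_K_ok, simp_all add: B_s_K_def Rz_K_def kz_K_def)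

lemma sqr_B: "sqr (B_s S) (Rz_s S) (Rz_B S) (Rz_B S)" "sqr (B_s S) (kz_s S) (kz_B S) (kz_B S)"
proof -
 have "app (Rz_B S) (app (Rz_s S) f) = app (B_s S) (app (Rz_B S) f)" if "f \<in> carrier Rz" for f
  using ring_hom_closed[OF fps_to_bi_hom that]
  by (simp add: Rz_s_def Rz_B_def B_s_emb frob_fps_to_bi)
 thus "sqr (B_s S) (Rz_s S) (Rz_B S) (Rz_B S)"
  by (simp add: sqr_def B_s_ok Rz_s_ok Rz_B_ok)
 have "app (kz_B S) (app (kz_s S) u) = app (B_s S) (app (kz_B S) u)" for u
  using ring_hom_closed[OF fls_to_bi_hom, of u]
  by (simp add: kz_s_def kz_B_def B_s_emb frob_fls_to_bi)
 thus "sqr (B_s S) (kz_s S) (kz_B S) (kz_B S)"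
  by (simp add: sqr_def B_s_ok kz_s_ok kz_B_ok)
qed

lemma tri_F: "tri P_F (Rz_P S) (Rz_F S)" "tri P_F (kz_P S) (kz_F S)"
 by (simp_all add: tri_def P_F_ok Rz_P_ok Rz_F_ok kz_P_ok kz_F_ok, simp_all add: Rz_F_def kz_F_def)

lemma tri_K: "tri P_K (Rz_P S) (Rz_K S)" "tri P_K (kz_P S) (kz_K S)"
 by (simp_all add: tri_def P_K_ok Rz_P_ok Rz_K_ok kz_P_ok kz_K_ok, simp_all add: Rz_K_def kz_K_def)

lemma tri_Z: "tri (Z_B S) Rz_Z (Rz_B S)" "tri (Z_kz S) Rz_Z (Rz_kz S)"
 by (simp_all add: tri_def Z_B_ok Z_kz_ok Rz_Z_ok Rz_B_ok Rz_kz_ok Z_B_of Z_kz_of)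

lemma sqr_Z: "sqr (Z_s_P S) (Rz_s S) Rz_Z (Rz_P S)" "sqr (Z_s_K S) (Rz_s S) Rz_Z (Rz_K S)"
 by (simp_all add: sqr_def Z_s_P_ok Z_s_K_ok Rz_s_ok Rz_Z_ok Rz_P_ok Rz_K_ok Z_s_P_of Z_s_K_of)

lemma tri_L: "tri (L_B S) (Rz_L S) (Rz_B S)" "tri (L_kz S) (Rz_L S) (Rz_kz S)"
 by (simp_all add: tri_def L_B_ok L_kz_ok Rz_L_ok Rz_B_ok Rz_kz_ok L_B_of L_kz_of)

lemma B_s_K_Z_B:
 assumes "x \<in> carrier Rz_z"
 shows "app (B_s_K S) (app (Z_B S) x) = app (Z_s_K S) x"
proof -
 have "(\<lambda>x. app (B_s_K S) (app (Z_B S) x)) \<in> ring_hom Rz_z (ring_on UNIV)"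
  by (rule ring_hom_comp[OF hom_of[OF Z_B_ok, unfolded B_simps] hom_of[OF B_s_K_ok, unfolded B_simps]])
 moreover have "app (B_s_K S) (app (Z_B S) (loc_frac Rz fps_X f 0)) = app (Rz_K S) (app (Rz_s S) f)"
  if f: "f \<in> carrier Rz" for f
  using sqrD(10)[OF sqr_K(1), of f] Z_B_of[OF f] f by (simp add: Rz_Z_def)
 ultimately show ?thesis
  unfolding Z_s_K_def
  using loc_ctx.loc_lift_unique[OF Rz_loc[OF X_Rz] cring_ring_on_UNIV Z_s_K_hom] Z_s_K_unit assms
  by (simp add: Rz_z_def)
qed

lemma B_kz_kz_B: "app (B_kz S) (app (kz_B S) f) = f"
 using ring_hom_closed[OF fls_to_bi_hom, of f]
 by (simp add: kz_B_def B_kz_emb fls_eq_iff red_nth) (simp add: fls_to_bi_def res_sec)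

lemma tri_B_kz: "tri (B_kz S) (Rz_B S) (Rz_kz S)"
proof -
 have "app (Rz_kz S) f = app (B_kz S) (app (Rz_B S) f)" if "f \<in> carrier Rz" for f
  using ring_hom_closed[OF fps_to_bi_hom that]
  by (simp add: Rz_B_def B_kz_emb fls_eq_iff red_nth) (auto simp: Rz_kz_def Rz_ki_def fps_to_bi_def res_simps)
 thus ?thesis by (simp add: tri_def B_kz_ok Rz_B_ok Rz_kz_ok)
qed

end

section \<open>Compatibility of twists with maps already defined over smaller rings\<close>

lemma bc_map_hom:
 assumes "rhom_ok h" "module (src h) M" "module (src h) N" "module_hom (src h) M N f"
 shows "module_hom (tgt h) (bc h M) (bc h N) (bc_map h M N f)"
 unfolding module_hom_def by (rule bc_map_spec[OF assms])

lemma twist_extend_cong: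
 assumes "sqr g s h h'" "sqr g t k k'" "module (src h) M" "module (src k) N"
  "module_hom (tgt h) (bc h M) (bc k N) f"
  "module_hom (tgt h) (bc h M) (bc k N) f'"
  "!!x. x \<in> carrier (bc h M) ==> f x = f' x" "x \<in> carrier (bc h' (bc s M))"
 shows "twist_extend g s h h' M t k k' N f x = twist_extend g s h h' M t k k' N f' x"
proof (rule twist_push_eqI[OF assms(1,3), of "id_hom (tgt g)" "bc k' (bc t N)"])
 note 1 = twist_extend_spec[OF assms(1,2,3,4,5)] and 2 = twist_extend_spec[OF assms(1,2,3,4,6)]
 show "semilinear (id_hom (tgt g)) (bc h' (bc s M)) (bc k' (bc t N))
   (twist_extend g s h h' M t k k' N f)" by (rule 1)
 show "semilinear (id_hom (tgt g)) (bc h' (bc s M)) (bc k' (bc t N))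
   (twist_extend g s h h' M t k k' N f')" by (rule 2)
 show "abelian_group (bc k' (bc t N))"
  by (rule module_abelian[OF twist_module(2)[OF assms(2,4)]])
 show "twist_extend g s h h' M t k k' N f (twist_push g s h h' M y) = twist_extend g s h h' M t k k' N f' (twist_push g s h h' M y)"
  if "y \<in> carrier (bc h M)" for y
  using 1(2)[OF that] 2(2)[OF that] assms(7)[OF that] by simp
qed (use assms(8) in simp_all)

text \<open>Reconciles two constructions of the twist of a map defined over the base: extend scalars
  and then twist, or pull back along \<open>s\<close> and then extend. Both send m \<otimes> 1
  \<otimes> 1 to f m \<otimes> 1 \<otimes> 1.\<close>

lemma twist_extend_bc_map:
 assumes "sqr g s h h'" "module (src h) M" "module (src h) N" "module_hom (src h) M N f"
  "x \<in> carrier (bc h' (bc s M))"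
 shows "twist_extend g s h h' M s h h' N (bc_map h M N f) x =
  bc_map h' (bc s M) (bc s N) (bc_map s M N f) x"
proof -
 note q = sqrD[OF assms(1)]
 have ms: "module (src s) M" "module (src s) N" "module_hom (src s) M N f" using assms q by simp_all
 note b = bc_map_spec[OF q(3) assms(2,3,4)] and bs = bc_map_spec[OF q(2) ms]
 note h1 = bc_map_hom[OF q(3) assms(2,3,4)]
 note T = twist_extend_spec[OF assms(1,1,2,3) h1]
 note mM = twist_module(1)[OF assms(1,2)] and mN = twist_module(1)[OF assms(1,3)]
 have h2: "module_hom (src h') (bc s M) (bc s N) (bc_map s M N f)"
  using bc_map_hom[OF q(2) ms] q(7) by simp
 note b' = bc_map_spec[OF q(4) mM mN h2]
 show ?thesis
 proof (rule twist_eqI[OF assms(1,2), of "id_hom (tgt g)" "bc h' (bc s N)"])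
  show "semilinear (id_hom (tgt g)) (bc h' (bc s M)) (bc h' (bc s N))
   (twist_extend g s h h' M s h h' N (bc_map h M N f))" by (rule T)
  show "semilinear (id_hom (tgt g)) (bc h' (bc s M)) (bc h' (bc s N))
   (bc_map h' (bc s M) (bc s N) (bc_map s M N f))" using b'(1) q(9) by simp
  show "abelian_group (bc h' (bc s N))"
   by (rule module_abelian[OF twist_module(2)[OF assms(1,3)]])
  fix m assume m: "m \<in> carrier M"
  have fm: "f m \<in> carrier N" using semilinearD(1)[OF module_homD[OF assms(4)] m] .
  have um: "bc_unit s M m \<in> carrier (bc s M)" by (rule bc_unit_closed[OF q(2) ms(1) m])
  show "twist_extend g s h h' M s h h' N (bc_map h M N f) (twist_unit s h' M m) =
     bc_map h' (bc s M) (bc s N) (bc_map s M N f) (twist_unit s h' M m)"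
   using T(3)[OF m] b(2)[OF m] twist_push_spec(2)[OF assms(1,3) fm] b'(2)[OF um] bs(2)[OF m]
   by (simp add: twist_unit_def)
 qed (use assms(5) in simp_all)
qed

text \<open>The same for a map that only exists over an intermediate ring, such as a quasi-morphism
  over R[[z]][1/z]. The twist along \<open>g\<close> of its extension is the twist along g r of the
  map itself.\<close>

lemma twist_extend_bc_extend:
 assumes "sqr g s h h'" "tri r p h" "sqr g' s p h'" "module (src h) M" "module (src h) N"
  "module_hom (tgt p) (bc p M) (bc p N) f"
  "!!a. a \<in> carrier (tgt p) ==> app g' a = app g (app r a)"
  "x \<in> carrier (bc h' (bc s M))"
 shows "twist_extend g s h h' M s h h' N (bc_extend r p h M p h N f) x =
  twist_extend g' s p h' M s p h' N f x"
proof -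
 note q = sqrD[OF assms(1)] and p = triD[OF assms(2)] and q' = sqrD[OF assms(3)]
 have mp: "module (src p) M" "module (src p) N" using assms(4,5) p(5) by simp_all
 note b = bc_extend_spec[OF assms(2,2) mp assms(6)]
 have bh: "module_hom (tgt h) (bc h M) (bc h N) (bc_extend r p h M p h N f)"
  unfolding module_hom_def using b(1) p(6) by simp
 note T = twist_extend_spec[OF assms(1,1,4,5) bh]
 note T' = twist_extend_spec[OF assms(3,3) mp assms(6)]
 have tp: "twist_push g s h h' N (bc_push p h r N y) = twist_push g' s p h' N y"
  if y: "y \<in> carrier (bc p N)" for y
 proof (rule bc_eqI[of p N g' "bc h' (bc s N)"])
  show "semilinear g' (bc p N) (bc h' (bc s N)) (\<lambda>y. twist_push g s h h' N (bc_push p h r N y))"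
   by (rule semilinear_comp[OF bc_push_spec(1)[OF assms(2) mp(2)] twist_push_spec(1)[OF assms(1,5)]])
    (use p(1,4,6) q(5) q'(5) assms(7) in simp_all)
  show "semilinear g' (bc p N) (bc h' (bc s N)) (twist_push g' s p h' N)"
   by (rule twist_push_spec(1)[OF assms(3) mp(2)])
  show "abelian_group (bc h' (bc s N))"
   by (rule module_abelian[OF twist_module(2)[OF assms(1,5)]])
  show "twist_push g s h h' N (bc_push p h r N (bc_unit p N m)) = twist_push g' s p h' N (bc_unit p N m)"
   if "m \<in> carrier N" for m
   using bc_push_spec(2)[OF assms(2) mp(2) that] twist_push_spec(2)[OF assms(1,5) that]
    twist_push_spec(2)[OF assms(3) mp(2) that] by simp
 qed (use p(2) mp q'(5) y in simp_all)
 show ?thesis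
 proof (rule twist_eqI[OF assms(1,4), of "id_hom (tgt g)" "bc h' (bc s N)"])
  show "semilinear (id_hom (tgt g)) (bc h' (bc s M)) (bc h' (bc s N))
   (twist_extend g s h h' M s h h' N (bc_extend r p h M p h N f))" by (rule T)
  show "semilinear (id_hom (tgt g)) (bc h' (bc s M)) (bc h' (bc s N))
   (twist_extend g' s p h' M s p h' N f)" using T'(1) q(9) q'(9) by simp
  show "abelian_group (bc h' (bc s N))"
   by (rule module_abelian[OF twist_module(2)[OF assms(1,5)]])
  fix m assume m: "m \<in> carrier M"
  have fm: "f (bc_unit p M m) \<in> carrier (bc p N)"
   using semilinearD(1)[OF module_homD[OF assms(6)] bc_unit_closed[OF p(2) mp(1) m]] .
  show "twist_extend g s h h' M s h h' N (bc_extend r p h M p h N f) (twist_unit s h' M m) =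
     twist_extend g' s p h' M s p h' N f (twist_unit s h' M m)"
   using T(3)[OF m] T'(3)[OF m] b(2)[OF m] tp[OF fm] by simp
 qed (use assms(8) in simp_all)
qed

section \<open>The comparison maps: isomorphy, lattices, filtrations and functoriality\<close>

context ana_setting
begin

context
 fixes U :: "('K, 'k, 'm) rig_shtuka"
 assumes rig: "rigidified_shtuka S U"
begin

lemma smod_module: "module Rz (smod U)"
 using rig by (auto simp: rigidified_shtuka_def local_shtuka_def free_of_rank_def)

lemma Dt_module: "module (ring_on UNIV) (Dt S U)"
 unfolding Dt_def using bc_module[OF Rz_kz_ok, of "smod U"] smod_module by simp

lemma sdelta_iso: "module_iso (Rzil S) (bc (Rz_B S) (smod U)) (bc (kz_B S) (Dt S U)) (sdelta U)"
 using rig by (simp add: rigidified_shtuka_def)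

lemma sdelta_hom: "module_hom (tgt (Rz_B S)) (bc (Rz_B S) (smod U)) (bc (kz_B S) (Dt S U)) (sdelta U)"
 using sdelta_iso by (simp add: module_iso_def)

lemma mods: "module (src (Rz_B S)) (smod U)" "module (src (kz_B S)) (Dt S U)"
 using smod_module Dt_module by simp_all

lemma sig_delta_iso:
 assumes "sqr g (Rz_s S) (Rz_B S) h" "sqr g (kz_s S) (kz_B S) k"
 shows "module_iso (tgt g) (bc h (sig_mod S U)) (bc k (cris S U)) (sig_delta S U g h k)"
 unfolding sig_mod_def cris_def sig_delta_def
 by (rule twist_extend_iso[OF assms mods]) (use sdelta_iso in simp)

lemma h_P_iso: "module_iso (ring_on UNIV) (dR_P S U) (cris_P S U) (h_dR_cris_P S U)"
 using sig_delta_iso[OF sqr_P] by (simp add: dR_P_def cris_P_def h_dR_cris_P_def)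

lemma h_K_iso: "module_iso (ring_on UNIV) (dR_K S U) (cris_K S U) (h_dR_cris_K S U)"
 using sig_delta_iso[OF sqr_K] by (simp add: dR_K_def cris_K_def h_dR_cris_K_def)

lemma h_red:
 assumes "x \<in> carrier (dR_P S U)"
 shows "cris_red S U (h_dR_cris_P S U x) = h_dR_cris_K S U (dR_red S U x)"
 using assms
 unfolding dR_P_def cris_red_def h_dR_cris_P_def h_dR_cris_K_def dR_red_def sig_delta_def sig_mod_def cris_def
 by (intro twist_extend_push[OF sqr_P mods sdelta_hom tri_K sqr_K]) (simp_all add: B_s_K_def)

lemma h_push:
 assumes "x \<in> carrier (dR_P S U)"
 shows "bc_push (kz_P S) (kz_F S) P_F (cris S U) (h_dR_cris_P S U x) =
  sig_delta S U (B_s_F S) (Rz_F S) (kz_F S) (bc_push (Rz_P S) (Rz_F S) P_F (sig_mod S U) x)"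
 using assms
 unfolding dR_P_def h_dR_cris_P_def sig_delta_def sig_mod_def cris_def
 by (intro twist_extend_push[OF sqr_P mods sdelta_hom tri_F sqr_F]) (simp_all add: B_s_F_def)

lemma sig_module: "module Rz (sig_mod S U)"
 using twist_module(1)[OF sqr_P(1) mods(1)] by (simp add: sig_mod_def)

lemma cris_module: "module (ring_on UNIV) (cris S U)"
 using twist_module(1)[OF sqr_P(2) mods(2)] by (simp add: cris_def)

text \<open>The left side extends the comparison map from K[[z - \<zeta>]] to K((z - \<zeta>)),
  while the crystalline lattice is defined with \<delta> twisted directly over K((z - \<zeta>)).
  Both are linear and agree on y \<otimes> 1.\<close>

lemma h_F_eq:
 assumes "x \<in> carrier (bc (Rz_F S) (sig_mod S U))"
 shows "h_dR_cris_F S U x = sig_delta S U (B_s_F S) (Rz_F S) (kz_F S) x"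
proof -
 have m: "module (src (Rz_P S)) (sig_mod S U)" "module (src (kz_P S)) (cris S U)" "module (src (Rz_F S)) (sig_mod S U)"
  "module (src (kz_F S)) (cris S U)"
  using sig_module cris_module by simp_all
 have hh: "module_hom (tgt (Rz_P S)) (bc (Rz_P S) (sig_mod S U)) (bc (kz_P S) (cris S U)) (h_dR_cris_P S U)"
  using h_P_iso by (simp add: module_iso_def dR_P_def cris_P_def)
 note E = bc_extend_spec[OF tri_F m(1,2) hh]
 note F = sig_delta_iso[OF sqr_F, unfolded module_iso_def, THEN conjunct1, THEN module_homD]
 show ?thesis
 proof (rule bc_eqI[OF Rz_F_ok m(3), of "id_hom (ring_on UNIV)" "bc (kz_F S) (cris S U)"])
  show "abelian_group (bc (kz_F S) (cris S U))"
   by (rule module_abelian[OF bc_module[OF kz_F_ok m(4)]])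
  show "semilinear (id_hom (ring_on UNIV)) (bc (Rz_F S) (sig_mod S U)) (bc (kz_F S) (cris S U)) (h_dR_cris_F S U)"
   unfolding h_dR_cris_F_def using E(1) by simp
  show "semilinear (id_hom (ring_on UNIV)) (bc (Rz_F S) (sig_mod S U)) (bc (kz_F S) (cris S U))
   (sig_delta S U (B_s_F S) (Rz_F S) (kz_F S))" using F by simp
  fix y assume y: "y \<in> carrier (sig_mod S U)"
  have "bc_unit (Rz_P S) (sig_mod S U) y \<in> carrier (dR_P S U)"
   unfolding dR_P_def by (rule bc_unit_closed[OF Rz_P_ok m(1) y])
  thus "h_dR_cris_F S U (bc_unit (Rz_F S) (sig_mod S U) y) =
    sig_delta S U (B_s_F S) (Rz_F S) (kz_F S) (bc_unit (Rz_F S) (sig_mod S U) y)"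
   using E(2)[OF y] h_push bc_push_spec(2)[OF tri_F(1) m(1) y] by (simp add: h_dR_cris_F_def)
 qed (use assms in simp_all)
qed

lemma dR_lattice_sub: "dR_lattice S U \<subseteq> carrier (bc (Rz_F S) (sig_mod S U))"
 by (auto simp: dR_lattice_def)

lemma h_F_lattice: "h_dR_cris_F S U ` dR_lattice S U = cris_lattice S U"
 unfolding cris_lattice_def using h_F_eq dR_lattice_sub by (intro image_cong) auto

text \<open>The bijection over K[[z - \<zeta>]] carries the intersection defining the i-th step to
  its crystalline counterpart, and reduction modulo z - \<zeta> then carries the images
  along.\<close>

lemma h_K_fil: "h_dR_cris_K S U ` dR_fil S U i = cris_fil S U i"
proof -
 let ?p = "bc_push (Rz_P S) (Rz_F S) P_F (sig_mod S U)" and ?p' = "bc_push (kz_P S) (kz_F S) P_F (cris S U)"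
 let ?C = "bc (Rz_F S) (sig_mod S U)" and ?C' = "bc (kz_F S) (cris S U)"
 let ?F = "sig_delta S U (B_s_F S) (Rz_F S) (kz_F S)" and ?L = "dR_lattice S U"
 let ?A = "{x \<in> carrier (dR_P S U). ?p x \<in> (\<lambda>y. fls_X_intpow i \<odot>\<^bsub>?C\<^esub> y) ` ?L}"
 let ?B = "{x \<in> carrier (cris_P S U). ?p' x \<in> (\<lambda>y. fls_X_intpow i \<odot>\<^bsub>?C'\<^esub> y) ` ?F ` ?L}"
 have m: "module (src (Rz_P S)) (sig_mod S U)" "module (src (Rz_F S)) (sig_mod S U)"
  using sig_module by simp_all
 interpret C: module "tgt (Rz_F S)" ?C by (rule bc_module[OF Rz_F_ok m(2)])
 note I = sig_delta_iso[OF sqr_F, unfolded module_iso_def]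
 note F = semilinearD[OF module_homD[OF conjunct1[OF I]]]
 have inj: "inj_on ?F (carrier ?C)" using I by (auto simp: bij_betw_def)
 have bij: "bij_betw (h_dR_cris_P S U) (carrier (dR_P S U)) (carrier (cris_P S U))"
  using h_P_iso by (simp add: module_iso_def)
 have pc: "?p x \<in> carrier ?C" if "x \<in> carrier (dR_P S U)" for x
  using semilinearD(1)[OF bc_push_spec(1)[OF tri_F(1) m(1)]] that by (simp add: dR_P_def)
 have Fs: "?F (fls_X_intpow i \<odot>\<^bsub>?C\<^esub> l) = fls_X_intpow i \<odot>\<^bsub>?C'\<^esub> ?F l" if "l \<in> ?L" for l
  using F(3)[of "fls_X_intpow i" l] that dR_lattice_sub by auto
 have Lc: "fls_X_intpow i \<odot>\<^bsub>?C\<^esub> l \<in> carrier ?C" if "l \<in> ?L" for l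
  using C.smult_closed[of "fls_X_intpow i" l] that dR_lattice_sub by auto
 have "h_dR_cris_P S U ` ?A = ?B"
 proof (intro subset_antisym subsetI)
  fix y assume "y \<in> h_dR_cris_P S U ` ?A"
  then obtain x l where x: "x \<in> carrier (dR_P S U)" "y = h_dR_cris_P S U x" and l: "l \<in> ?L" "?p x = fls_X_intpow i \<odot>\<^bsub>?C\<^esub> l"
   by auto
  have "?p' y = fls_X_intpow i \<odot>\<^bsub>?C'\<^esub> ?F l" using h_push[OF x(1)] x(2) l(2) Fs[OF l(1)] by simp
  moreover have "y \<in> carrier (cris_P S U)" using bij x by (auto simp: bij_betw_def)
  ultimately show "y \<in> ?B" using l(1) by auto
 next
  fix y assume "y \<in> ?B"
  then obtain l where y: "y \<in> carrier (cris_P S U)" and l: "l \<in> ?L" "?p' y = fls_X_intpow i \<odot>\<^bsub>?C'\<^esub> ?F l" by auto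
  obtain x where x: "x \<in> carrier (dR_P S U)" "y = h_dR_cris_P S U x" using bij y by (auto simp: bij_betw_def)
  \<comment> \<open>For this inclusion membership in the lattice has to be pulled back, which is
    where injectivity over K((z - \<zeta>)) enters.\<close>
  have "?F (?p x) = ?F (fls_X_intpow i \<odot>\<^bsub>?C\<^esub> l)" using h_push[OF x(1)] x(2) l(2) Fs[OF l(1)] by simp
  hence "?p x = fls_X_intpow i \<odot>\<^bsub>?C\<^esub> l" using inj_onD[OF inj] pc[OF x(1)] Lc[OF l(1)] by blast
  thus "y \<in> h_dR_cris_P S U ` ?A" using x l(1) by auto
 qed
 hence "cris_fil S U i = cris_red S U ` h_dR_cris_P S U ` ?A"
  unfolding cris_fil_def cris_lattice_def by simp
 also have "\<dots> = h_dR_cris_K S U ` dR_red S U ` ?A"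
  unfolding image_image by (rule image_cong) (auto simp: h_red)
 finally show ?thesis by (simp add: dR_fil_def)
qed

end

text \<open>The map enters only through its incarnations \<open>fB\<close> over B and
  \<open>fD\<close> over k((z)), tied together by \<delta>. Twisting this one commutative square
  gives the claim; morphisms and quasi-morphisms are two instances, and \<open>g\<close>,
  \<open>h\<close>, \<open>k\<close> may end in K[[z - \<zeta>]] or in K.\<close>

lemma sig_delta_functorial:
 fixes U :: "('K, 'k, 'm) rig_shtuka" and W :: "('K, 'k, 'n) rig_shtuka"
 assumes U: "rigidified_shtuka S U" and W: "rigidified_shtuka S W"
  and g: "sqr g (Rz_s S) (Rz_B S) h" "sqr g (kz_s S) (kz_B S) k"
  and fB: "module_hom (Rzil S) (bc (Rz_B S) (smod U)) (bc (Rz_B S) (smod W)) fB"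
  and fD: "module_hom (ring_on UNIV) (Dt S U) (Dt S W) fD"
  and comm: "!!x. x \<in> carrier (bc (Rz_B S) (smod U)) ==>
   bc_map (kz_B S) (Dt S U) (Dt S W) fD (sdelta U x) = sdelta W (fB x)"
  and x: "x \<in> carrier (bc h (sig_mod S U))"
 shows "sig_delta S W g h k (twist_extend g (Rz_s S) (Rz_B S) h (smod U) (Rz_s S) (Rz_B S) h (smod W) fB x) =
  bc_map k (cris S U) (cris S W) (bc_map (kz_s S) (Dt S U) (Dt S W) fD) (sig_delta S U g h k x)"
proof -
 note mU = mods[OF U] and mW = mods[OF W] and dU = sdelta_hom[OF U] and dW = sdelta_hom[OF W]
 have fB': "module_hom (tgt (Rz_B S)) (bc (Rz_B S) (smod U)) (bc (Rz_B S) (smod W)) fB"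
  using fB by simp
 have fD': "module_hom (src (kz_B S)) (Dt S U) (Dt S W) fD" using fD by simp
 note bD = bc_map_hom[OF kz_B_ok mU(2) mW(2) fD']
 have x': "x \<in> carrier (bc h (bc (Rz_s S) (smod U)))" using x by (simp add: sig_mod_def)
 have iB: "rhom_ok (id_hom (Rzil S))" by (rule rhom_ok_id[OF Rzil_cring])
 have c1: "module_hom (tgt (Rz_B S)) (bc (Rz_B S) (smod U)) (bc (kz_B S) (Dt S W)) (\<lambda>x. sdelta W (fB x))"
  unfolding module_hom_def
  by (rule semilinear_comp[OF module_homD[OF fB'] module_homD[OF dW]]) (use iB in simp_all)
 have c2: "module_hom (tgt (Rz_B S)) (bc (Rz_B S) (smod U)) (bc (kz_B S) (Dt S W))
   (\<lambda>x. bc_map (kz_B S) (Dt S U) (Dt S W) fD (sdelta U x))"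
  unfolding module_hom_def
  by (rule semilinear_comp[OF module_homD[OF dU] module_homD[OF bD]]) (use iB in simp_all)
 let ?T = "twist_extend g (Rz_s S) (Rz_B S) h (smod U)"
 have "sig_delta S W g h k (?T (Rz_s S) (Rz_B S) h (smod W) fB x) =
   ?T (kz_s S) (kz_B S) k (Dt S W) (\<lambda>x. sdelta W (fB x)) x"
  unfolding sig_delta_def
  by (rule twist_extend_comp[OF g(1) g(1) g(2) mU(1) mW(1) mW(2) fB' dW x'])
 also have "\<dots> = ?T (kz_s S) (kz_B S) k (Dt S W) (\<lambda>x. bc_map (kz_B S) (Dt S U) (Dt S W) fD (sdelta U x)) x"
  by (rule twist_extend_cong[OF g mU(1) mW(2) c1 c2 _ x']) (simp add: comm)
 also have "\<dots> = twist_extend g (kz_s S) (kz_B S) k (Dt S U) (kz_s S) (kz_B S) k (Dt S W)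
   (bc_map (kz_B S) (Dt S U) (Dt S W) fD) (sig_delta S U g h k x)"
  unfolding sig_delta_def
  by (rule twist_extend_comp[OF g g(2) mU mW(2) dU bD x', symmetric])
 also have "\<dots> = bc_map k (cris S U) (cris S W) (bc_map (kz_s S) (Dt S U) (Dt S W) fD) (sig_delta S U g h k x)"
  unfolding cris_def
 proof (rule twist_extend_bc_map[OF g(2) mU(2) mW(2) fD'])
  show "sig_delta S U g h k x \<in> carrier (bc k (bc (kz_s S) (Dt S U)))"
   using semilinearD(1)[OF module_homD, of "tgt g" "bc h (sig_mod S U)" "bc k (cris S U)" "sig_delta S U g h k" x]
    sig_delta_iso[OF U g] x by (simp add: module_iso_def cris_def)
 qed
 finally show ?thesis .
qed

lemma rig_morphism_functorial:
 fixes U :: "('K, 'k, 'm) rig_shtuka" and W :: "('K, 'k, 'n) rig_shtuka"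
 assumes U: "rigidified_shtuka S U" and W: "rigidified_shtuka S W" and f: "rig_morphism S U W f"
  and g: "sqr g (Rz_s S) (Rz_B S) h" "sqr g (kz_s S) (kz_B S) k"
  and x: "x \<in> carrier (bc h (sig_mod S U))"
 shows "sig_delta S W g h k (rig_morphism_dR S U W f h x) =
  bc_map k (cris S U) (cris S W) (rig_morphism_cris S U W f) (sig_delta S U g h k x)"
proof -
 note mU = mods[OF U] and mW = mods[OF W]
 have f1: "module_hom (src (Rz_B S)) (smod U) (smod W) f" "module_hom (src (Rz_kz S)) (smod U) (smod W) f"
  "module (src (Rz_kz S)) (smod U)" "module (src (Rz_kz S)) (smod W)"
  using f smod_module[OF U] smod_module[OF W] by (simp_all add: rig_morphism_def)
 have fB: "module_hom (Rzil S) (bc (Rz_B S) (smod U)) (bc (Rz_B S) (smod W)) (bc_map (Rz_B S) (smod U) (smod W) f)"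
  using bc_map_hom[OF Rz_B_ok mU(1) mW(1) f1(1)] by simp
 have fD: "module_hom (ring_on UNIV) (Dt S U) (Dt S W) (bc_map (Rz_kz S) (smod U) (smod W) f)"
  using bc_map_hom[OF Rz_kz_ok f1(3,4,2)] by (simp add: Dt_def)
 have comm: "bc_map (kz_B S) (Dt S U) (Dt S W) (bc_map (Rz_kz S) (smod U) (smod W) f) (sdelta U x) =
   sdelta W (bc_map (Rz_B S) (smod U) (smod W) f x)" if "x \<in> carrier (bc (Rz_B S) (smod U))" for x
  using f that by (simp add: rig_morphism_def)
 have "twist_extend g (Rz_s S) (Rz_B S) h (smod U) (Rz_s S) (Rz_B S) h (smod W) (bc_map (Rz_B S) (smod U) (smod W) f) x =
   rig_morphism_dR S U W f h x"
  unfolding rig_morphism_dR_def sig_mod_def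
  by (rule twist_extend_bc_map[OF g(1) mU(1) mW(1) f1(1)]) (use x in \<open>simp add: sig_mod_def\<close>)
 thus ?thesis
  using sig_delta_functorial[OF U W g fB fD comm x] by (simp add: rig_morphism_cris_def)
qed

lemma rig_quasi_morphism_functorial:
 fixes U :: "('K, 'k, 'm) rig_shtuka" and W :: "('K, 'k, 'n) rig_shtuka"
 assumes U: "rigidified_shtuka S U" and W: "rigidified_shtuka S W" and f: "rig_quasi_morphism S U W f"
  and g: "sqr g (Rz_s S) (Rz_B S) h" "sqr g (kz_s S) (kz_B S) k"
  and g': "sqr g' (Rz_s S) Rz_Z h" "!!a. a \<in> carrier Rz_z ==> app g' a = app g (app (Z_B S) a)"
  and x: "x \<in> carrier (bc h (sig_mod S U))"
 shows "sig_delta S W g h k (quasi_sig_ext S U W f g' h x) =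
  bc_map k (cris S U) (cris S W) (quasi_morphism_cris S U W f) (sig_delta S U g h k x)"
proof -
 note mU = mods[OF U] and mW = mods[OF W]
 have f1: "module_hom (tgt Rz_Z) (bc Rz_Z (smod U)) (bc Rz_Z (smod W)) f"
  "module (src (Rz_Z :: ('K fps, 'K loc) rhom)) (smod U)" "module (src (Rz_Z :: ('K fps, 'K loc) rhom)) (smod W)"
  using f smod_module[OF U] smod_module[OF W] by (simp_all add: rig_quasi_morphism_def)
 have fB: "module_hom (Rzil S) (bc (Rz_B S) (smod U)) (bc (Rz_B S) (smod W)) (quasi_ext U W f (Z_B S) (Rz_B S))"
  using bc_extend_spec(1)[OF tri_Z(1) tri_Z(1) f1(2,3,1)] by (simp add: module_hom_def quasi_ext_def)
 have fD: "module_hom (ring_on UNIV) (Dt S U) (Dt S W) (quasi_ext U W f (Z_kz S) (Rz_kz S))"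
  using bc_extend_spec(1)[OF tri_Z(2) tri_Z(2) f1(2,3,1)] by (simp add: module_hom_def quasi_ext_def Dt_def)
 have comm: "bc_map (kz_B S) (Dt S U) (Dt S W) (quasi_ext U W f (Z_kz S) (Rz_kz S)) (sdelta U x) =
   sdelta W (quasi_ext U W f (Z_B S) (Rz_B S) x)" if "x \<in> carrier (bc (Rz_B S) (smod U))" for x
  using f that by (simp add: rig_quasi_morphism_def)
 have "twist_extend g (Rz_s S) (Rz_B S) h (smod U) (Rz_s S) (Rz_B S) h (smod W) (quasi_ext U W f (Z_B S) (Rz_B S)) x =
   quasi_sig_ext S U W f g' h x"
  unfolding quasi_sig_ext_def quasi_ext_def
  by (rule twist_extend_bc_extend[OF g(1) tri_Z(1) g'(1) mU(1) mW(1) f1(1)])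
   (use x g'(2) in \<open>simp_all add: sig_mod_def\<close>)
 thus ?thesis
  using sig_delta_functorial[OF U W g fB fD comm x] by (simp add: quasi_morphism_cris_def)
qed

end

section \<open>Function fields over a finite constant field\<close>

locale finite_const_field =
 fixes F :: "'Q::field set"
 assumes F0: "0 \<in> F" and F1: "1 \<in> F"
  and Fadd: "!!x y. x \<in> F ==> y \<in> F ==> x + y \<in> F"
  and Fneg: "!!x. x \<in> F ==> - x \<in> F"
  and Fmult: "!!x y. x \<in> F ==> y \<in> F ==> x * y \<in> F"
  and Finv: "!!x. x \<in> F ==> inverse x \<in> F"
  and Ffin: "finite F"
begin

abbreviation FP :: "'Q poly => bool" where "FP p \<equiv> (\<forall>i. poly.coeff p i \<in> F)"

lemma Fdiff: "x \<in> F ==> y \<in> F ==> x - y \<in> F"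
 using Fadd[OF _ Fneg, of x y] by simp

lemma Fsum: "(!!i. i \<in> A ==> f i \<in> F) ==> sum f A \<in> F"
 by (induction A rule: infinite_finite_induct) (simp_all add: F0 Fadd)

lemma FP_simps: "FP 0" "FP 1" "!!p g. FP p ==> FP g ==> FP (p + g)" "!!p. FP p ==> FP (- p)"
 "!!p g. FP p ==> FP g ==> FP (p * g)" "!!c n. c \<in> F ==> FP (Polynomial.monom c n)"
 using F0 F1
 by (auto simp: coeff_mult intro!: Fadd Fneg Fmult Fsum)

lemma FP_pow: "FP p ==> FP (p ^ n)"
 by (induction n) (use FP_simps(2,5) in auto)

lemma FP_sum: "(!!i. i \<in> A ==> FP (f i)) ==> FP (sum f A)"
 by (simp add: coeff_sum Fsum)

lemma FP_pCons: "FP (pCons a p) \<longleftrightarrow> a \<in> F \<and> FP p"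
 by (auto simp: coeff_pCons split: nat.splits)

lemma card_F: "2 \<le> card F"
 using card_mono[OF Ffin, of "{0,1}"] F0 F1 by simp

text \<open>A piece of bounded degree in the F[x]-module spanned by the \<open>b l\<close>. As F is
  finite, such pieces can be counted, and cardinalities with the pigeonhole principle take the place
  of dimensions.\<close>

definition fspan :: "'Q => nat => (nat => 'Q) => nat => 'Q set"
 where "fspan x n b N = {\<Sum>l<n. poly (p l) x * b l | p. \<forall>l. FP (p l) \<and> degree (p l) \<le> N}"

lemma fspan_mono: "a \<in> fspan x n b N ==> N \<le> M ==> a \<in> fspan x n b M"
 unfolding fspan_def by (smt (verit) mem_Collect_eq order_trans)

lemma fspan_zero: "0 \<in> fspan x n b N"
 unfolding fspan_def by (rule CollectI, rule exI[of _ "\<lambda>_. 0"]) (simp add: F0)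

lemma fspan_add: "a \<in> fspan x n b N ==> a' \<in> fspan x n b N ==> a + a' \<in> fspan x n b N"
proof -
 assume "a \<in> fspan x n b N" "a' \<in> fspan x n b N"
 then obtain p p' where p: "\<forall>l. FP (p l) \<and> degree (p l) \<le> N" "a = (\<Sum>l<n. poly (p l) x * b l)"
  "\<forall>l. FP (p' l) \<and> degree (p' l) \<le> N" "a' = (\<Sum>l<n. poly (p' l) x * b l)"
  unfolding fspan_def by auto
 have "\<forall>l. FP (p l + p' l) \<and> degree (p l + p' l) \<le> N" using p FP_simps(3) degree_add_le by blast
 moreover have "a + a' = (\<Sum>l<n. poly (p l + p' l) x * b l)"
  by (simp add: p sum.distrib distrib_right)
 ultimately show ?thesis unfolding fspan_def by (intro CollectI exI[of _ "\<lambda>l. p l + p' l"]) simp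
qed

lemma fspan_sum: "(!!i. i \<in> A ==> f i \<in> fspan x n b N) ==> sum f A \<in> fspan x n b N"
 by (induction A rule: infinite_finite_induct) (simp_all add: fspan_zero fspan_add)

lemma fspan_poly:
 assumes "a \<in> fspan x n b N" "FP g" "degree g \<le> d"
 shows "poly g x * a \<in> fspan x n b (N + d)"
proof -
 obtain p where p: "\<forall>l. FP (p l) \<and> degree (p l) \<le> N" "a = (\<Sum>l<n. poly (p l) x * b l)"
  using assms unfolding fspan_def by auto
 have "\<forall>l. FP (g * p l) \<and> degree (g * p l) \<le> N + d"
  using p assms FP_simps(5) degree_mult_le[of g] by (metis add.commute add_mono order_trans)
 moreover have "poly g x * a = (\<Sum>l<n. poly (g * p l) x * b l)"
  by (simp add: p sum_distrib_left mult.assoc)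
 ultimately show ?thesis unfolding fspan_def by (intro CollectI exI[of _ "\<lambda>l. g * p l"]) simp
qed

lemma fspan_const: "a \<in> fspan x n b N ==> c \<in> F ==> c * a \<in> fspan x n b N"
 using fspan_poly[of a x n b N "[:c:]" 0] F0 by (simp add: FP_pCons)

lemma fspan_card: "finite (fspan x n b N)" "card (fspan x n b N) \<le> card F ^ ((N + 1) * n)"
proof -
 let ?I = "{..<n} \<times> {..N}"
 let ?g = "\<lambda>c. \<Sum>l<n. (\<Sum>j\<le>N. c (l, j) * x ^ j) * b l"
 have sub: "fspan x n b N \<subseteq> ?g ` (?I \<rightarrow>\<^sub>E F)"
 proof
  fix a assume "a \<in> fspan x n b N"
  then obtain p where p: "\<forall>l. FP (p l) \<and> degree (p l) \<le> N" "a = (\<Sum>l<n. poly (p l) x * b l)"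
   unfolding fspan_def by auto
  let ?c = "restrict (\<lambda>(l, j). poly.coeff (p l) j) ?I"
  have "poly (p l) x = (\<Sum>j\<le>N. poly.coeff (p l) j * x ^ j)" for l

  proof -
   have "poly (p l) x = (\<Sum>j\<le>degree (p l). poly.coeff (p l) j * x ^ j)" by (rule poly_altdef)
   also have "\<dots> = (\<Sum>j\<le>N. poly.coeff (p l) j * x ^ j)"
    using p(1) by (intro sum.mono_neutral_left) (auto simp: coeff_eq_0)
   finally show ?thesis .
  qed
  hence "a = ?g ?c" by (simp add: p(2))
  moreover have "?c \<in> ?I \<rightarrow>\<^sub>E F" using p by auto
  ultimately show "a \<in> ?g ` (?I \<rightarrow>\<^sub>E F)" by blast
 qed
 have fin: "finite (?I \<rightarrow>\<^sub>E F)" using Ffin by (intro finite_PiE) auto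
 show "finite (fspan x n b N)" using finite_subset[OF sub] fin by blast
 have "card (fspan x n b N) \<le> card (?I \<rightarrow>\<^sub>E F)"
  using card_mono[OF finite_imageI[OF fin] sub] card_image_le[OF fin, of ?g] by linarith
 also have "\<dots> = card F ^ ((N + 1) * n)"
  by (simp add: card_PiE card_cartesian_product mult.commute)
 finally show "card (fspan x n b N) \<le> card F ^ ((N + 1) * n)" .
qed

end

text \<open>The assumption \<open>gen\<close> is finite dimension over F(x) with the denominators
  cleared; \<open>Falg\<close> expresses geometric irreducibility of the curve.\<close>

locale finite_function_field = finite_const_field F for F :: "'Q::field set" +
 assumes gen: "\<exists>x n b. \<forall>w. \<exists>d N. FP d \<and> poly d x \<noteq> 0 \<and> poly d x * w \<in> fspan x n b N"
  and Falg: "!!p y. FP p ==> p \<noteq> 0 ==> poly p y = 0 ==> y \<in> F"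
begin

lemma gen_common:
 assumes "!!w. \<exists>d N. FP d \<and> poly d x \<noteq> 0 \<and> poly d x * w \<in> fspan x n b N"
 shows "\<exists>d N. FP d \<and> poly d x \<noteq> 0 \<and> (\<forall>i<m::nat. poly d x * w i \<in> fspan x n b N)"
proof (induction m)
 case 0 show ?case by (rule exI[of _ 1]) (simp add: F0 F1)
next
 case (Suc m)
 then obtain d N where d: "FP d" "poly d x \<noteq> 0" "!!i. i < m ==> poly d x * w i \<in> fspan x n b N" by auto
 obtain d' N' where d': "FP d'" "poly d' x \<noteq> 0" "poly d' x * w m \<in> fspan x n b N'" using assms by blast
 have "poly (d * d') x * w i \<in> fspan x n b (N + degree d' + (N' + degree d))" if "i < Suc m" for i
 proof (cases "i = m")
  case True
  have "poly d x * (poly d' x * w m) \<in> fspan x n b (N' + degree d)"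
   by (rule fspan_poly[OF d'(3) d(1)]) simp
  hence "poly d x * (poly d' x * w m) \<in> fspan x n b (N + degree d' + (N' + degree d))" by (rule fspan_mono) simp
  thus ?thesis using True by (simp add: mult_ac)
 next
  case False
  have "poly d' x * (poly d x * w i) \<in> fspan x n b (N + degree d')"
   by (rule fspan_poly[OF d(3) d'(1)]) (use False that in auto)
  hence "poly d' x * (poly d x * w i) \<in> fspan x n b (N + degree d' + (N' + degree d))" by (rule fspan_mono) simp
  thus ?thesis by (simp add: mult_ac)
 qed
 thus ?case using FP_simps(5)[OF d(1) d'(1)] d(2) d'(2)
  by (intro exI[of _ "d * d'"]) auto
qed

text \<open>
 Counting: the combinations of the \<open>t\<^sup>j w\<^sub>i\<close>, \<open>i < m\<close>, \<open>j \<le> J\<close>, lie in a set whose size grows with \<open>J\<close>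
 at a rate independent of \<open>m\<close>, so that for large \<open>m\<close> two of them agree.
\<close>

lemma dependent:
 "\<exists>m::nat. \<forall>w. \<exists>c. (\<forall>i. FP (c i)) \<and> (\<exists>i<m. c i \<noteq> 0) \<and> (\<Sum>i<m. poly (c i) t * w i) = 0"
proof -
 obtain x n b where g: "!!w. \<exists>d N. FP d \<and> poly d x \<noteq> 0 \<and> poly d x * w \<in> fspan x n b N"
  using gen by metis
 let ?S = "fspan x n b"
 obtain D d where D: "FP D" "poly D x \<noteq> 0" "!!l. l < n ==> poly D x * (t * b l) \<in> ?S d"
  using gen_common[OF g, of n "\<lambda>l. t * b l"] by blast
 have step: "poly D x * (t * a) \<in> ?S (N + d)" if a: "a \<in> ?S N" for a N
 proof -
  obtain p where p: "\<forall>l. FP (p l) \<and> degree (p l) \<le> N" "a = (\<Sum>l<n. poly (p l) x * b l)"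
   using a unfolding fspan_def by blast
  have "poly (p l) x * (poly D x * (t * b l)) \<in> ?S (d + N)" if "l < n" for l
   using fspan_poly[OF D(3)[OF that]] p(1) by blast
  hence "(\<Sum>l<n. poly (p l) x * (poly D x * (t * b l))) \<in> ?S (d + N)" by (intro fspan_sum) auto
  thus ?thesis by (simp add: p(2) sum_distrib_left mult_ac add.commute)
 qed
 have steps: "poly D x ^ j * (t ^ j * a) \<in> ?S (N + j * d)" if "a \<in> ?S N" for a N j
 proof (induction j)
  case (Suc j) thus ?case using step[OF Suc] by (simp add: mult_ac add.commute add.left_commute)
 qed (use that in simp)
 define d' where "d' = d + degree D"
 \<comment> \<open>The products t^j w_i with j \<le> J have m (J + 1) free coefficients and land in
   a set described by (e + J d' + 1) n coefficients. With m = n d' + 1 the first number grows faster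
   in J, and J = (e + 1) n below outweighs the constant.\<close>
 define m where "m = n * d' + 1"
 have key: "\<exists>c. (\<forall>i. FP (c i)) \<and> (\<exists>i<m. c i \<noteq> 0) \<and> (\<Sum>i<m. poly (c i) t * w i) = 0" for w
 proof -
  obtain h e where h: "FP h" "poly h x \<noteq> 0" "!!i. i < m ==> poly h x * w i \<in> ?S e"
   using gen_common[OF g, of m w] by blast
  define J where "J = (e + 1) * n"
  have trm: "poly D x ^ J * poly h x * (t ^ j * w i) \<in> ?S (e + J * d')" if "i < m" "j \<le> J" for i j
  proof -
   have *: "poly (D ^ (J - j)) x * (poly D x ^ j * (t ^ j * (poly h x * w i))) \<in> ?S (e + j * d + (J - j) * degree D)"
    by (rule fspan_poly[OF steps[OF h(3)[OF that(1)]]]) (use FP_pow[OF D(1)] degree_power_le[of D "J - j"] in \<open>simp_all add: mult.commute\<close>)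
   have "poly D x ^ J = poly D x ^ (J - j) * poly D x ^ j"
    using that(2) by (simp flip: power_add)
   hence "poly (D ^ (J - j)) x * (poly D x ^ j * (t ^ j * (poly h x * w i))) = poly D x ^ J * poly h x * (t ^ j * w i)"
    by (simp only: poly_power mult_ac)
   with * have "poly D x ^ J * poly h x * (t ^ j * w i) \<in> ?S (e + j * d + (J - j) * degree D)" by (simp only:)
   moreover have "e + j * d + (J - j) * degree D \<le> e + J * d'"
    using mult_le_mono1[OF that(2), of d] by (simp add: d'_def distrib_left add_mono)
   ultimately show ?thesis by (rule fspan_mono)
  qed
  let ?I = "{..<m} \<times> {..J}"
  let ?g = "\<lambda>c. poly D x ^ J * poly h x * (\<Sum>i<m. \<Sum>j\<le>J. c (i, j) * (t ^ j * w i))"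
  have im: "?g ` (?I \<rightarrow>\<^sub>E F) \<subseteq> ?S (e + J * d')"
  proof
   fix a assume "a \<in> ?g ` (?I \<rightarrow>\<^sub>E F)"
   then obtain c where c: "c \<in> ?I \<rightarrow>\<^sub>E F" "a = ?g c" by blast
   have "a = (\<Sum>i<m. \<Sum>j\<le>J. c (i, j) * (poly D x ^ J * poly h x * (t ^ j * w i)))"
    unfolding c(2) by (simp add: sum_distrib_left mult_ac)
   also have "\<dots> \<in> ?S (e + J * d')"
    using c(1) by (intro fspan_sum fspan_const trm) auto
   finally show "a \<in> ?S (e + J * d')" .
  qed
  have lt: "(e + J * d' + 1) * n < m * (J + 1)"
   by (simp add: m_def J_def algebra_simps)
  have "card (?g ` (?I \<rightarrow>\<^sub>E F)) \<le> card F ^ ((e + J * d' + 1) * n)"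
   using card_mono[OF fspan_card(1) im] fspan_card(2) le_trans by blast
  also have "\<dots> < card F ^ (m * (J + 1))" using card_F lt by (intro power_strict_increasing) auto
  also have "\<dots> = card (?I \<rightarrow>\<^sub>E F)" by (simp add: card_PiE card_cartesian_product)
  finally have "\<not> inj_on ?g (?I \<rightarrow>\<^sub>E F)" by (rule pigeonhole)
  then obtain c c' where c: "c \<in> ?I \<rightarrow>\<^sub>E F" "c' \<in> ?I \<rightarrow>\<^sub>E F" "c \<noteq> c'" "?g c = ?g c'"
   unfolding inj_on_def by blast
  then obtain i0 j0 where ij: "i0 < m" "j0 \<le> J" "c (i0, j0) \<noteq> c' (i0, j0)"
   using PiE_ext[OF c(1,2)] by auto
  have eq: "(\<Sum>i<m. \<Sum>j\<le>J. c (i, j) * (t ^ j * w i)) = (\<Sum>i<m. \<Sum>j\<le>J. c' (i, j) * (t ^ j * w i))"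
   using c(4) D(2) h(2) by simp
  define p where "p = (\<lambda>i. if i < m then (\<Sum>j\<le>J. Polynomial.monom (c (i, j) - c' (i, j)) j) else 0)"
  have "FP (p i)" for i
   using c(1,2) by (cases "i < m") (auto simp: p_def F0 intro!: FP_sum[rule_format] FP_simps(6)[rule_format] Fdiff)
  moreover have "poly.coeff (p i0) j0 \<noteq> 0"
   using ij by (simp add: p_def coeff_sum)
  hence "p i0 \<noteq> 0" by auto
  moreover have "(\<Sum>i<m. poly (p i) t * w i) = 0"
  proof -
   have "(\<Sum>i<m. poly (p i) t * w i) = (\<Sum>i<m. \<Sum>j\<le>J. c (i, j) * (t ^ j * w i)) - (\<Sum>i<m. \<Sum>j\<le>J. c' (i, j) * (t ^ j * w i))"
    by (simp add: p_def poly_sum poly_monom sum_distrib_right left_diff_distrib sum_subtractf mult.assoc)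
   thus ?thesis using eq by simp
  qed
  ultimately show ?thesis using ij(1) by blast
 qed
 show ?thesis
 proof (rule exI[of _ m], rule allI)
  fix w show "\<exists>c. (\<forall>i. FP (c i)) \<and> (\<exists>i<m. c i \<noteq> 0) \<and> (\<Sum>i<m. poly (c i) t * w i) = 0" by (rule key)
 qed
qed

definition fsub :: "'Q set => bool"
 where "fsub W \<longleftrightarrow> 0 \<in> W \<and> (\<forall>x\<in>W. \<forall>y\<in>W. x + y \<in> W) \<and> (\<forall>c\<in>F. \<forall>x\<in>W. c * x \<in> W)"

definition depend :: "'Q set => (nat => 'Q) => nat => bool"
 where "depend U w m \<longleftrightarrow> (\<exists>a. (\<forall>i. a i \<in> F) \<and> (\<exists>i<m. a i \<noteq> 0) \<and> (\<Sum>i<m. a i * w i) \<in> U)"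

lemma fsubD:
 assumes "fsub W"
 shows "0 \<in> W" "!!x y. x \<in> W ==> y \<in> W ==> x + y \<in> W" "!!c x. c \<in> F ==> x \<in> W ==> c * x \<in> W"
  "!!x. x \<in> W ==> - x \<in> W" "!!x y. x \<in> W ==> y \<in> W ==> x - y \<in> W"
proof -
 show *: "0 \<in> W" "!!x y. x \<in> W ==> y \<in> W ==> x + y \<in> W" "!!c x. c \<in> F ==> x \<in> W ==> c * x \<in> W"
  using assms by (auto simp: fsub_def)
 show n: "- x \<in> W" if "x \<in> W" for x using *(3)[OF Fneg[OF F1] that] by simp
 show "x - y \<in> W" if "x \<in> W" "y \<in> W" for x y using *(2)[OF that(1) n[OF that(2)]] by simp
qed

lemma fsub_sum: "fsub W ==> (!!i. i \<in> A ==> f i \<in> W) ==> sum f A \<in> W"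
 by (induction A rule: infinite_finite_induct) (simp_all add: fsubD)

lemma fsub_poly:
 assumes W: "fsub W" "!!w. w \<in> W ==> t * w \<in> W" and p: "FP p" and w: "w \<in> W"
 shows "poly p t * w \<in> W"
 using p
proof (induction p)
 case 0 thus ?case by (simp add: fsubD[OF W(1)])
next
 case (pCons a p)
 have a: "a \<in> F" "FP p" using pCons.prems by (auto simp: FP_pCons)
 have "a * w + t * (poly p t * w) \<in> W"
  by (rule fsubD(2)[OF W(1) fsubD(3)[OF W(1) a(1) w] W(2)[OF pCons.IH[OF a(2)]]])
 thus ?case by (simp add: algebra_simps)
qed

text \<open>The constant terms of a relation over F[t] form an F-linear relation modulo t W. If all
  of them vanish, the relation can be divided by t, which lowers the total degree, so the descent
  ends with a nontrivial relation.\<close>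

lemma depend_shift:
 assumes W: "fsub W" "!!w. w \<in> W ==> t * w \<in> W" and w: "!!i. i < m ==> w i \<in> W" and t: "t \<noteq> 0"
  and c: "\<forall>i. FP (c i)" "\<exists>i<m. c i \<noteq> 0" "(\<Sum>i<m. poly (c i) t * w i) = 0"
 shows "depend ((\<lambda>w. t * w) ` W) w m"
 using c
proof (induction "\<Sum>i<m. degree (c i)" arbitrary: c rule: less_induct)
 case less
 define a where "a i = poly.coeff (c i) 0" for i
 define c' where "c' i = poly_shift 1 (c i)" for i
 have c: "c i = pCons (a i) (c' i)" for i
  by (rule poly_eqI) (simp add: a_def c'_def coeff_pCons coeff_poly_shift split: nat.splits)
 have F: "a i \<in> F" "FP (c' i)" for i using less(2) by (auto simp: c FP_pCons)
 have sm: "(\<Sum>i<m. a i * w i) + t * (\<Sum>i<m. poly (c' i) t * w i) = 0"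
  using less(4) by (simp add: c distrib_right sum.distrib sum_distrib_left mult.assoc)
 show ?case
 proof (cases "\<exists>i<m. a i \<noteq> 0")
  case True
  have "- (\<Sum>i<m. poly (c' i) t * w i) \<in> W"
   by (rule fsubD(4)[OF W(1) fsub_sum[OF W(1) fsub_poly[OF W]]]) (use w F in auto)
  moreover have "(\<Sum>i<m. a i * w i) = t * - (\<Sum>i<m. poly (c' i) t * w i)"
   using sm by (simp add: eq_neg_iff_add_eq_0)
  ultimately show ?thesis using True F(1) unfolding depend_def by blast
 next
  case False
  hence "(\<Sum>i<m. a i * w i) = 0" by simp
  hence s0: "(\<Sum>i<m. poly (c' i) t * w i) = 0" using sm t by simp
  obtain j where j: "j < m" "c j \<noteq> 0" using less(3) by blast
  hence j': "c' j \<noteq> 0" using False by (auto simp: c)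
  have "degree (c' i) \<le> degree (c i)" for i by (simp add: c)
  moreover have "degree (c' j) < degree (c j)" using j' by (simp add: c)
  ultimately have "(\<Sum>i<m. degree (c' i)) < (\<Sum>i<m. degree (c i))"
   using j(1) by (intro sum_strict_mono_ex1) auto
  from less(1)[OF this] show ?thesis using F(2) j(1) j' s0 by blast
 qed
qed

text \<open>If any n + 1 elements of W are dependent modulo U, then W modulo U has dimension at most
  n over F, and the combinations of a maximal independent family represent all classes.\<close>

lemma depend_cover:
 assumes U: "fsub U" and d: "!!w. (!!i. i < Suc n ==> w i \<in> W) ==> depend U w (Suc n)"
 shows "\<exists>T. finite T \<and> card T \<le> card F ^ n \<and> (\<forall>w\<in>W. \<exists>v\<in>T. w - v \<in> U)"
proof -
 define P where "P k \<longleftrightarrow> (\<exists>w. (\<forall>i<k. w i \<in> W) \<and> \<not> depend U w k)" for k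
 have P0: "P 0" by (simp add: P_def depend_def)
 have nP: "\<not> P (Suc n)" using d by (auto simp: P_def)
 obtain k where k: "k \<le> n" "P k" "\<not> P (Suc k)"
  using P0 nP by (induction n) (use le_SucI in blast)+
 obtain w where w: "\<forall>i<k. w i \<in> W" "\<not> depend U w k" using k(2) P_def by blast
 let ?T = "(\<lambda>c. \<Sum>i<k. c i * w i) ` ({..<k} \<rightarrow>\<^sub>E F)"
 have fin: "finite ({..<k} \<rightarrow>\<^sub>E F)" using Ffin by (intro finite_PiE) auto
 have "card ?T \<le> card F ^ k" using card_image_le[OF fin] by (simp add: card_PiE)
 also have "\<dots> \<le> card F ^ n" using k(1) card_F by (intro power_increasing) auto
 finally have card: "card ?T \<le> card F ^ n" .
 have "\<exists>v'\<in>?T. v - v' \<in> U" if "v \<in> W" for v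
 proof -
  have "\<forall>i<Suc k. (w(k := v)) i \<in> W" using w(1) that by simp
  hence "depend U (w(k := v)) (Suc k)" using k(3) unfolding P_def by blast
  then obtain a where a: "\<forall>i. a i \<in> F" "\<exists>i<Suc k. a i \<noteq> 0" "(\<Sum>i<k. a i * w i) + a k * v \<in> U"
   by (auto simp: depend_def)
  have ak: "a k \<noteq> 0"
  proof
   assume "a k = 0"
   hence "depend U w k" using a less_Suc_eq unfolding depend_def by (intro exI[of _ a]) auto
   thus False using w(2) by blast
  qed
  have "inverse (a k) * ((\<Sum>i<k. a i * w i) + a k * v) \<in> U" using a(1,3) by (intro fsubD(3)[OF U] Finv) auto
  hence "v - (\<Sum>i<k. (- inverse (a k) * a i) * w i) \<in> U"
   using ak by (simp add: distrib_left sum_distrib_left sum_negf mult.assoc add.commute flip: mult.assoc)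
  hence "v - (\<Sum>i<k. restrict (\<lambda>i. - inverse (a k) * a i) {..<k} i * w i) \<in> U" by simp
  moreover have "restrict (\<lambda>i. - inverse (a k) * a i) {..<k} \<in> {..<k} \<rightarrow>\<^sub>E F"
   using a(1) by (auto intro!: Fmult Fneg Finv simp del: mult_minus_left)
  ultimately show ?thesis by blast
 qed
 thus ?thesis using card fin by blast
qed

section \<open>Places: denominators, weak approximation and finiteness of the set of poles\<close>

abbreviation place :: "'Q set => bool" where "place V \<equiv> is_place F V"

text \<open>The maximal ideal of the valuation ring. Zero is listed separately because its inverse
  is 0 by convention and lies in \<open>V\<close>.\<close>

definition mx :: "'Q set => 'Q set"
 where "mx V = {x. x = 0 \<or> inverse x \<notin> V}"

lemma placeD:
 assumes "place V"
 shows "0 \<in> V" "1 \<in> V" "!!x y. x \<in> V ==> y \<in> V ==> x + y \<in> V" "!!x. x \<in> V ==> - x \<in> V"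
  "!!x y. x \<in> V ==> y \<in> V ==> x * y \<in> V" "!!x. x \<in> F ==> x \<in> V" "!!x. x \<notin> V ==> inverse x \<in> V"
  "V \<noteq> UNIV" "!!x n. x \<in> V ==> x ^ n \<in> V" "!!x y. x \<in> V ==> y \<in> V ==> x - y \<in> V" "fsub V"
proof -
 have sr: "subring V (ring_on UNIV)" using assms by (simp add: is_place_def)
 note sr' = subringE[OF sr, unfolded ring_on_def, simplified]
 show 0: "0 \<in> V" "1 \<in> V" "!!x y. x \<in> V ==> y \<in> V ==> x + y \<in> V"
  "!!x y. x \<in> V ==> y \<in> V ==> x * y \<in> V" using sr' by auto
 show F: "!!x. x \<in> F ==> x \<in> V" "!!x. x \<notin> V ==> inverse x \<in> V" "V \<noteq> UNIV"
  using assms by (auto simp: is_place_def)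
 show "fsub V" unfolding fsub_def using 0 F by blast
 thus "!!x. x \<in> V ==> - x \<in> V" "!!x y. x \<in> V ==> y \<in> V ==> x - y \<in> V" by (simp_all add: fsubD)
 show "x ^ n \<in> V" if "x \<in> V" for x n by (induction n) (simp_all add: 0 that)
qed

lemma mxD:
 assumes V: "place V"
 shows "!!x. x \<in> mx V ==> x \<in> V" "0 \<in> mx V" "!!x y. x \<in> V ==> y \<in> mx V ==> x * y \<in> mx V"
  "!!x y. x \<in> mx V ==> y \<in> mx V ==> x + y \<in> mx V" "!!c. c \<in> F ==> c \<in> mx V ==> c = 0"
  "!!x y. x \<in> mx V ==> y \<in> V ==> x * y \<in> mx V" "!!x y. x \<in> mx V ==> y \<in> mx V ==> x - y \<in> mx V"
  "fsub (mx V)"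
proof -
 show 1: "!!x. x \<in> mx V ==> x \<in> V" "0 \<in> mx V" unfolding mx_def using placeD(1,7)[OF V] by auto
 show 3: "x * y \<in> mx V" if "x \<in> V" "y \<in> mx V" for x y
 proof (cases "x * y = 0")
  case False
  have "inverse (x * y) \<notin> V"
  proof
   assume "inverse (x * y) \<in> V"
   hence *: "x * inverse (x * y) \<in> V" using placeD(5)[OF V] that by blast
   have "x * inverse (x * y) = inverse y" using False by (simp add: field_simps)
   hence "inverse y \<in> V" using * by (simp only:)
   thus False using False that by (simp add: mx_def)
  qed
  thus ?thesis by (simp add: mx_def)
 qed (simp add: mx_def)
 thus "x * y \<in> mx V" if "x \<in> mx V" "y \<in> V" for x y using 3[OF that(2,1)] by (simp add: mult.commute)
 have half: "x + y \<in> mx V" if "y \<in> mx V" "x / y \<in> V" "y \<noteq> 0" for x y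
 proof -
  have "(x / y + 1) * y \<in> mx V" by (rule 3[OF placeD(3)[OF V that(2) placeD(2)[OF V]] that(1)])
  thus ?thesis using that by (simp add: distrib_right)
 qed
 show 4: "x + y \<in> mx V" if xy: "x \<in> mx V" "y \<in> mx V" for x y
 proof (cases "x = 0 \<or> y = 0")
  case False
  have "x / y \<in> V \<or> y / x \<in> V" using placeD(7)[OF V, of "x / y"] by auto
  thus ?thesis using half[of y x] half[of x y] xy False by (auto simp: add.commute)
 qed (use xy in auto)
 show "c = 0" if "c \<in> F" "c \<in> mx V" for c
  using that placeD(6)[OF V] Finv by (auto simp: mx_def)
 show "fsub (mx V)" unfolding fsub_def using 1 3 4 placeD(6)[OF V] by blast
 thus "!!x y. x \<in> mx V ==> y \<in> mx V ==> x - y \<in> mx V" by (rule fsubD)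
qed

text \<open>Multiplying an algebraic element by its leading coefficient makes it integral; here the
  leading coefficient is s times a unit g, and s alone suffices. If y = s e had a pole, dividing the
  relation by the appropriate power of y would put g into the maximal ideal.\<close>

lemma scale_integral:
 assumes V: "place V" and r: "!!i. i \<le> d ==> r i \<in> V" and e: "(\<Sum>i\<le>d. r i * e ^ i) = 0"
  and s: "r d = s * g" "s \<in> V" "s \<noteq> 0" "g \<noteq> 0" "inverse g \<in> V"
 shows "s * e \<in> V"
proof (rule ccontr)
 define y where "y = s * e"
 assume "s * e \<notin> V"
 hence y: "y \<notin> V" "y \<noteq> 0" "inverse y \<in> mx V" using placeD(1)[OF V] by (auto simp: y_def mx_def)
 have tm: "r i * e ^ i = s / inverse y ^ d / s ^ d * (r i * s ^ (d - 1 - i) * inverse y ^ (d - i))" if "i < d" for i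
 proof -
  obtain k where k: "d = Suc (i + k)" using less_imp_Suc_add[OF \<open>i < d\<close>] by blast
  have "e \<noteq> 0" using y(2) by (auto simp: y_def)
  thus ?thesis using s(3) by (simp add: k y_def power_add power_mult_distrib field_simps)
 qed
 have td: "r d * e ^ d = s / inverse y ^ d / s ^ d * g"
  using s(3) y(2) by (simp add: s(1) y_def power_mult_distrib field_simps)
 define T where "T = (\<Sum>i<d. r i * s ^ (d - 1 - i) * inverse y ^ (d - i))"
 have nz: "s / inverse y ^ d / s ^ d \<noteq> 0" using s(3) y(2) by simp
 have "(\<Sum>i\<le>d. r i * e ^ i) = (\<Sum>i<d. r i * e ^ i) + r d * e ^ d"
  by (simp flip: lessThan_Suc_atMost)
 also have "\<dots> = s / inverse y ^ d / s ^ d * (T + g)"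
  unfolding td distrib_left T_def sum_distrib_left by (intro arg_cong2[where f = "(+)"] sum.cong refl tm) simp
 finally have "T + g = 0" using e nz by (metis mult_eq_0_iff)
 hence gT: "g = - T" by (metis add.commute eq_neg_iff_add_eq_0)
 have "r i * s ^ (d - 1 - i) * inverse y ^ (d - i) \<in> mx V" if "i < d" for i
 proof -
  define k where "k = d - i - 1"
  have k: "d - i = Suc k" using \<open>i < d\<close> by (simp add: k_def)
  have "r i * s ^ (d - 1 - i) * inverse y ^ k * inverse y \<in> mx V"
   using that s(2) r y(3) mxD(1)[OF V] by (intro mxD(3)[OF V] placeD(5,9)[OF V]) auto
  thus ?thesis by (simp add: k mult_ac)
 qed
 hence "T \<in> mx V" unfolding T_def by (intro fsub_sum[OF mxD(8)[OF V]]) auto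
 hence "g \<in> mx V" unfolding gT by (rule fsubD(4)[OF mxD(8)[OF V]])
 thus False using s(4,5) by (auto simp: mx_def)
qed

lemma algebraic_relation:
 "\<exists>(d::nat) c. (\<forall>i. FP (c i)) \<and> c d \<noteq> 0 \<and> (\<Sum>i\<le>d. poly (c i) t * e ^ i) = 0"
proof -
 obtain m c where c: "\<forall>i. FP (c i)" "\<exists>i<m. c i \<noteq> 0" "(\<Sum>i<m. poly (c i) t * e ^ i) = 0"
  using dependent[of t] by meson
 define d where "d = Max {i. i < m \<and> c i \<noteq> 0}"
 have ne: "{i. i < m \<and> c i \<noteq> 0} \<noteq> {}" "finite {i. i < m \<and> c i \<noteq> 0}" using c(2) by auto
 have d: "d < m" "c d \<noteq> 0" using Max_in[OF ne(2,1)] by (auto simp: d_def)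
 have up: "c i = 0" if "d < i" "i < m" for i
 proof (rule ccontr)
  assume "c i \<noteq> 0"
  hence "i \<le> d" unfolding d_def using that(2) by (intro Max_ge[OF ne(2)]) simp
  thus False using that(1) by simp
 qed
 have "(\<Sum>i\<le>d. poly (c i) t * e ^ i) = (\<Sum>i<m. poly (c i) t * e ^ i)"
  using d(1) up by (intro sum.mono_neutral_left) (auto simp: not_le)
 hence "(\<Sum>i\<le>d. poly (c i) t * e ^ i) = 0" using c(3) by simp
 thus ?thesis using c(1) d(2) by blast
qed

lemma transc: "t \<notin> F ==> FP p ==> poly p t = 0 \<longleftrightarrow> p = 0"
 using Falg by fastforce

lemma place_poly: "place V ==> FP p ==> t \<in> V ==> poly p t \<in> V"
 using fsub_poly[of V t p 1] placeD[of V] by simp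

text \<open>The leading coefficient of one algebraic relation of e over F[t] clears the denominators
  of e at all places where t is integral, simultaneously.\<close>

lemma scale_poly:
 assumes t: "t \<notin> F"
 shows "\<exists>a. FP a \<and> a \<noteq> 0 \<and> (\<forall>V. place V --> t \<in> V --> poly a t * e \<in> V)"
proof -
 obtain d c where c: "\<forall>i. FP (c i)" "c d \<noteq> 0" "(\<Sum>i\<le>d. poly (c i) t * e ^ i) = 0"
  using algebraic_relation[of t e] by metis
 have "poly (c d) t * e \<in> V" if V: "place V" "t \<in> V" for V
  by (rule scale_integral[OF V(1) _ c(3), where g = 1])
   (use place_poly[OF V(1) c(1)[THEN spec] V(2)] transc[OF t c(1)[THEN spec]] c(2) placeD(2)[OF V(1)] in auto)
 thus ?thesis using c by blast
qed

text \<open>Write the leading coefficient of a relation as t^k g(t) with g(0) \<noteq> 0. At a zero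
  of t the value g(t) is a nonzero constant plus a multiple of t, hence a unit, so only the power of
  t remains as a denominator.\<close>

lemma scale_power:
 assumes t: "t \<notin> F"
 shows "\<exists>k. \<forall>V. place V --> t \<in> mx V --> t ^ k * e \<in> V"
proof -
 obtain d c where c: "\<forall>i. FP (c i)" "c d \<noteq> 0" "(\<Sum>i\<le>d. poly (c i) t * e ^ i) = 0"
  using algebraic_relation[of t e] by metis
 define k where "k = Polynomial.order 0 (c d)"
 obtain g where g: "c d = [:- 0, 1:] ^ k * g" "\<not> [:- 0, 1:] dvd g"
  using order_decomp[OF c(2), of 0] unfolding k_def by blast
 have cd: "c d = Polynomial.monom 1 k * g" using g(1) by (simp add: monom_altdef)
 have Fg: "FP g"
 proof
  fix i show "poly.coeff g i \<in> F" using c(1)[rule_format, of d "i + k"]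
   by (simp add: cd coeff_monom_mult)
 qed
 have g0: "poly.coeff g 0 \<noteq> 0" using g(2) by (simp add: dvd_iff_poly_eq_0 poly_0_coeff_0)
 define g' where "g' = poly_shift 1 g"
 have gg: "g = pCons (poly.coeff g 0) g'"
  by (rule poly_eqI) (simp add: g'_def coeff_pCons coeff_poly_shift split: nat.splits)
 have Fg': "FP g'" using Fg by (simp add: g'_def coeff_poly_shift)
 have "t ^ k * e \<in> V" if V: "place V" "t \<in> mx V" for V
 proof (rule scale_integral[OF V(1) _ c(3)])
  note tV = mxD(1)[OF V]
  have pg: "poly g t = poly.coeff g 0 + t * poly g' t"
   using arg_cong[OF gg, of "\<lambda>p. poly p t"] by (simp only: poly_pCons)
  have "poly g t \<notin> mx V"
  proof
   assume "poly g t \<in> mx V"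
   moreover have "t * poly g' t \<in> mx V" by (rule mxD(6)[OF V(1) V(2) place_poly[OF V(1) Fg' tV]])
   ultimately have "poly g t - t * poly g' t \<in> mx V" by (rule mxD(7)[OF V(1)])
   hence "poly.coeff g 0 \<in> mx V" by (simp add: pg)
   thus False using mxD(5)[OF V(1)] Fg g0 by blast
  qed
  thus "poly g t \<noteq> 0" "inverse (poly g t) \<in> V" by (auto simp: mx_def)
  show "poly (c d) t = t ^ k * poly g t" by (simp add: cd poly_monom)
  show "poly (c i) t \<in> V" for i by (rule place_poly[OF V(1) c(1)[THEN spec] tV])
  show "t ^ k \<in> V" by (rule placeD(9)[OF V(1) tV])
  show "t ^ k \<noteq> 0" using t F0 by auto
 qed
 thus ?thesis by blast
qed

text \<open>Places have rank one: powers of a noninvertible element eventually beat any denominator.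
  A constant in the maximal ideal is zero, so \<open>scale_power\<close> covers all other
  elements.\<close>

lemma scale_mx:
 assumes V: "place V" and y: "y \<in> mx V"
 shows "\<exists>k. \<forall>j\<ge>k. y ^ j * e \<in> mx V"
proof -
 have "\<exists>k. y ^ k * e \<in> V"
 proof (cases "y \<in> F")
  case True
  hence "y = 0" using mxD(5)[OF V] y by blast
  thus ?thesis using placeD(1)[OF V] by (intro exI[of _ 1]) simp
 next
  case False
  obtain k where "\<forall>V. place V --> y \<in> mx V --> y ^ k * e \<in> V" using scale_power[OF False] ..
  thus ?thesis using V y by (intro exI[of _ k]) simp
 qed
 then obtain k where k: "y ^ k * e \<in> V" ..
 have "y ^ j * e \<in> mx V" if "j \<ge> Suc k" for j
 proof -
  obtain i where i: "j = Suc (k + i)" using less_imp_Suc_add[OF Suc_le_lessD[OF \<open>Suc k \<le> j\<close>]] ..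
  have "y * (y ^ i * (y ^ k * e)) \<in> mx V"
   by (intro mxD(6)[OF V y] placeD(5,9)[OF V] mxD(1)[OF V y] k)
  thus ?thesis by (simp add: i power_add mult_ac)
 qed
 thus ?thesis by blast
qed

text \<open>For w in the larger ring but not in the smaller, a power of 1/w brings any element e
  into the smaller ring; multiplying back by the power of w shows that e lies in the larger one,
  which would be the whole field.\<close>

lemma place_maximal:
 assumes V: "place V" and V': "place V'" and sub: "V \<subseteq> V'"
 shows "V = V'"
proof (rule ccontr)
 assume "V \<noteq> V'"
 then obtain w where w: "w \<in> V'" "w \<notin> V" using sub by blast
 hence y: "inverse w \<in> mx V" "w \<noteq> 0" using placeD(1)[OF V] by (auto simp: mx_def)
 have "e \<in> V'" for e
 proof -
  obtain k where "inverse w ^ k * e \<in> mx V" using scale_mx[OF V y(1)] by (meson order_refl)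
  hence "inverse w ^ k * e \<in> V'" using sub mxD(1)[OF V] by blast
  hence *: "w ^ k * (inverse w ^ k * e) \<in> V'" by (rule placeD(5)[OF V' placeD(9)[OF V' w(1)]])
  have "w ^ k * inverse w ^ k = 1" using y(2) by (simp flip: power_mult_distrib)
  thus ?thesis using * by (simp flip: mult.assoc)
 qed
 thus False using placeD(8)[OF V'] by blast
qed

text \<open>By maximality there are a and b, each integral at exactly one of the two places. Then
  a/b is small at V and has a pole at V', so 1/(1 + a/b) is close to 1 at V and small at V'.\<close>

lemma approx_two:
 assumes V: "place V" and V': "place V'" and ne: "V \<noteq> V'"
 shows "\<exists>u. 1 - u \<in> mx V \<and> u \<in> mx V'"
proof -
 have "\<not> V \<subseteq> V'" "\<not> V' \<subseteq> V" using place_maximal[OF V V'] place_maximal[OF V' V] ne by auto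
 then obtain a b where ab: "a \<in> V" "a \<notin> V'" "b \<in> V'" "b \<notin> V"
  by blast
 have nz: "a \<noteq> 0" "b \<noteq> 0" using ab placeD(1)[OF V] placeD(1)[OF V'] by auto
 have "inverse b \<in> mx V" "inverse a \<in> mx V'" using ab nz by (simp_all add: mx_def)
 hence y: "inverse b * a \<in> mx V" "inverse a * b \<in> mx V'"
  using mxD(6)[OF V] mxD(6)[OF V'] ab by blast+
 have unit: "inverse (1 + y) \<in> V \<and> 1 + y \<noteq> 0" if "place V" "y \<in> mx V" for V y
 proof -
  have "1 + y \<notin> mx V"
   using mxD(7)[OF that(1), of "1 + y" y] mxD(5)[OF that(1) F1] that by auto
  thus ?thesis by (auto simp: mx_def)
 qed
 define u where "u = inverse (1 + inverse b * a)"
 have u1: "u \<in> V" "1 + inverse b * a \<noteq> 0" using unit[OF V y(1)] by (auto simp: u_def)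
 have "1 - u = u * (inverse b * a)" using u1(2) by (simp add: u_def field_simps)
 hence "1 - u \<in> mx V" using mxD(3)[OF V u1(1) y(1)] by simp
 moreover have "u = (inverse a * b) * inverse (1 + inverse a * b)"
  using u1(2) unit[OF V' y(2)] nz by (simp add: u_def field_simps)
 hence "u \<in> mx V'" using mxD(6)[OF V' y(2)] unit[OF V' y(2)] by simp
 ultimately show ?thesis by blast
qed

lemma mx_unit:
 assumes V: "place V" and u: "1 - u \<in> mx V"
 shows "u \<noteq> 0 \<and> inverse u \<in> V \<and> u \<in> V"
proof -
 have "u \<notin> mx V"
 proof
  assume "u \<in> mx V"
  hence "1 - u + u \<in> mx V" by (rule mxD(4)[OF V u])
  thus False using mxD(5)[OF V F1] by simp
 qed
 moreover have "1 - (1 - u) \<in> V" by (rule placeD(10)[OF V placeD(2)[OF V] mxD(1)[OF V u]])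
 ultimately show ?thesis by (simp add: mx_def)
qed

lemma mx_one_mult:
 assumes "place V" "1 - u \<in> mx V" "1 - v \<in> mx V"
 shows "1 - u * v \<in> mx V"
proof -
 have "(1 - u) + u * (1 - v) \<in> mx V"
  by (intro mxD(4)[OF assms(1)] mxD(3)[OF assms(1)] assms) (use mx_unit[OF assms(1,2)] in simp)
 thus ?thesis by (simp add: algebra_simps)
qed

lemma mx_one_power: "place V ==> 1 - u \<in> mx V ==> 1 - u ^ n \<in> mx V"
 by (induction n) (simp_all add: mxD mx_one_mult)

lemma scale_mx_finite:
 assumes "finite I" "!!i. i \<in> I ==> place (V i)" "!!i. i \<in> I ==> y \<in> mx (V i)"
 shows "\<exists>k. \<forall>i\<in>I. \<forall>j\<ge>k. y ^ j * e i \<in> mx (V i)"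
 using assms
proof (induction I rule: finite_induct)
 case (insert i I)
 then obtain k where k: "\<forall>i\<in>I. \<forall>j\<ge>k. y ^ j * e i \<in> mx (V i)" by auto
 obtain k' where k': "\<forall>j\<ge>k'. y ^ j * e i \<in> mx (V i)" using scale_mx[of "V i" y "e i"] insert by auto
 show ?case by (rule exI[of _ "max k k'"]) (use k k' in auto)
qed simp

text \<open>Weak approximation, one place at a time. The induction splits on whether the element
  found so far has a pole at the new place.\<close>

lemma approx:
 assumes V: "place V" and "finite P" "!!W. W \<in> P ==> place W" "V \<notin> P"
 shows "\<exists>u. 1 - u \<in> mx V \<and> (\<forall>W\<in>P. u \<in> mx W)"
 using assms(2-4)
proof (induction P rule: finite_induct)
 case empty show ?case by (rule exI[of _ 1]) (simp add: mxD[OF V])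
next
 case (insert V' P)
 obtain u where u: "1 - u \<in> mx V" "!!W. W \<in> P ==> u \<in> mx W" using insert by auto
 have V': "place V'" "V \<noteq> V'" using insert by auto
 obtain v where v: "1 - v \<in> mx V" "v \<in> mx V'" using approx_two[OF V V'] by blast
 have P: "place W" if "W \<in> P" for W using insert(4) that by simp
 show ?case
 proof (cases "u \<in> V'")
  case True
  \<comment> \<open>Multiplying by v makes the element small at the new place; a high power of u
    makes up for any poles of v at the old ones.\<close>
  obtain k where k: "\<forall>W\<in>P. \<forall>j\<ge>k. u ^ j * v \<in> mx W"
   using scale_mx_finite[OF insert(1), of "\<lambda>W. W" u "\<lambda>_. v"] P u(2) by auto
  have "1 - u ^ k * v \<in> mx V" by (intro mx_one_mult[OF V] mx_one_power[OF V] u v)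
  moreover have "u ^ k * v \<in> mx V'" by (intro mxD(3)[OF V'(1)] placeD(9)[OF V'(1)] True v)
  ultimately show ?thesis using k by (intro exI[of _ "u ^ k * v"]) auto
 next
  case False
  \<comment> \<open>The quotient u / (1 - u + u^2) behaves like 1/u at a pole of u and is therefore
    small at V'. Where u is close to 0 or to 1 the denominator is close to 1, so the conditions
    already achieved survive.\<close>
  define d where "d = 1 - u * (1 - u)"
  have d: "1 - d \<in> mx W" if "place W" "u \<in> mx W \<or> 1 - u \<in> mx W" for W
  proof -
   have "u \<in> W \<and> 1 - u \<in> W"
    using that mxD(1)[OF that(1)] mx_unit[OF that(1)] placeD(10)[OF that(1) placeD(2)[OF that(1)], of u] by blast
   hence "u * (1 - u) \<in> mx W" using that(2) mxD(3,6)[OF that(1)] by blast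
   thus ?thesis by (simp add: d_def)
  qed
  have 1: "1 - u / d \<in> mx V"
  proof -
   have dV: "d \<noteq> 0" "inverse d \<in> V" "1 - d \<in> mx V" using d[OF V] u(1) mx_unit[OF V] by auto
   have "(1 - u) - (1 - d) \<in> mx V" by (rule mxD(7)[OF V u(1) dV(3)])
   hence "((1 - u) - (1 - d)) * inverse d \<in> mx V" by (rule mxD(6)[OF V _ dV(2)])
   moreover have "((1 - u) - (1 - d)) * inverse d = 1 - u / d" using dV(1) by (simp add: field_simps)
   ultimately show ?thesis by simp
  qed
  have 2: "u / d \<in> mx W" if "W \<in> P" for W
   using mxD(6)[OF P[OF that] u(2)[OF that], of "inverse d"] mx_unit[OF P[OF that] d[OF P[OF that]]] u(2)[OF that]
   by (simp add: divide_inverse)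
  have u0: "u \<noteq> 0" "inverse u \<in> mx V'" using False placeD(1)[OF V'(1)] by (auto simp: mx_def)
  have "1 - inverse u + inverse u * inverse u \<noteq> 0 \<and> inverse (1 - inverse u + inverse u * inverse u) \<in> V'"
  proof -
   have "inverse u * (1 - inverse u) \<in> mx V'"
    using mxD(6)[OF V'(1) u0(2)] placeD(10)[OF V'(1) placeD(2)[OF V'(1)]] mxD(1)[OF V'(1) u0(2)] by blast
   hence "1 - (1 - inverse u + inverse u * inverse u) \<in> mx V'" by (simp add: algebra_simps)
   thus ?thesis using mx_unit[OF V'(1)] by blast
  qed
  hence "inverse u * inverse (1 - inverse u + inverse u * inverse u) \<in> mx V'"
   and nz: "1 - inverse u + inverse u * inverse u \<noteq> 0"
   using mxD(6)[OF V'(1) u0(2)] by auto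
  moreover have "inverse u * inverse (1 - inverse u + inverse u * inverse u) = u / d"
  proof -
   have *: "d = u * u * (1 - inverse u + inverse u * inverse u)"
    using u0(1) by (simp add: d_def field_simps)
   show ?thesis unfolding * using u0(1) by (simp add: divide_inverse)
  qed
  ultimately have 3: "u / d \<in> mx V'" by simp
  show ?thesis using 1 2 3 by blast
 qed
qed

text \<open>Among m poles of x, with m from \<open>dependent\<close> for t = 1/x, choose u_i close
  to 1 at the i-th and small at the others. A relation over F[t] yields constants a_i, not all zero,
  with the sum of the a_i u_i divisible by t; read at the i-th pole this puts a_i into the maximal
  ideal, so a_i = 0.\<close>

lemma finite_places:
 assumes x: "x \<notin> F"
 shows "finite {V. place V \<and> x \<notin> V}"
proof (rule ccontr)
 assume inf: "infinite {V. place V \<and> x \<notin> V}"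
 define t where "t = inverse x"
 have x0: "x \<noteq> 0" using x F0 by auto
 have t: "t \<notin> F" "t \<noteq> 0" using x Finv[of t] x0 by (auto simp: t_def)
 obtain m :: nat where m: "\<forall>w. \<exists>c. (\<forall>i. FP (c i)) \<and> (\<exists>i<m. c i \<noteq> 0) \<and> (\<Sum>i<m. poly (c i) t * w i) = 0"
  using dependent[of t] ..
 obtain P where P: "finite P" "card P = m" "P \<subseteq> {V. place V \<and> x \<notin> V}"
  using infinite_arbitrarily_large[OF inf] by blast
 obtain V where V: "bij_betw V {..<m} P" using P(1,2) ex_bij_betw_nat_finite[OF P(1)] by (auto simp: atLeast0LessThan)
 have pl: "place (V i)" "x \<notin> V i" if "i < m" for i using bij_betwE[OF V] that P(3) by auto
 have ne: "V i \<noteq> V j" if "i < m" "j < m" "i \<noteq> j" for i j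
  using V that by (auto simp: bij_betw_def inj_on_def)
 have tm: "t \<in> mx (V i)" if "i < m" for i using pl[OF that] x0 by (simp add: t_def mx_def)
 have "\<forall>i. \<exists>u. i < m --> 1 - u \<in> mx (V i) \<and> (\<forall>W\<in>V ` ({..<m} - {i}). u \<in> mx W)"
 proof
  fix i
  have "\<exists>u. 1 - u \<in> mx (V i) \<and> (\<forall>W\<in>V ` ({..<m} - {i}). u \<in> mx W)" if i: "i < m"
  proof (rule approx[OF pl(1)[OF i]])
   show "place W" if "W \<in> V ` ({..<m} - {i})" for W using that pl(1) by auto
   show "V i \<notin> V ` ({..<m} - {i})" using ne[OF i] by auto
  qed simp
  thus "\<exists>u. i < m --> 1 - u \<in> mx (V i) \<and> (\<forall>W\<in>V ` ({..<m} - {i}). u \<in> mx W)" by blast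
 qed
 then obtain u where uu: "\<forall>i. i < m --> 1 - u i \<in> mx (V i) \<and> (\<forall>W\<in>V ` ({..<m} - {i}). u i \<in> mx W)"
  using choice[of "\<lambda>i u. i < m --> 1 - u \<in> mx (V i) \<and> (\<forall>W\<in>V ` ({..<m} - {i}). u \<in> mx W)"] by blast
 have u: "1 - u i \<in> mx (V i)" "j < m ==> j \<noteq> i ==> u i \<in> mx (V j)" if "i < m" for i j
  using uu that by auto
 define W where "W = (\<Inter>i<m. V i)"
 have W: "fsub W" unfolding W_def fsub_def using placeD(1,3,5,6)[OF pl(1)] by auto
 have tW: "t * w \<in> W" if "w \<in> W" for w
  unfolding W_def
 proof
  fix i assume "i \<in> {..<m}"
  hence i: "i < m" by simp
  thus "t * w \<in> V i" using that mxD(1)[OF pl(1)[OF i] tm[OF i]] by (intro placeD(5)[OF pl(1)[OF i]]) (auto simp: W_def)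
 qed
 have uW: "u i \<in> W" if "i < m" for i
  unfolding W_def
 proof
  fix j assume "j \<in> {..<m}"
  hence j: "j < m" by simp
  show "u i \<in> V j"
   using mx_unit[OF pl(1)[OF j] u(1)[OF j]] mxD(1)[OF pl(1)[OF j] u(2)[OF that j]] by (cases "j = i") auto
 qed
 obtain c where c: "\<forall>i. FP (c i)" "\<exists>i<m. c i \<noteq> 0" "(\<Sum>i<m. poly (c i) t * u i) = 0"
  using m[THEN spec, of u] by blast
 have "depend ((\<lambda>w. t * w) ` W) u m" by (rule depend_shift[OF W tW uW t(2) c])
 then obtain a i where a: "\<forall>i. a i \<in> F" "(\<Sum>i<m. a i * u i) \<in> (\<lambda>w. t * w) ` W" "i < m" "a i \<noteq> 0"
  unfolding depend_def by blast
 then obtain w where w: "w \<in> W" "(\<Sum>i<m. a i * u i) = t * w" by blast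
 note pi = pl(1)[OF a(3)]
 have "t * w \<in> mx (V i)" using mxD(6)[OF pi tm[OF a(3)]] w(1) a(3) by (auto simp: W_def)
 moreover have "(\<Sum>j\<in>{..<m} - {i}. a j * u j) \<in> mx (V i)"
  using u(2)[OF _ a(3)] a(1) placeD(6)[OF pi] by (intro fsub_sum[OF mxD(8)[OF pi]] mxD(3)[OF pi]) auto
 ultimately have "t * w - (\<Sum>j\<in>{..<m} - {i}. a j * u j) \<in> mx (V i)" by (rule mxD(7)[OF pi])
 moreover have "t * w = a i * u i + (\<Sum>j\<in>{..<m} - {i}. a j * u j)"
  using w(2) a(3) by (simp add: sum.remove)
 ultimately have "a i * u i \<in> mx (V i)" by simp
 moreover have "a i * (1 - u i) \<in> mx (V i)" by (rule mxD(3)[OF pi placeD(6)[OF pi] u(1)[OF a(3)]]) (use a in simp)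
 ultimately have "a i * u i + a i * (1 - u i) \<in> mx (V i)" by (rule mxD(4)[OF pi])
 hence "a i \<in> mx (V i)" by (simp add: algebra_simps)
 thus False using mxD(5)[OF pi] a by blast
qed

end

section \<open>Functions with a single pole, and the existence of zeros\<close>

context finite_function_field
begin

definition rank_less :: "'Q => nat => bool"
 where "rank_less t m \<longleftrightarrow>
  (\<forall>w. \<exists>c. (\<forall>i. FP (c i)) \<and> (\<exists>i<m. c i \<noteq> 0) \<and> (\<Sum>i<m. poly (c i) t * w i) = 0)"

text \<open>F(x) and F(1/x) are the same field: multiplying a relation by x^(-N) and reversing the
  coefficient polynomials turns x into 1/x.\<close>

lemma rank_less_inverse:
 assumes x: "x \<noteq> 0" and r: "rank_less x m"
 shows "rank_less (inverse x) m"
 unfolding rank_less_def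
proof
 fix w :: "nat => 'Q"
 obtain c where c: "\<forall>i. FP (c i)" "\<exists>i<m. c i \<noteq> 0" "(\<Sum>i<m. poly (c i) x * w i) = 0"
  using r[unfolded rank_less_def, THEN spec, of w] by blast
 define N where "N = (\<Sum>i<m. degree (c i))"
 have N: "degree (c i) \<le> N" if "i < m" for i
  unfolding N_def using that by (intro member_le_sum) auto
 define c' where "c' i = (if i < m then \<Sum>j\<le>N. Polynomial.monom (poly.coeff (c i) (N - j)) j else 0)" for i
 have "FP (c' i)" for i using c(1) by (simp add: c'_def coeff_sum Fsum F0)
 moreover have "\<exists>i<m. c' i \<noteq> 0"
 proof -
  obtain i where i: "i < m" "c i \<noteq> 0" using c(2) by blast
  have "poly.coeff (c' i) (N - degree (c i)) = poly.coeff (c i) (degree (c i))"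
   using i(1) N[OF i(1)] by (simp add: c'_def coeff_sum)
  hence "c' i \<noteq> 0" using i(2) by auto
  thus ?thesis using i(1) by blast
 qed
 moreover have p: "poly (c' i) (inverse x) = inverse x ^ N * poly (c i) x" if i: "i < m" for i
 proof -
  have "poly (c' i) (inverse x) = (\<Sum>j\<le>N. poly.coeff (c i) (N - j) * inverse x ^ j)"
   using i by (simp add: c'_def poly_sum poly_monom)
  also have "\<dots> = (\<Sum>j\<le>N. poly.coeff (c i) j * inverse x ^ (N - j))"
   by (rule sum.reindex_bij_witness[of _ "\<lambda>j. N - j" "\<lambda>j. N - j"]) auto
  also have "\<dots> = (\<Sum>j\<le>N. inverse x ^ N * (poly.coeff (c i) j * x ^ j))"
  proof (rule sum.cong[OF refl])
   fix j assume "j \<in> {..N}"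
   hence "inverse x ^ N = inverse x ^ (N - j) * inverse x ^ j" by (simp flip: power_add)
   moreover have "inverse x ^ j * x ^ j = 1" using x by (simp flip: power_mult_distrib)
   ultimately show "poly.coeff (c i) j * inverse x ^ (N - j) = inverse x ^ N * (poly.coeff (c i) j * x ^ j)"
    by (simp add: mult_ac)
  qed
  also have "\<dots> = inverse x ^ N * (\<Sum>j\<le>degree (c i). poly.coeff (c i) j * x ^ j)"
   unfolding sum_distrib_left[symmetric]
   using N[OF i] by (intro arg_cong2[where f = "(*)"] refl sum.mono_neutral_right) (auto simp: coeff_eq_0)
  finally show ?thesis by (simp add: poly_altdef)
 qed
 moreover have "(\<Sum>i<m. poly (c' i) (inverse x) * w i) = inverse x ^ N * (\<Sum>i<m. poly (c i) x * w i)"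
  unfolding sum_distrib_left by (intro sum.cong refl) (simp add: p mult.assoc)
 ultimately show "\<exists>c. (\<forall>i. FP (c i)) \<and> (\<exists>i<m. c i \<noteq> 0) \<and> (\<Sum>i<m. poly (c i) (inverse x) * w i) = 0"
  using c(3) by (intro exI[of _ c']) simp
qed

lemma fsub_image: "fsub W ==> fsub ((*) x ` W)"
 unfolding fsub_def image_iff by (auto simp: mult.left_commute simp flip: distrib_left)

lemma fsub_Int: "fsub U ==> fsub W ==> fsub (U \<inter> W)"
 unfolding fsub_def by blast

lemma card_coset:
 assumes L: "fsub L" "finite L" and U: "fsub U"
 shows "card (L \<inter> {a. a - v \<in> U}) \<le> card (L \<inter> U)"
proof (cases "L \<inter> {a. a - v \<in> U} = {}")
 case False
 then obtain a where a: "a \<in> L" "a - v \<in> U" by blast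
 have "b - a \<in> L \<inter> U" if "b \<in> L \<inter> {a. a - v \<in> U}" for b
  using that fsubD(5)[OF L(1) _ a(1), of b] fsubD(5)[OF U _ a(2), of "b - v"] by simp
 thus ?thesis using L(2) by (intro card_inj_on_le[where f = "\<lambda>b. b - a"]) (auto simp: inj_on_def)
qed simp

text \<open>Each step from x^(k+1) W down to x^k W splits a finite F-subspace into at most c cosets,
  hence costs at most a factor c.\<close>

lemma card_descent:
 assumes W: "fsub W" and x: "x \<noteq> 0" and T: "finite T" "card T \<le> c" "\<forall>w\<in>W. \<exists>v\<in>T. w - v \<in> (*) (inverse x) ` W"
 shows "fsub L ==> finite L ==> L \<subseteq> (*) (x ^ k) ` W ==> card L \<le> c ^ k * card (L \<inter> W)"
proof (induction k arbitrary: L)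
 case 0
 hence "L \<inter> W = L" by auto
 thus ?case by simp
next
 case (Suc k)
 let ?U = "(*) (x ^ k) ` W"
 have "L \<subseteq> (\<Union>v\<in>T. L \<inter> {a. a - x ^ Suc k * v \<in> ?U})"
 proof
  fix l assume l: "l \<in> L"
  then obtain w where w: "w \<in> W" "l = x ^ Suc k * w" using Suc.prems(3) by blast
  then obtain v u where v: "v \<in> T" "u \<in> W" "w - v = inverse x * u" using T(3) by blast
  have "l - x ^ Suc k * v = x ^ Suc k * (w - v)" by (simp add: w(2) right_diff_distrib)
  also have "\<dots> = x ^ k * u" using x by (simp add: v(3))
  finally show "l \<in> (\<Union>v\<in>T. L \<inter> {a. a - x ^ Suc k * v \<in> ?U})" using l v by blast
 qed
 hence "card L \<le> card (\<Union>v\<in>T. L \<inter> {a. a - x ^ Suc k * v \<in> ?U})"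
  using T(1) Suc.prems(2) by (intro card_mono) auto
 also have "\<dots> \<le> (\<Sum>v\<in>T. card (L \<inter> {a. a - x ^ Suc k * v \<in> ?U}))"
  by (rule card_UN_le[OF T(1)])
 also have "\<dots> \<le> (\<Sum>v\<in>T. card (L \<inter> ?U))"
  by (intro sum_mono card_coset Suc.prems fsub_image W)
 also have "\<dots> \<le> c * card (L \<inter> ?U)" using T(2) by simp
 also have "\<dots> \<le> c * (c ^ k * card (L \<inter> ?U \<inter> W))"
  by (intro mult_left_mono Suc.IH fsub_Int fsub_image Suc.prems W) (use Suc.prems(2) in auto)
 also have "\<dots> \<le> c * (c ^ k * card (L \<inter> W))"
  using Suc.prems(2) by (intro mult_left_mono card_mono) auto
 finally show ?case by (simp add: mult.assoc)
qed

text \<open>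
 A weak form of Riemann's inequality. With \<open>n + 1\<close> the degree of the field over \<open>F(x)\<close> and \<open>W\<close> the
 elements that are integral at the poles of \<open>x\<close> other than \<open>V\<^sub>0\<close>, the quotient \<open>W / x\<^sup>-\<^sup>1 W\<close> has
 dimension at most \<open>n\<close>, because the pole \<open>V\<^sub>0\<close> is missing. A lattice over \<open>F[x]\<close> grows at the rate
 \<open>n + 1\<close>, so that it contains many elements of \<open>W\<close>.
\<close>

lemma nonconstant:
 assumes V0: "place V0"
 shows "\<exists>a. a \<notin> F \<and> (\<forall>V. place V --> V \<noteq> V0 --> a \<in> V)"
proof -
 obtain x where xV: "x \<notin> V0" using placeD(8)[OF V0] by blast
 have xF: "x \<notin> F" using xV placeD(6)[OF V0] by blast
 have x0: "x \<noteq> 0" using xF F0 by auto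
 define t where "t = inverse x"
 have t: "t \<notin> F" "t \<noteq> 0" using xF Finv[of t] x0 by (auto simp: t_def)
 have tx: "t * x = 1" using x0 by (simp add: t_def)
 have tmx: "t \<in> mx V" if "x \<notin> V" for V using that x0 by (simp add: t_def mx_def)
 define r where "r = (LEAST m. rank_less x m)"
 have ex: "\<exists>m. rank_less x m" using dependent[of x] by (simp add: rank_less_def)
 have rx: "rank_less x r" unfolding r_def using ex by (rule LeastI_ex)
 have r2: "\<not> rank_less x m" if "m < r" for m using that not_less_Least unfolding r_def by blast
 have "\<not> rank_less x 0" by (simp add: rank_less_def)
 moreover have "\<not> rank_less x 1"
 proof
  assume "rank_less x 1"
  then obtain c where "\<forall>i. FP (c i)" "\<exists>i<1. c i \<noteq> 0" "(\<Sum>i<1::nat. poly (c i) x * 1) = 0"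
   unfolding rank_less_def by (drule_tac spec[of _ "\<lambda>_. 1"]) blast
  thus False using transc[OF xF, of "c 0"] by simp
 qed
 ultimately have "r \<noteq> 0" "r \<noteq> 1" using rx by (metis, metis)
 \<comment> \<open>The least r is the degree of the field over F(x) plus one. It is at least 2, as 1
   alone is independent over F[x], so the degree is n + 1.\<close>
 then obtain n where n: "r = n + 2" by (metis One_nat_def add_2_eq_Suc' not0_implies_Suc)
 have "\<not> rank_less x (n + 1)" by (rule r2) (simp add: n)
 then obtain e where e: "!!c. \<forall>i. FP (c i) ==> (\<Sum>i<n+1. poly (c i) x * e i) = 0 ==> \<forall>i<n+1. c i = 0"
  unfolding rank_less_def by blast
 have "\<forall>i. \<exists>a. FP a \<and> a \<noteq> 0 \<and> (\<forall>V. place V --> x \<in> V --> poly a x * e i \<in> V)"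
  using scale_poly[OF xF] by blast
 from choice[OF this] obtain h where h: "!!i. FP (h i)" "!!i. h i \<noteq> 0"
  "!!i V. place V ==> x \<in> V ==> poly (h i) x * e i \<in> V" by blast
 \<comment> \<open>The basis is rescaled to be integral wherever x is, so that its F[x]-combinations
   have poles only at poles of x.\<close>
 define b where "b i = poly (h i) x * e i" for i
 have bV: "b i \<in> V" if "place V" "x \<in> V" for i V using h(3) that by (simp add: b_def)
 have b: "\<forall>i<n+1. c i = 0" if c: "\<forall>i. FP (c i)" "(\<Sum>i<n+1. poly (c i) x * b i) = 0" for c
 proof -
  have "\<forall>i<n+1. c i * h i = 0"
  proof (rule e)
   show "\<forall>i. FP (c i * h i)" using FP_simps(5)[OF c(1)[THEN spec] h(1)] by blast
   show "(\<Sum>i<n+1. poly (c i * h i) x * e i) = 0" using c(2) by (simp add: b_def mult.assoc)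
  qed
  thus ?thesis using h(2) by simp
 qed
 have "\<forall>i. \<exists>k. \<forall>V. place V --> t \<in> mx V --> t ^ k * b i \<in> V"
  using scale_power[OF t(1)] by blast
 from choice[OF this] obtain s where s: "!!i V. place V ==> t \<in> mx V ==> t ^ s i * b i \<in> V" by blast
 \<comment> \<open>A uniform bound for the pole orders of the b_i at the poles of x, measured in
   powers of t.\<close>
 define k where "k = (\<Sum>i<n+1. s i)"
 have k: "t ^ k * b i \<in> V" if V: "place V" "t \<in> mx V" and i: "i < n + 1" for V i
 proof -
  have "s i \<le> k" unfolding k_def using i by (intro member_le_sum) auto
  hence "t ^ k = t ^ (k - s i) * t ^ s i" by (simp flip: power_add)
  thus ?thesis
   using placeD(5)[OF V(1) placeD(9)[OF V(1) mxD(1)[OF V], of "k - s i"] s[OF V, of i]] by (simp add: mult.assoc)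
 qed
 define P where "P = {V. place V \<and> x \<notin> V} - {V0}"
 have P: "finite P" "!!V. V \<in> P ==> place V" "V0 \<notin> P" "!!V. V \<in> P ==> t \<in> mx V"
  using finite_places[OF xF] tmx by (auto simp: P_def)
 define W where "W = \<Inter>P"
 have W: "fsub W" unfolding W_def fsub_def using placeD(1,3,5,6)[OF P(2)] by auto
 have Wm: "v * w \<in> W" if "v \<in> W" "w \<in> W" for v w
  using that placeD(5)[OF P(2)] by (auto simp: W_def)
 have W1: "1 \<in> W" "t \<in> W" using placeD(2)[OF P(2)] mxD(1)[OF P(2) P(4)] by (auto simp: W_def)
 have Wp: "w ^ i \<in> W" if "w \<in> W" for w i by (induction i) (auto intro: Wm W1 that)
 obtain u0 where u0: "1 - u0 \<in> mx V0" "\<forall>V\<in>P. u0 \<in> mx V" using approx[OF V0 P(1,2,3)] by blast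
 obtain K where K: "\<forall>V\<in>P. \<forall>j\<ge>K. u0 ^ j * x \<in> mx V"
  using scale_mx_finite[OF P(1), of "\<lambda>V. V" u0 "\<lambda>_. x"] P(2) u0(2) by auto
 \<comment> \<open>The power is high enough for u x to be integral at the poles of x other than V0,
   so u is divisible by t in W while it is close to 1 at V0.\<close>
 define u where "u = u0 ^ K"
 have u1: "1 - u \<in> mx V0" unfolding u_def by (rule mx_one_power[OF V0 u0(1)])
 have uxW: "u * x \<in> W" unfolding W_def using K mxD(1)[OF P(2)] by (auto simp: u_def)
 have utx: "u = t * (u * x)" using tx by (simp add: mult_ac)
 have uW: "u \<in> W" by (subst utx) (rule Wm[OF W1(2) uxW])
 have uV0: "u \<in> V0" using mx_unit[OF V0 u1] by blast
 have u2: "1 - u \<in> W" using fsubD(5)[OF W W1(1) uW] .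
 let ?tW = "(*) t ` W"
 have dep: "depend ?tW w (Suc n)" if w: "!!i. i < Suc n ==> w i \<in> W" for w
 proof -
  obtain J where J: "\<forall>i\<in>{..n}. \<forall>j\<ge>J. (1 - u) ^ j * w i \<in> mx V0"
   using scale_mx_finite[of "{..n}" "\<lambda>_. V0" "1 - u" w] V0 u1 by auto
  define y where "y = (1 - u) ^ J"
  have y: "y \<in> W" "!!i. i < Suc n ==> y * w i \<in> mx V0" using J Wp[OF u2] by (auto simp: y_def)
  obtain g where g: "g \<in> W" "y = 1 - u * g"
  proof -
   have "\<exists>g\<in>W. (1 - u) ^ j = 1 - u * g" for j
   proof (induction j)
    case (Suc j)
    then obtain g where "g \<in> W" "(1 - u) ^ j = 1 - u * g" by blast
    moreover have "(1 - u) * (1 - u * g) = 1 - u * (1 + g - u * g)" by (simp add: algebra_simps)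
    ultimately show ?case
     using fsubD(5)[OF W fsubD(2)[OF W W1(1) \<open>g \<in> W\<close>] Wm[OF uW \<open>g \<in> W\<close>]] by auto
   qed (use fsubD(1)[OF W] in auto)
   thus ?thesis using that by (auto simp: y_def)
  qed
  define w' where "w' i = (if i < Suc n then y * w i else u)" for i
  have w'W: "w' i \<in> W \<inter> V0" for i
   using Wm[OF y(1) w] mxD(1)[OF V0 y(2)] uW uV0 by (auto simp: w'_def)
  have "rank_less t (n + 2)" using rank_less_inverse[OF x0 rx] by (simp add: t_def n)
  then obtain c where c: "\<forall>i. FP (c i)" "\<exists>i<n+2. c i \<noteq> 0" "(\<Sum>i<n+2. poly (c i) t * w' i) = 0"
   unfolding rank_less_def by blast
  have tV0: "t \<in> mx V0" by (rule tmx[OF xV])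
  have "depend ((\<lambda>w. t * w) ` (W \<inter> V0)) w' (n + 2)"
   by (rule depend_shift[OF fsub_Int[OF W placeD(11)[OF V0]] _ w'W t(2) c])
    (use Wm[OF W1(2)] placeD(5)[OF V0 mxD(1)[OF V0 tV0]] in auto)
  then obtain a v where a: "\<forall>i. a i \<in> F" "\<exists>i<n+2. a i \<noteq> 0" "(\<Sum>i<n+2. a i * w' i) = t * v" "v \<in> W" "v \<in> V0"
   unfolding depend_def by blast
  have sm: "(\<Sum>i<Suc n. a i * (y * w i)) + a (Suc n) * u = t * v"
   using a(3) by (simp add: w'_def numeral_2_eq_2)
  have "t * v - (\<Sum>i<Suc n. a i * (y * w i)) \<in> mx V0"
   by (intro mxD(7)[OF V0] mxD(6)[OF V0 tV0] a fsub_sum[OF mxD(8)[OF V0]] mxD(3)[OF V0] y placeD(6)[OF V0]) (use a in auto)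
  moreover have "t * v - (\<Sum>i<Suc n. a i * (y * w i)) = a (Suc n) * u"
   using sm by (metis add_diff_cancel_left')
  ultimately have "a (Suc n) * u \<in> mx V0" by simp
  moreover have "a (Suc n) * (1 - u) \<in> mx V0" using a(1) by (intro mxD(3)[OF V0 _ u1] placeD(6)[OF V0]) simp
  ultimately have "a (Suc n) * u + a (Suc n) * (1 - u) \<in> mx V0" by (rule mxD(4)[OF V0])
  hence "a (Suc n) \<in> mx V0" by (simp add: algebra_simps)
  hence an: "a (Suc n) = 0" using mxD(5)[OF V0] a(1) by blast
  have nz: "\<exists>i<Suc n. a i \<noteq> 0" using a(2) an by (auto simp: less_Suc_eq numeral_2_eq_2)
  have sW: "(\<Sum>i<Suc n. a i * (g * w i)) \<in> W" by (intro fsub_sum[OF W] fsubD(3)[OF W] Wm g w) (use a in auto)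
  have eq: "(\<Sum>i<Suc n. a i * w i) = (\<Sum>i<Suc n. a i * (y * w i)) + u * (\<Sum>i<Suc n. a i * (g * w i))"
   unfolding sum_distrib_left sum.distrib[symmetric] g(2) by (intro sum.cong refl) (simp add: algebra_simps)
  have "(\<Sum>i<Suc n. a i * (y * w i)) = t * v" using sm an by simp
  moreover have "u * (\<Sum>i<Suc n. a i * (g * w i)) = t * ((u * x) * (\<Sum>i<Suc n. a i * (g * w i)))"
   by (subst utx) (simp only: mult.assoc)
  ultimately have "(\<Sum>i<Suc n. a i * w i) = t * (v + (u * x) * (\<Sum>i<Suc n. a i * (g * w i)))"
   unfolding eq by (simp only: distrib_left)
  hence "(\<Sum>i<Suc n. a i * w i) \<in> ?tW"
   using fsubD(2)[OF W a(4) Wm[OF uxW sW]] by blast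
  thus ?thesis using a(1) nz unfolding depend_def by blast
 qed
 obtain T where T: "finite T" "card T \<le> card F ^ n" "\<forall>w\<in>W. \<exists>v\<in>T. w - v \<in> ?tW"
  using depend_cover[OF fsub_image[OF W] dep] by blast
 \<comment> \<open>Chosen so that (n + 1) (M + 1) exceeds n (M + k) by at least 2. The lattice then
   meets W in at least |F|^2 elements, more than there are constants.\<close>
 define M where "M = n * k + 1"
 define L where "L = fspan x (n + 1) b M"
 have L: "fsub L" "finite L"
  unfolding fsub_def L_def using fspan_zero fspan_add fspan_const fspan_card(1) by blast+
 have "L \<subseteq> (*) (x ^ (M + k)) ` W"
 proof
  fix l assume "l \<in> L"
  then obtain p where p: "\<forall>i. FP (p i) \<and> degree (p i) \<le> M" "l = (\<Sum>i<n+1. poly (p i) x * b i)"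
   unfolding L_def fspan_def by blast
  have "t ^ (M + k) * l \<in> V" if "V \<in> P" for V
  proof -
   note V = P(2,4)[OF that]
   have "t ^ M * poly (p i) x \<in> V" for i
   proof -
    have "t ^ M * poly (p i) x = (\<Sum>j\<le>degree (p i). poly.coeff (p i) j * t ^ (M - j))"
     unfolding poly_altdef sum_distrib_left
    proof (rule sum.cong[OF refl])
     fix j assume "j \<in> {..degree (p i)}"
     hence "j \<le> M" using p(1) by (meson atMost_iff le_trans)
     hence "t ^ M = t ^ (M - j) * t ^ j" by (simp flip: power_add)
     moreover have "t ^ j * x ^ j = 1" using tx by (simp flip: power_mult_distrib)
     ultimately show "t ^ M * (poly.coeff (p i) j * x ^ j) = poly.coeff (p i) j * t ^ (M - j)"
      by (simp add: mult_ac)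
    qed
    also have "\<dots> \<in> V"
     using p(1) placeD(9)[OF V(1) mxD(1)[OF V]] by (intro fsub_sum placeD(11) fsubD(3) V) auto
    finally show ?thesis .
   qed
   hence "(\<Sum>i<n+1. (t ^ M * poly (p i) x) * (t ^ k * b i)) \<in> V"
    by (intro fsub_sum[OF placeD(11)[OF V(1)]]) (rule placeD(5)[OF V(1)], simp, simp add: k[OF V])
   thus ?thesis by (simp add: p(2) sum_distrib_left power_add mult_ac del: sum.lessThan_Suc)
  qed
  hence "t ^ (M + k) * l \<in> W" by (auto simp: W_def)
  moreover have "x ^ (M + k) * t ^ (M + k) = 1"
   unfolding power_mult_distrib[symmetric] using x0 by (simp add: t_def)
  hence "l = x ^ (M + k) * (t ^ (M + k) * l)" by (simp only: mult.assoc[symmetric] mult_1_left)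
  ultimately show "l \<in> (*) (x ^ (M + k)) ` W" by blast
 qed
 hence l1: "card L \<le> (card F ^ n) ^ (M + k) * card (L \<inter> W)"
  by (intro card_descent[OF W x0 T(1,2)]) (use T(3) L t_def in auto)
 have l2: "card F ^ ((n + 1) * (M + 1)) \<le> card L"
 proof -
  let ?I = "{..<n+1} \<times> {..M}"
  define p where "p c i = (\<Sum>j\<le>M. Polynomial.monom (if i < n + 1 then c (i, j) else 0) j)" for c :: "nat \<times> nat => 'Q" and i
  have Fp: "FP (p c i)" "degree (p c i) \<le> M" if "c \<in> ?I \<rightarrow>\<^sub>E F" for c i
   using that F0 by (auto simp: p_def coeff_sum Pi_iff PiE_iff intro!: degree_le)
  have pc: "poly.coeff (p c i) j = (if i < n + 1 \<and> j \<le> M then c (i, j) else 0)" for c i j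
   by (simp add: p_def coeff_sum)
  let ?g = "\<lambda>c. \<Sum>i<n+1. poly (p c i) x * b i"
  have "inj_on ?g (?I \<rightarrow>\<^sub>E F)"
  proof (rule inj_onI)
   fix c c' assume c: "c \<in> ?I \<rightarrow>\<^sub>E F" "c' \<in> ?I \<rightarrow>\<^sub>E F" "?g c = ?g c'"
   have "\<forall>i<n+1. p c i - p c' i = 0"
   proof (rule b)
    show "\<forall>i. FP (p c i - p c' i)" using Fp(1)[OF c(1)] Fp(1)[OF c(2)] by (simp add: Fdiff)
    show "(\<Sum>i<n+1. poly (p c i - p c' i) x * b i) = 0"
     using c(3) by (simp add: left_diff_distrib sum_subtractf)
   qed
   hence "c (i, j) = c' (i, j)" if "i < n + 1" "j \<le> M" for i j
    using pc[of c i j] pc[of c' i j] that by auto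
   thus "c = c'" by (intro PiE_ext[OF c(1,2)]) auto
  qed
  moreover have "?g ` (?I \<rightarrow>\<^sub>E F) \<subseteq> L"
  proof (rule image_subsetI)
   fix c assume c: "c \<in> ?I \<rightarrow>\<^sub>E F"
   show "?g c \<in> L" unfolding L_def fspan_def using Fp[OF c] by blast
  qed
  ultimately have "card (?I \<rightarrow>\<^sub>E F) \<le> card L" using L(2) by (rule card_inj_on_le)
  thus ?thesis by (simp add: card_PiE card_cartesian_product)
 qed
 have l3: "card F ^ (n * (M + k) + 2) \<le> card F ^ ((n + 1) * (M + 1))"
  using card_F by (intro power_increasing) (auto simp: M_def algebra_simps)
 have "card F ^ (n * (M + k)) * card F ^ 2 \<le> card F ^ (n * (M + k)) * card (L \<inter> W)"
  using order_trans[OF l3 order_trans[OF l2 l1]] by (simp only: power_mult power_add)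
 moreover have "0 < card F ^ (n * (M + k))" using card_F by simp
 ultimately have "card F * card F \<le> card (L \<inter> W)"
  unfolding power2_eq_square using nat_mult_le_cancel1 by blast
 moreover have "card F * 2 \<le> card F * card F" using card_F by (intro mult_le_mono2)
 ultimately have "card F < card (L \<inter> W)" using card_F by linarith
 have "\<not> L \<inter> W \<subseteq> F"
 proof
  assume "L \<inter> W \<subseteq> F"
  from card_mono[OF Ffin this] \<open>card F < card (L \<inter> W)\<close> show False by simp
 qed
 then obtain a where a: "a \<in> L" "a \<in> W" "a \<notin> F" by blast
 have "a \<in> V" if V: "place V" "V \<noteq> V0" for V
 proof (cases "x \<in> V")
  case True
  obtain p where p: "\<forall>i. FP (p i) \<and> degree (p i) \<le> M" "a = (\<Sum>i<n+1. poly (p i) x * b i)"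
   using a(1) unfolding L_def fspan_def by blast
  show ?thesis unfolding p(2)
   by (intro fsub_sum[OF placeD(11)[OF V(1)]] placeD(5)[OF V(1)] place_poly[OF V(1)] bV[OF V(1) True] True) (use p(1) in auto)
 next
  case False
  thus ?thesis using a(2) V by (auto simp: W_def P_def)
 qed
 thus ?thesis using a(3) by blast
qed

text \<open>Chevalley's extension theorem. A subring maximal among those that contain F and a but
  not 1/a is a valuation ring, and it has a in its maximal ideal.\<close>

lemma exists_place:
 assumes a: "a \<notin> F"
 shows "\<exists>V. place V \<and> a \<in> mx V"
proof -
 define sr where "sr R \<longleftrightarrow> F \<subseteq> R \<and> (\<forall>x\<in>R. \<forall>y\<in>R. x + y \<in> R) \<and> (\<forall>x\<in>R. \<forall>y\<in>R. x * y \<in> R)" for R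
 have srD: "x + y \<in> R" "x * y \<in> R" "- x \<in> R" "x - y \<in> R" "c \<in> F ==> c \<in> R" "x ^ n \<in> R" "fsub R"
  if "sr R" "x \<in> R" "y \<in> R" for R x y c and n :: nat
 proof -
  show *: "x + y \<in> R" "x * y \<in> R" "c \<in> F ==> c \<in> R" using that by (auto simp: sr_def)
  show "fsub R" unfolding fsub_def using that(1) F0 by (auto simp: sr_def)
  thus "- x \<in> R" "x - y \<in> R" using that by (simp_all add: fsubD)
  show "x ^ n \<in> R" using that F1 by (induction n) (auto simp: sr_def)
 qed
 \<comment> \<open>The ring R[y], given by expansions of finite length so that the length can serve
   for descent.\<close>
 define adj where "adj R y = {\<Sum>i\<le>n. c i * y ^ i | n c. \<forall>i::nat. c i \<in> R}" for R and y :: 'Q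
 have adjE: "\<exists>c. (\<forall>i. c i \<in> R) \<and> (\<forall>i>n. c i = 0) \<and> v = (\<Sum>i\<le>n. c i * y ^ i)"
  if "v = (\<Sum>i\<le>m. c i * y ^ i)" "\<forall>i::nat. c i \<in> R" "m \<le> n" "sr R" for R v y m n c
 proof (intro exI conjI)
  show "\<forall>i. (if i \<le> m then c i else 0) \<in> R" using that F0 by (auto simp: sr_def)
  show "\<forall>i>n. (if i \<le> m then c i else 0) = 0" using that by auto
  show "v = (\<Sum>i\<le>n. (if i \<le> m then c i else 0) * y ^ i)"
   unfolding that(1) using that(3) by (intro sum.mono_neutral_cong_left) auto
 qed
 have polyadj: "poly p y \<in> adj R y" if "\<forall>i. poly.coeff p i \<in> R" for p R y
  unfolding adj_def poly_altdef using that by blast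
 have adjpoly: "\<exists>p. (\<forall>i. poly.coeff p i \<in> R) \<and> v = poly p y" if v: "v \<in> adj R y" "sr R" for v R y
 proof -
  obtain n c where c: "\<forall>i. c i \<in> R" "v = (\<Sum>i\<le>n. c i * y ^ i)" using v(1) unfolding adj_def by blast
  have "\<forall>i. poly.coeff (\<Sum>i\<le>n. Polynomial.monom (c i) i) i \<in> R"
   using c(1) v(2) F0 by (auto simp: coeff_sum sr_def)
  moreover have "v = poly (\<Sum>i\<le>n. Polynomial.monom (c i) i) y" by (simp add: c(2) poly_sum poly_monom)
  ultimately show ?thesis by blast
 qed
 have sradj: "sr (adj R y)" "R \<subseteq> adj R y" "y \<in> adj R y" if R: "sr R" for R y
 proof -
  show sub: "R \<subseteq> adj R y"
  proof
   fix v assume "v \<in> R"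
   thus "v \<in> adj R y" using polyadj[of "[:v:]" R y] R F0 by (auto simp: coeff_pCons sr_def split: nat.splits)
  qed
  show "y \<in> adj R y" unfolding adj_def
   by (rule CollectI, rule exI[of _ 1], rule exI[of _ "\<lambda>i. if i = 1 then 1 else 0"])
    (use R F0 F1 in \<open>auto simp: sr_def\<close>)
  have *: "v + w \<in> adj R y \<and> v * w \<in> adj R y" if vw: "v \<in> adj R y" "w \<in> adj R y" for v w
  proof -
   obtain p g where p: "\<forall>i. poly.coeff p i \<in> R" "v = poly p y" "\<forall>i. poly.coeff g i \<in> R" "w = poly g y"
    using adjpoly[OF vw(1) R] adjpoly[OF vw(2) R] by blast
   have "\<forall>i. poly.coeff (p + g) i \<in> R" using p R by (auto simp: sr_def)
   moreover have "\<forall>i. poly.coeff (p * g) i \<in> R"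
    unfolding coeff_mult using p R F0 by (intro allI fsub_sum[OF srD(7)[OF R]]) (auto simp: sr_def)
   ultimately show ?thesis using polyadj[of "p + g" R y] polyadj[of "p * g" R y] p by simp
  qed
  have "F \<subseteq> adj R y" using sub R by (auto simp: sr_def)
  thus "sr (adj R y)" by (simp add: sr_def *)
 qed
 have a0: "a \<noteq> 0" using a F0 by auto
 define Z where "Z = {R. sr R \<and> a \<in> R \<and> inverse a \<notin> R}"
 have srF: "sr F" by (simp add: sr_def Fadd Fmult)
 have "adj F a \<in> Z"
 proof -
  have "inverse a \<notin> adj F a"
  proof
   assume "inverse a \<in> adj F a"
   then obtain p where p: "FP p" "inverse a = poly p a" using adjpoly[OF _ srF] by blast
   hence "poly (pCons (- 1) p) a = 0" using a0 by (simp flip: p(2))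
   moreover have "FP (pCons (- 1) p)" using p Fneg[OF F1] by (simp add: FP_pCons)
   ultimately show False using transc[OF a] by fastforce
  qed
  thus ?thesis using sradj[OF srF] by (simp add: Z_def)
 qed
 hence "Z \<noteq> {}" by blast
 moreover have "\<Union>C \<in> Z" if C: "C \<noteq> {}" "subset.chain Z C" for C
 proof -
  have CZ: "C \<subseteq> Z" and ch: "!!R R'. R \<in> C ==> R' \<in> C ==> R \<subseteq> R' \<or> R' \<subseteq> R"
   using C(2) by (auto simp: subset_chain_def)
  have "x + y \<in> \<Union>C \<and> x * y \<in> \<Union>C" if xy: "x \<in> \<Union>C" "y \<in> \<Union>C" for x y
  proof -
   obtain R R' where "R \<in> C" "x \<in> R" "R' \<in> C" "y \<in> R'" using xy by blast
   then obtain R where R: "R \<in> C" "x \<in> R" "y \<in> R" using ch by blast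
   have "sr R" using CZ R(1) by (auto simp: Z_def)
   thus ?thesis using srD(1,2)[OF _ R(2,3)] R(1) by blast
  qed
  moreover obtain R0 where R0: "R0 \<in> C" using C(1) by blast
  hence "F \<subseteq> R0" "a \<in> R0" using CZ by (auto simp: Z_def sr_def)
  hence "F \<subseteq> \<Union>C" "a \<in> \<Union>C" using R0 by blast+
  moreover have "inverse a \<notin> \<Union>C" using CZ by (auto simp: Z_def)
  ultimately show ?thesis by (simp add: Z_def sr_def)
 qed
 ultimately obtain R where R: "R \<in> Z" "!!R'. R' \<in> Z ==> R \<subseteq> R' ==> R' = R"
  using subset_Zorn_nonempty[of Z] by metis
 have sR: "sr R" and aR: "a \<in> R" "inverse a \<notin> R" using R(1) by (auto simp: Z_def)
 note RD = srD[OF sR]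
 have R01: "0 \<in> R" "1 \<in> R" using F0 F1 sR by (auto simp: sr_def)
 \<comment> \<open>By maximality, adjoining any new element must produce 1/a.\<close>
 have inv_adj: "inverse a \<in> adj R y" if "y \<notin> R" for y
 proof (rule ccontr)
  assume "inverse a \<notin> adj R y"
  hence "adj R y \<in> Z" using sradj[OF sR, of y] aR by (auto simp: Z_def)
  from R(2)[OF this sradj(2)[OF sR]] have "adj R y = R" .
  thus False using sradj(3)[OF sR, of y] that by simp
 qed
 \<comment> \<open>Otherwise 1/a is a polynomial in the inverse of 1 - a s. Multiplying by the n-th
   power of 1 - a s, which has the form 1 - a g, gives 1/a - g in R and so 1/a in R, a
   contradiction.\<close>
 have unit: "inverse (1 - a * s) \<in> R \<and> 1 - a * s \<noteq> 0" if s: "s \<in> R" for s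
 proof -
  have nz: "1 - a * s \<noteq> 0"
  proof
   assume "1 - a * s = 0"
   hence "s = inverse a" using a0 by (simp add: field_simps)
   thus False using s aR by simp
  qed
  moreover have "inverse (1 - a * s) \<in> R"
  proof (rule ccontr)
   let ?y = "inverse (1 - a * s)"
   assume "?y \<notin> R"
   from inv_adj[OF this] obtain n c where c: "\<forall>i. c i \<in> R" "inverse a = (\<Sum>i\<le>n. c i * ?y ^ i)"
    unfolding adj_def by blast
   have oR: "1 - a * s \<in> R" by (intro RD(4)[OF R01(2)] RD(2)[OF aR(1)] s)
   have "(1 - a * s) ^ n * inverse a = (\<Sum>i\<le>n. c i * (1 - a * s) ^ (n - i))"
    unfolding c(2) sum_distrib_left
   proof (rule sum.cong[OF refl])
    fix i assume "i \<in> {..n}"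
    hence "(1 - a * s) ^ n = (1 - a * s) ^ (n - i) * (1 - a * s) ^ i" by (simp flip: power_add)
    moreover have "(1 - a * s) ^ i * ?y ^ i = 1" using nz by (simp flip: power_mult_distrib)
    ultimately show "(1 - a * s) ^ n * (c i * ?y ^ i) = c i * (1 - a * s) ^ (n - i)" by (simp add: mult_ac)
   qed
   also have "\<dots> \<in> R" by (intro fsub_sum[OF RD(7)[OF R01]] RD(2) RD(6)[OF oR oR]) (use c(1) in auto)
   finally have 1: "(1 - a * s) ^ n * inverse a \<in> R" .
   have "\<exists>g\<in>R. (1 - a * s) ^ j = 1 - a * g" for j
   proof (induction j)
    case (Suc j)
    then obtain g where g: "g \<in> R" "(1 - a * s) ^ j = 1 - a * g" by blast
    have "(1 - a * s) * (1 - a * g) = 1 - a * (s + g - a * (s * g))" by (simp add: algebra_simps)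
    moreover have "s + g - a * (s * g) \<in> R" by (intro RD(4) RD(1) RD(2) s g aR)
    ultimately show ?case using g(2) by (metis power_Suc)
   qed (use R01 in auto)
   then obtain g where g: "g \<in> R" "(1 - a * s) ^ n = 1 - a * g" by blast
   have "(1 - a * g) * inverse a + g \<in> R" using RD(1)[OF 1[unfolded g(2)] g(1)] .
   moreover have "(1 - a * g) * inverse a + g = inverse a" using a0 by (simp add: field_simps)
   ultimately show False using aR(2) by (simp only:)
  qed
  ultimately show ?thesis by blast
 qed
 define rep where "rep y n \<longleftrightarrow> (\<exists>c. (\<forall>i::nat. c i \<in> R) \<and> inverse a = (\<Sum>i\<le>n. c i * y ^ i))" for y and n :: nat
 have rep_mono: "rep y n" if "rep y m" "m \<le> n" for y m n
  using that adjE[OF _ _ that(2) sR] unfolding rep_def by metis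
 \<comment> \<open>The expansion in 1/y, multiplied by y^(m+1), expresses y^(m+1) by lower powers:
   its leading factor 1/a - g_0 equals (1 - a g_0)/a, and 1 - a g_0 is a unit of R. Substituting
   into the expansion in y shortens it by one.\<close>
 have red: "rep y m" if y: "y \<noteq> 0" and r1: "rep y (Suc m)" and r2: "rep (inverse y) (Suc m)" for y m
 proof -
  obtain p g where p: "\<forall>i. p i \<in> R" "inverse a = (\<Sum>i\<le>Suc m. p i * y ^ i)"
   and g: "\<forall>i. g i \<in> R" "inverse a = (\<Sum>i\<le>Suc m. g i * inverse y ^ i)"
   using r1 r2 unfolding rep_def by blast
  have "y ^ Suc m * inverse a = (\<Sum>i\<le>Suc m. g i * y ^ (Suc m - i))"
   unfolding g(2) sum_distrib_left
  proof (rule sum.cong[OF refl])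
   fix i assume "i \<in> {..Suc m}"
   hence "y ^ Suc m = y ^ (Suc m - i) * y ^ i" by (simp flip: power_add del: power_Suc)
   moreover have "y ^ i * inverse y ^ i = 1" using y by (simp flip: power_mult_distrib)
   ultimately show "y ^ Suc m * (g i * inverse y ^ i) = g i * y ^ (Suc m - i)"
    by (simp add: mult_ac del: power_Suc)
  qed
  also have "\<dots> = (\<Sum>j\<le>Suc m. g (Suc m - j) * y ^ j)"
   by (rule sum.reindex_bij_witness[of _ "\<lambda>j. Suc m - j" "\<lambda>j. Suc m - j"]) auto
  also have "\<dots> = (\<Sum>j\<le>m. g (Suc m - j) * y ^ j) + g 0 * y ^ Suc m" by simp
  finally have *: "y ^ Suc m * (inverse a - g 0) = (\<Sum>j\<le>m. g (Suc m - j) * y ^ j)"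
   by (simp add: algebra_simps del: power_Suc)
  let ?e = "inverse (1 - a * g 0)"
  have e: "?e \<in> R" "1 - a * g 0 \<noteq> 0" using unit g(1) by auto
  have "a * (inverse a - g 0) = 1 - a * g 0" using a0 by (simp add: right_diff_distrib)
  hence "a * ?e * (inverse a - g 0) = 1" using e(2) by (simp add: mult.commute[of a] mult.assoc)
  hence **: "y ^ Suc m = a * ?e * (\<Sum>j\<le>m. g (Suc m - j) * y ^ j)"
   unfolding *[symmetric] by (simp only: mult.left_commute mult.right_neutral)
  have "inverse a = (\<Sum>j\<le>m. p j * y ^ j) + p (Suc m) * (a * ?e * (\<Sum>j\<le>m. g (Suc m - j) * y ^ j))"
   unfolding p(2) by (simp add: **[symmetric] del: power_Suc)
  also have "\<dots> = (\<Sum>j\<le>m. (p j + p (Suc m) * (a * ?e * g (Suc m - j))) * y ^ j)"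
   by (simp add: distrib_right distrib_left sum.distrib sum_distrib_left mult_ac)
  finally show ?thesis unfolding rep_def
   using p(1) g(1) e(1) aR(1) RD(1,2) by (intro exI[of _ "\<lambda>j. p j + p (Suc m) * (a * ?e * g (Suc m - j))"]) simp
 qed
 \<comment> \<open>Descent on the sum of the two lengths: the longer expansion can always be
   shortened by the other, and length 0 would put 1/a into R.\<close>
 have no: False if "y \<noteq> 0" "rep y m" "rep (inverse y) l" for y m l
  using that
 proof (induction "m + l" arbitrary: y m l rule: less_induct)
  case less
  have r0: "\<not> rep y' 0" for y' using aR(2) by (auto simp: rep_def)
  obtain m' where m: "m = Suc m'" using less.prems(2) r0[of y] by (cases m) simp_all
  obtain l' where l: "l = Suc l'" using less.prems(3) r0[of "inverse y"] by (cases l) simp_all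
  note ml = m l
  show False
  proof (cases "l \<le> m")
   case True
   have "rep y m'" using red[of y m'] less.prems rep_mono[OF less.prems(3) True] ml by simp
   thus False using less.hyps[of m' l y] less.prems ml by simp
  next
   case False
   hence "rep (inverse (inverse y)) l" using rep_mono[OF less.prems(2)] by simp
   hence "rep (inverse y) l'" using red[of "inverse y" l'] less.prems ml by simp
   thus False using less.hyps[of m l' y] less.prems ml by simp
  qed
 qed
 have val: "y \<in> R \<or> inverse y \<in> R" for y
 proof (rule ccontr)
  assume n: "\<not> (y \<in> R \<or> inverse y \<in> R)"
  hence "y \<noteq> 0" using R01 by auto
  moreover obtain m where "rep y m" using inv_adj[of y] n unfolding adj_def rep_def by auto
  moreover obtain l where "rep (inverse y) l" using inv_adj[of "inverse y"] n unfolding adj_def rep_def by auto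
  ultimately show False using no by blast
 qed
 have "cring (ring_on R)" by (rule cring_ring_on) (use R01 RD(1,2,3) in auto)
 moreover have "(ring_on UNIV)\<lparr>carrier := R\<rparr> = ring_on R" by (simp add: ring_on_def)
 ultimately have "subring R (ring_on UNIV)"
  using ring.subring_iff[OF cring.axioms(1)[OF cring_ring_on_UNIV], of R] by (simp add: cring.axioms(1))
 hence "place R" using val sR aR(2) unfolding is_place_def sr_def by auto
 thus ?thesis using aR(2) by (auto simp: mx_def)
qed

text \<open>A nonconstant a has a zero, and so has 1/a. The zero of 1/a is a pole of a, hence it is
  V0; the zero of a is therefore a different place, at which a is not invertible.\<close>

lemma nonconstant_nonunit:
 assumes V0: "place V0"
 shows "\<exists>a. a \<noteq> 0 \<and> (\<forall>V. place V --> V \<noteq> V0 --> a \<in> V) \<and> (\<exists>V. place V \<and> V \<noteq> V0 \<and> inverse a \<notin> V)"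
proof -
 obtain a where a: "a \<notin> F" "\<forall>V. place V --> V \<noteq> V0 --> a \<in> V" using nonconstant[OF V0] by blast
 have a0: "a \<noteq> 0" "inverse a \<notin> F" using a(1) F0 Finv[of "inverse a"] by auto
 obtain V where V: "place V" "a \<in> mx V" using exists_place[OF a(1)] by (elim exE conjE)
 obtain V' where V': "place V'" "inverse a \<in> mx V'" using exists_place[OF a0(2)] by (elim exE conjE)
 have "a \<notin> V'" using V'(2) a0(1) by (simp add: mx_def)
 hence "V' = V0" using a(2) V'(1) by blast
 moreover have "a \<in> V" using mxD(1)[OF V] .
 ultimately have "V \<noteq> V0" using \<open>a \<notin> V'\<close> by blast
 moreover have "inverse a \<notin> V" using V(2) a0(1) by (simp add: mx_def)
 ultimately show ?thesis using a(2) a0(1) V(1) by blast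
qed

end

section \<open>From the function field to the analytic setting\<close>

text \<open>A second prime r dividing the order would give, by Sylow's theorem, a subgroup of order
  r, whose elements have an order dividing both r and p.\<close>

lemma (in group) order_prime_power:
 assumes fin: "finite (carrier G)" and p: "Factorial_Ring.prime p" and x: "!!x. x \<in> carrier G ==> x [^] (p::nat) = \<one>"
 shows "\<exists>k. Coset.order G = p ^ k"
proof -
 have "Coset.order G \<noteq> 0" using fin by (simp add: order_gt_0_iff_finite)
 moreover have "\<not> is_unit p" using prime_gt_1_nat[OF p] by simp
 ultimately obtain m where m: "Coset.order G = p ^ multiplicity p (Coset.order G) * m" "\<not> p dvd m"
  by (rule multiplicity_decompose')
 have "m = 1"
 proof (rule ccontr)
  assume "m \<noteq> 1"
  then obtain r where r: "Factorial_Ring.prime r" "r dvd m" using prime_factor_nat by blast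
  then obtain m' where "m = r * m'" by blast
  hence o: "Coset.order G = r ^ 1 * (p ^ multiplicity p (Coset.order G) * m')" using m(1) by (simp add: mult_ac)
  obtain H where H: "subgroup H G" "card H = r ^ 1" using sylow_thm[OF r(1) is_group o fin] by blast
  have "\<not> H \<subseteq> {\<one>}"
  proof
   assume "H \<subseteq> {\<one>}"
   hence "card H \<le> 1" using card_mono[of "{\<one>}" H] by simp
   thus False using H(2) prime_gt_1_nat[OF r(1)] by simp
  qed
  then obtain h where h: "h \<in> H" "h \<noteq> \<one>" by blast
  have hG: "h \<in> carrier G" using subgroup.mem_carrier[OF H(1) h(1)] .
  interpret HG: group "G\<lparr>carrier := H\<rparr>" by (rule subgroup.subgroup_is_group[OF H(1) is_group])
  have "h [^]\<^bsub>G\<lparr>carrier := H\<rparr>\<^esub> Coset.order (G\<lparr>carrier := H\<rparr>) = \<one>\<^bsub>G\<lparr>carrier := H\<rparr>\<^esub>"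
   by (rule HG.pow_order_eq_1) (simp add: h)
  hence "h [^] r = \<one>" using H(2) by (simp add: Coset.order_def nat_pow_def)
  hence "ord h dvd r" "ord h dvd p" using pow_eq_id[OF hG] x[OF hG] by auto
  moreover have "r \<noteq> p" using r m(2) by blast
  hence "coprime r p" using r(1) p by (simp add: primes_coprime)
  ultimately have "ord h = 1" using coprime_common_divisor_nat[of r p "ord h"] by simp
  thus False using h(2) ord_eq_1[OF hG] by simp
 qed
 thus ?thesis using m(1) by (metis mult_1_right)
qed

lemma field_ring_on_UNIV: "field (ring_on (UNIV :: 'a::field set))"
 by (rule cring.cring_fieldI2[OF cring_ring_on_UNIV]) (auto intro: right_inverse)

lemma ring_on_UNIV: "ring (ring_on (UNIV :: 'a::comm_ring_1 set))"
 by (rule cring.axioms(1)[OF cring_ring_on_UNIV])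

lemma a_inv_ring_on [simp]: "\<ominus>\<^bsub>ring_on (UNIV :: 'a::comm_ring_1 set)\<^esub> x = - x"
 by (rule abelian_group.minus_equality[OF ring.is_abelian_group[OF ring_on_UNIV]]) simp_all

lemma inv_ring_on: "x \<noteq> 0 ==> inv\<^bsub>ring_on (UNIV :: 'a::field set)\<^esub> x = inverse x"
 by (rule comm_monoid.comm_inv_char[OF cring.axioms(2)[OF cring_ring_on_UNIV]]) simp_all

text \<open>Links the two representations of polynomials: lists with the highest coefficient first,
  on which algebraicity is defined, and the type \<open>poly\<close>.\<close>

lemma eval_rev_coeffs:
 "ring.eval (ring_on UNIV) (rev (Polynomial.coeffs p)) y = poly p (y :: 'a::field)"
proof (induction p)
 case 0 show ?case by (simp add: ring.eval.simps[OF ring_on_UNIV])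
next
 case (pCons a p)
 have "ring.eval (ring_on UNIV) (rev (Polynomial.coeffs p) @ [a]) y = poly p y * y + a"
  using ring.eval_append_aux[OF ring_on_UNIV, of "rev (Polynomial.coeffs p)" a y] pCons by simp
 thus ?case using pCons by (auto simp: cCons_def mult.commute add.commute)
qed

lemma finite_function_fieldI:
 fixes F :: "'Q::field set"
 assumes g: "global_function_field F"
 shows "finite_function_field F"
proof -
 note R = ring_on_UNIV[where 'a = 'Q]
 have sF: "subfield F (ring_on UNIV)" and fin: "finite F"
  and alg: "!!x. ring.algebraic (ring_on UNIV) F x ==> x \<in> F"
  using g by (auto simp: global_function_field_def)
 note sr = subringE[OF subfieldE(1)[OF sF], simplified]
 have inv: "inverse c \<in> F" if "c \<in> F" for c
  using ring.subfield_m_inv(1)[OF R sF, of c] that sr(2) by (cases "c = 0") (auto simp: inv_ring_on)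
 interpret finite_const_field F
  by unfold_locales (assumption | rule sr(2,3,5,6,7) inv fin)+
 obtain x where dim: "ring.finite_dimension (ring_on UNIV) (generate_field (ring_on UNIV) (insert x F)) UNIV"
  using g by (auto simp: global_function_field_def)
 let ?K = "generate_field (ring_on UNIV) (insert x F)"
 \<comment> \<open>The generated field is abstract; containing it in explicit fractions makes it
   possible to clear denominators.\<close>
 define G where "G = {poly p x / poly d x | p d. FP p \<and> FP d \<and> poly d x \<noteq> 0}"
 have GI: "FP p ==> FP d ==> poly d x \<noteq> 0 ==> v = poly p x / poly d x ==> v \<in> G" for p d v
  unfolding G_def by blast
 have "h \<in> G" if "h \<in> ?K" for h
  using that
 proof (induction rule: generate_field.induct)
  case one show ?case by (rule GI[of 1 1]) (use FP_simps(2) in auto)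
 next
  case (incl h)
  have "FP [:h:]" if "h \<in> F" using that F0 by (simp add: FP_pCons)
  moreover have "FP [:0, 1:]" using F0 F1 by (simp add: FP_pCons)
  ultimately show ?case using incl GI[of "[:h:]" 1] GI[of "[:0,1:]" 1] FP_simps(2) by auto
 next
  case (a_inv h)
  then obtain p d where "FP p" "FP d" "poly d x \<noteq> 0" "h = poly p x / poly d x" unfolding G_def by blast
  thus ?case using GI[of "- p" d] FP_simps(4) by simp
 next
  case (m_inv h)
  then obtain p d where "FP p" "FP d" "poly d x \<noteq> 0" "h = poly p x / poly d x" unfolding G_def by blast
  thus ?case using GI[of d p] m_inv(2) by (simp add: inv_ring_on)
 next
  case (eng_add h h')
  then obtain p d p' d' where pd: "FP p" "FP d" "poly d x \<noteq> 0" "h = poly p x / poly d x"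
   "FP p'" "FP d'" "poly d' x \<noteq> 0" "h' = poly p' x / poly d' x" unfolding G_def by blast
  have "FP (p * d' + p' * d)" "FP (d * d')" using pd FP_simps(3,5) by blast+
  thus ?case using pd by (intro GI[of "p * d' + p' * d" "d * d'"]) (simp_all add: add_frac_eq)
 next
  case (eng_mult h h')
  then obtain p d p' d' where pd: "FP p" "FP d" "poly d x \<noteq> 0" "h = poly p x / poly d x"
   "FP p'" "FP d'" "poly d' x \<noteq> 0" "h' = poly p' x / poly d' x" unfolding G_def by blast
  have "FP (p * p')" "FP (d * d')" using pd FP_simps(5) by blast+
  thus ?case using pd by (intro GI[of "p * p'" "d * d'"]) simp_all
 qed
 hence KG: "?K \<subseteq> G" by blast
 have sK: "subfield ?K (ring_on UNIV)" by (rule field.generate_field_is_subfield[OF field_ring_on_UNIV]) simp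
 obtain n where "ring.dimension (ring_on UNIV) n ?K UNIV"
  using dim ring.finite_dimension_def[OF R] by auto
 then obtain Us where Us: "length Us = n" "ring.Span (ring_on UNIV) ?K Us = UNIV"
  using ring.exists_base[OF R sK] by blast
 have comb: "\<exists>d p. FP d \<and> poly d x \<noteq> 0 \<and> (\<forall>i. FP (p i)) \<and>
   poly d x * ring.combine (ring_on UNIV) Ks Us = (\<Sum>i<length Us. poly (p i) x * Us ! i)"
  if "length Ks = length Us" "set Ks \<subseteq> G" for Ks Us
  using that
 proof (induction Ks Us rule: list_induct2)
  case Nil
  show ?case using FP_simps(1,2) by (intro exI[of _ 1] exI[of _ "\<lambda>_. 0"]) (simp add: ring.combine.simps[OF R])
 next
  case (Cons k Ks u Us)
  then obtain d p where dp: "FP d" "poly d x \<noteq> 0" "\<forall>i. FP (p i)"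
   "poly d x * ring.combine (ring_on UNIV) Ks Us = (\<Sum>i<length Us. poly (p i) x * Us ! i)" by auto
  obtain p' d' where k: "FP p'" "FP d'" "poly d' x \<noteq> 0" "k = poly p' x / poly d' x"
   using Cons.prems unfolding G_def by auto
  let ?p = "case_nat (d * p') (\<lambda>i. d' * p i)"
  have FPs: "FP (d * d')" "\<forall>i. FP (?p i)" using FP_simps(5)[of d d'] FP_simps(5)[of d p'] FP_simps(5)[of d'] dp k
   by (simp_all split: nat.splits)
  have "poly (d * d') x * ring.combine (ring_on UNIV) (k # Ks) (u # Us) =
    poly d x * (poly d' x * k) * u + poly d' x * (poly d x * ring.combine (ring_on UNIV) Ks Us)"
   by (simp add: ring.combine.simps[OF R] algebra_simps)
  also have "\<dots> = (\<Sum>i<length (u # Us). poly (?p i) x * (u # Us) ! i)"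
   unfolding dp(4) length_Cons sum.lessThan_Suc_shift using k(3) by (simp add: k(4) sum_distrib_left mult.assoc)
  finally have eq: "poly (d * d') x * ring.combine (ring_on UNIV) (k # Ks) (u # Us) =
    (\<Sum>i<length (u # Us). poly (?p i) x * (u # Us) ! i)" .
  have "poly (d * d') x \<noteq> 0" using dp(2) k(3) by simp
  thus ?case using FPs eq by (intro exI[of _ "d * d'"] exI[of _ ?p] conjI)
 qed
 have gen: "\<exists>d N. FP d \<and> poly d x \<noteq> 0 \<and> poly d x * w \<in> fspan x n (\<lambda>i. Us ! i) N" for w
 proof -
  have "w \<in> ring.Span (ring_on UNIV) ?K Us" using Us by simp
  then obtain Ks where Ks: "w = ring.combine (ring_on UNIV) Ks Us" "length Ks = length Us" "set Ks \<subseteq> ?K"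
   using ring.Span_eq_combine_set_length_version[OF R sK, of Us] by auto
  obtain d p where dp: "FP d" "poly d x \<noteq> 0" "\<forall>i. FP (p i)" "poly d x * w = (\<Sum>i<n. poly (p i) x * Us ! i)"
   using comb[OF Ks(2)] Ks(1,3) KG Us(1) by blast
  define N where "N = (\<Sum>i<n. degree (p i))"
  define p' where "p' i = (if i < n then p i else 0)" for i
  have "degree (p i) \<le> N" if "i < n" for i unfolding N_def using that by (intro member_le_sum) auto
  hence "\<forall>i. FP (p' i) \<and> degree (p' i) \<le> N" using dp(3) F0 by (simp add: p'_def)
  moreover have "poly d x * w = (\<Sum>i<n. poly (p' i) x * Us ! i)" by (simp add: dp(4) p'_def)
  ultimately have "poly d x * w \<in> fspan x n (\<lambda>i. Us ! i) N" unfolding fspan_def by blast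
  thus ?thesis using dp(1,2) by blast
 qed
 have "y \<in> F" if p: "FP p" "p \<noteq> 0" "poly p y = 0" for p y
 proof (rule alg)
  let ?l = "rev (Polynomial.coeffs p)"
  have "set ?l \<subseteq> F" using p(1) by (auto simp: Polynomial.coeffs_def split: if_splits)
  moreover have "hd ?l \<noteq> 0" using p(2) by (simp add: hd_rev last_coeffs_eq_coeff_degree)
  ultimately have "polynomial\<^bsub>ring_on UNIV\<^esub> F ?l" by (simp add: polynomial_def)
  hence 1: "?l \<in> carrier (univ_poly (ring_on UNIV) F)" by (simp add: univ_poly_carrier)
  have 2: "[] \<in> carrier (univ_poly (ring_on UNIV) F)" by (simp add: polynomial_def flip: univ_poly_carrier)
  have "ring.eval (ring_on UNIV) ?l y = ring.eval (ring_on UNIV) [] y"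
   using p(3) by (simp add: eval_rev_coeffs ring.eval.simps[OF R])
  moreover have "?l \<noteq> []" using p(2) by simp
  ultimately show "ring.algebraic (ring_on UNIV) F y"
   unfolding ring.transcendental_def[OF R] inj_on_def using 1 2 by blast
 qed
 thus ?thesis using gen by unfold_locales blast+
qed

text \<open>Any m elements of A are dependent over F[y], with m from \<open>dependent\<close>. By
  \<open>depend_shift\<close> they are then dependent over F modulo y A, which is contained in
  I.\<close>

lemma (in finite_function_field) quotient_finite:
 assumes A: "fsub A" and I: "fsub I" and y: "y \<notin> F" "y \<noteq> 0" "!!a. a \<in> A ==> y * a \<in> I \<and> y * a \<in> A"
 shows "\<exists>T. finite T \<and> (\<forall>a\<in>A. \<exists>v\<in>T. a - v \<in> I)"
proof -
 obtain m :: nat where m: "\<forall>w. \<exists>c. (\<forall>i. FP (c i)) \<and> (\<exists>i<m. c i \<noteq> 0) \<and> (\<Sum>i<m. poly (c i) y * w i) = 0"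
  using dependent[of y] ..
 have "m \<noteq> 0" using m by (intro notI) simp
 then obtain n where n: "m = Suc n" using not0_implies_Suc by blast
 have "depend I w (Suc n)" if w: "!!i. i < Suc n ==> w i \<in> A" for w
 proof -
  obtain c where c: "\<forall>i. FP (c i)" "\<exists>i<Suc n. c i \<noteq> 0" "(\<Sum>i<Suc n. poly (c i) y * w i) = 0"
   using m[THEN spec, of w] unfolding n by blast
  have "depend ((\<lambda>w. y * w) ` A) w (Suc n)" by (rule depend_shift[OF A _ w y(2) c]) (use y(3) in auto)
  then obtain a where a: "\<forall>i. a i \<in> F" "\<exists>i<Suc n. a i \<noteq> 0" "(\<Sum>i<Suc n. a i * w i) \<in> (\<lambda>w. y * w) ` A"
   unfolding depend_def by blast
  have "(\<lambda>w. y * w) ` A \<subseteq> I" using y(3) by blast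
  hence "(\<Sum>i<Suc n. a i * w i) \<in> I" using a(3) by (rule subsetD)
  thus ?thesis using a(1,2) unfolding depend_def by (intro exI[of _ a] conjI)
 qed
 thus ?thesis using depend_cover[OF I, of n A] by blast
qed

lemma shtuka_setting_ana:
 fixes S :: "('Q::field, 'K::complete_nonarch_field, 'k::field) shtuka_base"
 assumes S: "shtuka_setting S"
 shows "ana_setting S"
proof -
 define A where "A = curve_ring S"
 define E where "E = eps S"
 define F where "F = fconst S"
 note defs = S[unfolded shtuka_setting_def, folded A_def E_def F_def]
 have gff: "global_function_field F" and pl: "is_place F (infty S)"
  and hom: "gam S \<in> ring_hom (ring_on A) (ring_on val_ring)" and inj: "inj_on (gam S) A"
  and mx: "maximalideal E (ring_on A)"
  and uf: "eps_local_ideal S = (\<lambda>x. unif S * x) ` eps_local_ring S"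
  and rs: "res_map S \<in> ring_hom (ring_on val_ring) (ring_on UNIV)" "{x \<in> val_ring. res_map S x = 0} = val_ideal"
   "res_sec S \<in> ring_hom (ring_on UNIV) (ring_on val_ring)" "!!c. res_map S (res_sec S c) = c"
  using defs by blast+
 interpret finite_function_field F by (rule finite_function_fieldI[OF gff])
 have Adef: "A = \<Inter>{V. place V \<and> V \<noteq> infty S}" by (simp add: A_def F_def curve_ring_def)
 have A: "0 \<in> A" "1 \<in> A" "!!x y. x \<in> A ==> y \<in> A ==> x + y \<in> A" "!!x. x \<in> A ==> - x \<in> A"
  "!!x y. x \<in> A ==> y \<in> A ==> x * y \<in> A" "F \<subseteq> A"
  unfolding Adef using placeD(1-6) by auto
 interpret RA: cring "ring_on A" by (rule cring_ring_on) (use A in auto)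
 interpret mx: maximalideal E "ring_on A" by (rule mx)
 have Edef: "E = {a \<in> A. nabs (gam S a) < 1}" by (simp add: E_def A_def eps_def val_ideal_def)
 have g: "!!x. x \<in> A ==> nabs (gam S x) \<le> 1" "gam S 1 = 1" "!!x y. x \<in> A ==> y \<in> A ==> gam S (x * y) = gam S x * gam S y"
  "!!x y. x \<in> A ==> y \<in> A ==> gam S (x + y) = gam S x + gam S y"
  using hom[unfolded ring_on_hom] by (auto simp: val_ring_def)
 have "gam S 0 + gam S 0 = gam S 0 + 0" using g(4)[OF A(1,1)] by (simp only: add_0_right)
 hence g0: "gam S 0 = 0" by (simp only: add_left_cancel)
 have gnz: "gam S x \<noteq> 0" if "x \<in> A" "x \<noteq> 0" for x
  using inj_onD[OF inj, of x 0] that g0 A(1) by auto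
 have EA: "E \<subseteq> A" and E1: "1 \<notin> E" and E0: "0 \<in> E" by (auto simp: Edef g(2) g0 A(1,2))
 obtain a where a: "a \<noteq> 0" "a \<in> A" "inverse a \<notin> A"
  using nonconstant_nonunit[OF pl] unfolding Adef by blast
 \<comment> \<open>If the maximal ideal were zero, A would be a field. But \<open>a\<close> lies in
   A and its inverse does not, having a pole away from infinity.\<close>
 have "E \<noteq> {0}"
 proof
  assume E0: "E = {0}"
  have J: "ideal (PIdl\<^bsub>ring_on A\<^esub> a) (ring_on A)" by (rule RA.cgenideal_ideal) (simp add: a)
  have Jd: "PIdl\<^bsub>ring_on A\<^esub> a = {x * a | x. x \<in> A}" by (simp add: cgenideal_def)
  have "PIdl\<^bsub>ring_on A\<^esub> a = E \<or> PIdl\<^bsub>ring_on A\<^esub> a = carrier (ring_on A)"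
   by (rule mx.I_maximal[OF J]) (use E0 A(1,5) a(2) in \<open>auto simp: Jd intro: exI[of _ 0]\<close>)
  moreover have "a \<in> PIdl\<^bsub>ring_on A\<^esub> a" using A(2) by (auto simp: Jd intro: exI[of _ 1])
  hence "PIdl\<^bsub>ring_on A\<^esub> a \<noteq> E" using E0 a(1) by auto
  moreover have "1 \<notin> PIdl\<^bsub>ring_on A\<^esub> a"
  proof
   assume "1 \<in> PIdl\<^bsub>ring_on A\<^esub> a"
   then obtain x where "x \<in> A" "1 = x * a" by (auto simp: Jd)
   hence "inverse a = x" using inverse_unique[of a x] by (simp add: mult.commute)
   thus False using a(3) \<open>x \<in> A\<close> by simp
  qed
  ultimately show False using A(2) by auto
 qed
 then obtain y where y: "y \<in> E" "y \<noteq> 0" using E0 by blast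
 \<comment> \<open>A nonzero constant has its inverse in A, so its image would be a unit of R and
   not of absolute value below 1.\<close>
 have yF: "y \<notin> F"
 proof
  assume "y \<in> F"
  hence iy: "inverse y \<in> A" using Finv A(6) by blast
  have "gam S y * gam S (inverse y) = 1" using g(3)[of y "inverse y"] y EA iy g(2) by auto
  hence "nabs (gam S y) * nabs (gam S (inverse y)) = 1" by (metis nabs_mult nabs_one)
  moreover have "nabs (gam S y) < 1" "nabs (gam S (inverse y)) \<le> 1" using y g(1)[OF iy] by (auto simp: Edef)
  ultimately show False using nabs_nonneg[of "gam S y"] mult_left_le[of "nabs (gam S (inverse y))" "nabs (gam S y)"] by linarith
 qed
 have EI: "x * e \<in> E" if "x \<in> A" "e \<in> E" for x e using mx.I_l_closed[of e x] that by simp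
 have Eadd: "e + e' \<in> E" if "e \<in> E" "e' \<in> E" for e e' using mx.a_closed[of e e'] that by simp
 have fA: "fsub A" unfolding fsub_def using A(1,3,5,6) by auto
 have fE: "fsub E" unfolding fsub_def using E0 EI Eadd A(6) by auto
 have yE: "y * b \<in> E \<and> y * b \<in> A" if "b \<in> A" for b
  using EI[OF that y(1)] EA by (auto simp: mult.commute)
 from quotient_finite[OF fA fE yF y(2) yE] obtain T where T: "finite T" "\<forall>a\<in>A. \<exists>v\<in>T. a - v \<in> E" by blast
 let ?Q = "ring_on A Quot E"
 interpret Q: field ?Q by (rule mx.quotient_is_field[OF RA.is_cring])
 have cQ: "carrier ?Q = (\<Union>a\<in>A. {E +>\<^bsub>ring_on A\<^esub> a})"
  by (simp add: FactRing_def A_RCOSETS_def RCOSETS_def a_r_coset_def)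
 have "carrier ?Q \<subseteq> (\<lambda>v. E +>\<^bsub>ring_on A\<^esub> v) ` (T \<inter> A)"
 proof
  fix Y assume "Y \<in> carrier ?Q"
  then obtain b where b: "b \<in> A" "Y = E +>\<^bsub>ring_on A\<^esub> b" unfolding cQ by blast
  obtain v where v: "v \<in> T" "b - v \<in> E" using T(2) b(1) by blast
  have vA: "v \<in> A" using A(3)[OF b(1) A(4), of "b - v"] EA v(2) by auto
  have bv: "e + (b - v) \<in> E" "e - (b - v) \<in> E" if "e \<in> E" for e
   using fsubD(2,5)[OF fE that v(2)] by auto
  have h1: "\<exists>x\<in>E. e + v = x + b" if "e \<in> E" for e by (rule bexI[OF _ bv(2)[OF that]]) simp
  have h2: "\<exists>x\<in>E. e + b = x + v" if "e \<in> E" for e by (rule bexI[OF _ bv(1)[OF that]]) simp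
  have "E +>\<^bsub>ring_on A\<^esub> v = Y"
   unfolding b(2) a_r_coset_def' using h1 h2 by auto
  hence "Y = E +>\<^bsub>ring_on A\<^esub> v" by (rule sym)
  moreover have "v \<in> T \<inter> A" using v(1) vA by blast
  ultimately show "Y \<in> (\<lambda>v. E +>\<^bsub>ring_on A\<^esub> v) ` (T \<inter> A)" by (rule image_eqI)
 qed
 hence finQ: "finite (carrier ?Q)" using finite_subset[OF _ finite_imageI[of "T \<inter> A"]] T(1) by simp
 have qh: "qhat S = card (carrier ?Q)" by (simp add: qhat_def A_def E_def)
 have "card {\<zero>\<^bsub>?Q\<^esub>, \<one>\<^bsub>?Q\<^esub>} \<le> card (carrier ?Q)" by (rule card_mono[OF finQ]) simp
 hence q2: "2 \<le> qhat S" using Q.one_not_zero by (simp add: qh)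
 have gn: "gam S (of_nat n) = of_nat n" "of_nat n \<in> A" for n
 proof -
  show n: "of_nat n \<in> A" for n by (induction n) (use A in auto)
  show "gam S (of_nat n) = of_nat n" by (induction n) (use g n A(2) g0 in auto)
 qed
 \<comment> \<open>The finite constant field contains all multiples of 1, so the characteristic is
   positive; \<gamma> carries this over to K.\<close>
 have "\<not> inj_on (of_nat :: nat => 'Q) UNIV"
 proof
  assume i: "inj_on (of_nat :: nat => 'Q) UNIV"
  have "range (of_nat :: nat => 'Q) \<subseteq> F"
  proof
   fix v :: 'Q assume "v \<in> range of_nat"
   then obtain n where "v = of_nat n" by blast
   moreover have "of_nat n \<in> F" by (induction n) (use F0 F1 Fadd in auto)
   ultimately show "v \<in> F" by simp
  qed
  thus False using finite_imageD[OF finite_subset[OF _ Ffin] i] by simp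
 qed
 then obtain i j where ij: "i < j" "(of_nat i :: 'Q) = of_nat j" unfolding inj_on_def by (metis linorder_neqE_nat)
 have "(of_nat (j - i) :: 'Q) = 0" using ij by (simp add: of_nat_diff)
 hence "(of_nat (j - i) :: 'K) = 0" using gn(1)[of "j - i"] g0 by simp
 hence "CHAR('K) dvd (j - i)" by (simp add: of_nat_eq_0_iff_char_dvd)
 hence "CHAR('K) > 0" using ij(1) by (intro Nat.gr0I) auto
 hence p: "Factorial_Ring.prime CHAR('K)" by (rule prime_CHAR_semidom)
 let ?p = "CHAR('K)"
 have pQ: "(of_nat ?p :: 'Q) = 0"
  using gnz[OF gn(2), of ?p] gn(1)[of ?p] by auto
 have AG: "group (add_monoid ?Q)" by (rule Q.a_group)
 note AGm = group.is_monoid[OF AG]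
 \<comment> \<open>Multiples in the additive group of the residue field are computed in A, where p =
   0. So p kills this finite group, and its order is a power of p.\<close>
 have pw: "(E +>\<^bsub>ring_on A\<^esub> b) [^]\<^bsub>add_monoid ?Q\<^esub> n = E +>\<^bsub>ring_on A\<^esub> (of_nat n * b)" if b: "b \<in> A" for b and n :: nat
 proof (induction n)
  case 0
  have "(E +>\<^bsub>ring_on A\<^esub> b) [^]\<^bsub>add_monoid ?Q\<^esub> (0::nat) = \<one>\<^bsub>add_monoid ?Q\<^esub>" by (rule monoid.nat_pow_0[OF AGm])
  also have "\<dots> = E +>\<^bsub>ring_on A\<^esub> (of_nat 0 * b)" by (simp add: FactRing_def a_r_coset_def')
  finally show ?case .
 next
  case (Suc n)
  have "(E +>\<^bsub>ring_on A\<^esub> b) [^]\<^bsub>add_monoid ?Q\<^esub> Suc n =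
    (E +>\<^bsub>ring_on A\<^esub> b) [^]\<^bsub>add_monoid ?Q\<^esub> n \<otimes>\<^bsub>add_monoid ?Q\<^esub> (E +>\<^bsub>ring_on A\<^esub> b)" by (rule monoid.nat_pow_Suc[OF AGm])
  also have "\<dots> = (E +>\<^bsub>ring_on A\<^esub> (of_nat n * b)) <+>\<^bsub>ring_on A\<^esub> (E +>\<^bsub>ring_on A\<^esub> b)"
   unfolding Suc by (simp add: FactRing_def)
  also have "\<dots> = E +>\<^bsub>ring_on A\<^esub> (of_nat n * b + b)"
   using mx.a_rcos_sum[of "of_nat n * b" b] b A(5)[OF gn(2) b] by simp
  finally show ?case by (simp add: algebra_simps)
 qed
 have o1: "finite (carrier (add_monoid ?Q))" using finQ by simp
 have o2: "Y [^]\<^bsub>add_monoid ?Q\<^esub> ?p = \<one>\<^bsub>add_monoid ?Q\<^esub>" if Y: "Y \<in> carrier (add_monoid ?Q)" for Y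
 proof -
  obtain b where b: "b \<in> A" "Y = E +>\<^bsub>ring_on A\<^esub> b" using cQ Y by auto
  have "Y [^]\<^bsub>add_monoid ?Q\<^esub> ?p = (E +>\<^bsub>ring_on A\<^esub> b) [^]\<^bsub>add_monoid ?Q\<^esub> (0::nat)"
   unfolding b(2) pw[OF b(1)] by (simp add: pQ)
  also have "\<dots> = \<one>\<^bsub>add_monoid ?Q\<^esub>" by (rule monoid.nat_pow_0[OF AGm])
  finally show ?thesis .
 qed
 from group.order_prime_power[OF AG o1 p o2] have "\<exists>k. Coset.order (add_monoid ?Q) = ?p ^ k" .
 then obtain k where k: "qhat S = ?p ^ k" by (auto simp: qh Coset.order_def)
 have frob: "(x + y) ^ qhat S = x ^ qhat S + y ^ qhat S" for x y :: 'K
  by (rule freshmans_dream'[OF p k])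
 have "1 \<in> eps_local_ring S" unfolding eps_local_ring_def A_def[symmetric] E_def[symmetric]
  using A(2) E1 by - (rule CollectI, rule exI[of _ 1], rule exI[of _ 1], simp)
 hence "unif S \<in> eps_local_ideal S" unfolding uf by force
 then obtain a b where ab: "a \<in> E" "b \<in> A" "b \<notin> E" "unif S = a / b"
  unfolding eps_local_ideal_def A_def[symmetric] E_def[symmetric] by blast
 have "y \<in> eps_local_ideal S" unfolding eps_local_ideal_def A_def[symmetric] E_def[symmetric]
  using y(1) A(2) E1 by - (rule CollectI, rule exI[of _ y], rule exI[of _ 1], simp)
 hence "unif S \<noteq> 0" using y(2) unfolding uf by auto
 hence a0: "a \<noteq> 0" and b0: "b \<noteq> 0" using ab by auto
 have aA: "a \<in> A" using ab EA by blast
 \<comment> \<open>The value does not depend on the fraction chosen for the uniformizer: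
   cross-multiply in A and apply \<gamma>.\<close>
 have zeta: "zeta S = gam S a / gam S b"
  unfolding zeta_def A_def[symmetric] E_def[symmetric]
 proof (rule the_equality)
  show "\<exists>a'\<in>A. \<exists>b'\<in>A - E. unif S = a' / b' \<and> gam S a / gam S b = gam S a' / gam S b'"
   using aA ab by blast
  fix x assume "\<exists>a'\<in>A. \<exists>b'\<in>A - E. unif S = a' / b' \<and> x = gam S a' / gam S b'"
  then obtain a' b' where ab': "a' \<in> A" "b' \<in> A" "b' \<notin> E" "unif S = a' / b'" "x = gam S a' / gam S b'" by blast
  have b'0: "b' \<noteq> 0" using ab'(3) E0 by auto
  have "a' * b = a * b'" using ab(4) ab'(4) b0 b'0 by (simp add: field_simps)
  hence "gam S a' * gam S b = gam S a * gam S b'" using g(3) ab ab' aA by metis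
  thus "x = gam S a / gam S b" using gnz[OF ab(2) b0] gnz[OF ab'(2) b'0] ab'(5) by (simp add: frac_eq_eq)
 qed
 have "nabs (gam S b) = 1" using ab(2,3) g(1)[OF ab(2)] by (auto simp: Edef)
 moreover have "nabs (zeta S) * nabs (gam S b) = nabs (gam S a)"
  using gnz[OF ab(2) b0] by (simp add: zeta flip: nabs_mult)
 ultimately have zlt: "nabs (zeta S) < 1" using ab(1) by (simp add: Edef)
 have znz: "zeta S \<noteq> 0" using gnz[OF aA a0] gnz[OF ab(2) b0] by (simp add: zeta)
 show ?thesis by (rule ana_setting.intro[OF znz zlt q2 frob rs])
qed

section \<open>Free modules with a chosen basis\<close>

definition self_mod :: "'a ring => ('a, 'a) module"
 where "self_mod R = \<lparr>carrier = carrier R, monoid.mult = monoid.mult R, one = \<one>\<^bsub>R\<^esub>,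
  ring.zero = \<zero>\<^bsub>R\<^esub>, add = ring.add R, module.smult = monoid.mult R\<rparr>"

lemma self_mod_simps [simp]: "carrier (self_mod R) = carrier R" "x \<oplus>\<^bsub>self_mod R\<^esub> y = x \<oplus>\<^bsub>R\<^esub> y"
  "\<zero>\<^bsub>self_mod R\<^esub> = \<zero>\<^bsub>R\<^esub>" "x \<odot>\<^bsub>self_mod R\<^esub> y = x \<otimes>\<^bsub>R\<^esub> y"
 by (simp_all add: self_mod_def)

lemma self_mod_module:
 assumes "cring R"
 shows "module R (self_mod R)"
proof -
 interpret cring R by fact
 have "abelian_group (self_mod R)"
 proof (rule abelian_groupI)
  fix x assume "x \<in> carrier (self_mod R)"
  thus "\<exists>y\<in>carrier (self_mod R). y \<oplus>\<^bsub>self_mod R\<^esub> x = \<zero>\<^bsub>self_mod R\<^esub>"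
   by (intro bexI[of _ "\<ominus>\<^bsub>R\<^esub> x"]) (auto simp: l_neg)
 qed (auto simp: a_ac)
 thus ?thesis
  by (intro moduleI) (auto simp: assms l_distr r_distr m_assoc)
qed

text \<open>Freeness is given by generators together with dual coordinate functionals. In this form
  it passes to base changes by the universal property, and it yields unique coordinates when they
  are wanted.\<close>

definition free_fam :: "'a ring => ('a, 'm) module => nat => (nat => 'm) => bool"
 where "free_fam R U n u \<longleftrightarrow> cring R \<and> module R U \<and> gens R U (u ` {..<n}) \<and>
  (\<exists>l. \<forall>i<n. semilinear (id_hom R) U (self_mod R) (l i) \<and>
   (\<forall>j<n. l i (u j) = (if j = i then \<one>\<^bsub>R\<^esub> else \<zero>\<^bsub>R\<^esub>)))"

lemma free_famD:
 assumes "free_fam R U n u"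
 shows "cring R" "module R U" "gens R U (u ` {..<n})" "abelian_group U" "!!i. i < n ==> u i \<in> carrier U"
 using assms module_abelian by (auto simp: free_fam_def gens_def)

lemma semilinear_finsum:
 assumes f: "semilinear g U W f" and U: "abelian_group U" "abelian_group W" and "finite A" "c \<in> A \<rightarrow> carrier U"
 shows "f (\<Oplus>\<^bsub>U\<^esub>i\<in>A. c i) = (\<Oplus>\<^bsub>W\<^esub>i\<in>A. f (c i))"
 using assms(4,5)
proof (induction A rule: finite_induct)
 case empty
 thus ?case using semilinear_zero[OF f U]
  by (simp add: abelian_monoid.finsum_empty[OF abelian_group.axioms(1)] U)
next
 case (insert i A)
 have c: "c \<in> A \<rightarrow> carrier U" "c i \<in> carrier U" using insert by auto
 have fc: "(\<lambda>i. f (c i)) \<in> A \<rightarrow> carrier W" "f (c i) \<in> carrier W" using c semilinearD(1)[OF f] by auto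
 note fi = abelian_monoid.finsum_insert[OF abelian_group.axioms(1)]
 have "f (c i \<oplus>\<^bsub>U\<^esub> (\<Oplus>\<^bsub>U\<^esub>i\<in>A. c i)) = f (c i) \<oplus>\<^bsub>W\<^esub> f (\<Oplus>\<^bsub>U\<^esub>i\<in>A. c i)"
  using semilinearD(2)[OF f] c abelian_monoid.finsum_closed[OF abelian_group.axioms(1)[OF U(1)] c(1)] by blast
 thus ?case
  using insert(1,2,3) c fc by (simp add: fi[OF U(1)] fi[OF U(2)])
qed

lemma free_fam_ext:
 assumes U: "free_fam R U n u" and g: "rhom_ok g" "src g = R" and W: "module (tgt g) W"
  and w: "!!i. i < n ==> w i \<in> carrier W"
 shows "\<exists>f. semilinear g U W f \<and> (\<forall>i<n. f (u i) = w i)"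
proof -
 obtain l where l: "!!i. i < n ==> semilinear (id_hom R) U (self_mod R) (l i)"
  "!!i j. i < n ==> j < n ==> l i (u j) = (if j = i then \<one>\<^bsub>R\<^esub> else \<zero>\<^bsub>R\<^esub>)"
  using U by (auto simp: free_fam_def)
 interpret W: module "tgt g" W by (rule W)
 have lc: "l i x \<in> carrier R" if "i < n" "x \<in> carrier U" for i x
  using semilinearD(1)[OF l(1)[OF that(1)]] that(2) by auto
 have gc: "app g a \<in> carrier (tgt g)" if "a \<in> carrier R" for a using rhom_okD(6)[OF g(1)] that g(2) by simp
 define f where "f x = (\<Oplus>\<^bsub>W\<^esub>i\<in>{..<n}. app g (l i x) \<odot>\<^bsub>W\<^esub> w i)" for x
 have tc: "(\<lambda>i. app g (l i x) \<odot>\<^bsub>W\<^esub> w i) \<in> {..<n} \<rightarrow> carrier W" if "x \<in> carrier U" for x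
  using lc gc w that by auto
 have ghom: "app g (a \<oplus>\<^bsub>R\<^esub> b) = app g a \<oplus>\<^bsub>tgt g\<^esub> app g b" "app g (a \<otimes>\<^bsub>R\<^esub> b) = app g a \<otimes>\<^bsub>tgt g\<^esub> app g b"
  if "a \<in> carrier R" "b \<in> carrier R" for a b
  using rhom_okD(3)[OF g(1)] that g(2) by (auto simp: ring_hom_def)
 have "semilinear g U W f"
 proof (rule semilinearI)
  show "f x \<in> carrier W" if "x \<in> carrier U" for x
   unfolding f_def by (rule W.finsum_closed[OF tc[OF that]])
  show "f (x \<oplus>\<^bsub>U\<^esub> y) = f x \<oplus>\<^bsub>W\<^esub> f y" if x: "x \<in> carrier U" and y: "y \<in> carrier U" for x y
  proof -
   have "f (x \<oplus>\<^bsub>U\<^esub> y) = (\<Oplus>\<^bsub>W\<^esub>i\<in>{..<n}. app g (l i x) \<odot>\<^bsub>W\<^esub> w i \<oplus>\<^bsub>W\<^esub> app g (l i y) \<odot>\<^bsub>W\<^esub> w i)"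
    unfolding f_def
   proof (rule W.finsum_cong'[OF refl])
    fix i assume "i \<in> {..<n}"
    hence i: "i < n" by simp
    have "l i (x \<oplus>\<^bsub>U\<^esub> y) = l i x \<oplus>\<^bsub>R\<^esub> l i y" using semilinearD(2)[OF l(1)[OF i] x y] by simp
    thus "app g (l i (x \<oplus>\<^bsub>U\<^esub> y)) \<odot>\<^bsub>W\<^esub> w i = app g (l i x) \<odot>\<^bsub>W\<^esub> w i \<oplus>\<^bsub>W\<^esub> app g (l i y) \<odot>\<^bsub>W\<^esub> w i"
     using lc[OF i] x y gc w[OF i] by (simp add: ghom W.smult_l_distr)
   qed (use tc x y in auto)
   thus ?thesis unfolding f_def using W.finsum_addf[OF tc[OF x] tc[OF y]] by simp
  qed
  show "f (b \<odot>\<^bsub>U\<^esub> x) = app g b \<odot>\<^bsub>W\<^esub> f x" if b: "b \<in> carrier (src g)" and x: "x \<in> carrier U" for b x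
  proof -
   have b': "b \<in> carrier R" using b g(2) by simp
   have "f (b \<odot>\<^bsub>U\<^esub> x) = (\<Oplus>\<^bsub>W\<^esub>i\<in>{..<n}. app g b \<odot>\<^bsub>W\<^esub> (app g (l i x) \<odot>\<^bsub>W\<^esub> w i))"
    unfolding f_def
   proof (rule W.finsum_cong'[OF refl])
    fix i assume "i \<in> {..<n}"
    hence i: "i < n" by simp
    have "l i (b \<odot>\<^bsub>U\<^esub> x) = b \<otimes>\<^bsub>R\<^esub> l i x" using semilinearD(3)[OF l(1)[OF i], of b x] b' x by simp
    thus "app g (l i (b \<odot>\<^bsub>U\<^esub> x)) \<odot>\<^bsub>W\<^esub> w i = app g b \<odot>\<^bsub>W\<^esub> (app g (l i x) \<odot>\<^bsub>W\<^esub> w i)"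
     using lc[OF i x] gc w[OF i] b' by (simp add: ghom W.smult_assoc1)
   qed (use tc[OF x] gc[OF b'] in auto)
   thus ?thesis unfolding f_def using W.finsum_smult_ldistr[of "{..<n}" "app g b"] tc[OF x] gc[OF b'] by simp
  qed
 qed
 moreover have "f (u j) = w j" if j: "j < n" for j
 proof -
  have g01: "app g \<zero>\<^bsub>R\<^esub> = \<zero>\<^bsub>tgt g\<^esub>" "app g \<one>\<^bsub>R\<^esub> = \<one>\<^bsub>tgt g\<^esub>"
   using rhom_okD(3)[OF g(1)] g(2) ring_hom_zero[OF rhom_okD(3)[OF g(1)] rhom_okD(4,5)[OF g(1)]] by (auto simp: ring_hom_def)
  have "f (u j) = (\<Oplus>\<^bsub>W\<^esub>i\<in>{..<n}. if j = i then w i else \<zero>\<^bsub>W\<^esub>)"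
   unfolding f_def by (rule W.finsum_cong'[OF refl]) (use w j in \<open>auto simp: l(2) g01 W.smult_l_null\<close>)
  thus ?thesis using W.finsum_singleton[of j "{..<n}" w] j w by auto
 qed
 ultimately show ?thesis by blast
qed

lemma free_fam_bc:
 assumes U: "free_fam (src h) U n u" and h: "rhom_ok h"
 shows "free_fam (tgt h) (bc h U) n (\<lambda>i. bc_unit h U (u i))"
proof -
 note mU = free_famD(2)[OF U]
 obtain l where l: "!!i. i < n ==> semilinear (id_hom (src h)) U (self_mod (src h)) (l i)"
  "!!i j. i < n ==> j < n ==> l i (u j) = (if j = i then \<one>\<^bsub>src h\<^esub> else \<zero>\<^bsub>src h\<^esub>)"
  using U by (auto simp: free_fam_def)
 note hD = rhom_okD[OF h]
 have h01: "app h \<zero>\<^bsub>src h\<^esub> = \<zero>\<^bsub>tgt h\<^esub>" "app h \<one>\<^bsub>src h\<^esub> = \<one>\<^bsub>tgt h\<^esub>"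
  using hD(3) ring_hom_zero[OF hD(3) hD(4,5)] by (auto simp: ring_hom_def)
 define l' where "l' i = semilin_ext (id_hom (tgt h)) (bc h U) (self_mod (tgt h)) (carrier U) (bc_unit h U) (\<lambda>m. app h (l i m))" for i
 have sl: "semilinear h U (self_mod (tgt h)) (\<lambda>m. app h (l i m))" if "i < n" for i
 proof -
  have *: "semilinear h (self_mod (src h)) (self_mod (tgt h)) (app h)"
   by (rule semilinearI) (use hD(3) in \<open>auto simp: ring_hom_def\<close>)
  show ?thesis
   by (rule semilinear_comp[OF l(1)[OF that] *]) (use rhom_ok_id[OF hD(1)] in auto)
 qed
 have "semilinear (id_hom (tgt h)) (bc h U) (self_mod (tgt h)) (l' i)"
  and "!!m. m \<in> carrier U ==> l' i (bc_unit h U m) = app h (l i m)" if "i < n" for i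
  unfolding l'_def using bc_ext_spec[OF h mU rhom_ok_id[OF hD(2)] _ _ sl[OF that]] self_mod_module[OF hD(2)] by auto
 moreover have "gens (tgt h) (bc h U) ((\<lambda>i. bc_unit h U (u i)) ` {..<n})"
  using bc_gens[OF h mU free_famD(3)[OF U]] by (simp add: image_image)
 ultimately show ?thesis unfolding free_fam_def
  using hD(2) bc_module[OF h mU] free_famD(5)[OF U] l(2) h01 by (intro conjI exI[of _ l']) auto
qed

lemma free_fam_eqI:
 assumes "free_fam R U n u" "src g = R" "abelian_group W" "semilinear g U W f" "semilinear g U W f'"
  "!!i. i < n ==> f (u i) = f' (u i)" "x \<in> carrier U"
 shows "f x = f' x"
 by (rule semilinear_unique[where I = "u ` {..<n}", OF _ assms(4,5) free_famD(4)[OF assms(1)] assms(3) _ assms(7)])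
  (use free_famD(3)[OF assms(1)] assms(2,6) in auto)

lemma free_fam_rank:
 assumes U: "free_fam R U n u"
 shows "free_of_rank R U n"
proof -
 note D = free_famD[OF U]
 interpret U: module R U by (rule D(2))
 obtain l where l: "!!i. i < n ==> semilinear (id_hom R) U (self_mod R) (l i)"
  "!!i j. i < n ==> j < n ==> l i (u j) = (if j = i then \<one>\<^bsub>R\<^esub> else \<zero>\<^bsub>R\<^esub>)"
  using U by (auto simp: free_fam_def)
 interpret S: module R "self_mod R" by (rule self_mod_module[OF D(1)])
 have coord: "l i (\<Oplus>\<^bsub>U\<^esub>j\<in>{..<n}. c j \<odot>\<^bsub>U\<^esub> u j) = c i" if i: "i < n" and c: "c \<in> {..<n} \<rightarrow> carrier R" for c i
 proof -
  have "l i (\<Oplus>\<^bsub>U\<^esub>j\<in>{..<n}. c j \<odot>\<^bsub>U\<^esub> u j) = (\<Oplus>\<^bsub>self_mod R\<^esub>j\<in>{..<n}. l i (c j \<odot>\<^bsub>U\<^esub> u j))"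
   by (rule semilinear_finsum[OF l(1)[OF i] D(4) S.abelian_group_axioms]) (use c D(5) in auto)
  also have "\<dots> = (\<Oplus>\<^bsub>self_mod R\<^esub>j\<in>{..<n}. if i = j then c j else \<zero>\<^bsub>self_mod R\<^esub>)"
  proof (rule S.finsum_cong'[OF refl])
   fix j assume "j \<in> {..<n}"
   hence j: "j < n" "c j \<in> carrier R" using c by auto
   thus "l i (c j \<odot>\<^bsub>U\<^esub> u j) = (if i = j then c j else \<zero>\<^bsub>self_mod R\<^esub>)"
    using semilinearD(3)[OF l(1)[OF i], of "c j" "u j"] D(5)[OF j(1)] l(2)[OF i j(1)] by simp
  qed (use c in auto)
  also have "\<dots> = c i" using S.finsum_singleton[of i "{..<n}" c] i c by auto
  finally show ?thesis .
 qed
 have ex: "x = (\<Oplus>\<^bsub>U\<^esub>j\<in>{..<n}. l j x \<odot>\<^bsub>U\<^esub> u j)" if x: "x \<in> carrier U" for x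
 proof -
  define P where "P y \<longleftrightarrow> (\<exists>c\<in>{..<n} \<rightarrow> carrier R. y = (\<Oplus>\<^bsub>U\<^esub>j\<in>{..<n}. c j \<odot>\<^bsub>U\<^esub> u j))" for y
  have "P x"
   using D(3) x
  proof (induction rule: gens_induct)
   case zero
   show ?case unfolding P_def
    by (intro bexI[of _ "\<lambda>_. \<zero>\<^bsub>R\<^esub>"]) (use D(5) in \<open>auto simp: U.smult_l_null intro!: U.add.finprod_one_eqI[symmetric]\<close>)
  next
   case (add y y')
   then obtain c c' where c: "c \<in> {..<n} \<rightarrow> carrier R" "y = (\<Oplus>\<^bsub>U\<^esub>j\<in>{..<n}. c j \<odot>\<^bsub>U\<^esub> u j)"
    "c' \<in> {..<n} \<rightarrow> carrier R" "y' = (\<Oplus>\<^bsub>U\<^esub>j\<in>{..<n}. c' j \<odot>\<^bsub>U\<^esub> u j)" unfolding P_def by blast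
   have "y \<oplus>\<^bsub>U\<^esub> y' = (\<Oplus>\<^bsub>U\<^esub>j\<in>{..<n}. c j \<odot>\<^bsub>U\<^esub> u j \<oplus>\<^bsub>U\<^esub> c' j \<odot>\<^bsub>U\<^esub> u j)"
    unfolding c(2,4) by (rule U.finsum_addf[symmetric]) (use c D(5) in auto)
   also have "\<dots> = (\<Oplus>\<^bsub>U\<^esub>j\<in>{..<n}. (c j \<oplus>\<^bsub>R\<^esub> c' j) \<odot>\<^bsub>U\<^esub> u j)"
    by (rule U.finsum_cong'[OF refl]) (use c D(5) in \<open>auto simp: U.smult_l_distr Pi_iff\<close>)
   finally show ?case unfolding P_def using c(1,3) by (intro bexI[of _ "\<lambda>j. c j \<oplus>\<^bsub>R\<^esub> c' j"]) auto
  next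
   case (smult b y)
   then obtain i where i: "i < n" "y = u i" by auto
   have "(\<Oplus>\<^bsub>U\<^esub>j\<in>{..<n}. (if i = j then b else \<zero>\<^bsub>R\<^esub>) \<odot>\<^bsub>U\<^esub> u j) = (\<Oplus>\<^bsub>U\<^esub>j\<in>{..<n}. if i = j then b \<odot>\<^bsub>U\<^esub> u j else \<zero>\<^bsub>U\<^esub>)"
    by (rule U.finsum_cong'[OF refl]) (use smult(1) D(5) in \<open>auto simp: U.smult_l_null\<close>)
   also have "\<dots> = b \<odot>\<^bsub>U\<^esub> u i" using U.finsum_singleton[of i "{..<n}" "\<lambda>j. b \<odot>\<^bsub>U\<^esub> u j"] i D(5) smult(1) by auto
   finally show ?case unfolding P_def i(2)
    using smult(1) by (intro bexI[of _ "\<lambda>j. if i = j then b else \<zero>\<^bsub>R\<^esub>"]) auto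
  qed
  then obtain c where c: "c \<in> {..<n} \<rightarrow> carrier R" "x = (\<Oplus>\<^bsub>U\<^esub>j\<in>{..<n}. c j \<odot>\<^bsub>U\<^esub> u j)" unfolding P_def by blast
  have "(\<Oplus>\<^bsub>U\<^esub>j\<in>{..<n}. l j x \<odot>\<^bsub>U\<^esub> u j) = (\<Oplus>\<^bsub>U\<^esub>j\<in>{..<n}. c j \<odot>\<^bsub>U\<^esub> u j)"
   by (rule U.finsum_cong'[OF refl]) (use c D(5) coord in \<open>auto simp: c(2)\<close>)
  thus ?thesis using c(2) by simp
 qed
 have ux: "\<exists>!c. c \<in> {..<n} \<rightarrow>\<^sub>E carrier R \<and> x = (\<Oplus>\<^bsub>U\<^esub>i\<in>{..<n}. c i \<odot>\<^bsub>U\<^esub> u i)" if x: "x \<in> carrier U" for x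
 proof (rule ex1I[of _ "restrict (\<lambda>i. l i x) {..<n}"])
  have lc: "l i x \<in> carrier R" if "i < n" for i using semilinearD(1)[OF l(1)[OF that]] x by auto
  have eq: "(\<Oplus>\<^bsub>U\<^esub>i\<in>{..<n}. restrict (\<lambda>i. l i x) {..<n} i \<odot>\<^bsub>U\<^esub> u i) = (\<Oplus>\<^bsub>U\<^esub>j\<in>{..<n}. l j x \<odot>\<^bsub>U\<^esub> u j)"
   by (rule U.finsum_cong'[OF refl]) (use lc D(5) in auto)
  have r: "restrict (\<lambda>i. l i x) {..<n} \<in> {..<n} \<rightarrow>\<^sub>E carrier R" using lc by auto
  show "restrict (\<lambda>i. l i x) {..<n} \<in> {..<n} \<rightarrow>\<^sub>E carrier R \<and>
    x = (\<Oplus>\<^bsub>U\<^esub>i\<in>{..<n}. restrict (\<lambda>i. l i x) {..<n} i \<odot>\<^bsub>U\<^esub> u i)"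
   unfolding eq by (rule conjI[OF r ex[OF x]])
  fix c assume c: "c \<in> {..<n} \<rightarrow>\<^sub>E carrier R \<and> x = (\<Oplus>\<^bsub>U\<^esub>i\<in>{..<n}. c i \<odot>\<^bsub>U\<^esub> u i)"
  hence cP: "c \<in> {..<n} \<rightarrow> carrier R" by (simp add: PiE_iff Pi_iff)
  have ci: "c i = l i x" if "i < n" for i
   by (subst conjunct2[OF c]) (rule coord[OF that cP, symmetric])
  show "c = restrict (\<lambda>i. l i x) {..<n}" using c ci by (intro extensionalityI[of _ "{..<n}"]) (simp_all add: PiE_iff)
 qed
 have "u \<in> {..<n} \<rightarrow> carrier U" using D(5) by auto
 thus ?thesis
  unfolding free_of_rank_def free_basis_def by (intro conjI exI[of _ u] ballI D(2) ux)
qed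

text \<open>The values on a basis of a map that is an upper triangular 2 by 2 block on the first two
  vectors and the identity on the others, so that a single construction serves every rank n \<ge>
  2.\<close>

definition tri_val :: "('a, 'm) module => (nat => 'm) => 'a => 'a => 'a => nat => 'm"
 where "tri_val W w a b c i = (if i = 0 then a \<odot>\<^bsub>W\<^esub> w 0
  else if i = 1 then b \<odot>\<^bsub>W\<^esub> w 0 \<oplus>\<^bsub>W\<^esub> c \<odot>\<^bsub>W\<^esub> w 1 else w i)"

lemma semilinear_tri_val:
 assumes f: "semilinear g U W f" and U: "module (src g) U" and u: "!!i. i < n ==> u i \<in> carrier U"
  and n: "2 \<le> n" "i < n" and abc: "a \<in> carrier (src g)" "b \<in> carrier (src g)" "c \<in> carrier (src g)"
 shows "f (tri_val U u a b c i) = tri_val W (\<lambda>i. f (u i)) (app g a) (app g b) (app g c) i"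
proof -
 interpret U: module "src g" U by (rule U)
 have "u 0 \<in> carrier U" "u 1 \<in> carrier U" using u n(1) by auto
 thus ?thesis using semilinearD(2,3)[OF f] abc by (simp add: tri_val_def)
qed

lemma linear_tri_val:
 assumes "semilinear (id_hom R) U W f" "module R U" "!!i. i < n ==> u i \<in> carrier U" "2 \<le> n" "i < n"
  "a \<in> carrier R" "b \<in> carrier R" "c \<in> carrier R"
 shows "f (tri_val U u a b c i) = tri_val W (\<lambda>i. f (u i)) a b c i"
 using semilinear_tri_val[OF assms(1) _ assms(3-5), where a = a and b = b and c = c] assms(2,6-8) by simp

lemma tri_val_closed:
 assumes W: "module R W" and w: "!!i. i < n ==> w i \<in> carrier W" and n: "2 \<le> n" "i < n"
  and abc: "a \<in> carrier R" "b \<in> carrier R" "c \<in> carrier R"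
 shows "tri_val W w a b c i \<in> carrier W"
proof -
 interpret W: module R W by (rule W)
 have "w 0 \<in> carrier W" "w 1 \<in> carrier W" using w n(1) by auto
 thus ?thesis using w[OF n(2)] abc by (simp add: tri_val_def)
qed

lemma tri_val_inverse:
 fixes V :: "('a, 'm) module" and V' :: "('a, 'n) module" and a b c a' b' c' :: 'a
 assumes g: "semilinear (id_hom R) V V' g" "!!i. i < n ==> g (v i) = tri_val V' v' a b c i"
  and g': "semilinear (id_hom R) V' V g'" "!!i. i < n ==> g' (v' i) = tri_val V v a' b' c' i"
  and V: "module R V" "module R V'" "!!i. i < n ==> v i \<in> carrier V" "!!i. i < n ==> v' i \<in> carrier V'"
  and abc: "a \<in> carrier R" "b \<in> carrier R" "c \<in> carrier R" "a' \<in> carrier R" "b' \<in> carrier R" "c' \<in> carrier R"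
  and e: "a \<otimes>\<^bsub>R\<^esub> a' = \<one>\<^bsub>R\<^esub>" "c \<otimes>\<^bsub>R\<^esub> c' = \<one>\<^bsub>R\<^esub>" "b \<otimes>\<^bsub>R\<^esub> a' \<oplus>\<^bsub>R\<^esub> c \<otimes>\<^bsub>R\<^esub> b' = \<zero>\<^bsub>R\<^esub>"
  and n: "2 \<le> n" and i: "i < n"
 shows "g' (g (v i)) = v i"
proof -
 interpret V: module R V by (rule V(1))
 have v01: "v 0 \<in> carrier V" "v 1 \<in> carrier V" using V(3) n by auto
 have "g' (g (v i)) = tri_val V (\<lambda>i. g' (v' i)) a b c i"
  using semilinear_tri_val[OF g'(1) _ V(4) n i, where a = a and b = b and c = c] g(2)[OF i] V(2) abc by simp
 also have "\<dots> = v i"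
 proof -
  consider "i = 0" | "i = 1" | "2 \<le> i" by linarith
  thus ?thesis
  proof cases
   case 1
   thus ?thesis using g'(2)[of 0] n v01 abc by (simp add: tri_val_def e V.smult_assoc1[symmetric])
  next
   case 2
   have "b \<odot>\<^bsub>V\<^esub> (a' \<odot>\<^bsub>V\<^esub> v 0) \<oplus>\<^bsub>V\<^esub> c \<odot>\<^bsub>V\<^esub> (b' \<odot>\<^bsub>V\<^esub> v 0 \<oplus>\<^bsub>V\<^esub> c' \<odot>\<^bsub>V\<^esub> v 1) =
     (b \<otimes>\<^bsub>R\<^esub> a' \<oplus>\<^bsub>R\<^esub> c \<otimes>\<^bsub>R\<^esub> b') \<odot>\<^bsub>V\<^esub> v 0 \<oplus>\<^bsub>V\<^esub> (c \<otimes>\<^bsub>R\<^esub> c') \<odot>\<^bsub>V\<^esub> v 1"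
    using v01 abc by (simp add: V.smult_r_distr V.smult_l_distr V.smult_assoc1 V.a_assoc del: One_nat_def)
   thus ?thesis using 2 g'(2)[of 0] g'(2)[of 1] n v01
    by (simp add: tri_val_def e V.smult_l_null del: One_nat_def)
  next
   case 3
   thus ?thesis using g'(2)[OF i] by (simp add: tri_val_def)
  qed
 qed
 finally show ?thesis .
qed

lemma free_fam_tri_iso:
 assumes U: "free_fam R U n u" and W: "free_fam R W n w" and n: "2 \<le> n"
  and a: "a \<in> Units R" and c: "c \<in> Units R" and b: "b \<in> carrier R"
 shows "\<exists>f. module_iso R U W f \<and> (\<forall>i<n. f (u i) = tri_val W w a b c i)"
proof -
 note DU = free_famD[OF U] and DW = free_famD[OF W]
 interpret U: module R U by (rule DU(2))
 interpret W: module R W by (rule DW(2))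
 let ?a = "inv\<^bsub>R\<^esub> a" and ?c = "inv\<^bsub>R\<^esub> c"
 have ac: "a \<in> carrier R" "c \<in> carrier R" "?a \<in> carrier R" "?c \<in> carrier R"
  using a c by (auto simp: U.Units_closed)
 \<comment> \<open>The off-diagonal entry of the inverse of a triangular block, - b / (a c).\<close>
 let ?b = "\<ominus>\<^bsub>R\<^esub> (?a \<otimes>\<^bsub>R\<^esub> b \<otimes>\<^bsub>R\<^esub> ?c)"
 have b': "?b \<in> carrier R" using ac b by simp
 have id: "rhom_ok (id_hom R)" by (rule rhom_ok_id[OF DU(1)])
 obtain f where f: "semilinear (id_hom R) U W f" "!!i. i < n ==> f (u i) = tri_val W w a b c i"
  using free_fam_ext[OF U id, of W "tri_val W w a b c"] tri_val_closed[OF DW(2,5) n _ ac(1) b ac(2)] DW(2) by auto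
 obtain f' where f': "semilinear (id_hom R) W U f'" "!!i. i < n ==> f' (w i) = tri_val U u ?a ?b ?c i"
  using free_fam_ext[OF W id, of U "tri_val U u ?a ?b ?c"] tri_val_closed[OF DU(2,5) n _ ac(3) b' ac(4)] DU(2) by auto
 have u01: "u 0 \<in> carrier U" "u 1 \<in> carrier U" and w01: "w 0 \<in> carrier W" "w 1 \<in> carrier W"
  using DU(5) DW(5) n by auto
 have inv: "a \<otimes>\<^bsub>R\<^esub> ?a = \<one>\<^bsub>R\<^esub>" "?a \<otimes>\<^bsub>R\<^esub> a = \<one>\<^bsub>R\<^esub>" "c \<otimes>\<^bsub>R\<^esub> ?c = \<one>\<^bsub>R\<^esub>" "?c \<otimes>\<^bsub>R\<^esub> c = \<one>\<^bsub>R\<^esub>"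
  using a c by (simp_all add: U.Units_r_inv U.Units_l_inv)
 have aR: "abelian_group R" using DU(1) by (simp add: cring.axioms(1) ring.is_abelian_group)
 note neg = abelian_group.r_neg[OF aR] abelian_group.l_neg[OF aR]
 have e1: "b \<otimes>\<^bsub>R\<^esub> ?a \<oplus>\<^bsub>R\<^esub> c \<otimes>\<^bsub>R\<^esub> ?b = \<zero>\<^bsub>R\<^esub>"
 proof -
  have "c \<otimes>\<^bsub>R\<^esub> (?a \<otimes>\<^bsub>R\<^esub> b \<otimes>\<^bsub>R\<^esub> ?c) = b \<otimes>\<^bsub>R\<^esub> ?a \<otimes>\<^bsub>R\<^esub> (c \<otimes>\<^bsub>R\<^esub> ?c)" using ac b by (simp add: U.m_ac)
  thus ?thesis using ac b by (simp add: inv U.r_minus neg)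
 qed
 have e2: "?b \<otimes>\<^bsub>R\<^esub> a \<oplus>\<^bsub>R\<^esub> ?c \<otimes>\<^bsub>R\<^esub> b = \<zero>\<^bsub>R\<^esub>"
 proof -
  have "?a \<otimes>\<^bsub>R\<^esub> b \<otimes>\<^bsub>R\<^esub> ?c \<otimes>\<^bsub>R\<^esub> a = ?c \<otimes>\<^bsub>R\<^esub> b \<otimes>\<^bsub>R\<^esub> (a \<otimes>\<^bsub>R\<^esub> ?a)" using ac b by (simp add: U.m_ac)
  thus ?thesis using ac b by (simp add: inv U.l_minus neg)
 qed
 have idU: "semilinear (id_hom R) U U (\<lambda>x. x)" and idW: "semilinear (id_hom R) W W (\<lambda>x. x)"
  by (rule semilinearI; simp)+
 have c1: "semilinear (id_hom R) U U (\<lambda>x. f' (f x))" and c2: "semilinear (id_hom R) W W (\<lambda>x. f (f' x))"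
  by (rule semilinear_comp[OF f(1) f'(1)]; simp add: id) (rule semilinear_comp[OF f'(1) f(1)]; simp add: id)
 have i1: "f' (f x) = x" if "x \<in> carrier U" for x
  by (rule free_fam_eqI[OF U _ DU(4) c1 idU _ that])
   (use tri_val_inverse[OF f f' DU(2) DW(2) DU(5) DW(5) ac(1) b ac(2,3) b' ac(4) inv(1,3) e1 n] in auto)
 have i2: "f (f' x) = x" if "x \<in> carrier W" for x
  by (rule free_fam_eqI[OF W _ DW(4) c2 idW _ that])
   (use tri_val_inverse[OF f' f DW(2) DU(2) DW(5) DU(5) ac(3) b' ac(4,1) b ac(2) inv(2,4) e2 n] in auto)
 have "bij_betw f (carrier U) (carrier W)"
  by (rule bij_betw_byWitness[of _ f']) (use i1 i2 semilinearD(1)[OF f(1)] semilinearD(1)[OF f'(1)] in auto)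
 thus ?thesis using f by (auto simp: module_iso_def module_hom_def)
qed

section \<open>The two-sided series in the entries of the example\<close>

context ana_setting
begin

text \<open>Series in 1/z with constant term 1 that converge with all terms bounded by 1 at z =
  \<zeta>. The class is closed under products, so the bounds for the powers in the recursion come
  for free.\<close>

definition nrm :: "(int => 'K) => bool"
 where "nrm b \<longleftrightarrow> b \<in> carrier (Rzi S) \<and> (\<forall>i>0. b i = 0) \<and> b 0 = 1 \<and> (\<forall>j. nabs (b (- int j)) \<le> nabs z ^ j)"

lemma nrm_conv:
 assumes b: "nrm b" and c: "nrm c"
 shows "nrm (conv b c)"
proof -
 have bR: "b \<in> carrier (Rzi S)" and cR: "c \<in> carrier (Rzi S)" using b c by (auto simp: nrm_def)
 have b0: "b i = 0" if "i > 0" for i using b that by (auto simp: nrm_def)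
 have c0: "c i = 0" if "i > 0" for i using c that by (auto simp: nrm_def)
 have bb: "nabs (b (- int j)) \<le> nabs z ^ j" and cb: "nabs (c (- int j)) \<le> nabs z ^ j" for j
  using b c by (auto simp: nrm_def)
 have pos: "conv b c n = 0" if "n > 0" for n
 proof -
  have eq: "b i * c (n - i) = 0" for i using b0[of i] c0[of "n - i"] that by (cases "i > 0") auto
  show ?thesis unfolding conv_def by (rule infsum_0) (rule eq)
 qed
 have zero: "conv b c 0 = 1"
 proof -
  have "b i * c (0 - i) = 0" if "i \<noteq> 0" for i using b0[of i] c0[of "0 - i"] that by (cases "i > 0") auto
  hence "conv b c 0 = b 0 * c 0"
   unfolding conv_def using infsum_single[of 0 "\<lambda>i. b i * c (0 - i)"] by simp
  thus ?thesis using b c by (simp add: nrm_def)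
 qed
 have "nabs (conv b c (- int m)) \<le> nabs z ^ m" for m
  unfolding conv_def
 proof (rule nabs_infsum_le)
  fix i :: int
  show "nabs (b i * c (- int m - i)) \<le> nabs z ^ m"
  proof (cases "i > 0 \<or> - int m - i > 0")
   case True thus ?thesis using b0[of i] c0[of "- int m - i"] by auto
  next
   case False
   define j where "j = nat (- i)"
   have j: "i = - int j" "- int m - i = - int (m - j)" "j \<le> m" using False by (auto simp: j_def)
   have b2: "nabs (b i) \<le> nabs z ^ j" unfolding j(1) by (rule bb)
   have c2: "nabs (c (- int m - i)) \<le> nabs z ^ (m - j)" unfolding j(2) by (rule cb)
   have "nabs (b i * c (- int m - i)) \<le> nabs z ^ j * nabs z ^ (m - j)"
    unfolding nabs_mult by (rule mult_mono[OF b2 c2 zero_le_power[OF nabs_nonneg] nabs_nonneg])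
   thus ?thesis using j(3) by (simp flip: power_add)
  qed
 qed simp
 thus ?thesis unfolding nrm_def using pos zero conv_Rzi[OF bR cR] by blast
qed

lemma nrm_one: "nrm (\<one>\<^bsub>Rzi S\<^esub>)"
 unfolding nrm_def using cring.cring_simprules(6)[OF Rzi_cring] by (auto simp: Rzi_simps(3) bmono_def)

lemma nrm_pow: "nrm b ==> nrm (b [^]\<^bsub>Rzi S\<^esub> (n::nat))"
proof (induction n)
 case 0 show ?case using nrm_one by (simp add: nat_pow_def)
next
 case (Suc n)
 have "b [^]\<^bsub>Rzi S\<^esub> Suc n = conv (b [^]\<^bsub>Rzi S\<^esub> n) b"
  by (simp add: nat_pow_def Rzi_simps)
 thus ?case using nrm_conv[OF Suc.IH[OF Suc.prems] Suc.prems] by simp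
qed

lemma nrm_sell: "nrm sell"
proof -
 have "nabs (sell (- int j)) \<le> nabs z ^ j" for j
 proof -
  have "j \<le> q * j" using q2 by simp
  hence "nabs z ^ (q * j) \<le> nabs z ^ j" using d_pos zeta_lt by (intro power_decreasing) auto
  thus ?thesis using sell_bound[of j] by linarith
 qed
 thus ?thesis using sell_Rzi sell_0 sell_pos by (simp add: nrm_def)
qed

lemma wlin_nth: "wlin i = (if i = 0 then 1 else if i = -1 then - z else 0)"
 by (simp add: wlin_def bmono_def)

lemma nrm_wlin: "nrm wlin"
proof -
 have "nabs (wlin (- int j)) \<le> nabs z ^ j" for j
  by (cases "j = 0"; cases "j = 1") (simp_all add: wlin_nth)
 thus ?thesis using wlin_Rzi by (simp add: nrm_def wlin_nth)
qed

definition wp :: "int => 'K" where "wp = wlin [^]\<^bsub>Rzi S\<^esub> q"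

definition sp :: "int => 'K" where "sp = sell [^]\<^bsub>Rzi S\<^esub> (q + 1)"

lemma nrm_wp: "nrm wp" and nrm_sp: "nrm sp"
 unfolding wp_def sp_def by (intro nrm_pow nrm_wlin nrm_sell)+

text \<open>(1 - \<zeta>/z)^k is a polynomial of degree k in 1/z. This is why the sum in
  \<open>gcoef\<close> stops at j = q.\<close>

lemma wlin_pow_low: "i < - int k ==> (wlin [^]\<^bsub>Rzi S\<^esub> (k::nat)) i = 0"
proof (induction k arbitrary: i)
 case 0 thus ?case by (simp add: nat_pow_def Rzi_simps bmono_def)
next
 case (Suc k)
 have R: "wlin [^]\<^bsub>Rzi S\<^esub> k \<in> carrier (Rzi S)" using nrm_pow[OF nrm_wlin] by (simp add: nrm_def)
 have "wlin [^]\<^bsub>Rzi S\<^esub> Suc k = conv (wlin [^]\<^bsub>Rzi S\<^esub> k) wlin" by (simp add: nat_pow_def Rzi_simps)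
 also have "\<dots> = conv wlin (wlin [^]\<^bsub>Rzi S\<^esub> k)" by (rule conv_commute)
 finally have eq: "wlin [^]\<^bsub>Rzi S\<^esub> Suc k = conv wlin (wlin [^]\<^bsub>Rzi S\<^esub> k)" .
 show ?case unfolding eq wlin_conv[OF R] using Suc.IH[of i] Suc.IH[of "i + 1"] Suc.prems by simp
qed

text \<open>
 The entry of the rigidification that is not integral: the solution \<open>\<gamma>\<close> of
 \<open>z\<^sup>q\<^sup>+\<^sup>1 \<gamma> = z\<^sup>q (1 - \<zeta>/z)\<^sup>q \<sigma>(\<gamma>) + \<zeta> \<sigma>(\<ell>\<^sub>-)\<^sup>q\<^sup>+\<^sup>1\<close> with leading term \<open>\<zeta> z\<^sup>-\<^sup>q\<^sup>-\<^sup>1\<close>. Its coefficient at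
 \<open>z\<^sup>-\<^sup>q\<^sup>-\<^sup>1\<^sup>-\<^sup>m\<close> is \<open>gcoef m\<close>.
\<close>

fun gcoef :: "nat => 'K"
 where "gcoef m = z * sp (- int m) +
  (\<Sum>j\<in>{0..<m}. if j \<le> q then wp (- int j) * gcoef (m - 1 - j) ^ q else 0)"

declare gcoef.simps [simp del]

definition gam0 :: "int => 'K"
 where "gam0 i = (if i \<le> - int q - 1 then gcoef (nat (- int q - 1 - i)) else 0)"

lemma nrm_bound: "nrm b ==> nabs (b (- int j)) \<le> nabs z ^ j"
 by (simp add: nrm_def)

text \<open>An earlier coefficient enters through its q-th power, so the j-th summand has size at
  most |\<zeta>|^(j + (m - j) q). As q \<ge> 2 and j < m, this exponent is at least m + 1.\<close>

lemma gcoef_bound: "nabs (gcoef m) \<le> nabs z ^ (m + 1)"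
proof (induction m rule: less_induct)
 case (less m)
 have "nabs (z * sp (- int m)) \<le> nabs z ^ (m + 1)"
  using mult_left_mono[OF nrm_bound[OF nrm_sp, of m] nabs_nonneg[of z]] by (simp add: nabs_mult del: mult_le_cancel_left)
 moreover have "nabs (\<Sum>j\<in>{0..<m}. if j \<le> q then wp (- int j) * gcoef (m - 1 - j) ^ q else 0) \<le> nabs z ^ (m + 1)"
 proof (rule nabs_sum_le)
  fix j assume "j \<in> {0..<m}"
  hence j: "j < m" by simp
  show "nabs (if j \<le> q then wp (- int j) * gcoef (m - 1 - j) ^ q else 0) \<le> nabs z ^ (m + 1)"
  proof (cases "j \<le> q")
   case True
   have "nabs (wp (- int j) * gcoef (m - 1 - j) ^ q) \<le> nabs z ^ j * (nabs z ^ (m - 1 - j + 1)) ^ q"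
    unfolding nabs_mult nabs_power
    by (intro mult_mono nrm_bound[OF nrm_wp] power_mono less.IH) (use j in auto)
   also have "\<dots> = nabs z ^ (j + (m - j) * q)"
   proof -
    have e: "m - 1 - j + 1 = m - j" using j by simp
    show ?thesis unfolding e by (simp add: power_add power_mult)
   qed
   also have "\<dots> \<le> nabs z ^ (m + 1)"
   proof (rule power_decreasing)
    have "(m - j) * 2 \<le> (m - j) * q" using q2 by simp
    thus "m + 1 \<le> j + (m - j) * q" using j by linarith
   qed (use d_pos zeta_lt in auto)
   finally show ?thesis using True by simp
  qed simp
 qed simp
 ultimately show ?case
  by (subst gcoef.simps) (rule order_trans[OF nabs_add], simp)
qed

lemma gam0_bound: "nabs (gam0 i) \<le> nabs z"
proof -
 have "nabs z ^ (m + 1) \<le> nabs z" for m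
  using power_decreasing[of 1 "m + 1" "nabs z"] d_pos zeta_lt by simp
 thus ?thesis unfolding gam0_def using order_trans[OF gcoef_bound] by simp
qed

text \<open>The bound |\<zeta>|^(m+1) is only geometric. For every rate the recursion falls under
  \<open>super_decay\<close>, with \<open>sp\<close> as inhomogeneous term and the degree q of
  \<open>wp\<close> in 1/z as maximal delay.\<close>

lemma gam0_Rzi: "gam0 \<in> carrier (Rzi S)"
proof (rule Rzi_decayI[where N = "- int q - 1"])
 show "nabs (gam0 i) \<le> 1" for i using gam0_bound[of i] zeta_lt by linarith
 show "gam0 i = 0" if "i > - int q - 1" for i using that by (simp add: gam0_def)
 fix r :: nat
 have "\<exists>C. \<forall>m. nabs (gcoef m) \<le> C * (nabs z ^ r) ^ m"
 proof (cases "r = 0")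
  case True
  have "nabs (gcoef m) \<le> 1" for m
   using gcoef_bound[of m] power_le_one[of "nabs z" "m + 1"] d_pos zeta_lt by linarith
  thus ?thesis using True by (intro exI[of _ 1]) simp
 next
  case False
  have spR: "sp \<in> carrier (Rzi S)" using nrm_sp by (simp add: nrm_def)
  obtain H where H: "!!m. nabs (sp (- int m)) \<le> H * (nabs z ^ r) ^ m" using Rzi_decayD[OF spR] by blast
  show ?thesis
  proof (rule super_decay[where h = "\<lambda>m. nabs (z * sp (- int m))" and H = H and K = q])
   show "0 < nabs z ^ r" using d_pos by simp
   show "nabs z ^ r < 1" using False d_pos zeta_lt by (intro power_less_one_iff[THEN iffD2]) auto
   show "0 \<le> nabs (gcoef m)" for m by simp
   show "(\<lambda>m. nabs (gcoef m)) \<longlonglongrightarrow> 0"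
   proof (rule tendsto_sandwich[OF _ _ tendsto_const])
    show "(\<lambda>m. nabs z ^ (m + 1)) \<longlonglongrightarrow> 0"
     using LIMSEQ_power_zero[of "nabs z"] d_pos zeta_lt by (intro LIMSEQ_ignore_initial_segment) auto
   qed (use gcoef_bound in auto)
   show "nabs (z * sp (- int m)) \<le> H * (nabs z ^ r) ^ m" for m
    using H[of m] mult_left_le_one_le[of "nabs (sp (- int m))" "nabs z"] d_pos zeta_lt by (simp add: nabs_mult)
   show "nabs (gcoef (Suc m)) \<le> nabs (z * sp (- int (Suc m))) \<or>
    (\<exists>j\<le>q. j \<le> m \<and> nabs (gcoef (Suc m)) \<le> nabs (gcoef (m - j)) ^ 2)" for m
   proof (rule ccontr)
    assume n: "\<not> ?thesis"
    \<comment> \<open>If neither alternative held, the new coefficient would strictly exceed the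
      inhomogeneous term and each of the finitely many squares, hence their maximum, against the
      ultrametric inequality. The inserted 0 covers the summands with j > q.\<close>
    have "nabs (\<Sum>j\<in>{0..<Suc m}. if j \<le> q then wp (- int j) * gcoef (Suc m - 1 - j) ^ q else 0)
      \<le> Max (insert 0 ((\<lambda>j. nabs (gcoef (m - j)) ^ 2) ` {j. j \<le> q \<and> j \<le> m}))"
    proof (rule nabs_sum_le)
     fix j assume "j \<in> {0..<Suc m}"
     hence j: "j \<le> m" by simp
     let ?M = "Max (insert 0 ((\<lambda>j. nabs (gcoef (m - j)) ^ 2) ` {j. j \<le> q \<and> j \<le> m}))"
     show "nabs (if j \<le> q then wp (- int j) * gcoef (Suc m - 1 - j) ^ q else 0) \<le> ?M"
     proof (cases "j \<le> q")
      case True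
      have w1: "nabs (wp (- int j)) \<le> 1"
       using nrm_bound[OF nrm_wp, of j] power_le_one[of "nabs z" j] d_pos zeta_lt by linarith
      have "nabs (gcoef (m - j)) \<le> 1"
       using gcoef_bound[of "m - j"] power_le_one[of "nabs z" "m - j + 1"] d_pos zeta_lt by linarith
      hence g2: "nabs (gcoef (m - j)) ^ q \<le> nabs (gcoef (m - j)) ^ 2"
       using q2 by (intro power_decreasing) auto
      have "nabs (wp (- int j) * gcoef (Suc m - 1 - j) ^ q) \<le> 1 * nabs (gcoef (m - j)) ^ 2"
       unfolding nabs_mult nabs_power by (intro mult_mono w1) (use g2 in auto)
      also have "\<dots> \<le> ?M" using True j by (intro Max_ge) auto
      finally show ?thesis using True by simp
     next
      case False
      have "0 \<le> ?M" by (intro Max_ge) auto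
      thus ?thesis using False by simp
     qed
    qed (auto intro: Max_ge)
    also have "\<dots> < nabs (gcoef (Suc m))"
    proof -
     have pos: "0 < nabs (gcoef (Suc m))" using n nabs_nonneg[of "z * sp (- int (Suc m))"] by linarith
     have lt: "nabs (gcoef (m - j)) ^ 2 < nabs (gcoef (Suc m))" if "j \<le> q" "j \<le> m" for j
      using n that by (meson not_le)
     show ?thesis by (subst Max_less_iff) (use pos lt in auto)
    qed
    finally show False
     using n nabs_add[of "z * sp (- int (Suc m))" "\<Sum>j\<in>{0..<Suc m}. if j \<le> q then wp (- int j) * gcoef (Suc m - 1 - j) ^ q else 0"]
     by (simp only: gcoef.simps[of "Suc m", symmetric]) linarith
   qed
  qed
 qed
 thus "\<exists>C. \<forall>m. nabs (gam0 (- int q - 1 - int m)) \<le> C * (nabs z ^ r) ^ m" by (simp add: gam0_def)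
qed

lemma gam0_fe:
 "conv (bmono (int q + 1) 1) gam0 = (\<lambda>i. conv (bmono (int q) 1) (conv wp (frob_bi q gam0)) i + z * sp i)"
proof
 fix i :: int
 have w: "wp k = 0" if "k > 0 \<or> k < - int q" for k
  using that nrm_wp wlin_pow_low[of k q] by (auto simp: nrm_def wp_def)
 have sp0: "sp k = 0" if "k > 0" for k using nrm_sp that by (auto simp: nrm_def)
 \<comment> \<open>Only indices between -q and 0 contribute, so the infinite convolution is a finite
   sum that can be matched with the recursion.\<close>
 have "conv wp (frob_bi q gam0) (i - int q) = (\<Sum>\<^sub>\<infinity>k\<in>(\<lambda>j. - int j) ` {0..q}. wp k * gam0 (i - int q - k) ^ q)"
  unfolding conv_def frob_bi_def
 proof (rule infsum_cong_neutral)
  fix k assume "k \<in> UNIV - (\<lambda>j. - int j) ` {0..q}"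
  hence k: "k \<notin> (\<lambda>j. - int j) ` {0..q}" by simp
  have "k > 0 \<or> k < - int q"
  proof (rule ccontr)
   assume "\<not> ?thesis"
   hence "k = - int (nat (- k))" "nat (- k) \<in> {0..q}" by auto
   thus False using k by blast
  qed
  thus "wp k * gam0 (i - int q - k) ^ q = 0" using w by simp
 qed auto
 also have "\<dots> = (\<Sum>j\<in>{0..q}. wp (- int j) * gam0 (i - int q + int j) ^ q)"
  by (subst infsum_finite) (simp_all add: sum.reindex inj_on_def)
 finally have c: "conv wp (frob_bi q gam0) (i - int q) = (\<Sum>j\<in>{0..q}. wp (- int j) * gam0 (i - int q + int j) ^ q)" .
 show "conv (bmono (int q + 1) 1) gam0 i = conv (bmono (int q) 1) (conv wp (frob_bi q gam0)) i + z * sp i"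
 proof (cases "i > 0")
  case True
  hence "gam0 (i - int q + int j) = 0" for j by (simp add: gam0_def)
  moreover have "gam0 (i - (int q + 1)) = 0" using True by (simp add: gam0_def)
  moreover have "(0::'K) ^ q = 0" using q2 by simp
  ultimately show ?thesis using True c q2 by (simp add: conv_bmono sp0 power_0_left)
 next
  case False
  define m where "m = nat (- i)"
  have i: "i = - int m" using False by (simp add: m_def)
  have gj: "gam0 (i - int q + int j) = (if j < m then gcoef (m - 1 - j) else 0)" for j
  proof (cases "j < m")
   case True
   hence "nat (- int q - 1 - (i - int q + int j)) = m - 1 - j" by (simp add: i)
   thus ?thesis using True by (simp add: gam0_def i)
  qed (simp add: gam0_def i)
  have "(\<Sum>j\<in>{0..q}. wp (- int j) * gam0 (i - int q + int j) ^ q) =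
    (\<Sum>j\<in>{0..q} \<inter> {0..<m}. wp (- int j) * gcoef (m - 1 - j) ^ q)"
   using q2 by (intro sum.mono_neutral_cong_right) (auto simp: gj)
  also have "\<dots> = (\<Sum>j\<in>{0..<m}. if j \<le> q then wp (- int j) * gcoef (m - 1 - j) ^ q else 0)"
   by (intro sum.mono_neutral_cong_left) auto
  finally have "z * sp i + conv wp (frob_bi q gam0) (i - int q) = gcoef m"
   unfolding c by (subst gcoef.simps) (simp add: i)
  moreover have "gam0 (i - (int q + 1)) = gcoef m" by (simp add: gam0_def i)
  ultimately show ?thesis by (simp add: conv_bmono add.commute)
 qed
qed

lemma gam0_red: "red_bi (res_map S) gam0 = 0"
proof (rule fls_eqI)
 fix n
 have "nabs (gam0 n) < 1" using gam0_bound[of n] zeta_lt by linarith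
 hence "res_map S (gam0 n) = 0" using res_zero_iff[of "gam0 n"] by (simp add: val_ring_def)
 thus "fls_nth (red_bi (res_map S) gam0) n = fls_nth 0 n" by (simp add: red_nth[OF gam0_Rzi])
qed

text \<open>The leading term contributes \<zeta>^q \<zeta>^(-q-1) = \<zeta>^(-1). By
  \<open>gcoef_bound\<close> all later terms have absolute value at most 1 at \<zeta>, so the
  leading one dominates.\<close>

lemma taylor_gam0: "nabs (fps_nth (taylor z (frob_bi q gam0)) 0) = inverse (nabs z)"
proof -
 let ?N = "- int q - 1"
 have "sp 0 = 1" using nrm_sp by (simp add: nrm_def)
 hence g0: "gam0 ?N = z" by (simp add: gam0_def gcoef.simps[of 0])
 have zq: "nabs (frob_bi q gam0 ?N * z powi ?N) = inverse (nabs z)"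
 proof -
  have "inverse (nabs z) = nabs z powi (int q + ?N)" by (simp add: power_int_minus)
  also have "\<dots> = nabs z powi int q * nabs z powi ?N" by (rule power_int_add) (use zeta_nz in simp)
  finally have e: "nabs z ^ q * nabs z powi ?N = inverse (nabs z)" by (simp only: power_int_of_nat)
  show ?thesis unfolding frob_bi_def g0 nabs_mult nabs_power nabs_power_int by (rule e)
 qed
 have R: "frob_bi q gam0 \<in> carrier (Rzi S)" using ring_hom_closed[OF frob_bi_hom gam0_Rzi] .
 have "nabs (fps_nth (taylor z (frob_bi q gam0)) 0) = nabs (frob_bi q gam0 ?N * z powi ?N)"
 proof (rule nabs_val_dominant[where c = 1])
  show "vanish (tw z 1 (frob_bi q gam0)) UNIV" using RziD(2)[OF R] by simp
  show "1 < nabs (frob_bi q gam0 ?N * z powi ?N)"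
   unfolding zq using d_pos zeta_lt by (simp add: one_less_inverse_iff)
  fix i assume i: "i \<noteq> ?N"
  show "nabs (frob_bi q gam0 i * z powi i) \<le> 1"
  proof (cases "i \<le> ?N")
   case False thus ?thesis using q2 by (simp add: frob_bi_def gam0_def power_0_left)
  next
   case True
   define m where "m = nat (?N - i) - 1"
   have i': "i = ?N - int (m + 1)" using True i by (simp add: m_def)
   have "nabs (gam0 i) ^ q \<le> (nabs z ^ (m + 1 + 1)) ^ q"
    using gcoef_bound[of "m + 1"] by (intro power_mono) (simp_all add: gam0_def i' nat_add_distrib)
   also have "\<dots> \<le> nabs z ^ (q + m + 2)"
   proof -
    have "2 * m + 2 \<le> q * (m + 1)" using mult_le_mono1[OF q2, of "m + 1"] by simp
    hence "q + m + 2 \<le> (m + 1 + 1) * q" by (simp add: algebra_simps)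
    thus ?thesis unfolding power_mult[symmetric] using d_pos zeta_lt by (intro power_decreasing) auto
   qed
   finally have "nabs (gam0 i) ^ q * nabs z powi i \<le> nabs z ^ (q + m + 2) * nabs z powi i"
    using d_pos by (intro mult_right_mono) auto
   also have "\<dots> = nabs z powi (int (q + m + 2) + i)"
   proof -
    have "nabs z powi (int (q + m + 2) + i) = nabs z powi int (q + m + 2) * nabs z powi i"
     by (rule power_int_add) (use zeta_nz in simp)
    thus ?thesis by (simp only: power_int_of_nat)
   qed
   also have "int (q + m + 2) + i = 0" by (simp add: i')
   finally show ?thesis by (simp add: frob_bi_def nabs_mult nabs_power nabs_power_int)
  qed
 qed simp
 thus ?thesis using zq by simp
qed

end

section \<open>Shtukas whose comparison isomorphism is not integral\<close>

text \<open>The standard free module of rank n, as sequences that are zero from n on, so that one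
  type carries all ranks.\<close>

definition fmodule :: "nat => ('K::complete_nonarch_field fps, nat => 'K fps) module"
 where "fmodule n = \<lparr>carrier = {x. (\<forall>i. x i \<in> carrier Rz) \<and> (\<forall>i\<ge>n. x i = 0)}, monoid.mult = undefined,
  one = undefined, ring.zero = (\<lambda>i. 0), add = (\<lambda>x y i. x i + y i), module.smult = (\<lambda>a x i. a * x i)\<rparr>"

definition ebas :: "nat => nat => 'K::complete_nonarch_field fps"
 where "ebas i j = (if j = i then 1 else 0)"

lemma rhom_pow:
 assumes h: "rhom_ok h" and a: "a \<in> carrier (src h)"
 shows "app h (a [^]\<^bsub>src h\<^esub> (n::nat)) = app h a [^]\<^bsub>tgt h\<^esub> n"
proof -
 have m: "monoid (src h)" "monoid (tgt h)" using rhom_okD(4,5)[OF h] by (simp_all add: ring.is_monoid)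
 show ?thesis
  by (induction n) (simp_all add: monoid.nat_pow_0[OF m(1)] monoid.nat_pow_0[OF m(2)] monoid.nat_pow_Suc[OF m(1)]
   monoid.nat_pow_Suc[OF m(2)] rhom_okD[OF h] a monoid.nat_pow_closed[OF m(1)])
qed

lemma tri_val_cong:
 "2 \<le> n ==> i < n ==> (!!j. j < n ==> w j = w' j) ==> tri_val W w a b c i = tri_val W w' a b c i"
 by (simp add: tri_val_def)

lemma tri_val_comp:
 assumes W: "module R W" and w: "!!i. i < n ==> w i \<in> carrier W" and n: "2 \<le> n" "i < n"
  and abc: "a \<in> carrier R" "b \<in> carrier R" "c \<in> carrier R" "x \<in> carrier R" "y \<in> carrier R" "t \<in> carrier R"
 shows "tri_val W (tri_val W w x y t) a b c i =
  tri_val W w (a \<otimes>\<^bsub>R\<^esub> x) (b \<otimes>\<^bsub>R\<^esub> x \<oplus>\<^bsub>R\<^esub> c \<otimes>\<^bsub>R\<^esub> y) (c \<otimes>\<^bsub>R\<^esub> t) i"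
proof -
 interpret W: module R W by (rule W)
 have w01: "w 0 \<in> carrier W" "w (Suc 0) \<in> carrier W" using w n(1) by auto
 show ?thesis using w01 abc
  by (simp add: tri_val_def W.smult_assoc1 W.smult_l_distr W.smult_r_distr W.a_assoc)
qed

lemma tri_val_unit:
 assumes W: "module R W" and w: "!!i. i < n ==> w i \<in> carrier W" and n: "2 \<le> n" "i < n"
 shows "tri_val W w \<one>\<^bsub>R\<^esub> \<zero>\<^bsub>R\<^esub> \<one>\<^bsub>R\<^esub> i = w i"
proof -
 interpret W: module R W by (rule W)
 have w01: "w 0 \<in> carrier W" "w (Suc 0) \<in> carrier W" using w n(1) by auto
 show ?thesis using w01 by (simp add: tri_val_def W.smult_l_null)
qed

text \<open>The condition that \<delta> commutes with \<tau>, entry by entry: Z is z, W is 1 -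
  \<zeta>/z, s is \<sigma>(\<open>ell\<close>), i and j are the inverses of \<open>ell\<close> and
  of s, G and G' are the series \<open>gam0\<close> and its Frobenius image, t is \<zeta>. The first
  claim is the diagonal, the second the corner, and \<open>rel\<close> is the functional equation of
  \<open>gam0\<close>.\<close>

lemma (in cring) rigidification_identity:
 assumes c: "Z \<in> carrier R" "W \<in> carrier R" "s \<in> carrier R" "i \<in> carrier R" "j \<in> carrier R"
   "G \<in> carrier R" "G' \<in> carrier R" "t \<in> carrier R"
  and i: "(W \<otimes> s) \<otimes> i = \<one>" and j: "s \<otimes> j = \<one>"
  and rel: "Z [^] ((k::nat) + 1) \<otimes> G = Z [^] k \<otimes> (W [^] k \<otimes> G') \<oplus> t \<otimes> s [^] (k + 1)"
 shows "(Z \<otimes> W) [^] (m::nat) \<otimes> i [^] m = j [^] m \<otimes> Z [^] m"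
  "(\<ominus> t) \<otimes> i [^] k \<oplus> (Z \<otimes> W) [^] (k + 1) \<otimes> (G \<otimes> (i [^] k \<otimes> i [^] (k + 1))) =
   (G' \<otimes> (j [^] k \<otimes> j [^] (k + 1))) \<otimes> Z [^] k"
proof -
 have "j = j \<otimes> ((W \<otimes> s) \<otimes> i)" using c i by simp
 also have "\<dots> = (s \<otimes> j) \<otimes> (W \<otimes> i)" using c by (simp add: m_ac)
 finally have Wi: "W \<otimes> i = j" using c j by simp
 have Wim: "W [^] m \<otimes> i [^] m = j [^] m" for m :: nat
  using nat_pow_distrib[OF c(2,4), of m] Wi by simp
 have sj: "s [^] m \<otimes> j [^] m = \<one>" for m :: nat
  using nat_pow_distrib[OF c(3,5), of m] j by simp
 have ZW: "(Z \<otimes> W) [^] m = Z [^] m \<otimes> W [^] m" for m :: nat by (rule nat_pow_distrib[OF c(1,2)])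
 have p: "x [^] (m::nat) \<in> carrier R" if "x \<in> carrier R" for x m using that by simp
 show "(Z \<otimes> W) [^] m \<otimes> i [^] m = j [^] m \<otimes> Z [^] m"
  unfolding ZW Wim[symmetric] using c by (simp add: m_ac)
 define A where "A = i [^] k"
 define C where "C = j [^] (k + 1)"
 define P where "P = Z [^] k"
 define Wk where "Wk = W [^] k"
 define S where "S = s [^] (k + 1)"
 define Z1 where "Z1 = Z [^] (k + 1)"
 define W1 where "W1 = W [^] (k + 1)"
 define i1 where "i1 = i [^] (k + 1)"
 define D where "D = j [^] k"
 have cl: "A \<in> carrier R" "C \<in> carrier R" "P \<in> carrier R" "Wk \<in> carrier R" "S \<in> carrier R" "Z1 \<in> carrier R"
  "W1 \<in> carrier R" "i1 \<in> carrier R" "D \<in> carrier R"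
  unfolding A_def C_def P_def Wk_def S_def Z1_def W1_def i1_def D_def using c by (auto intro: p)
 have r: "W1 \<otimes> i1 = C" "S \<otimes> C = \<one>" "Wk \<otimes> A = D" "Z1 \<otimes> G = P \<otimes> (Wk \<otimes> G') \<oplus> t \<otimes> S"
  unfolding A_def C_def P_def Wk_def S_def Z1_def W1_def i1_def D_def by (rule Wim sj rel)+
 have "Z1 \<otimes> W1 \<otimes> (G \<otimes> (A \<otimes> i1)) = (Z1 \<otimes> G) \<otimes> ((W1 \<otimes> i1) \<otimes> A)"
  using cl c by (simp add: m_ac)
 also have "\<dots> = P \<otimes> (Wk \<otimes> G') \<otimes> (C \<otimes> A) \<oplus> t \<otimes> S \<otimes> (C \<otimes> A)"
  unfolding r using cl c by (simp add: l_distr)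
 also have "P \<otimes> (Wk \<otimes> G') \<otimes> (C \<otimes> A) = G' \<otimes> ((Wk \<otimes> A) \<otimes> C) \<otimes> P" using cl c by (simp add: m_ac)
 also have "t \<otimes> S \<otimes> (C \<otimes> A) = (S \<otimes> C) \<otimes> (t \<otimes> A)" using cl c by (simp add: m_ac)
 finally have *: "Z1 \<otimes> W1 \<otimes> (G \<otimes> (A \<otimes> i1)) = G' \<otimes> (D \<otimes> C) \<otimes> P \<oplus> t \<otimes> A"
  unfolding r using cl c by simp
 have cancel: "\<ominus> u \<oplus> (y \<oplus> u) = y" if "u \<in> carrier R" "y \<in> carrier R" for u y
  using a_lcomm[of "\<ominus> u" y u] that by (simp add: l_neg)
 have "(\<ominus> t) \<otimes> A \<oplus> Z1 \<otimes> W1 \<otimes> (G \<otimes> (A \<otimes> i1)) = G' \<otimes> (D \<otimes> C) \<otimes> P"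
  unfolding * using cl c by (simp add: l_minus cancel)
 thus "(\<ominus> t) \<otimes> i [^] k \<oplus> (Z \<otimes> W) [^] (k + 1) \<otimes> (G \<otimes> (i [^] k \<otimes> i [^] (k + 1))) =
   (G' \<otimes> (j [^] k \<otimes> j [^] (k + 1))) \<otimes> Z [^] k"
  unfolding ZW A_def C_def P_def Wk_def S_def Z1_def W1_def i1_def D_def .
qed

context ana_setting
begin

lemma Rz_closed: "f \<in> carrier Rz ==> g \<in> carrier Rz ==> f + g \<in> carrier (Rz :: 'K fps ring)"
  "f \<in> carrier Rz ==> g \<in> carrier Rz ==> f * g \<in> carrier (Rz :: 'K fps ring)"
  "f \<in> carrier Rz ==> - f \<in> carrier (Rz :: 'K fps ring)"
  "0 \<in> carrier (Rz :: 'K fps ring)" "1 \<in> carrier (Rz :: 'K fps ring)"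
 using val_simps(1,2) by (auto simp: Rz_carrier fps_mult_nth intro!: val_simps)

lemma Rz_pow_closed: "f \<in> carrier Rz ==> f ^ n \<in> carrier (Rz :: 'K fps ring)"
 by (induction n) (simp_all add: Rz_closed)

lemma fmodule_free: "free_fam (Rz :: 'K fps ring) (fmodule n) n ebas"
proof -
 let ?M = "fmodule n :: ('K fps, nat => 'K fps) module"
 have M: "x \<in> carrier ?M \<longleftrightarrow> (\<forall>i. x i \<in> carrier Rz) \<and> (\<forall>i\<ge>n. x i = 0)" "x \<oplus>\<^bsub>?M\<^esub> y = (\<lambda>i. x i + y i)"
  "\<zero>\<^bsub>?M\<^esub> = (\<lambda>i. 0)" "a \<odot>\<^bsub>?M\<^esub> x = (\<lambda>i. a * x i)" for x y a
  by (simp_all add: fmodule_def)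
 have ab: "abelian_group ?M"
 proof (rule abelian_groupI)
  fix x assume "x \<in> carrier ?M"
  thus "\<exists>y\<in>carrier ?M. y \<oplus>\<^bsub>?M\<^esub> x = \<zero>\<^bsub>?M\<^esub>"
   by (intro bexI[of _ "\<lambda>i. - x i"]) (auto simp: M Rz_closed)
 qed (auto simp: M Rz_closed algebra_simps)
 have mod: "module Rz ?M"
  by (rule moduleI[OF Rz_cring ab]) (auto simp: M Rz_closed Rz_simps algebra_simps)
 have e: "ebas i \<in> carrier ?M" if "i < n" for i using that by (auto simp: M ebas_def Rz_closed)
 have gens: "gens Rz ?M (ebas ` {..<n})"
  unfolding gens_def
 proof (intro conjI allI impI subsetI)
  fix x :: "nat => 'K fps" assume "x \<in> ebas ` {..<n}"
  thus "x \<in> carrier ?M" using e by auto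
 next
  fix H and x :: "nat => 'K fps"
  assume H: "\<zero>\<^bsub>?M\<^esub> \<in> H \<and> (\<forall>x\<in>H \<inter> carrier ?M. \<forall>y\<in>H \<inter> carrier ?M. x \<oplus>\<^bsub>?M\<^esub> y \<in> H) \<and>
   (\<forall>b\<in>carrier Rz. \<forall>x\<in>ebas ` {..<n}. b \<odot>\<^bsub>?M\<^esub> x \<in> H)" and x: "x \<in> carrier ?M"
  have "(\<lambda>j. if j < k then x j else 0) \<in> H" if "k \<le> n" for k
   using that
  proof (induction k)
   case 0 thus ?case using H by (simp add: M)
  next
   case (Suc k)
   let ?y = "\<lambda>j. if j < k then x j else 0"
   have k: "k < n" "?y \<in> H" "x k \<in> carrier Rz" using Suc x by (auto simp: M)
   have 1: "x k \<odot>\<^bsub>?M\<^esub> ebas k \<in> H" using H k by blast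
   have 2: "?y \<in> carrier ?M" "x k \<odot>\<^bsub>?M\<^esub> ebas k \<in> carrier ?M"
    using x k by (auto simp: M ebas_def Rz_closed)
   have "?y \<oplus>\<^bsub>?M\<^esub> (x k \<odot>\<^bsub>?M\<^esub> ebas k) \<in> H" using H k(2) 1 2 by blast
   moreover have "?y \<oplus>\<^bsub>?M\<^esub> (x k \<odot>\<^bsub>?M\<^esub> ebas k) = (\<lambda>j. if j < Suc k then x j else 0)"
    by (auto simp: M ebas_def fun_eq_iff less_Suc_eq)
   ultimately show ?case by simp
  qed
  from this[of n] have "(\<lambda>j. if j < n then x j else 0) \<in> H" by simp
  moreover have "(\<lambda>j. if j < n then x j else 0) = x" using x by (auto simp: M fun_eq_iff)
  ultimately show "x \<in> H" by simp
 qed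
 have "semilinear (id_hom Rz) ?M (self_mod Rz) (\<lambda>x. x i)" for i
  by (rule semilinearI) (auto simp: M Rz_simps)
 thus ?thesis unfolding free_fam_def using Rz_cring mod gens
  by (intro conjI exI[of _ "\<lambda>i x. x i"]) (auto simp: ebas_def Rz_simps)
qed

abbreviation "bL \<equiv> emb (ell S)"
abbreviation "bs \<equiv> emb sell"
abbreviation "bW \<equiv> emb wlin"
abbreviation "bZ \<equiv> emb (bmono 1 1)"
abbreviation "bt \<equiv> emb (bmono 0 z)"
text \<open>The powers q and q + 1 of 1/\<open>ell\<close> are the diagonal entries of \<delta>;
  \<open>bj\<close> is the Frobenius image of \<open>bi\<close>, that is,
  1/\<sigma>(\<open>ell\<close>).\<close>

definition "bi = inv\<^bsub>Rzil S\<^esub> bL"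
definition "bj = app (B_s S) bi"

lemma one_bmono_Rzi: "bmono k 1 \<in> carrier (Rzi S)" and z_bmono_Rzi: "bmono 0 z \<in> carrier (Rzi S)"
 by (intro bmono_Rzi val_simps)+

lemma b_closed: "bL \<in> carrier (Rzil S)" "bs \<in> carrier (Rzil S)" "bW \<in> carrier (Rzil S)" "bZ \<in> carrier (Rzil S)"
 "bt \<in> carrier (Rzil S)" "bi \<in> carrier (Rzil S)" "bj \<in> carrier (Rzil S)" "emb gam0 \<in> carrier (Rzil S)"
 "emb (frob_bi q gam0) \<in> carrier (Rzil S)"
proof -
 show bi: "bi \<in> carrier (Rzil S)" unfolding bi_def
  by (rule monoid.Units_inv_closed[OF ring.is_monoid[OF cring.axioms(1)[OF Rzil_cring]] ell_unit])
 show "bj \<in> carrier (Rzil S)" unfolding bj_def using rhom_okD(6)[OF B_s_ok] bi by simp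
qed (intro emb_closed ell_Rzi sell_Rzi wlin_Rzi one_bmono_Rzi z_bmono_Rzi gam0_Rzi ring_hom_closed[OF frob_bi_hom])+

lemma bL_fact: "bL = bW \<otimes>\<^bsub>Rzil S\<^esub> bs"
 using emb_conv[OF wlin_Rzi sell_Rzi] by (simp add: ell_fact)

lemma bL_bi: "bL \<otimes>\<^bsub>Rzil S\<^esub> bi = \<one>\<^bsub>Rzil S\<^esub>"
 unfolding bi_def by (rule monoid.Units_r_inv[OF ring.is_monoid[OF cring.axioms(1)[OF Rzil_cring]] ell_unit])

lemma bs_bj: "bs \<otimes>\<^bsub>Rzil S\<^esub> bj = \<one>\<^bsub>Rzil S\<^esub>"
proof -
 have "app (B_s S) bL = bs" using B_s_emb[OF ell_Rzi] by (simp add: sell_def)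
 thus ?thesis
  using rhom_okD(7)[OF B_s_ok, of bL bi] rhom_okD(9)[OF B_s_ok] b_closed bL_bi by (simp add: bj_def)
qed

lemma emb_ok: "rhom_ok (RHom (Rzi S) (Rzil S) emb)"
 using Rzi_cring Rzil_cring emb_hom by (simp add: rhom_ok_def)

lemma emb_pow: "b \<in> carrier (Rzi S) ==> emb (b [^]\<^bsub>Rzi S\<^esub> (n::nat)) = emb b [^]\<^bsub>Rzil S\<^esub> n"
 using rhom_pow[OF emb_ok] by simp

lemma bmono_pow: "bmono 1 1 [^]\<^bsub>Rzi S\<^esub> (n::nat) = bmono (int n) 1"
proof (induction n)
 case 0 show ?case by (simp add: nat_pow_def Rzi_simps)
next
 case (Suc n)
 have "bmono 1 1 [^]\<^bsub>Rzi S\<^esub> Suc n = conv (bmono 1 1 [^]\<^bsub>Rzi S\<^esub> n) (bmono 1 1)" by (simp add: nat_pow_def Rzi_simps)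
 thus ?case by (simp add: Suc conv_bmono_bmono add.commute)
qed

lemma bZ_pow: "bZ [^]\<^bsub>Rzil S\<^esub> (n::nat) = emb (bmono (int n) 1)"
 using emb_pow[OF one_bmono_Rzi, of 1 n] by (simp add: bmono_pow)

lemma gam0_rel: "bZ [^]\<^bsub>Rzil S\<^esub> (q + 1) \<otimes>\<^bsub>Rzil S\<^esub> emb gam0 =
 bZ [^]\<^bsub>Rzil S\<^esub> q \<otimes>\<^bsub>Rzil S\<^esub> (bW [^]\<^bsub>Rzil S\<^esub> q \<otimes>\<^bsub>Rzil S\<^esub> emb (frob_bi q gam0)) \<oplus>\<^bsub>Rzil S\<^esub>
 bt \<otimes>\<^bsub>Rzil S\<^esub> bs [^]\<^bsub>Rzil S\<^esub> (q + 1)"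
proof -
 have wR: "wp \<in> carrier (Rzi S)" and sR: "sp \<in> carrier (Rzi S)" using nrm_wp nrm_sp by (auto simp: nrm_def)
 have fR: "frob_bi q gam0 \<in> carrier (Rzi S)" by (rule ring_hom_closed[OF frob_bi_hom gam0_Rzi])
 have wf: "conv wp (frob_bi q gam0) \<in> carrier (Rzi S)" by (rule conv_Rzi[OF wR fR])
 have zw: "conv (bmono (int q) 1) (conv wp (frob_bi q gam0)) \<in> carrier (Rzi S)" by (rule conv_Rzi[OF one_bmono_Rzi wf])
 have zs: "conv (bmono 0 z) sp \<in> carrier (Rzi S)" by (rule conv_Rzi[OF z_bmono_Rzi sR])
 have "conv (bmono (int q + 1) 1) gam0 =
   conv (bmono (int q) 1) (conv wp (frob_bi q gam0)) \<oplus>\<^bsub>Rzi S\<^esub> conv (bmono 0 z) sp"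
  unfolding gam0_fe by (simp add: Rzi_simps conv_bmono fun_eq_iff)
 hence "emb (conv (bmono (int q + 1) 1) gam0) =
   emb (conv (bmono (int q) 1) (conv wp (frob_bi q gam0))) \<oplus>\<^bsub>Rzil S\<^esub> emb (conv (bmono 0 z) sp)"
  using ring_hom_add[OF emb_hom zw zs] by simp
 hence *: "emb (bmono (int q + 1) 1) \<otimes>\<^bsub>Rzil S\<^esub> emb gam0 =
   emb (bmono (int q) 1) \<otimes>\<^bsub>Rzil S\<^esub> (emb wp \<otimes>\<^bsub>Rzil S\<^esub> emb (frob_bi q gam0)) \<oplus>\<^bsub>Rzil S\<^esub> bt \<otimes>\<^bsub>Rzil S\<^esub> emb sp"
  by (simp only: emb_conv[OF one_bmono_Rzi gam0_Rzi] emb_conv[OF one_bmono_Rzi wf] emb_conv[OF wR fR] emb_conv[OF z_bmono_Rzi sR])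
 have 1: "emb (bmono (int q + 1) 1) = bZ [^]\<^bsub>Rzil S\<^esub> (q + 1)" unfolding bZ_pow by (simp add: add.commute)
 have 2: "emb wp = bW [^]\<^bsub>Rzil S\<^esub> q" unfolding wp_def by (rule emb_pow[OF wlin_Rzi])
 have 3: "emb sp = bs [^]\<^bsub>Rzil S\<^esub> (q + 1)" unfolding sp_def by (rule emb_pow[OF sell_Rzi])
 show ?thesis using * unfolding 1 2 3 bZ_pow[of q, symmetric] .
qed

text \<open>The corner of \<delta>. Dividing by both diagonal denominators turns the condition on
  the corner into the equation without denominators that \<open>gam0\<close> solves.\<close>

definition "cbeta = emb gam0 \<otimes>\<^bsub>Rzil S\<^esub> (bi [^]\<^bsub>Rzil S\<^esub> q \<otimes>\<^bsub>Rzil S\<^esub> bi [^]\<^bsub>Rzil S\<^esub> (q + 1))"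

lemmas B_ids = cring.rigidification_identity[OF Rzil_cring b_closed(4,3,2,6,7,8,9,5) bL_bi[unfolded bL_fact] bs_bj gam0_rel]

lemma B_pow_closed: "x \<in> carrier (Rzil S) ==> x [^]\<^bsub>Rzil S\<^esub> (n::nat) \<in> carrier (Rzil S)"
 by (rule monoid.nat_pow_closed[OF ring.is_monoid[OF cring.axioms(1)[OF Rzil_cring]]])

lemma B_mult_closed: "x \<in> carrier (Rzil S) ==> y \<in> carrier (Rzil S) ==> x \<otimes>\<^bsub>Rzil S\<^esub> y \<in> carrier (Rzil S)"
 by (rule monoid.m_closed[OF ring.is_monoid[OF cring.axioms(1)[OF Rzil_cring]]])

lemma cbeta_closed: "cbeta \<in> carrier (Rzil S)"
 unfolding cbeta_def by (intro B_mult_closed B_pow_closed b_closed)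

lemma B_s_entries: "app (B_s S) (bi [^]\<^bsub>Rzil S\<^esub> (n::nat)) = bj [^]\<^bsub>Rzil S\<^esub> n"
 "app (B_s S) cbeta = emb (frob_bi q gam0) \<otimes>\<^bsub>Rzil S\<^esub> (bj [^]\<^bsub>Rzil S\<^esub> q \<otimes>\<^bsub>Rzil S\<^esub> bj [^]\<^bsub>Rzil S\<^esub> (q + 1))"
proof -
 show 1: "app (B_s S) (bi [^]\<^bsub>Rzil S\<^esub> (n::nat)) = bj [^]\<^bsub>Rzil S\<^esub> n" for n
  using rhom_pow[OF B_s_ok, of bi n] b_closed by (simp add: bj_def)
 have m: "app (B_s S) (x \<otimes>\<^bsub>Rzil S\<^esub> y) = app (B_s S) x \<otimes>\<^bsub>Rzil S\<^esub> app (B_s S) y"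
  if "x \<in> carrier (Rzil S)" "y \<in> carrier (Rzil S)" for x y
  using rhom_okD(7)[OF B_s_ok, of x y] that by simp
 show "app (B_s S) cbeta = emb (frob_bi q gam0) \<otimes>\<^bsub>Rzil S\<^esub> (bj [^]\<^bsub>Rzil S\<^esub> q \<otimes>\<^bsub>Rzil S\<^esub> bj [^]\<^bsub>Rzil S\<^esub> (q + 1))"
  unfolding cbeta_def
  by (subst m m[OF B_pow_closed[OF b_closed(6)] B_pow_closed[OF b_closed(6)]], rule b_closed(8),
    rule B_mult_closed[OF B_pow_closed[OF b_closed(6)] B_pow_closed[OF b_closed(6)]],
    subst m[OF B_pow_closed[OF b_closed(6)] B_pow_closed[OF b_closed(6)]])
   (simp only: 1 B_s_emb[OF gam0_Rzi])
qed

lemma B_kz_entries: "app (B_kz S) (bi [^]\<^bsub>Rzil S\<^esub> (n::nat)) = 1" "app (B_kz S) cbeta = 0"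
proof -
 have h: "app (B_kz S) (x \<otimes>\<^bsub>Rzil S\<^esub> y) = app (B_kz S) x * app (B_kz S) y"
  if "x \<in> carrier (Rzil S)" "y \<in> carrier (Rzil S)" for x y
  using rhom_okD(7)[OF B_kz_ok, of x y] that by simp
 have "app (B_kz S) bL * app (B_kz S) bi = 1"
  using h[OF b_closed(1,6)] bL_bi rhom_okD(9)[OF B_kz_ok] by simp
 hence "app (B_kz S) bi = 1" by (simp add: B_kz_emb[OF ell_Rzi] red_ell)
 thus "app (B_kz S) (bi [^]\<^bsub>Rzil S\<^esub> (n::nat)) = 1"
  using rhom_pow[OF B_kz_ok, of bi n] b_closed by simp
 show "app (B_kz S) cbeta = 0" unfolding cbeta_def
  using h[OF b_closed(8) B_mult_closed[OF B_pow_closed[OF b_closed(6)] B_pow_closed[OF b_closed(6)]]]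
  by (simp only: B_kz_emb[OF gam0_Rzi] gam0_red mult_zero_left)
qed

text \<open>After the twist \<open>ell\<close> has a value of absolute value 1 at \<zeta>, so its
  powers do not change the size and only \<open>gam0\<close> counts.\<close>

lemma B_s_K_cbeta: "nabs (app (B_s_K S) cbeta) = inverse (nabs z)"
proof -
 have h: "app (B_s_K S) (x \<otimes>\<^bsub>Rzil S\<^esub> y) = app (B_s_K S) x * app (B_s_K S) y"
  if "x \<in> carrier (Rzil S)" "y \<in> carrier (Rzil S)" for x y
  using rhom_okD(7)[OF B_s_K_ok, of x y] that by simp
 have e: "app (B_s_K S) (emb b) = fps_nth (taylor z (frob_bi q b)) 0" if "b \<in> carrier (Rzi S)" for b
  using B_s_P_emb[OF that] by (simp add: B_s_K_def tf_def)
 have "app (B_s_K S) bL * app (B_s_K S) bi = 1"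
  using h[OF b_closed(1,6)] bL_bi rhom_okD(9)[OF B_s_K_ok] by simp
 hence "nabs (app (B_s_K S) bL) * nabs (app (B_s_K S) bi) = 1" by (metis nabs_mult nabs_one)
 moreover have "nabs (app (B_s_K S) bL) = 1"
  using e[OF ell_Rzi] taylor_sell by (simp add: sell_def)
 ultimately have 1: "nabs (app (B_s_K S) bi) = 1" by simp
 have 2: "nabs (app (B_s_K S) (bi [^]\<^bsub>Rzil S\<^esub> (n::nat))) = 1" for n
  using rhom_pow[OF B_s_K_ok, of bi n] b_closed 1 by (simp add: nabs_power)
 show ?thesis
  unfolding cbeta_def
  using h[OF b_closed(8) B_mult_closed[OF B_pow_closed[OF b_closed(6)] B_pow_closed[OF b_closed(6)]]]
   h[OF B_pow_closed[OF b_closed(6)] B_pow_closed[OF b_closed(6)]]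
  by (simp only: nabs_mult 2 e[OF gam0_Rzi] taylor_gam0 mult_1_right)
qed

lemma const_Rz: "fps_const (- z) \<in> carrier Rz"
 using val_simps(1) val_simps(5)[OF val_simps(8)] by (simp add: Rz_carrier fps_nth_fps_const)

lemma Rz_B_entries: "app (Rz_B S) (zmz S ^ n) = (bZ \<otimes>\<^bsub>Rzil S\<^esub> bW) [^]\<^bsub>Rzil S\<^esub> n"
 "app (Rz_B S) (fps_const (- z)) = \<ominus>\<^bsub>Rzil S\<^esub> bt"
proof -
 have "app (Rz_B S) (zmz S) = bZ \<otimes>\<^bsub>Rzil S\<^esub> bW"
  using emb_conv[OF one_bmono_Rzi wlin_Rzi] by (simp add: Rz_B_def fps_to_bi_zmz)
 thus "app (Rz_B S) (zmz S ^ n) = (bZ \<otimes>\<^bsub>Rzil S\<^esub> bW) [^]\<^bsub>Rzil S\<^esub> n"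
  using rhom_pow[OF Rz_B_ok, of "zmz S" n] zmz_Rz by (simp add: Rz_simps)
 have mz: "bmono 0 (- z) \<in> carrier (Rzi S)" by (intro bmono_Rzi val_simps)
 have "fps_to_bi (fps_const (- z)) = bmono 0 (- z)"
  by (rule ext) (simp add: fps_to_bi_def bmono_def fps_nth_fps_const)
 hence 1: "app (Rz_B S) (fps_const (- z)) = emb (bmono 0 (- z))" by (simp add: Rz_B_def)
 have "bmono 0 (- z) \<oplus>\<^bsub>Rzi S\<^esub> bmono 0 z = \<zero>\<^bsub>Rzi S\<^esub>" by (simp add: Rzi_simps bmono_def fun_eq_iff)
 hence "emb (bmono 0 (- z)) \<oplus>\<^bsub>Rzil S\<^esub> bt = \<zero>\<^bsub>Rzil S\<^esub>"
  using ring_hom_add[OF emb_hom mz z_bmono_Rzi]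
   ring_hom_zero[OF emb_hom cring.axioms(1)[OF Rzi_cring] cring.axioms(1)[OF Rzil_cring]] by simp
 hence "\<ominus>\<^bsub>Rzil S\<^esub> bt = emb (bmono 0 (- z))"
  by (rule abelian_group.minus_equality[OF ring.is_abelian_group[OF cring.axioms(1)[OF Rzil_cring]]])
   (simp_all add: b_closed emb_closed[OF mz])
 thus "app (Rz_B S) (fps_const (- z)) = \<ominus>\<^bsub>Rzil S\<^esub> bt" using 1 by simp
qed

text \<open>Since \<zeta> reduces to zero, z - \<zeta> becomes z and the corner of \<tau>
  disappears: the reduced Frobenius is diagonal.\<close>

lemma kz_B_entries: "app (kz_B S) (app (Rz_kz S) (zmz S ^ n)) = bZ [^]\<^bsub>Rzil S\<^esub> n"
 "app (Rz_kz S) (fps_const (- z)) = 0"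
proof -
 have rz: "res_map S z = 0" "res_map S (- z) = 0"
  using res_zero_iff[OF val_simps(8)] res_zero_iff[OF val_simps(5)[OF val_simps(8)]] zeta_lt by auto
 have "fls_to_bi (res_sec S) (app (Rz_kz S) (zmz S)) = bmono 1 1"
  by (rule ext) (auto simp: fls_to_bi_def Rz_kz_def Rz_ki_def zmz_def bmono_def fps_nth_fps_const rz res_simps sec_simps
   fps_X_def)
 hence 1: "app (kz_B S) (app (Rz_kz S) (zmz S)) = bZ" by (simp add: kz_B_def)
 have "app (Rz_kz S) (zmz S ^ n) = app (Rz_kz S) (zmz S) ^ n"
  using rhom_pow[OF Rz_kz_ok, of "zmz S" n] zmz_Rz by (simp add: Rz_simps)
 thus "app (kz_B S) (app (Rz_kz S) (zmz S ^ n)) = bZ [^]\<^bsub>Rzil S\<^esub> n"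
  using rhom_pow[OF kz_B_ok, of "app (Rz_kz S) (zmz S)" n] 1 by simp
 show "app (Rz_kz S) (fps_const (- z)) = 0"
  by (simp add: fls_eq_iff Rz_kz_def Rz_ki_def fps_nth_fps_const rz res_simps)
qed

text \<open>A power series over k has coefficients in R after the section and is evaluated at
  |\<zeta>| < 1. It is what keeps multiples by elements of k[[z]] integral at \<zeta>.\<close>

lemma kz_K_integral: "app (kz_K S) (fps_to_fls f) \<in> val_ring"
proof -
 have R: "fls_to_bi (res_sec S) (fps_to_fls f) \<in> carrier (Rzi S)" by (rule ring_hom_closed[OF fls_to_bi_hom]) simp
 have v: "vanish (tw z 1 (fls_to_bi (res_sec S) (fps_to_fls f))) UNIV" using RziD(2)[OF R] by simp
 have "nabs (fps_nth (taylor z (fls_to_bi (res_sec S) (fps_to_fls f))) 0) \<le> 1"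
  unfolding taylor_const[OF v]
 proof (rule nabs_infsum_le)
  fix i :: int
  show "nabs (fls_to_bi (res_sec S) (fps_to_fls f) i * z powi i) \<le> 1"
  proof (cases "i \<ge> 0")
   case True
   have "nabs (fls_to_bi (res_sec S) (fps_to_fls f) i) \<le> 1" using RziD(1)[OF R] by simp
   moreover have "nabs (z powi i) \<le> 1"
    using True power_le_one[of "nabs z" "nat i"] d_pos zeta_lt by (simp add: power_int_def nabs_power)
   ultimately show ?thesis unfolding nabs_mult using mult_mono[of _ 1 _ 1] by (simp add: mult_le_one)
  qed (simp add: fls_to_bi_def sec_simps)
 qed simp
 thus ?thesis by (simp add: kz_K_def kz_P_def val_ring_def)
qed

end

section \<open>The triangular shtuka: rigidification and failure of integrality\<close>

locale tri_shtuka = ana_setting S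
 for S :: "('Q::field, 'K::complete_nonarch_field, 'k::field) shtuka_base" +
 fixes U :: "('K, 'k, nat => 'K fps) rig_shtuka" and n :: nat
 assumes n2: "2 \<le> n" and smod: "smod U = fmodule n"
  and st: "module_iso (Rz_zmz S) (bc (Rz_L S) (sig_mod S U)) (bc (Rz_L S) (smod U)) (stau U)"
  and stv: "!!i. i < n ==> stau U (bc_unit (Rz_L S) (sig_mod S U) (bc_unit (Rz_s S) (smod U) (ebas i))) =
   tri_val (bc (Rz_L S) (smod U)) (\<lambda>i. bc_unit (Rz_L S) (smod U) (ebas i)) (app (Rz_L S) (zmz S ^ qhat S))
    (app (Rz_L S) (fps_const (- zeta S))) (app (Rz_L S) (zmz S ^ (qhat S + 1))) i"
  and sd: "module_iso (Rzil S) (bc (Rz_B S) (smod U)) (bc (kz_B S) (Dt S U)) (sdelta U)"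
  and sdv: "!!i. i < n ==> sdelta U (bc_unit (Rz_B S) (smod U) (ebas i)) =
   tri_val (bc (kz_B S) (Dt S U)) (\<lambda>i. bc_unit (kz_B S) (Dt S U) (bc_unit (Rz_kz S) (smod U) (ebas i)))
    (bi [^]\<^bsub>Rzil S\<^esub> q) cbeta (bi [^]\<^bsub>Rzil S\<^esub> (q + 1)) i"
begin

abbreviation "sv i \<equiv> bc_unit (Rz_s S) (smod U) (ebas i)"
abbreviation "dv i \<equiv> bc_unit (Rz_kz S) (smod U) (ebas i)"
abbreviation "cv i \<equiv> bc_unit (kz_s S) (Dt S U) (dv i)"

lemma fM: "free_fam Rz (smod U) n ebas"
 unfolding smod by (rule fmodule_free)

lemma fsig: "free_fam Rz (sig_mod S U) n sv"
 using free_fam_bc[of "Rz_s S", OF _ Rz_s_ok] fM by (simp add: sig_mod_def)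

lemma fD: "free_fam (ring_on UNIV) (Dt S U) n dv"
 using free_fam_bc[of "Rz_kz S", OF _ Rz_kz_ok] fM by (simp add: Dt_def)

lemma fcris: "free_fam (ring_on UNIV) (cris S U) n cv"
 using free_fam_bc[of "kz_s S", OF _ kz_s_ok] fD by (simp add: cris_def)

lemma fMh: "rhom_ok h ==> src h = Rz ==> free_fam (tgt h) (bc h (smod U)) n (\<lambda>i. bc_unit h (smod U) (ebas i))"
 using free_fam_bc[of h] fM by simp

lemma fsigh: "rhom_ok h ==> src h = Rz ==> free_fam (tgt h) (bc h (sig_mod S U)) n (\<lambda>i. bc_unit h (sig_mod S U) (sv i))"
 using free_fam_bc[of h] fsig by simp

lemma fDh: "rhom_ok h ==> src h = ring_on UNIV ==> free_fam (tgt h) (bc h (Dt S U)) n (\<lambda>i. bc_unit h (Dt S U) (dv i))"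
 using free_fam_bc[of h] fD by simp

lemma fcrish: "rhom_ok h ==> src h = ring_on UNIV ==> free_fam (tgt h) (bc h (cris S U)) n (\<lambda>i. bc_unit h (cris S U) (cv i))"
 using free_fam_bc[of h] fcris by simp

lemma t_closed: "zmz S ^ k \<in> carrier Rz" "app (Rz_L S) (zmz S ^ k) \<in> carrier (Rz_zmz S)"
 "app (Rz_L S) (fps_const (- z)) \<in> carrier (Rz_zmz S)"
 using Rz_pow_closed[OF zmz_Rz] rhom_okD(6)[OF Rz_L_ok] const_Rz by auto

lemma p_closed: "bi [^]\<^bsub>Rzil S\<^esub> (k::nat) \<in> carrier (Rzil S)"
 by (rule B_pow_closed[OF b_closed(6)])

lemma st_hom: "module_hom (tgt (Rz_L S)) (bc (Rz_L S) (sig_mod S U)) (bc (Rz_L S) (smod U)) (stau U)"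
 using st by (simp add: module_iso_def)

lemma sd_hom: "module_hom (tgt (Rz_B S)) (bc (Rz_B S) (smod U)) (bc (kz_B S) (Dt S U)) (sdelta U)"
 using sd by (simp add: module_iso_def)

lemma mods': "module (src (Rz_L S)) (sig_mod S U)" "module (src (Rz_L S)) (smod U)" "module (src (Rz_B S)) (smod U)"
 "module (src (kz_B S)) (Dt S U)" "module (src (kz_B S)) (cris S U)"
 using free_famD(2)[OF fsig] free_famD(2)[OF fM] free_famD(2)[OF fD] free_famD(2)[OF fcris] by simp_all

lemma tau_sl:
 assumes g: "tri g (Rz_L S) h"
 shows "semilinear (id_hom (tgt g)) (bc h (sig_mod S U)) (bc h (smod U)) (tau_ext S U g h)"
 unfolding tau_ext_def by (rule bc_extend_spec(1)[OF g g mods'(1,2) st_hom])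

lemma tau_val:
 assumes g: "tri g (Rz_L S) h" and i: "i < n"
 shows "tau_ext S U g h (bc_unit h (sig_mod S U) (sv i)) = tri_val (bc h (smod U)) (\<lambda>i. bc_unit h (smod U) (ebas i))
  (app g (app (Rz_L S) (zmz S ^ q))) (app g (app (Rz_L S) (fps_const (- z)))) (app g (app (Rz_L S) (zmz S ^ (q + 1)))) i"
proof -
 have sg: "src g = Rz_zmz S" using triD[OF g] by simp
 have fL: "free_fam (Rz_zmz S) (bc (Rz_L S) (smod U)) n (\<lambda>i. bc_unit (Rz_L S) (smod U) (ebas i))"
  using fMh[OF Rz_L_ok] by simp
 have "tau_ext S U g h (bc_unit h (sig_mod S U) (sv i)) =
   bc_push (Rz_L S) h g (smod U) (stau U (bc_unit (Rz_L S) (sig_mod S U) (sv i)))"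
  unfolding tau_ext_def by (rule bc_extend_spec(2)[OF g g mods'(1,2) st_hom free_famD(5)[OF fsig i]])
 also have "\<dots> = tri_val (bc h (smod U)) (\<lambda>i. bc_push (Rz_L S) h g (smod U) (bc_unit (Rz_L S) (smod U) (ebas i)))
   (app g (app (Rz_L S) (zmz S ^ q))) (app g (app (Rz_L S) (fps_const (- z)))) (app g (app (Rz_L S) (zmz S ^ (q + 1)))) i"
  unfolding stv[OF i]
  by (rule semilinear_tri_val[OF bc_push_spec(1)[OF g mods'(2)] _ _ n2 i], unfold sg, rule free_famD(2)[OF fL],
    erule free_famD(5)[OF fL], rule t_closed(2), rule t_closed(3), rule t_closed(2))
 also have "\<dots> = tri_val (bc h (smod U)) (\<lambda>i. bc_unit h (smod U) (ebas i))
   (app g (app (Rz_L S) (zmz S ^ q))) (app g (app (Rz_L S) (fps_const (- z)))) (app g (app (Rz_L S) (zmz S ^ (q + 1)))) i"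
  by (rule tri_val_cong[OF n2 i]) (rule bc_push_spec(2)[OF g mods'(2) free_famD(5)[OF fM]])
 finally show ?thesis .
qed

lemma sigd_sl:
 assumes g: "sqr g (Rz_s S) (Rz_B S) h" "sqr g (kz_s S) (kz_B S) k"
 shows "semilinear (id_hom (tgt g)) (bc h (sig_mod S U)) (bc k (cris S U)) (sig_delta S U g h k)"
 unfolding sig_delta_def sig_mod_def cris_def by (rule twist_extend_spec(1)[OF g mods'(3,4) sd_hom])

lemma sigd_val:
 assumes g: "sqr g (Rz_s S) (Rz_B S) h" "sqr g (kz_s S) (kz_B S) k" and i: "i < n"
 shows "sig_delta S U g h k (bc_unit h (sig_mod S U) (sv i)) =
  tri_val (bc k (cris S U)) (\<lambda>i. bc_unit k (cris S U) (cv i))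
   (app g (bi [^]\<^bsub>Rzil S\<^esub> q)) (app g cbeta) (app g (bi [^]\<^bsub>Rzil S\<^esub> (q + 1))) i"
proof -
 have sg: "src g = Rzil S" using sqrD[OF g(1)] by simp
 have fL: "free_fam (Rzil S) (bc (kz_B S) (Dt S U)) n (\<lambda>i. bc_unit (kz_B S) (Dt S U) (dv i))"
  using fDh[OF kz_B_ok] by simp
 have "sig_delta S U g h k (bc_unit h (sig_mod S U) (sv i)) =
   twist_push g (kz_s S) (kz_B S) k (Dt S U) (sdelta U (bc_unit (Rz_B S) (smod U) (ebas i)))"
  unfolding sig_delta_def sig_mod_def
  using twist_extend_spec(3)[OF g mods'(3,4) sd_hom free_famD(5)[OF fM i]] by (simp add: twist_unit_def)
 also have "\<dots> = tri_val (bc k (cris S U)) (\<lambda>i. twist_push g (kz_s S) (kz_B S) k (Dt S U) (bc_unit (kz_B S) (Dt S U) (dv i)))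
   (app g (bi [^]\<^bsub>Rzil S\<^esub> q)) (app g cbeta) (app g (bi [^]\<^bsub>Rzil S\<^esub> (q + 1))) i"
  unfolding sdv[OF i] cris_def
  by (rule semilinear_tri_val[OF twist_push_spec(1)[OF g(2) mods'(4)] _ _ n2 i], unfold sg, rule free_famD(2)[OF fL],
    erule free_famD(5)[OF fL], rule p_closed, rule cbeta_closed, rule p_closed)
 also have "\<dots> = tri_val (bc k (cris S U)) (\<lambda>i. bc_unit k (cris S U) (cv i))
   (app g (bi [^]\<^bsub>Rzil S\<^esub> q)) (app g cbeta) (app g (bi [^]\<^bsub>Rzil S\<^esub> (q + 1))) i"
  by (rule tri_val_cong[OF n2 i])
   (use twist_push_spec(2)[OF g(2) mods'(4) free_famD(5)[OF fD]] in \<open>simp add: twist_unit_def cris_def\<close>)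
 finally show ?thesis .
qed

text \<open>The homomorphism over which m \<mapsto> m \<otimes> 1 \<otimes> 1 from the shtuka to its
  crystalline realization is semilinear.\<close>

definition kk :: "('K fps, 'k fls) rhom"
 where "kk = RHom Rz (ring_on UNIV) (\<lambda>a. app (Rz_kz S) (app (Rz_s S) a))"

lemma res_pow: "x \<in> val_ring ==> res_map S (x ^ m) = res_map S x ^ m"
 by (induction m) (simp_all add: res_simps val_simps)

lemma kz_s_Rz_kz: "a \<in> carrier Rz ==> app (kz_s S) (app (Rz_kz S) a) = app kk a"
proof -
 assume "a \<in> carrier Rz"
 hence v: "fps_nth a i \<in> val_ring" for i by (simp add: Rz_carrier)
 have "(0::'k) ^ q = 0" using q2 by simp
 thus ?thesis
  by (simp add: fls_eq_iff kk_def kz_s_def Rz_kz_def Rz_ki_def Rz_s_def frob_fps_def frob_fls_nth res_pow v)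
qed

lemma sl_cris: "semilinear kk (smod U) (cris S U) (\<lambda>m. bc_unit (kz_s S) (Dt S U) (bc_unit (Rz_kz S) (smod U) m))"
proof -
 have 1: "semilinear (Rz_kz S) (smod U) (Dt S U) (bc_unit (Rz_kz S) (smod U))"
  unfolding Dt_def by (rule bc_unit_semilinear[OF Rz_kz_ok]) (use free_famD(2)[OF fM] in simp)
 have 2: "semilinear (kz_s S) (Dt S U) (cris S U) (bc_unit (kz_s S) (Dt S U))"
  unfolding cris_def by (rule bc_unit_semilinear[OF kz_s_ok]) (use free_famD(2)[OF fD] in simp)
 show ?thesis
  by (rule semilinear_comp[OF 1 2 Rz_kz_ok]) (use kz_s_Rz_kz in \<open>simp_all add: kk_def\<close>)
qed

lemma sl_sig:
 assumes h: "rhom_ok h" "src h = Rz"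
 shows "semilinear (RHom Rz (tgt h) (\<lambda>a. app h (app (Rz_s S) a))) (smod U) (bc h (sig_mod S U))
  (\<lambda>m. bc_unit h (sig_mod S U) (bc_unit (Rz_s S) (smod U) m))"
proof -
 have 1: "semilinear (Rz_s S) (smod U) (sig_mod S U) (bc_unit (Rz_s S) (smod U))"
  unfolding sig_mod_def by (rule bc_unit_semilinear[OF Rz_s_ok]) (use free_famD(2)[OF fM] in simp)
 have 2: "semilinear h (sig_mod S U) (bc h (sig_mod S U)) (bc_unit h (sig_mod S U))"
  by (rule bc_unit_semilinear[OF h(1)]) (use free_famD(2)[OF fsig] h(2) in simp)
 show ?thesis by (rule semilinear_comp[OF 1 2 Rz_s_ok]) (use h(2) in simp_all)
qed

lemma gens_cris: "gens (ring_on UNIV) (cris S U) ((\<lambda>m. bc_unit (kz_s S) (Dt S U) (bc_unit (Rz_kz S) (smod U) m)) ` carrier (smod U))"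
 by (rule gens_mono[OF free_famD(3)[OF fcris]])
  (use free_famD(5)[OF fM] semilinearD(1)[OF sl_cris] in auto)

lemma tau_Dt_spec:
 "semilinear (id_hom (ring_on UNIV)) (cris S U) (Dt S U) (tau_Dt S U)"
 "i < n ==> tau_Dt S U (cv i) = tri_val (Dt S U) dv (app (Rz_kz S) (zmz S ^ q)) 0 (app (Rz_kz S) (zmz S ^ (q + 1))) i"
proof -
 let ?j = "\<lambda>m. tau_ext S U (L_kz S) (Rz_kz S) (twist_unit (Rz_s S) (Rz_kz S) (smod U) m)"
 have tsl: "semilinear (id_hom (ring_on UNIV)) (bc (Rz_kz S) (sig_mod S U)) (Dt S U) (tau_ext S U (L_kz S) (Rz_kz S))"
  using tau_sl[OF tri_L(2)] by (simp add: Dt_def)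
 have j: "semilinear kk (smod U) (Dt S U) ?j"
  unfolding twist_unit_def sig_mod_def[symmetric]
  by (rule semilinear_comp[OF sl_sig[OF Rz_kz_ok] tsl])
   (use rhom_ok_comp[OF Rz_s_ok Rz_kz_ok] in \<open>simp_all add: kk_def\<close>)
 have jc: "?j (ebas i) \<in> carrier (Dt S U)" if "i < n" for i using semilinearD(1)[OF j] free_famD(5)[OF fM that] by auto
 \<comment> \<open>The description in \<open>tau_Dt\<close> prescribes values at all m \<otimes> 1
   \<otimes> 1. A map is first prescribed on the basis alone; two semilinear maps on the shtuka that
   agree on its basis then agree everywhere.\<close>
 obtain f where f: "semilinear (id_hom (ring_on UNIV)) (cris S U) (Dt S U) f" "!!i. i < n ==> f (cv i) = ?j (ebas i)"
  using free_fam_ext[OF fcris rhom_ok_id[OF cring_ring_on_UNIV], of "Dt S U" "\<lambda>i. ?j (ebas i)"] free_famD(2)[OF fD] jc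
  by auto
 have kkok: "rhom_ok kk" using rhom_ok_comp[OF Rz_s_ok Rz_kz_ok] by (simp add: kk_def)
 have fsl: "semilinear kk (smod U) (Dt S U) (\<lambda>m. f (bc_unit (kz_s S) (Dt S U) (bc_unit (Rz_kz S) (smod U) m)))"
  by (rule semilinear_comp[OF sl_cris f(1) kkok]) (simp_all add: kk_def)
 have agree: "f (bc_unit (kz_s S) (Dt S U) (bc_unit (Rz_kz S) (smod U) m)) = ?j m" if "m \<in> carrier (smod U)" for m
  by (rule free_fam_eqI[OF fM _ free_famD(4)[OF fD] fsl j _ that]) (use f(2) in \<open>simp_all add: kk_def\<close>)
 have ex: "\<exists>f. semilinear (id_hom (ring_on UNIV)) (cris S U) (Dt S U) f \<and>
  (\<forall>m\<in>carrier (smod U). f (bc_unit (kz_s S) (Dt S U) (bc_unit (Rz_kz S) (smod U) m)) = ?j m)"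
  using f(1) agree by blast
 have spec: "semilinear (id_hom (ring_on UNIV)) (cris S U) (Dt S U) (tau_Dt S U)"
  "!!m. m \<in> carrier (smod U) ==> tau_Dt S U (bc_unit (kz_s S) (Dt S U) (bc_unit (Rz_kz S) (smod U) m)) = ?j m"
  unfolding tau_Dt_def
  using semilin_ext_spec[OF ex] gens_cris free_famD(2,4)[OF fcris] free_famD(4)[OF fD] by simp_all
 show "semilinear (id_hom (ring_on UNIV)) (cris S U) (Dt S U) (tau_Dt S U)" by (rule spec(1))
 show "tau_Dt S U (cv i) = tri_val (Dt S U) dv (app (Rz_kz S) (zmz S ^ q)) 0 (app (Rz_kz S) (zmz S ^ (q + 1))) i" if i: "i < n"
 proof -
  have "tau_Dt S U (cv i) = tau_ext S U (L_kz S) (Rz_kz S) (bc_unit (Rz_kz S) (sig_mod S U) (sv i))"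
   using spec(2)[OF free_famD(5)[OF fM i]] by (simp add: twist_unit_def sig_mod_def)
  also have "\<dots> = tri_val (bc (Rz_kz S) (smod U)) dv (app (Rz_kz S) (zmz S ^ q))
    (app (Rz_kz S) (fps_const (- z))) (app (Rz_kz S) (zmz S ^ (q + 1))) i"
   using tau_val[OF tri_L(2) i] unfolding L_kz_of[OF t_closed(1)] L_kz_of[OF const_Rz] .
  finally show ?thesis by (simp only: kz_B_entries(2) Dt_def)
 qed
qed

text \<open>Both sides are linear, so it is enough to compare two products of triangular blocks on
  the basis; their entries agree by \<open>B_ids\<close>.\<close>

lemma delta_tau:
 assumes x: "x \<in> carrier (bc (Rz_B S) (sig_mod S U))"
 shows "sdelta U (tau_ext S U (L_B S) (Rz_B S) x) =
  bc_map (kz_B S) (cris S U) (Dt S U) (tau_Dt S U) (sig_delta S U (B_s S) (Rz_B S) (kz_B S) x)"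
proof -
 let ?WD = "bc (kz_B S) (Dt S U)" and ?dd = "\<lambda>i. bc_unit (kz_B S) (Dt S U) (dv i)"
 let ?P = "bi [^]\<^bsub>Rzil S\<^esub> q" and ?P' = "bi [^]\<^bsub>Rzil S\<^esub> (q + 1)"
 have idB: "rhom_ok (id_hom (Rzil S))" by (rule rhom_ok_id[OF Rzil_cring])
 have fWD: "free_fam (Rzil S) ?WD n ?dd" using fDh[OF kz_B_ok] by simp
 have fS: "free_fam (Rzil S) (bc (Rz_B S) (sig_mod S U)) n (\<lambda>i. bc_unit (Rz_B S) (sig_mod S U) (sv i))"
  using fsigh[OF Rz_B_ok] by simp
 have fB: "free_fam (Rzil S) (bc (Rz_B S) (smod U)) n (\<lambda>i. bc_unit (Rz_B S) (smod U) (ebas i))"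
  using fMh[OF Rz_B_ok] by simp
 have fC: "free_fam (Rzil S) (bc (kz_B S) (cris S U)) n (\<lambda>i. bc_unit (kz_B S) (cris S U) (cv i))"
  using fcrish[OF kz_B_ok] by simp
 have sds: "semilinear (id_hom (Rzil S)) (bc (Rz_B S) (smod U)) ?WD (sdelta U)"
  using sd_hom by (simp add: module_hom_def)
 have ts: "semilinear (id_hom (Rzil S)) (bc (Rz_B S) (sig_mod S U)) (bc (Rz_B S) (smod U)) (tau_ext S U (L_B S) (Rz_B S))"
  using tau_sl[OF tri_L(1)] by simp
 have ss: "semilinear (id_hom (Rzil S)) (bc (Rz_B S) (sig_mod S U)) (bc (kz_B S) (cris S U)) (sig_delta S U (B_s S) (Rz_B S) (kz_B S))"
  using sigd_sl[OF sqr_B] by simp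
 have tD: "module_hom (src (kz_B S)) (cris S U) (Dt S U) (tau_Dt S U)" using tau_Dt_spec(1) by (simp add: module_hom_def)
 note bm = bc_map_spec[OF kz_B_ok mods'(5,4) tD]
 have bs: "semilinear (id_hom (Rzil S)) (bc (kz_B S) (cris S U)) ?WD (bc_map (kz_B S) (cris S U) (Dt S U) (tau_Dt S U))"
  using bm(1) by simp
 have F1: "semilinear (id_hom (Rzil S)) (bc (Rz_B S) (sig_mod S U)) ?WD (\<lambda>x. sdelta U (tau_ext S U (L_B S) (Rz_B S) x))"
  by (rule semilinear_comp[OF ts sds idB]) simp_all
 have F2: "semilinear (id_hom (Rzil S)) (bc (Rz_B S) (sig_mod S U)) ?WD
   (\<lambda>x. bc_map (kz_B S) (cris S U) (Dt S U) (tau_Dt S U) (sig_delta S U (B_s S) (Rz_B S) (kz_B S) x))"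
  by (rule semilinear_comp[OF ss bs idB]) simp_all
 have LB: "app (L_B S) (app (Rz_L S) (zmz S ^ k)) = (bZ \<otimes>\<^bsub>Rzil S\<^esub> bW) [^]\<^bsub>Rzil S\<^esub> k"
  "app (L_B S) (app (Rz_L S) (fps_const (- z))) = \<ominus>\<^bsub>Rzil S\<^esub> bt" for k
  by (simp_all add: L_B_of t_closed const_Rz Rz_B_entries)
 let ?T = "\<lambda>k. (bZ \<otimes>\<^bsub>Rzil S\<^esub> bW) [^]\<^bsub>Rzil S\<^esub> (k::nat)"
 have Tc: "?T k \<in> carrier (Rzil S)" for k by (intro B_pow_closed B_mult_closed b_closed)
 have Zc: "bZ [^]\<^bsub>Rzil S\<^esub> (k::nat) \<in> carrier (Rzil S)" for k by (intro B_pow_closed b_closed)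
 have jc: "bj [^]\<^bsub>Rzil S\<^esub> (k::nat) \<in> carrier (Rzil S)" for k by (intro B_pow_closed b_closed)
 have tc: "\<ominus>\<^bsub>Rzil S\<^esub> bt \<in> carrier (Rzil S)"
  by (rule abelian_group.a_inv_closed[OF ring.is_abelian_group[OF cring.axioms(1)[OF Rzil_cring]] b_closed(5)])
 let ?b' = "emb (frob_bi q gam0) \<otimes>\<^bsub>Rzil S\<^esub> (bj [^]\<^bsub>Rzil S\<^esub> q \<otimes>\<^bsub>Rzil S\<^esub> bj [^]\<^bsub>Rzil S\<^esub> (q + 1))"
 have b'c: "?b' \<in> carrier (Rzil S)" by (intro B_mult_closed jc b_closed)
 have zc: "\<zero>\<^bsub>Rzil S\<^esub> \<in> carrier (Rzil S)" by (rule cring.cring_simprules(2)[OF Rzil_cring])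
 have v1: "sdelta U (tau_ext S U (L_B S) (Rz_B S) (bc_unit (Rz_B S) (sig_mod S U) (sv i))) =
   tri_val ?WD ?dd (?T q \<otimes>\<^bsub>Rzil S\<^esub> ?P) (\<ominus>\<^bsub>Rzil S\<^esub> bt \<otimes>\<^bsub>Rzil S\<^esub> ?P \<oplus>\<^bsub>Rzil S\<^esub> ?T (q + 1) \<otimes>\<^bsub>Rzil S\<^esub> cbeta)
    (?T (q + 1) \<otimes>\<^bsub>Rzil S\<^esub> ?P') i" if i: "i < n" for i
 proof -
  have "sdelta U (tau_ext S U (L_B S) (Rz_B S) (bc_unit (Rz_B S) (sig_mod S U) (sv i))) =
    tri_val ?WD (\<lambda>i. sdelta U (bc_unit (Rz_B S) (smod U) (ebas i))) (?T q) (\<ominus>\<^bsub>Rzil S\<^esub> bt) (?T (q + 1)) i"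
   unfolding tau_val[OF tri_L(1) i] LB
   by (rule linear_tri_val[OF sds free_famD(2,5)[OF fB] n2 i Tc tc Tc])
  also have "\<dots> = tri_val ?WD (tri_val ?WD ?dd ?P cbeta ?P') (?T q) (\<ominus>\<^bsub>Rzil S\<^esub> bt) (?T (q + 1)) i"
   by (rule tri_val_cong[OF n2 i]) (rule sdv)
  also have "\<dots> = tri_val ?WD ?dd (?T q \<otimes>\<^bsub>Rzil S\<^esub> ?P) (\<ominus>\<^bsub>Rzil S\<^esub> bt \<otimes>\<^bsub>Rzil S\<^esub> ?P \<oplus>\<^bsub>Rzil S\<^esub> ?T (q + 1) \<otimes>\<^bsub>Rzil S\<^esub> cbeta)
    (?T (q + 1) \<otimes>\<^bsub>Rzil S\<^esub> ?P') i"
   by (rule tri_val_comp[OF free_famD(2,5)[OF fWD] n2 i Tc tc Tc p_closed cbeta_closed p_closed])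
  finally show ?thesis .
 qed
 have kz0: "app (kz_B S) 0 = \<zero>\<^bsub>Rzil S\<^esub>"
  using ring_hom_zero[OF rhom_okD(3)[OF kz_B_ok] rhom_okD(4,5)[OF kz_B_ok]] by simp
 have v2: "bc_map (kz_B S) (cris S U) (Dt S U) (tau_Dt S U) (sig_delta S U (B_s S) (Rz_B S) (kz_B S) (bc_unit (Rz_B S) (sig_mod S U) (sv i))) =
   tri_val ?WD ?dd (bj [^]\<^bsub>Rzil S\<^esub> q \<otimes>\<^bsub>Rzil S\<^esub> bZ [^]\<^bsub>Rzil S\<^esub> q)
    (?b' \<otimes>\<^bsub>Rzil S\<^esub> bZ [^]\<^bsub>Rzil S\<^esub> q \<oplus>\<^bsub>Rzil S\<^esub> bj [^]\<^bsub>Rzil S\<^esub> (q + 1) \<otimes>\<^bsub>Rzil S\<^esub> \<zero>\<^bsub>Rzil S\<^esub>)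
    (bj [^]\<^bsub>Rzil S\<^esub> (q + 1) \<otimes>\<^bsub>Rzil S\<^esub> bZ [^]\<^bsub>Rzil S\<^esub> (q + 1)) i" if i: "i < n" for i
 proof -
  have "bc_map (kz_B S) (cris S U) (Dt S U) (tau_Dt S U) (sig_delta S U (B_s S) (Rz_B S) (kz_B S) (bc_unit (Rz_B S) (sig_mod S U) (sv i))) =
    tri_val ?WD (\<lambda>i. bc_map (kz_B S) (cris S U) (Dt S U) (tau_Dt S U) (bc_unit (kz_B S) (cris S U) (cv i)))
     (bj [^]\<^bsub>Rzil S\<^esub> q) ?b' (bj [^]\<^bsub>Rzil S\<^esub> (q + 1)) i"
   unfolding sigd_val[OF sqr_B i] B_s_entries
   by (rule linear_tri_val[OF bs free_famD(2,5)[OF fC] n2 i jc b'c jc])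
  also have "\<dots> = tri_val ?WD (tri_val ?WD ?dd (bZ [^]\<^bsub>Rzil S\<^esub> q) \<zero>\<^bsub>Rzil S\<^esub> (bZ [^]\<^bsub>Rzil S\<^esub> (q + 1)))
     (bj [^]\<^bsub>Rzil S\<^esub> q) ?b' (bj [^]\<^bsub>Rzil S\<^esub> (q + 1)) i"
  proof (rule tri_val_cong[OF n2 i])
   fix j assume j: "j < n"
   have "bc_map (kz_B S) (cris S U) (Dt S U) (tau_Dt S U) (bc_unit (kz_B S) (cris S U) (cv j)) =
     bc_unit (kz_B S) (Dt S U) (tau_Dt S U (cv j))" by (rule bm(2)[OF free_famD(5)[OF fcris j]])
   also have "\<dots> = tri_val ?WD ?dd (app (kz_B S) (app (Rz_kz S) (zmz S ^ q))) (app (kz_B S) 0) (app (kz_B S) (app (Rz_kz S) (zmz S ^ (q + 1)))) j"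
    unfolding tau_Dt_spec(2)[OF j]
    by (rule semilinear_tri_val[OF bc_unit_semilinear[OF kz_B_ok mods'(4)] mods'(4) _ n2 j])
     (use free_famD(5)[OF fD] in simp_all)
   finally show "bc_map (kz_B S) (cris S U) (Dt S U) (tau_Dt S U) (bc_unit (kz_B S) (cris S U) (cv j)) =
     tri_val ?WD ?dd (bZ [^]\<^bsub>Rzil S\<^esub> q) \<zero>\<^bsub>Rzil S\<^esub> (bZ [^]\<^bsub>Rzil S\<^esub> (q + 1)) j"
    unfolding kz_B_entries(1) kz0 .
  qed
  also have "\<dots> = tri_val ?WD ?dd (bj [^]\<^bsub>Rzil S\<^esub> q \<otimes>\<^bsub>Rzil S\<^esub> bZ [^]\<^bsub>Rzil S\<^esub> q)
    (?b' \<otimes>\<^bsub>Rzil S\<^esub> bZ [^]\<^bsub>Rzil S\<^esub> q \<oplus>\<^bsub>Rzil S\<^esub> bj [^]\<^bsub>Rzil S\<^esub> (q + 1) \<otimes>\<^bsub>Rzil S\<^esub> \<zero>\<^bsub>Rzil S\<^esub>)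
    (bj [^]\<^bsub>Rzil S\<^esub> (q + 1) \<otimes>\<^bsub>Rzil S\<^esub> bZ [^]\<^bsub>Rzil S\<^esub> (q + 1)) i"
   by (rule tri_val_comp[OF free_famD(2,5)[OF fWD] n2 i jc b'c jc Zc zc Zc])
  finally show ?thesis .
 qed
 have z0: "y \<oplus>\<^bsub>Rzil S\<^esub> bj [^]\<^bsub>Rzil S\<^esub> (q + 1) \<otimes>\<^bsub>Rzil S\<^esub> \<zero>\<^bsub>Rzil S\<^esub> = y" if "y \<in> carrier (Rzil S)" for y
  using that jc[of "q + 1"] Rzil_cring by (simp add: cring.cring_simprules)
 show ?thesis
  by (rule free_fam_eqI[OF fS _ free_famD(4)[OF fWD] F1 F2 _ x])
   (simp_all only: id_hom_simps v1 v2 z0 B_mult_closed b'c Zc B_ids cbeta_def)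
qed

text \<open>The diagonal entries reduce to 1, because \<open>ell\<close> does, and the corner
  reduces to 0, because all coefficients of \<open>gam0\<close> lie in the maximal ideal.\<close>

lemma delta_red:
 assumes x: "x \<in> carrier (bc (Rz_B S) (smod U))"
 shows "semilin_ext (B_kz S) (bc (kz_B S) (Dt S U)) (Dt S U) (carrier (Dt S U))
   (bc_unit (kz_B S) (Dt S U)) (\<lambda>d. d) (sdelta U x) = bc_push (Rz_B S) (Rz_kz S) (B_kz S) (smod U) x"
proof -
 let ?E = "semilin_ext (B_kz S) (bc (kz_B S) (Dt S U)) (Dt S U) (carrier (Dt S U)) (bc_unit (kz_B S) (Dt S U)) (\<lambda>d. d)"
 have idD: "semilinear (id_hom (ring_on UNIV)) (Dt S U) (Dt S U) (\<lambda>d. d)" by (rule semilinearI) simp_all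
 have E: "semilinear (B_kz S) (bc (kz_B S) (Dt S U)) (Dt S U) ?E"
  "!!m. m \<in> carrier (Dt S U) ==> ?E (bc_unit (kz_B S) (Dt S U) m) = m"
  using bc_ext_spec[OF kz_B_ok mods'(4) B_kz_ok _ _ idD] free_famD(2)[OF fD] by (simp_all add: B_kz_kz_B)
 have fB: "free_fam (Rzil S) (bc (Rz_B S) (smod U)) n (\<lambda>i. bc_unit (Rz_B S) (smod U) (ebas i))"
  using fMh[OF Rz_B_ok] by simp
 have fWD: "free_fam (Rzil S) (bc (kz_B S) (Dt S U)) n (\<lambda>i. bc_unit (kz_B S) (Dt S U) (dv i))"
  using fDh[OF kz_B_ok] by simp
 have sds: "semilinear (id_hom (Rzil S)) (bc (Rz_B S) (smod U)) (bc (kz_B S) (Dt S U)) (sdelta U)"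
  using sd_hom by (simp add: module_hom_def)
 have F1: "semilinear (B_kz S) (bc (Rz_B S) (smod U)) (Dt S U) (\<lambda>x. ?E (sdelta U x))"
  by (rule semilinear_comp[OF sds E(1) rhom_ok_id[OF Rzil_cring]]) simp_all
 have F2: "semilinear (B_kz S) (bc (Rz_B S) (smod U)) (Dt S U) (bc_push (Rz_B S) (Rz_kz S) (B_kz S) (smod U))"
  using bc_push_spec(1)[OF tri_B_kz mods'(3)] by (simp add: Dt_def)
 have "?E (sdelta U (bc_unit (Rz_B S) (smod U) (ebas i))) = bc_push (Rz_B S) (Rz_kz S) (B_kz S) (smod U) (bc_unit (Rz_B S) (smod U) (ebas i))"
  if i: "i < n" for i
 proof -
  have "?E (sdelta U (bc_unit (Rz_B S) (smod U) (ebas i))) =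
    tri_val (Dt S U) (\<lambda>i. ?E (bc_unit (kz_B S) (Dt S U) (dv i))) (app (B_kz S) (bi [^]\<^bsub>Rzil S\<^esub> q)) (app (B_kz S) cbeta) (app (B_kz S) (bi [^]\<^bsub>Rzil S\<^esub> (q + 1))) i"
   unfolding sdv[OF i]
   by (rule semilinear_tri_val[OF E(1) _ _ n2 i], unfold B_simps, rule free_famD(2)[OF fWD],
     erule free_famD(5)[OF fWD], rule p_closed, rule cbeta_closed, rule p_closed)
  also have "\<dots> = tri_val (Dt S U) dv 1 0 1 i"
   unfolding B_kz_entries by (rule tri_val_cong[OF n2 i]) (rule E(2)[OF free_famD(5)[OF fD]])
  also have "\<dots> = dv i"
   using tri_val_unit[OF free_famD(2,5)[OF fD] n2 i] by simp
  also have "\<dots> = bc_push (Rz_B S) (Rz_kz S) (B_kz S) (smod U) (bc_unit (Rz_B S) (smod U) (ebas i))"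
   by (rule bc_push_spec(2)[OF tri_B_kz mods'(3) free_famD(5)[OF fM i], symmetric])
  finally show ?thesis .
 qed
 thus ?thesis by (intro free_fam_eqI[OF fB _ free_famD(4)[OF fD] F1 F2 _ x]) simp_all
qed

lemma rigidified: "rigidified_shtuka S U"
 unfolding rigidified_shtuka_def local_shtuka_def
 using free_fam_rank[OF fM] st sd delta_tau delta_red by blast

lemma cris_integral_spec:
 "semilinear ki_kz (bc (Rz_ki S) (sig_mod S U)) (cris S U)
  (semilin_ext ki_kz (bc (Rz_ki S) (sig_mod S U)) (cris S U) (carrier (smod U)) (twist_unit (Rz_s S) (Rz_ki S) (smod U))
   (\<lambda>m. bc_unit (kz_s S) (Dt S U) (bc_unit (Rz_kz S) (smod U) m)))"
 "m \<in> carrier (smod U) ==>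
  semilin_ext ki_kz (bc (Rz_ki S) (sig_mod S U)) (cris S U) (carrier (smod U)) (twist_unit (Rz_s S) (Rz_ki S) (smod U))
   (\<lambda>m. bc_unit (kz_s S) (Dt S U) (bc_unit (Rz_kz S) (smod U) m)) (twist_unit (Rz_s S) (Rz_ki S) (smod U) m) =
  bc_unit (kz_s S) (Dt S U) (bc_unit (Rz_kz S) (smod U) m)"
 "free_fam (ring_on UNIV) (bc (Rz_ki S) (sig_mod S U)) n (\<lambda>i. twist_unit (Rz_s S) (Rz_ki S) (smod U) (ebas i))"
proof -
 let ?V = "bc (Rz_ki S) (sig_mod S U)"
 let ?i = "twist_unit (Rz_s S) (Rz_ki S) (smod U)"
 let ?j = "\<lambda>m. bc_unit (kz_s S) (Dt S U) (bc_unit (Rz_kz S) (smod U) m)"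
 let ?f = "semilin_ext ki_kz ?V (cris S U) (carrier (smod U)) ?i ?j"
 have fV: "free_fam (ring_on UNIV) ?V n (\<lambda>i. ?i (ebas i))"
  using fsigh[OF Rz_ki_ok] by (simp add: twist_unit_def sig_mod_def)
 obtain f where f: "semilinear ki_kz ?V (cris S U) f" "!!i. i < n ==> f (?i (ebas i)) = cv i"
  using free_fam_ext[OF fV ki_kz_ok, of "cris S U" cv] free_famD(2,5)[OF fcris] by auto
 have ss: "semilinear (RHom Rz (ring_on UNIV) (\<lambda>a. app (Rz_ki S) (app (Rz_s S) a))) (smod U) ?V ?i"
  using sl_sig[OF Rz_ki_ok] by (simp add: twist_unit_def[abs_def] sig_mod_def)
 have fsl: "semilinear kk (smod U) (cris S U) (\<lambda>m. f (?i m))"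
  by (rule semilinear_comp[OF ss f(1)])
   (use rhom_ok_comp[OF Rz_s_ok Rz_ki_ok] in \<open>simp_all add: kk_def Rz_kz_def ki_kz_def\<close>)
 have agree: "f (?i m) = ?j m" if "m \<in> carrier (smod U)" for m
  by (rule free_fam_eqI[OF fM _ free_famD(4)[OF fcris] fsl sl_cris _ that]) (use f(2) in \<open>simp_all add: kk_def\<close>)
 have ex: "\<exists>f. semilinear ki_kz ?V (cris S U) f \<and> (\<forall>m\<in>carrier (smod U). f (?i m) = ?j m)"
  using f(1) agree by blast
 have gV: "gens (src ki_kz) ?V (?i ` carrier (smod U))"
  using gens_mono[OF free_famD(3)[OF fV], of "?i ` carrier (smod U)"] free_famD(5)[OF fM] semilinearD(1)[OF ss] by auto
 have spec: "semilinear ki_kz ?V (cris S U) ?f" "!!m. m \<in> carrier (smod U) ==> ?f (?i m) = ?j m"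
  using semilin_ext_spec[OF ex gV] free_famD(2)[OF fV] free_famD(4)[OF fcris] by simp_all
 from spec fV show "semilinear ki_kz ?V (cris S U) ?f" "m \<in> carrier (smod U) ==> ?f (?i m) = ?j m"
  "free_fam (ring_on UNIV) ?V n (\<lambda>i. ?i (ebas i))" by auto
qed

text \<open>Integrality on the basis vectors spreads to the whole integral structure, since scalars
  in k[[z]] evaluate at \<zeta> into R.\<close>

lemma cris_integral_bound:
 assumes l: "semilinear (id_hom (ring_on UNIV)) (cris_K S U) (self_mod (ring_on UNIV)) l"
  "!!i. i < n ==> l (bc_unit (kz_K S) (cris S U) (cv i)) \<in> val_ring"
  and y: "y \<in> cris_integral S U"
 shows "l (bc_unit (kz_K S) (cris S U) y) \<in> val_ring"
proof -
 let ?V = "bc (Rz_ki S) (sig_mod S U)"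
 let ?i = "twist_unit (Rz_s S) (Rz_ki S) (smod U)"
 let ?j = "\<lambda>m. bc_unit (kz_s S) (Dt S U) (bc_unit (Rz_kz S) (smod U) m)"
 let ?f = "semilin_ext ki_kz ?V (cris S U) (carrier (smod U)) ?i ?j"
 note fV = cris_integral_spec(3) and spec = cris_integral_spec(1,2)
 obtain x where x: "x \<in> carrier ?V" "y = ?f x" using y unfolding cris_integral_def by blast
 have mc: "module (src (kz_K S)) (cris S U)" using free_famD(2)[OF fcris] by simp
 note bu = bc_unit_semilinear[OF kz_K_ok mc]
 have F: "semilinear (RHom (ring_on UNIV) (ring_on UNIV) (\<lambda>a. app (kz_K S) (app ki_kz a))) ?V (cris_K S U) (\<lambda>x. bc_unit (kz_K S) (cris S U) (?f x))"
  unfolding cris_K_def by (rule semilinear_comp[OF spec(1) bu ki_kz_ok]) simp_all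
 have L: "semilinear (RHom (ring_on UNIV) (ring_on UNIV) (\<lambda>a. app (kz_K S) (app ki_kz a))) ?V (self_mod (ring_on UNIV)) (\<lambda>x. l (bc_unit (kz_K S) (cris S U) (?f x)))"
  by (rule semilinear_comp[OF F l(1)]) (use rhom_ok_comp[OF ki_kz_ok kz_K_ok] in simp_all)
 have "l (bc_unit (kz_K S) (cris S U) (?f x)) \<in> val_ring"
  using free_famD(3)[OF fV] x(1)
 proof (induction rule: gens_induct)
  case zero
  show ?case
   using semilinear_zero[OF L free_famD(4)[OF fV] module_abelian[OF self_mod_module[OF cring_ring_on_UNIV]]] val_simps(1) by simp
 next
  case (add x y)
  thus ?case using semilinearD(2)[OF L] val_simps(3) by simp
 next
  case (smult b x)
  then obtain i where i: "i < n" "x = ?i (ebas i)" by auto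
  have "l (bc_unit (kz_K S) (cris S U) (?f x)) \<in> val_ring"
   using spec(2)[OF free_famD(5)[OF fM i(1)]] l(2)[OF i(1)] by (simp add: i(2))
  moreover have "app (kz_K S) (app ki_kz b) \<in> val_ring" using kz_K_integral by (simp add: ki_kz_def)
  ultimately show ?case
   using semilinearD(3)[OF L, of b x] free_famD(5)[OF fV i(1)] val_simps(4) by (simp add: i(2))
 qed
 thus ?thesis by (simp add: x(2))
qed

lemma cris_integral_carrier:
 assumes y: "y \<in> cris_integral S U"
 shows "y \<in> carrier (cris S U)"
 using cris_integral_spec y unfolding cris_integral_def by (blast dest: semilinearD(1))

text \<open>The first coordinate separates the two structures. It is integral on the crystalline
  lattice, but the second basis vector of the de Rham lattice is mapped to a vector whose first
  coordinate has absolute value 1/|\<zeta>|.\<close>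

lemma not_integral: "h_dR_cris_K S U ` dR_integral S U \<noteq> cris_integral_R S U"
proof
 assume eq: "h_dR_cris_K S U ` dR_integral S U = cris_integral_R S U"
 let ?C = "cris_K S U" and ?u = "\<lambda>i. bc_unit (kz_K S) (cris S U) (cv i)"
 have fC: "free_fam (ring_on UNIV) ?C n ?u" using fcrish[OF kz_K_ok] by (simp add: cris_K_def)
 obtain ll where ll: "\<forall>i<n. semilinear (id_hom (ring_on UNIV)) ?C (self_mod (ring_on UNIV)) (ll i) \<and>
   (\<forall>j<n. ll i (?u j) = (if j = i then \<one>\<^bsub>ring_on UNIV\<^esub> else \<zero>\<^bsub>ring_on UNIV\<^esub>))"
  using fC unfolding free_fam_def by blast
 define l where "l = ll 0"
 have l: "semilinear (id_hom (ring_on UNIV)) ?C (self_mod (ring_on UNIV)) l"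
  "!!i. i < n ==> l (?u i) = (if i = 0 then 1 else 0)"
  using ll[rule_format, of 0] n2 by (auto simp: l_def)
 interpret C: module "ring_on UNIV :: 'K ring" ?C by (rule free_famD(2)[OF fC])
 have l0: "l \<zero>\<^bsub>?C\<^esub> = 0"
  using semilinear_zero[OF l(1) free_famD(4)[OF fC] module_abelian[OF self_mod_module[OF cring_ring_on_UNIV]]] by simp
 have ladd: "l (x \<oplus>\<^bsub>?C\<^esub> y) = l x + l y" if "x \<in> carrier ?C" "y \<in> carrier ?C" for x y
  using semilinearD(2)[OF l(1) that] by simp
 have lsm: "l (b \<odot>\<^bsub>?C\<^esub> x) = b * l x" if "x \<in> carrier ?C" for b x
  using semilinearD(3)[OF l(1), of b x] that by simp
 \<comment> \<open>The preimage of R under the first coordinate is one of the submodules whose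
   intersection defines \<open>cris_integral_R\<close>, hence it contains that lattice.\<close>
 define H where "H = {y \<in> carrier ?C. l y \<in> val_ring}"
 have "submodule H (ring_on val_ring) ?C"
 proof (intro submodule.intro submodule_axioms.intro subgroup.intro)
  show "H \<subseteq> carrier (add_monoid ?C)" by (auto simp: H_def)
  show "x \<otimes>\<^bsub>add_monoid ?C\<^esub> y \<in> H" if "x \<in> H" "y \<in> H" for x y
   using that val_simps(3) by (auto simp: H_def ladd)
  show "\<one>\<^bsub>add_monoid ?C\<^esub> \<in> H" using l0 val_simps(1) by (simp add: H_def)
  show "inv\<^bsub>add_monoid ?C\<^esub> x \<in> H" if "x \<in> H" for x
  proof -
   have x: "x \<in> carrier ?C" "l x \<in> val_ring" using that by (auto simp: H_def)
   have nx: "\<ominus>\<^bsub>?C\<^esub> x \<in> carrier ?C" by (rule abelian_group.a_inv_closed[OF free_famD(4)[OF fC] x(1)])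
   have "l (\<ominus>\<^bsub>?C\<^esub> x) + l x = 0"
    using ladd[OF nx x(1)] abelian_group.l_neg[OF free_famD(4)[OF fC] x(1)] l0 by simp
   hence "l (\<ominus>\<^bsub>?C\<^esub> x) = - l x" by (simp add: eq_neg_iff_add_eq_0)
   thus ?thesis using nx x(2) val_simps(5) by (simp add: H_def a_inv_def)
  qed
  show "a \<odot>\<^bsub>?C\<^esub> x \<in> H" if "a \<in> carrier (ring_on val_ring)" "x \<in> H" for a x
   using that val_simps(4) by (auto simp: H_def lsm)
 qed
 moreover have "bc_unit (kz_K S) (cris S U) ` cris_integral S U \<subseteq> H"
 proof
  fix w assume "w \<in> bc_unit (kz_K S) (cris S U) ` cris_integral S U"
  then obtain y where y: "y \<in> cris_integral S U" "w = bc_unit (kz_K S) (cris S U) y" by blast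
  have "l w \<in> val_ring" unfolding y(2)
   by (rule cris_integral_bound[OF l(1) _ y(1)]) (use l(2) val_simps(1,2) in simp)
  moreover have "y \<in> carrier (cris S U)"
   using y(1) by (rule cris_integral_carrier)
  hence "w \<in> carrier ?C" unfolding y(2) cris_K_def
   using bc_unit_closed[OF kz_K_ok] free_famD(2)[OF fcris] by simp
  ultimately show "w \<in> H" by (simp add: H_def)
 qed
 ultimately have sub: "cris_integral_R S U \<subseteq> H" unfolding cris_integral_R_def by blast
 have n1: "1 < n" using n2 by simp
 have "bc_unit (Rz_K S) (sig_mod S U) (sv 1) \<in> dR_integral S U"
  unfolding dR_integral_def using free_famD(5)[OF fsig n1] by blast
 hence "h_dR_cris_K S U (bc_unit (Rz_K S) (sig_mod S U) (sv 1)) \<in> H" using eq sub by blast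
 moreover have "h_dR_cris_K S U (bc_unit (Rz_K S) (sig_mod S U) (sv 1)) =
   app (B_s_K S) cbeta \<odot>\<^bsub>?C\<^esub> ?u 0 \<oplus>\<^bsub>?C\<^esub> app (B_s_K S) (bi [^]\<^bsub>Rzil S\<^esub> (q + 1)) \<odot>\<^bsub>?C\<^esub> ?u 1"
  unfolding h_dR_cris_K_def sigd_val[OF sqr_K n1] by (simp add: tri_val_def cris_K_def)
 ultimately have "l (app (B_s_K S) cbeta \<odot>\<^bsub>?C\<^esub> ?u 0 \<oplus>\<^bsub>?C\<^esub> app (B_s_K S) (bi [^]\<^bsub>Rzil S\<^esub> (q + 1)) \<odot>\<^bsub>?C\<^esub> ?u 1) \<in> val_ring"
  by (simp add: H_def)
 moreover have u: "?u 0 \<in> carrier ?C" "?u 1 \<in> carrier ?C" using free_famD(5)[OF fC] n2 by auto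
 have "l (app (B_s_K S) cbeta \<odot>\<^bsub>?C\<^esub> ?u 0 \<oplus>\<^bsub>?C\<^esub> app (B_s_K S) (bi [^]\<^bsub>Rzil S\<^esub> (q + 1)) \<odot>\<^bsub>?C\<^esub> ?u 1) = app (B_s_K S) cbeta"
  using u l(2)[of 0] l(2)[OF n1] n2 C.smult_closed[OF _ u(1)] C.smult_closed[OF _ u(2)] by (simp add: ladd lsm)
 ultimately have "nabs (app (B_s_K S) cbeta) \<le> 1" by (simp add: val_ring_def)
 thus False unfolding B_s_K_cbeta using one_less_inverse[OF d_pos zeta_lt] by linarith
qed

end

lemma (in ana_setting) nonintegral_example:
 assumes n: "2 \<le> n"
 shows "\<exists>U :: ('K, 'k, nat => 'K fps) rig_shtuka. rigidified_shtuka S U \<and> free_of_rank Rz (smod U) n \<and>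
  h_dR_cris_K S U ` dR_integral S U \<noteq> cris_integral_R S U"
proof -
 let ?M = "fmodule n :: ('K fps, nat => 'K fps) module"
 have fM: "free_fam Rz ?M n ebas" by (rule fmodule_free)
 let ?sg = "bc (Rz_s S) ?M" and ?D = "bc (Rz_kz S) ?M"
 have fs: "free_fam Rz ?sg n (\<lambda>i. bc_unit (Rz_s S) ?M (ebas i))" using free_fam_bc[of "Rz_s S", OF _ Rz_s_ok] fM by simp
 have fD: "free_fam (ring_on UNIV) ?D n (\<lambda>i. bc_unit (Rz_kz S) ?M (ebas i))" using free_fam_bc[of "Rz_kz S", OF _ Rz_kz_ok] fM by simp
 have fL1: "free_fam (Rz_zmz S) (bc (Rz_L S) ?sg) n (\<lambda>i. bc_unit (Rz_L S) ?sg (bc_unit (Rz_s S) ?M (ebas i)))"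
  using free_fam_bc[of "Rz_L S", OF _ Rz_L_ok] fs by simp
 have fL2: "free_fam (Rz_zmz S) (bc (Rz_L S) ?M) n (\<lambda>i. bc_unit (Rz_L S) ?M (ebas i))"
  using free_fam_bc[of "Rz_L S", OF _ Rz_L_ok] fM by simp
 have fB: "free_fam (Rzil S) (bc (Rz_B S) ?M) n (\<lambda>i. bc_unit (Rz_B S) ?M (ebas i))"
  using free_fam_bc[of "Rz_B S", OF _ Rz_B_ok] fM by simp
 have fBD: "free_fam (Rzil S) (bc (kz_B S) ?D) n (\<lambda>i. bc_unit (kz_B S) ?D (bc_unit (Rz_kz S) ?M (ebas i)))"
  using free_fam_bc[of "kz_B S", OF _ kz_B_ok] fD by simp
 have mL: "monoid (Rz_zmz S)" and mB: "monoid (Rzil S)"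
  using free_famD(1)[OF fL1] Rzil_cring by (simp_all add: cring.axioms(1) ring.is_monoid)
 have zu: "app (Rz_L S) (zmz S) \<in> Units (Rz_zmz S)"
  using loc_ctx.s_unit[OF Rz_loc[OF zmz_Rz]] by (simp add: Rz_L_def loc_hom_def Rz_zmz_def)
 have zuk: "app (Rz_L S) (zmz S ^ k) \<in> Units (Rz_zmz S)" for k
  using rhom_pow[OF Rz_L_ok, of "zmz S" k] zmz_Rz monoid.Units_pow_closed[OF mL zu] by (simp add: Rz_simps)
 have cL: "app (Rz_L S) (fps_const (- z)) \<in> carrier (Rz_zmz S)" using rhom_okD(6)[OF Rz_L_ok] const_Rz by simp
 obtain st where st: "module_iso (Rz_zmz S) (bc (Rz_L S) ?sg) (bc (Rz_L S) ?M) st"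
  "!!i. i < n ==> st (bc_unit (Rz_L S) ?sg (bc_unit (Rz_s S) ?M (ebas i))) =
   tri_val (bc (Rz_L S) ?M) (\<lambda>i. bc_unit (Rz_L S) ?M (ebas i)) (app (Rz_L S) (zmz S ^ q))
    (app (Rz_L S) (fps_const (- z))) (app (Rz_L S) (zmz S ^ (q + 1))) i"
  using free_fam_tri_iso[OF fL1 fL2 n zuk[of q] zuk[of "q + 1"] cL] by blast
 have iu: "bi \<in> Units (Rzil S)" unfolding bi_def by (rule monoid.Units_inv_Units[OF mB ell_unit])
 obtain sd where sd: "module_iso (Rzil S) (bc (Rz_B S) ?M) (bc (kz_B S) ?D) sd"
  "!!i. i < n ==> sd (bc_unit (Rz_B S) ?M (ebas i)) =
   tri_val (bc (kz_B S) ?D) (\<lambda>i. bc_unit (kz_B S) ?D (bc_unit (Rz_kz S) ?M (ebas i)))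
    (bi [^]\<^bsub>Rzil S\<^esub> q) cbeta (bi [^]\<^bsub>Rzil S\<^esub> (q + 1)) i"
  using free_fam_tri_iso[OF fB fBD n monoid.Units_pow_closed[OF mB iu, of q] monoid.Units_pow_closed[OF mB iu, of "q + 1"] cbeta_closed]
  by blast
 define U where "U = \<lparr>smod = ?M, stau = st, sdelta = sd\<rparr>"
 have U: "smod U = ?M" "stau U = st" "sdelta U = sd" "sig_mod S U = ?sg" "Dt S U = ?D"
  by (simp_all add: U_def sig_mod_def Dt_def)
 have tri: "tri_shtuka S U n"
 proof (rule tri_shtuka.intro[OF ana_setting_axioms], rule tri_shtuka_axioms.intro)
  show "2 \<le> n" by (rule n)
  show "smod U = ?M" by (rule U)
 qed (unfold U, (rule st(1) sd(1) | (rule st(2) sd(2), assumption))+)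
 have r: "free_of_rank Rz (smod U) n" unfolding U(1) by (rule free_fam_rank[OF fM])
 show ?thesis
  by (intro exI[of _ U] conjI) (rule tri_shtuka.rigidified[OF tri], rule r, rule tri_shtuka.not_integral[OF tri])
qed

theorem theorem5p18:
  fixes S :: "('Q::field, 'K::complete_nonarch_field, 'k::field) shtuka_base"
  assumes "shtuka_setting S"
  shows "(\<forall>U :: ('K, 'k, 'm) rig_shtuka. rigidified_shtuka S U \<longrightarrow>
      module_iso (ring_on UNIV) (dR_P S U) (cris_P S U) (h_dR_cris_P S U) \<and>
      module_iso (ring_on UNIV) (dR_K S U) (cris_K S U) (h_dR_cris_K S U) \<and>
      (\<forall>x\<in>carrier (dR_P S U). cris_red S U (h_dR_cris_P S U x) = h_dR_cris_K S U (dR_red S U x)) \<and>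
      h_dR_cris_F S U ` dR_lattice S U = cris_lattice S U \<and>
      (\<forall>i::int. h_dR_cris_K S U ` dR_fil S U i = cris_fil S U i)) \<and>
    (\<forall>(U :: ('K, 'k, 'm) rig_shtuka) (W :: ('K, 'k, 'n) rig_shtuka) f.
      rigidified_shtuka S U \<and> rigidified_shtuka S W \<and> rig_morphism S U W f \<longrightarrow>
      (\<forall>x\<in>carrier (dR_P S U). h_dR_cris_P S W (rig_morphism_dR S U W f (Rz_P S) x) =
         bc_map (kz_P S) (cris S U) (cris S W) (rig_morphism_cris S U W f) (h_dR_cris_P S U x)) \<and>
      (\<forall>x\<in>carrier (dR_K S U). h_dR_cris_K S W (rig_morphism_dR S U W f (Rz_K S) x) =
         bc_map (kz_K S) (cris S U) (cris S W) (rig_morphism_cris S U W f) (h_dR_cris_K S U x))) \<and>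
    (\<forall>(U :: ('K, 'k, 'm) rig_shtuka) (W :: ('K, 'k, 'n) rig_shtuka) f.
      rigidified_shtuka S U \<and> rigidified_shtuka S W \<and> rig_quasi_morphism S U W f \<longrightarrow>
      (\<forall>x\<in>carrier (dR_P S U). h_dR_cris_P S W (quasi_sig_ext S U W f (Z_s_P S) (Rz_P S) x) =
         bc_map (kz_P S) (cris S U) (cris S W) (quasi_morphism_cris S U W f) (h_dR_cris_P S U x)) \<and>
      (\<forall>x\<in>carrier (dR_K S U). h_dR_cris_K S W (quasi_sig_ext S U W f (Z_s_K S) (Rz_K S) x) =
         bc_map (kz_K S) (cris S U) (cris S W) (quasi_morphism_cris S U W f) (h_dR_cris_K S U x))) \<and>
    (\<forall>n\<ge>2. \<exists>U :: ('K, 'k, nat \<Rightarrow> 'K fps) rig_shtuka.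
      rigidified_shtuka S U \<and> free_of_rank Rz (smod U) n \<and>
      h_dR_cris_K S U ` dR_integral S U \<noteq> cris_integral_R S U)"
proof -
 interpret ana_setting S by (rule shtuka_setting_ana[OF assms])
 have iso: "module_iso (ring_on UNIV) (dR_P S U) (cris_P S U) (h_dR_cris_P S U) \<and>
   module_iso (ring_on UNIV) (dR_K S U) (cris_K S U) (h_dR_cris_K S U) \<and>
   (\<forall>x\<in>carrier (dR_P S U). cris_red S U (h_dR_cris_P S U x) = h_dR_cris_K S U (dR_red S U x)) \<and>
   h_dR_cris_F S U ` dR_lattice S U = cris_lattice S U \<and>
   (\<forall>i::int. h_dR_cris_K S U ` dR_fil S U i = cris_fil S U i)"
  if "rigidified_shtuka S U" for U :: "('K, 'k, 'm) rig_shtuka"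
  using h_P_iso[OF that] h_K_iso[OF that] h_red[OF that] h_F_lattice[OF that] h_K_fil[OF that] by blast
 have mor: "(\<forall>x\<in>carrier (dR_P S U). h_dR_cris_P S W (rig_morphism_dR S U W f (Rz_P S) x) =
     bc_map (kz_P S) (cris S U) (cris S W) (rig_morphism_cris S U W f) (h_dR_cris_P S U x)) \<and>
   (\<forall>x\<in>carrier (dR_K S U). h_dR_cris_K S W (rig_morphism_dR S U W f (Rz_K S) x) =
     bc_map (kz_K S) (cris S U) (cris S W) (rig_morphism_cris S U W f) (h_dR_cris_K S U x))"
  if "rigidified_shtuka S U" "rigidified_shtuka S W" "rig_morphism S U W f"
  for U :: "('K, 'k, 'm) rig_shtuka" and W :: "('K, 'k, 'n) rig_shtuka" and f
  unfolding h_dR_cris_P_def h_dR_cris_K_def dR_P_def dR_K_def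
  using rig_morphism_functorial[OF that sqr_P] rig_morphism_functorial[OF that sqr_K] by blast
 have qmor: "(\<forall>x\<in>carrier (dR_P S U). h_dR_cris_P S W (quasi_sig_ext S U W f (Z_s_P S) (Rz_P S) x) =
     bc_map (kz_P S) (cris S U) (cris S W) (quasi_morphism_cris S U W f) (h_dR_cris_P S U x)) \<and>
   (\<forall>x\<in>carrier (dR_K S U). h_dR_cris_K S W (quasi_sig_ext S U W f (Z_s_K S) (Rz_K S) x) =
     bc_map (kz_K S) (cris S U) (cris S W) (quasi_morphism_cris S U W f) (h_dR_cris_K S U x))"
  if "rigidified_shtuka S U" "rigidified_shtuka S W" "rig_quasi_morphism S U W f"
  for U :: "('K, 'k, 'm) rig_shtuka" and W :: "('K, 'k, 'n) rig_shtuka" and f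
  unfolding h_dR_cris_P_def h_dR_cris_K_def dR_P_def dR_K_def
  using rig_quasi_morphism_functorial[OF that sqr_P sqr_Z(1) B_s_P_Z_B[symmetric]]
   rig_quasi_morphism_functorial[OF that sqr_K sqr_Z(2) B_s_K_Z_B[symmetric]] by blast
 show ?thesis
  by (rule conjI, (rule allI impI)+, rule iso, assumption,
    rule conjI, (rule allI impI)+, rule mor, (elim conjE, assumption)+,
    rule conjI, (rule allI impI)+, rule qmor, (elim conjE, assumption)+,
    (rule allI impI)+, rule nonintegral_example, assumption)
qed

end
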